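(* Consider the $\mathbb{Z}_2$-symmetric Filippov system (S) described in the context. Assume: (H0) there exist $a>0$ and $\tau_0>0$ such that the solution $\gamma_0^+(t)$ of the upper subsystem with $\alpha=0$ and $\gamma_0^+(0)=(-a,0)$ satisfies $\gamma_0^+(\tau_0)=(a,0)$ and $\gamma_0^+(t)\in\Sigma^+$ for $0<t<\tau_0$; (H1) $g^+(-a,0;0)=0$ and $f^+(-a,0;0)g^+_x(-a,0;0)>0$; (H2) $g^+(a,0;0)<0$. Let $\Gamma_0$ be the critical crossing cycle of (S) at $\alpha=0$ formed by $\{\gamma_0^+(t):0\le t\le\tau_0\}$ and its image under $(x,y)\mapsto(-x,-y)$. Put $$\theta_i=-\frac{\kappa_i}{g^+(a,0;0)}-\frac{g^+_{\alpha_i}(-a,0;0)}{g^+_x(-a,0;0)},\qquad i=1,\dots,m,$$ and assume $(\theta_1,\dots,\theta_m)\neq0$. Then for any sufficiently small annulus $\mathcal{A}$ of $\Gamma_0$ there exist a neighborhood $U$ of $\alpha=0$ and a local diffeomorphism $\beta=(\beta_1,\dots,\beta_m)=(\rho_1(\alpha),\dots,\rho_m(\alpha))$, $\rho_i(0)=0$, from $U$ onto its range $V$, such that for every $(\beta_2^*,\dots,\beta_m^* )\in V^*:=\{(\beta_2,\dots,\beta_m):(0,\beta_2,\dots,\beta_m)\in V\}$ the bifurcation diagram of (S) restricted to $\mathcal{A}$ on $(\beta_2,\dots,\beta_m)=(\beta_2^*,\dots,\beta_m^* )$ is the following. Dynamics on $\Sigma$ (for all $\beta_1$): $\Sigma\cap\mathcal{A}$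 near $(-a,0)$ contains exactly one tangent point $T^-$, which is a regular-fold and a visible fold of the upper subsystem. It splits $\Sigma\cap\mathcal{A}$ near $(-a,0)$ into an upward crossing segment and a stable sliding segment; the sliding segment lies to the left of $T^-$ with rightward sliding motion if $f^+(-a,0;0)>0$, and to the right of $T^-$ with leftward sliding motion if $f^+(-a,0;0)<0$. Near $(a,0)$ the picture is the $\mathbb{Z}_2$-symmetric one, with regular-fold $T^+=-T^-$. Cycles in $\mathcal{A}$ when $f^+(-a,0;0)>0$: (i) if $\beta_1<0$, there is exactly one crossing cycle, it is hyperbolically stable and does not enclose $T^\pm$, and there are no critical crossing cycles and no sliding cycles; (ii) if $\beta_1=0$, there is exactly one critical crossing cycle, it crosses $\Sigma$ at $T^-$ and $T^+$ and is internally stable, and there are no crossing cycles and no sliding cycles; (iii) if $\beta_1>0$, there is exactly one sliding cycle, it is stable and slides on both sliding segments, and there are no crossing cycles and no critical crossing cycles. Cycles in $\mathcal{A}$ when $f^+(-a,0;0)<0$: (i') if $\beta_1>0$, there is exactly one crossing cycle, it is hyperbolically stable and encloses $T^\pm$, and there are no critical crossing cycles and no sliding cycles; (ii') if $\beta_1=0$, there is exactly one critical crossing cycle, it crosses $\Sigma$ at $T^-$ and $T^+$ and is externally stable, and there are no crossing cycles and no sliding cycles; (iii') if $\beta_1<0$, there is exactly one sliding cycle, it is stable and slides on both sliding segments, and there are no crossing cycles and no critical crossing cycles.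
   Context: System (S): $m\ge1$, $k\ge3$, $\alpha=(\alpha_1,\dots,\alpha_m)\in\mathbb{R}^m$, $f^+,g^+:\mathbb{R}^2\times\mathbb{R}^m\to\mathbb{R}$ are $C^k$, and $$(\dot x,\dot y)=\begin{cases}Z^+(x,y;\alpha):=(f^+(x,y;\alpha),g^+(x,y;\alpha)),&(x,y)\in\Sigma^+=\{y>0\},\\ Z^-(x,y;\alpha):=(-f^+(-x,-y;\alpha),-g^+(-x,-y;\alpha)),&(x,y)\in\Sigma^-=\{y<0\}.\end{cases}$$ $\Sigma=\{y=0\}$ is the discontinuity boundary; $Z^+$ (resp. $Z^-$) is called the upper (resp. lower) subsystem. Subscripts denote partial derivatives. Filippov conventions. Let $g^\pm$ be the second component of $Z^\pm$. On $\Sigma$: crossing set $g^+g^->0$ (upward if both are positive, downward if both are negative), sliding set $g^+g^-\le0$. A sliding segment in the interior of the sliding set is stable if $g^+<0<g^-$ and unstable if $g^+>0>g^-$. Sliding motion follows $\mu Z^-+(1-\mu)Z^+$, with $\mu\in[0,1]$ chosen so that this vector is tangent to $\Sigma$. A point $p\in\Sigma$ is a tangent point of $Z^\pm$ if $Z^\pm(p)\ne0$ and $g^\pm(p)=0$. With $h(x,y)=y$ and $Z^\pm h=\langle Z^\pm,\nabla h\rangle$, it is a fold of $Z^\pm$ if the second Lie derivative $(Z^\pm)^2h(p)\neq0$; a fold of $Z^+$ (resp. $Z^-$) is visible if $(Z^+)^2h>0$ (resp. $(Z^-)^2h<0$). A regular-fold is a fold of one subsystem at which the other subsystem is transversal to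 $\Sigma$. Cycles are isolated periodic orbits (in the set of all periodic orbits). A crossing cycle concatenates orbits of the two subsystems and meets $\Sigma$ only at crossing points. A critical crossing cycle occupies both $\Sigma^\pm$, meets $\Sigma$ only at crossing points or boundary points of the sliding set ($g^+g^-=0$), and contains at least one tangent point. A sliding cycle contains a tangent point and a sliding segment of non-zero length; it is stable if its sliding segments are stable. Internally (externally) stable means attracting nearby orbits from the inside (outside). An annulus of $\Gamma_0$ is an annular neighborhood of $\Gamma_0$. Notation: $\lambda(t)=\exp\left(\int_t^{\tau_0}(f^+_x+g^+_y)(\gamma_0^+(s);0)\,ds\right)$ for $t\in[0,\tau_0]$, and $\kappa_i=\int_0^{\tau_0}\lambda(t)(f^+g^+_{\alpha_i}-g^+f^+_{\alpha_i})(\gamma_0^+(t);0)\,dt$. *)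

theory Defs
  imports "HOL-Analysis.Analysis"
begin

section \<open>Maps of class \<open>C\<^sup>k\<close>\<close>

text \<open>On an open subset of a finite-dimensional space the pointwise condition on the directional
  derivatives below is equivalent to continuity of all partial derivatives up to order \<open>k\<close>.\<close>

primrec Ck_on :: "nat \<Rightarrow> 'a::real_normed_vector set \<Rightarrow> ('a \<Rightarrow> 'b::real_normed_vector) \<Rightarrow> bool" where
  "Ck_on 0 S F \<longleftrightarrow> continuous_on S F"
| "Ck_on (Suc n) S F \<longleftrightarrow>
     (\<forall>x\<in>S. F differentiable (at x)) \<and> (\<forall>v. Ck_on n S (\<lambda>x. frechet_derivative F (at x) v))"

definition C1_diffeomorphism ::
  "('a::real_normed_vector \<Rightarrow> 'a) \<Rightarrow> 'a set \<Rightarrow> 'a set \<Rightarrow> bool" where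
  "C1_diffeomorphism \<rho> U V \<longleftrightarrow>
     open U \<and> open V \<and> bij_betw \<rho> U V \<and> Ck_on 1 U \<rho> \<and> Ck_on 1 V (inv_into U \<rho>)"

section \<open>Planar Filippov systems\<close>

text \<open>\<open>Zp\<close> and \<open>Zm\<close> are the vector fields \<open>Z\<^sup>+\<close> and \<open>Z\<^sup>-\<close>; both are defined on the
  whole plane, but \<open>Zp\<close> rules \<open>y > 0\<close> and \<open>Zm\<close> rules \<open>y < 0\<close>.\<close>

type_synonym plane = "real \<times> real"
type_synonym vfield = "plane \<Rightarrow> plane"

definition disc_boundary :: "plane set" where "disc_boundary = {p. snd p = 0}"
definition upper_half :: "plane set" where "upper_half = {p. snd p > 0}"
definition lower_half :: "plane set" where "lower_half = {p. snd p < 0}"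

definition upward_crossing :: "vfield \<Rightarrow> vfield \<Rightarrow> plane \<Rightarrow> bool" where
  "upward_crossing Zp Zm p \<longleftrightarrow> p \<in> disc_boundary \<and> snd (Zp p) > 0 \<and> snd (Zm p) > 0"

definition downward_crossing :: "vfield \<Rightarrow> vfield \<Rightarrow> plane \<Rightarrow> bool" where
  "downward_crossing Zp Zm p \<longleftrightarrow> p \<in> disc_boundary \<and> snd (Zp p) < 0 \<and> snd (Zm p) < 0"

definition crossing_set :: "vfield \<Rightarrow> vfield \<Rightarrow> plane set" where
  "crossing_set Zp Zm = {p \<in> disc_boundary. snd (Zp p) * snd (Zm p) > 0}"

definition sliding_set :: "vfield \<Rightarrow> vfield \<Rightarrow> plane set" where
  "sliding_set Zp Zm = {p \<in> disc_boundary. snd (Zp p) * snd (Zm p) \<le> 0}"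

definition stable_sliding :: "vfield \<Rightarrow> vfield \<Rightarrow> plane \<Rightarrow> bool" where
  "stable_sliding Zp Zm p \<longleftrightarrow> p \<in> disc_boundary \<and> snd (Zp p) < 0 \<and> 0 < snd (Zm p)"

definition sliding_velocity :: "vfield \<Rightarrow> vfield \<Rightarrow> plane \<Rightarrow> plane \<Rightarrow> bool" where
  "sliding_velocity Zp Zm p v \<longleftrightarrow>
     (\<exists>\<mu>\<in>{0..1}. v = \<mu> *\<^sub>R Zm p + (1 - \<mu>) *\<^sub>R Zp p \<and> snd v = 0)"

definition slides_rightward :: "vfield \<Rightarrow> vfield \<Rightarrow> plane \<Rightarrow> bool" where
  "slides_rightward Zp Zm p \<longleftrightarrow>
     (\<exists>v. sliding_velocity Zp Zm p v) \<and> (\<forall>v. sliding_velocity Zp Zm p v \<longrightarrow> fst v > 0)"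

definition slides_leftward :: "vfield \<Rightarrow> vfield \<Rightarrow> plane \<Rightarrow> bool" where
  "slides_leftward Zp Zm p \<longleftrightarrow>
     (\<exists>v. sliding_velocity Zp Zm p v) \<and> (\<forall>v. sliding_velocity Zp Zm p v \<longrightarrow> fst v < 0)"

subsection \<open>Tangent points and folds\<close>

definition lie_derivative :: "vfield \<Rightarrow> (plane \<Rightarrow> real) \<Rightarrow> plane \<Rightarrow> real" where
  "lie_derivative Z u p = frechet_derivative u (at p) (Z p)"

text \<open>Here \<open>snd\<close> is the function \<open>h(x,y) = y\<close>.\<close>

definition second_lie :: "vfield \<Rightarrow> plane \<Rightarrow> real" where
  "second_lie Z = lie_derivative Z (lie_derivative Z snd)"

definition tangent_of :: "vfield \<Rightarrow> plane \<Rightarrow> bool" where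
  "tangent_of Z p \<longleftrightarrow> p \<in> disc_boundary \<and> Z p \<noteq> 0 \<and> snd (Z p) = 0"

definition tangent_point :: "vfield \<Rightarrow> vfield \<Rightarrow> plane \<Rightarrow> bool" where
  "tangent_point Zp Zm p \<longleftrightarrow> tangent_of Zp p \<or> tangent_of Zm p"

definition fold_of :: "vfield \<Rightarrow> plane \<Rightarrow> bool" where
  "fold_of Z p \<longleftrightarrow> tangent_of Z p \<and> second_lie Z p \<noteq> 0"

definition visible_fold_upper :: "vfield \<Rightarrow> plane \<Rightarrow> bool" where
  "visible_fold_upper Zp p \<longleftrightarrow> fold_of Zp p \<and> second_lie Zp p > 0"

definition visible_fold_lower :: "vfield \<Rightarrow> plane \<Rightarrow> bool" where
  "visible_fold_lower Zm p \<longleftrightarrow> fold_of Zm p \<and> second_lie Zm p < 0"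

definition regular_fold :: "vfield \<Rightarrow> vfield \<Rightarrow> plane \<Rightarrow> bool" where
  "regular_fold Zp Zm p \<longleftrightarrow>
     (fold_of Zp p \<and> snd (Zm p) \<noteq> 0) \<or> (fold_of Zm p \<and> snd (Zp p) \<noteq> 0)"

subsection \<open>Solutions and periodic orbits\<close>

text \<open>A solution concatenates, at a locally finite set \<open>D\<close> of times, orbits of \<open>Zp\<close> in \<open>y > 0\<close>, of
  \<open>Zm\<close> in \<open>y < 0\<close> and sliding orbits. No velocity is admitted at a crossing point, so a solution can
  be there only at times in \<open>D\<close>.\<close>

definition filippov_velocity :: "vfield \<Rightarrow> vfield \<Rightarrow> plane \<Rightarrow> plane \<Rightarrow> bool" where
  "filippov_velocity Zp Zm p v \<longleftrightarrow>
     (p \<in> upper_half \<and> v = Zp p) \<or> (p \<in> lower_half \<and> v = Zm p) \<or>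
     (p \<in> sliding_set Zp Zm \<and> sliding_velocity Zp Zm p v)"

definition filippov_solution_on :: "vfield \<Rightarrow> vfield \<Rightarrow> real set \<Rightarrow> (real \<Rightarrow> plane) \<Rightarrow> bool" where
  "filippov_solution_on Zp Zm I z \<longleftrightarrow>
     continuous_on I z \<and>
     (\<exists>D. (\<forall>b. finite (D \<inter> {-b..b})) \<and>
          (\<forall>t\<in>I - D. \<exists>v. filippov_velocity Zp Zm (z t) v \<and> (z has_vector_derivative v) (at t within I)))"

definition periodic_orbit :: "vfield \<Rightarrow> vfield \<Rightarrow> plane set \<Rightarrow> bool" where
  "periodic_orbit Zp Zm \<Gamma> \<longleftrightarrow>
     (\<exists>z T. filippov_solution_on Zp Zm UNIV z \<and> T > 0 \<and> (\<forall>t. z (t + T) = z t) \<and>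
            (\<exists>t. z t \<noteq> z 0) \<and> \<Gamma> = range z)"

definition cycle :: "vfield \<Rightarrow> vfield \<Rightarrow> plane set \<Rightarrow> bool" where
  "cycle Zp Zm \<Gamma> \<longleftrightarrow>
     periodic_orbit Zp Zm \<Gamma> \<and>
     (\<exists>N. open N \<and> \<Gamma> \<subseteq> N \<and> (\<forall>\<Gamma>'. periodic_orbit Zp Zm \<Gamma>' \<and> \<Gamma>' \<subseteq> N \<longrightarrow> \<Gamma>' = \<Gamma>))"

definition crossing_cycle :: "vfield \<Rightarrow> vfield \<Rightarrow> plane set \<Rightarrow> bool" where
  "crossing_cycle Zp Zm \<Gamma> \<longleftrightarrow>
     cycle Zp Zm \<Gamma> \<and> \<Gamma> \<inter> upper_half \<noteq> {} \<and> \<Gamma> \<inter> lower_half \<noteq> {} \<and>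
     \<Gamma> \<inter> disc_boundary \<subseteq> crossing_set Zp Zm"

definition critical_crossing_cycle :: "vfield \<Rightarrow> vfield \<Rightarrow> plane set \<Rightarrow> bool" where
  "critical_crossing_cycle Zp Zm \<Gamma> \<longleftrightarrow>
     cycle Zp Zm \<Gamma> \<and> \<Gamma> \<inter> upper_half \<noteq> {} \<and> \<Gamma> \<inter> lower_half \<noteq> {} \<and>
     (\<forall>p\<in>\<Gamma> \<inter> disc_boundary. p \<in> crossing_set Zp Zm \<or> snd (Zp p) * snd (Zm p) = 0) \<and>
     (\<exists>p\<in>\<Gamma>. tangent_point Zp Zm p)"

text \<open>Sliding segments are taken without their end points, hence they lie in the interior of the
  sliding set relative to \<open>disc_boundary\<close>.\<close>

definition sliding_segment :: "vfield \<Rightarrow> vfield \<Rightarrow> plane set \<Rightarrow> bool" where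
  "sliding_segment Zp Zm I \<longleftrightarrow>
     (\<exists>c d. c < d \<and> I = {c<..<d} \<times> {0}) \<and> I \<subseteq> sliding_set Zp Zm"

definition sliding_cycle :: "vfield \<Rightarrow> vfield \<Rightarrow> plane set \<Rightarrow> bool" where
  "sliding_cycle Zp Zm \<Gamma> \<longleftrightarrow>
     cycle Zp Zm \<Gamma> \<and> (\<exists>p\<in>\<Gamma>. tangent_point Zp Zm p) \<and> (\<exists>I\<subseteq>\<Gamma>. sliding_segment Zp Zm I)"

definition stable_sliding_cycle :: "vfield \<Rightarrow> vfield \<Rightarrow> plane set \<Rightarrow> bool" where
  "stable_sliding_cycle Zp Zm \<Gamma> \<longleftrightarrow>
     sliding_cycle Zp Zm \<Gamma> \<and>
     (\<forall>I\<subseteq>\<Gamma>. sliding_segment Zp Zm I \<longrightarrow> (\<forall>p\<in>I. stable_sliding Zp Zm p))"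

subsection \<open>Stability of cycles\<close>

text \<open>\<open>P\<close> is the first return map of the section \<open>{(x,0). \<bar>x - c\<bar> < \<delta>}\<close>, which at a crossing
  point \<open>(c,0)\<close> is transversal to both vector fields.\<close>

definition first_return_map ::
  "vfield \<Rightarrow> vfield \<Rightarrow> real \<Rightarrow> real \<Rightarrow> (real \<Rightarrow> real) \<Rightarrow> bool" where
  "first_return_map Zp Zm c \<delta> P \<longleftrightarrow>
     (\<forall>x. \<bar>x - c\<bar> < \<delta> \<longrightarrow> \<bar>P x - c\<bar> < \<delta> \<and>
        (\<exists>z t. t > 0 \<and> filippov_solution_on Zp Zm {0..t} z \<and> z 0 = (x, 0) \<and> z t = (P x, 0) \<and>
               (\<forall>s\<in>{0<..<t}. \<not> (snd (z s) = 0 \<and> \<bar>fst (z s) - c\<bar> < \<delta>))))"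

text \<open>For crossing cycles; the multiplier \<open>D\<close> does not depend on the chosen crossing point.\<close>

definition hyperbolically_stable :: "vfield \<Rightarrow> vfield \<Rightarrow> plane set \<Rightarrow> bool" where
  "hyperbolically_stable Zp Zm \<Gamma> \<longleftrightarrow>
     (\<exists>c \<delta> P D. (c, 0) \<in> \<Gamma> \<and> (c, 0) \<in> crossing_set Zp Zm \<and> \<delta> > 0 \<and>
        first_return_map Zp Zm c \<delta> P \<and> P c = c \<and>
        (P has_real_derivative D) (at c) \<and> \<bar>D\<bar> < 1)"

definition attracts_from :: "vfield \<Rightarrow> vfield \<Rightarrow> plane set \<Rightarrow> plane set \<Rightarrow> bool" where
  "attracts_from Zp Zm S \<Gamma> \<longleftrightarrow>
     (\<exists>N. open N \<and> \<Gamma> \<subseteq> N \<and>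
        (\<forall>q\<in>N \<inter> S.
           (\<exists>z. filippov_solution_on Zp Zm {0..} z \<and> z 0 = q) \<and>
           (\<forall>z. filippov_solution_on Zp Zm {0..} z \<and> z 0 = q \<longrightarrow>
                ((\<lambda>t. infdist (z t) \<Gamma>) \<longlongrightarrow> 0) at_top)))"

definition internally_stable :: "vfield \<Rightarrow> vfield \<Rightarrow> plane set \<Rightarrow> bool" where
  "internally_stable Zp Zm \<Gamma> \<longleftrightarrow> attracts_from Zp Zm (inside \<Gamma>) \<Gamma>"

definition externally_stable :: "vfield \<Rightarrow> vfield \<Rightarrow> plane set \<Rightarrow> bool" where
  "externally_stable Zp Zm \<Gamma> \<longleftrightarrow> attracts_from Zp Zm (outside \<Gamma>) \<Gamma>"

subsection \<open>Annuli\<close>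

text \<open>An open topological annulus of which \<open>\<Gamma>\<close> is a core curve.\<close>

definition annulus_of :: "plane set \<Rightarrow> plane set \<Rightarrow> bool" where
  "annulus_of \<Gamma> A \<longleftrightarrow>
     open A \<and>
     (\<exists>h h'. homeomorphism {w::plane. 1 < norm w \<and> norm w < 3} A h h' \<and> h ` sphere 0 2 = \<Gamma>)"

section \<open>The symmetric system\<close>

definition upper_field ::
  "(plane \<Rightarrow> real^'m \<Rightarrow> real) \<Rightarrow> (plane \<Rightarrow> real^'m \<Rightarrow> real) \<Rightarrow> real^'m \<Rightarrow> vfield" where
  "upper_field f g \<alpha> p = (f p \<alpha>, g p \<alpha>)"

definition lower_field ::
  "(plane \<Rightarrow> real^'m \<Rightarrow> real) \<Rightarrow> (plane \<Rightarrow> real^'m \<Rightarrow> real) \<Rightarrow> real^'m \<Rightarrow> vfield" where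
  "lower_field f g \<alpha> p = (- f (- p) \<alpha>, - g (- p) \<alpha>)"

definition partial_x :: "(plane \<Rightarrow> real^'m \<Rightarrow> real) \<Rightarrow> plane \<Rightarrow> real^'m \<Rightarrow> real" where
  "partial_x F p \<alpha> = deriv (\<lambda>x. F (x, snd p) \<alpha>) (fst p)"

definition partial_y :: "(plane \<Rightarrow> real^'m \<Rightarrow> real) \<Rightarrow> plane \<Rightarrow> real^'m \<Rightarrow> real" where
  "partial_y F p \<alpha> = deriv (\<lambda>y. F (fst p, y) \<alpha>) (snd p)"

definition partial_par :: "'m \<Rightarrow> (plane \<Rightarrow> real^'m \<Rightarrow> real) \<Rightarrow> plane \<Rightarrow> real^'m \<Rightarrow> real" where
  "partial_par i F p \<alpha> = deriv (\<lambda>s. F p (\<alpha> + s *\<^sub>R axis i 1)) 0"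

definition lam ::
  "(plane \<Rightarrow> real^'m \<Rightarrow> real) \<Rightarrow> (plane \<Rightarrow> real^'m \<Rightarrow> real) \<Rightarrow> (real \<Rightarrow> plane) \<Rightarrow> real \<Rightarrow> real \<Rightarrow> real" where
  "lam f g \<gamma> \<tau> t = exp (integral {t..\<tau>} (\<lambda>s. partial_x f (\<gamma> s) 0 + partial_y g (\<gamma> s) 0))"

definition kappa ::
  "(plane \<Rightarrow> real^'m \<Rightarrow> real) \<Rightarrow> (plane \<Rightarrow> real^'m \<Rightarrow> real) \<Rightarrow> (real \<Rightarrow> plane) \<Rightarrow> real \<Rightarrow> 'm \<Rightarrow> real" where
  "kappa f g \<gamma> \<tau> i =
     integral {0..\<tau>} (\<lambda>t. lam f g \<gamma> \<tau> t *
       (f (\<gamma> t) 0 * partial_par i g (\<gamma> t) 0 - g (\<gamma> t) 0 * partial_par i f (\<gamma> t) 0))"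

definition theta ::
  "(plane \<Rightarrow> real^'m \<Rightarrow> real) \<Rightarrow> (plane \<Rightarrow> real^'m \<Rightarrow> real) \<Rightarrow> real \<Rightarrow> (real \<Rightarrow> plane) \<Rightarrow> real \<Rightarrow> 'm \<Rightarrow> real" where
  "theta f g a \<gamma> \<tau> i =
     - kappa f g \<gamma> \<tau> i / g (a, 0) 0 - partial_par i g (- a, 0) 0 / partial_x g (- a, 0) 0"

definition Gamma0 :: "(real \<Rightarrow> plane) \<Rightarrow> real \<Rightarrow> plane set" where
  "Gamma0 \<gamma> \<tau> = \<gamma> ` {0..\<tau>} \<union> uminus ` \<gamma> ` {0..\<tau>}"

section \<open>The bifurcation diagram\<close>

text \<open>A thin annulus of the closed curve meets the \<open>x\<close>-axis only near \<open>(-a,0)\<close> and \<open>(a,0)\<close>; the two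
  parts are told apart by the sign of \<open>x\<close>.\<close>

definition left_part :: "plane set \<Rightarrow> plane set" where
  "left_part A = {p \<in> disc_boundary \<inter> A. fst p < 0}"

definition right_part :: "plane set \<Rightarrow> plane set" where
  "right_part A = {p \<in> disc_boundary \<inter> A. fst p > 0}"

text \<open>\<open>T\<close> is \<open>T\<^sup>-\<close>, \<open>- T\<close> is \<open>T\<^sup>+\<close>, and \<open>\<phi>\<close> is the value of \<open>f\<^sup>+\<close> at \<open>(-a,0)\<close> for zero
  parameter. The annulus \<open>A\<close> may have a wild boundary, so \<open>left_part A\<close> need not be connected; the
  sign conditions hold on all of it, and since \<open>T\<close> lies in the component of \<open>(-a,0)\<close>, an open
  segment, it splits that component into two nonempty segments. Likewise on the right.\<close>

definition boundary_dynamics ::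
  "vfield \<Rightarrow> vfield \<Rightarrow> plane set \<Rightarrow> real \<Rightarrow> real \<Rightarrow> plane \<Rightarrow> bool" where
  "boundary_dynamics Zp Zm A a \<phi> T \<longleftrightarrow>
     {p \<in> left_part A. tangent_point Zp Zm p} = {T} \<and>
     connected_component (disc_boundary \<inter> A) (- a, 0) T \<and>
     regular_fold Zp Zm T \<and> visible_fold_upper Zp T \<and>
     (\<phi> > 0 \<longrightarrow> (\<forall>p\<in>left_part A.
        (fst p < fst T \<longrightarrow> stable_sliding Zp Zm p \<and> slides_rightward Zp Zm p) \<and>
        (fst p > fst T \<longrightarrow> upward_crossing Zp Zm p))) \<and>
     (\<phi> < 0 \<longrightarrow> (\<forall>p\<in>left_part A.
        (fst p > fst T \<longrightarrow> stable_sliding Zp Zm p \<and> slides_leftward Zp Zm p) \<and>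
        (fst p < fst T \<longrightarrow> upward_crossing Zp Zm p))) \<and>
     {p \<in> right_part A. tangent_point Zp Zm p} = {- T} \<and>
     connected_component (disc_boundary \<inter> A) (a, 0) (- T) \<and>
     regular_fold Zp Zm (- T) \<and> visible_fold_lower Zm (- T) \<and>
     (\<phi> > 0 \<longrightarrow> (\<forall>p\<in>right_part A.
        (fst p > fst (- T) \<longrightarrow> stable_sliding Zp Zm p \<and> slides_leftward Zp Zm p) \<and>
        (fst p < fst (- T) \<longrightarrow> downward_crossing Zp Zm p))) \<and>
     (\<phi> < 0 \<longrightarrow> (\<forall>p\<in>right_part A.
        (fst p < fst (- T) \<longrightarrow> stable_sliding Zp Zm p \<and> slides_rightward Zp Zm p) \<and>
        (fst p > fst (- T) \<longrightarrow> downward_crossing Zp Zm p)))"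

definition slides_on :: "vfield \<Rightarrow> vfield \<Rightarrow> plane set \<Rightarrow> plane set \<Rightarrow> bool" where
  "slides_on Zp Zm \<Gamma> S \<longleftrightarrow> (\<exists>I. sliding_segment Zp Zm I \<and> I \<subseteq> \<Gamma> \<inter> S)"

definition crossing_cycles :: "vfield \<Rightarrow> vfield \<Rightarrow> plane set \<Rightarrow> plane set set" where
  "crossing_cycles Zp Zm A = {\<Gamma>. crossing_cycle Zp Zm \<Gamma> \<and> \<Gamma> \<subseteq> A}"

definition critical_cycles :: "vfield \<Rightarrow> vfield \<Rightarrow> plane set \<Rightarrow> plane set set" where
  "critical_cycles Zp Zm A = {\<Gamma>. critical_crossing_cycle Zp Zm \<Gamma> \<and> \<Gamma> \<subseteq> A}"

definition sliding_cycles :: "vfield \<Rightarrow> vfield \<Rightarrow> plane set \<Rightarrow> plane set set" where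
  "sliding_cycles Zp Zm A = {\<Gamma>. sliding_cycle Zp Zm \<Gamma> \<and> \<Gamma> \<subseteq> A}"

definition cycles_pos ::
  "vfield \<Rightarrow> vfield \<Rightarrow> plane set \<Rightarrow> plane \<Rightarrow> real \<Rightarrow> bool" where
  "cycles_pos Zp Zm A T \<beta>\<^sub>1 \<longleftrightarrow>
     (\<beta>\<^sub>1 < 0 \<longrightarrow>
        (\<exists>\<Gamma>. crossing_cycles Zp Zm A = {\<Gamma>} \<and> hyperbolically_stable Zp Zm \<Gamma> \<and>
             T \<notin> inside \<Gamma> \<and> - T \<notin> inside \<Gamma>) \<and>
        critical_cycles Zp Zm A = {} \<and> sliding_cycles Zp Zm A = {}) \<and>
     (\<beta>\<^sub>1 = 0 \<longrightarrow>
        (\<exists>\<Gamma>. critical_cycles Zp Zm A = {\<Gamma>} \<and> \<Gamma> \<inter> disc_boundary = {T, - T} \<and>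
             internally_stable Zp Zm \<Gamma>) \<and>
        crossing_cycles Zp Zm A = {} \<and> sliding_cycles Zp Zm A = {}) \<and>
     (\<beta>\<^sub>1 > 0 \<longrightarrow>
        (\<exists>\<Gamma>. sliding_cycles Zp Zm A = {\<Gamma>} \<and> stable_sliding_cycle Zp Zm \<Gamma> \<and>
             slides_on Zp Zm \<Gamma> (left_part A) \<and> slides_on Zp Zm \<Gamma> (right_part A)) \<and>
        crossing_cycles Zp Zm A = {} \<and> critical_cycles Zp Zm A = {})"

definition cycles_neg ::
  "vfield \<Rightarrow> vfield \<Rightarrow> plane set \<Rightarrow> plane \<Rightarrow> real \<Rightarrow> bool" where
  "cycles_neg Zp Zm A T \<beta>\<^sub>1 \<longleftrightarrow>
     (\<beta>\<^sub>1 > 0 \<longrightarrow>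
        (\<exists>\<Gamma>. crossing_cycles Zp Zm A = {\<Gamma>} \<and> hyperbolically_stable Zp Zm \<Gamma> \<and>
             T \<in> inside \<Gamma> \<and> - T \<in> inside \<Gamma>) \<and>
        critical_cycles Zp Zm A = {} \<and> sliding_cycles Zp Zm A = {}) \<and>
     (\<beta>\<^sub>1 = 0 \<longrightarrow>
        (\<exists>\<Gamma>. critical_cycles Zp Zm A = {\<Gamma>} \<and> \<Gamma> \<inter> disc_boundary = {T, - T} \<and>
             externally_stable Zp Zm \<Gamma>) \<and>
        crossing_cycles Zp Zm A = {} \<and> sliding_cycles Zp Zm A = {}) \<and>
     (\<beta>\<^sub>1 < 0 \<longrightarrow>
        (\<exists>\<Gamma>. sliding_cycles Zp Zm A = {\<Gamma>} \<and> stable_sliding_cycle Zp Zm \<Gamma> \<and>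
             slides_on Zp Zm \<Gamma> (left_part A) \<and> slides_on Zp Zm \<Gamma> (right_part A)) \<and>
        crossing_cycles Zp Zm A = {} \<and> critical_cycles Zp Zm A = {})"

end

theory Submission
  imports Defs "HOL-Analysis.Analysis" "HOL-Complex_Analysis.Winding_Numbers"
begin

text \<open>The map \<open>p \<mapsto> - p\<close> carries orbits to orbits, so a periodic orbit near \<open>\<Gamma>\<^sub>0\<close> is
  determined by half of itself, from the axis near \<open>(-a, 0)\<close> to the axis near \<open>(a, 0)\<close>. Let \<open>xT\<close>
  be the position of the fold near \<open>-a\<close>, and let \<open>s\<close> be the sign of \<open>f\<^sup>+(-a, 0; 0)\<close>. Points of the
  left section with \<open>s (x - xT) > 0\<close> are crossing points; the upper orbit through such a point lands
  at \<open>(P x, 0)\<close>. Points with \<open>s (x - xT) < 0\<close> slide to the fold and lift off there. Hence the half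
  return map is \<open>R x = - P x\<close> on the crossing side and the constant \<open>- P xT\<close> on the sliding side.

  The decisive fact is that \<open>P\<close> has derivative zero at \<open>-a\<close> for zero parameter: the section is
  tangent to the field there, so moving the starting point along it is, to first order, a shift in
  time. Near the reference cycle \<open>R\<close> is therefore a contraction with constant \<open>1/2\<close>. Its fixed
  point \<open>xs\<close> gives one periodic orbit, every solution in the neighbourhood reaches the axis and then
  follows the iterates of \<open>R\<close>, and so this orbit attracts everything and is the only periodic orbit
  (\<open>periodic_orbit_unique\<close>, \<open>attracts\<close>). Only its type remains to be found, and that is the sign of
  \<open>s (xs - xT)\<close>: positive means crossing, zero means passing through the folds, negative means
  sliding. As \<open>R\<close> is a contraction, this sign is opposite to that of \<open>s (P xT + xT)\<close>
  (\<open>beta_sign\<close>), so the bifurcation parameter is \<open>\<beta>\<^sub>1 = P xT + xT\<close>.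

  That \<open>\<beta>\<^sub>1\<close> is a coordinate on parameter space is a first-order computation. The landing time and
  the fold position come from the implicit function theorem, applied to the flow of the system
  extended by constant parameters. The derivative of the landing point follows from
  \<open>wedge_formula\<close>: the wedge product of the field with a solution of the variational equation
  satisfies a scalar linear equation whose coefficient is the divergence. The gradient of
  \<open>\<beta>\<^sub>1\<close> at zero is \<open>(\<theta>\<^sub>1, \<dots>, \<theta>\<^sub>m)\<close>, and a nonzero gradient can be completed to a coordinate
  system (\<open>diffeomorphism_with_coordinate\<close>).

  The position of the folds relative to a crossing cycle is a topological question. For \<open>s = 1\<close> they
  are joined to infinity by rays of the axis that miss the cycle; for \<open>s = -1\<close> the winding number
  of the cycle around them is nonzero (\<open>inside_orbit\<close>).\<close>

section \<open>Gronwall estimates and global solutions of Lipschitz equations\<close>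

text \<open>The weak form of the Gronwall inequality, with an error term \<open>e\<close> in the differential inequality: it
  serves for dependence on initial values (\<open>e = 0\<close>) and for the variational equation, whose
  coefficients differ along two neighbouring orbits.\<close>

lemma gronwall_vector:
  fixes w :: "real \<Rightarrow> 'a::real_normed_vector"
  assumes L: "0 \<le> L" and ab: "a \<le> b" and contw: "continuous_on {a..b} w"
    and der: "\<And>t. a < t \<Longrightarrow> t < b \<Longrightarrow> (w has_vector_derivative w' t) (at t)"
    and bnd: "\<And>t. a < t \<Longrightarrow> t < b \<Longrightarrow> norm (w' t) \<le> L * norm (w t) + e"
    and e: "0 \<le> e"
  shows "norm (w b) \<le> (norm (w a) + e * (b - a)) * exp (L * (b - a))"
proof -
  \<comment> \<open>\<open>norm (w t)\<close> may fail to be differentiable, so it is dominated by the integral \<open>\<phi>\<close>.\<close>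
  define \<phi> where "\<phi> t = norm (w a) + integral {a..t} (\<lambda>s. L * norm (w s) + e)" for t
  have contn: "continuous_on {a..b} (\<lambda>s. L * norm (w s) + e)"
    by (intro continuous_intros contw)
  have contphi: "continuous_on {a..b} \<phi>"
    unfolding \<phi>_def
    by (intro continuous_intros indefinite_integral_continuous_1 integrable_continuous_real contn)
  have derphi: "(\<phi> has_real_derivative L * norm (w t) + e) (at t)" if "a < t" "t < b" for t
  proof -
    have "((\<lambda>u. integral {a..u} (\<lambda>s. L * norm (w s) + e)) has_real_derivative L * norm (w t) + e)
        (at t within {a..b})"
      using integral_has_real_derivative[OF contn] that by auto
    then have "((\<lambda>u. integral {a..u} (\<lambda>s. L * norm (w s) + e)) has_real_derivative L * norm (w t) + e) (at t)"
      using that by (simp add: at_within_Icc_at)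
    then show ?thesis unfolding \<phi>_def by (auto intro!: derivative_eq_intros)
  qed
  have le: "norm (w t) \<le> \<phi> t" if "a \<le> t" "t \<le> b" for t
  proof (cases "a = t")
    case True then show ?thesis by (simp add: \<phi>_def)
  next
    case False
    then have at: "a < t" using that by simp
    have "norm (w t - w a) \<le> \<phi> t - \<phi> a"
    proof (rule differentiable_bound_general[OF at])
      show "continuous_on {a..t} w" "continuous_on {a..t} \<phi>"
        using contw contphi that by (auto elim: continuous_on_subset)
      show "(w has_vector_derivative w' x) (at x)" if "a < x" "x < t" for x
        using der that \<open>t \<le> b\<close> by auto
      show "(\<phi> has_vector_derivative L * norm (w x) + e) (at x)" if "a < x" "x < t" for x
        using derphi that \<open>t \<le> b\<close> by (auto simp: has_real_derivative_iff_has_vector_derivative)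
      show "norm (w' x) \<le> L * norm (w x) + e" if "a < x" "x < t" for x
        using bnd that \<open>t \<le> b\<close> by auto
    qed
    moreover have "\<phi> a = norm (w a)" by (simp add: \<phi>_def)
    moreover have "norm (w t) \<le> norm (w t - w a) + norm (w a)"
      using norm_triangle_ineq[of "w t - w a" "w a"] by simp
    ultimately show ?thesis by linarith
  qed
  define \<psi> where "\<psi> t = exp (- L * (t - a)) * \<phi> t - e * (t - a)" for t
  have "\<psi> b \<le> \<psi> a"
  proof (rule DERIV_nonpos_imp_decreasing_open[OF ab])
    fix t assume t: "a < t" "t < b"
    have d: "(\<psi> has_real_derivative exp (- L * (t - a)) * (- L) * \<phi> t
        + exp (- L * (t - a)) * (L * norm (w t) + e) - e) (at t)"
      unfolding \<psi>_def by (auto intro!: derivative_eq_intros derphi t)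
    have "exp (- L * (t - a)) * (- L) * \<phi> t + exp (- L * (t - a)) * (L * norm (w t) + e) - e
      = exp (- L * (t - a)) * (L * (norm (w t) - \<phi> t)) + (exp (- L * (t - a)) - 1) * e"
      by (simp add: algebra_simps)
    also have "\<dots> \<le> 0"
    proof -
      have "L * (norm (w t) - \<phi> t) \<le> 0" using L le[of t] t by (simp add: mult_nonneg_nonpos)
      moreover have "exp (- L * (t - a)) \<le> 1" using L t by simp
      ultimately show ?thesis using e
        by (smt (verit) exp_ge_zero mult_nonneg_nonpos mult_nonpos_nonneg)
    qed
    finally show "\<exists>y. (\<psi> has_real_derivative y) (at t) \<and> y \<le> 0" using d by blast
  next
    show "continuous_on {a..b} \<psi>" unfolding \<psi>_def by (intro continuous_intros contphi)
  qed
  then have "exp (- L * (b - a)) * \<phi> b \<le> norm (w a) + e * (b - a)"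
    by (simp add: \<psi>_def \<phi>_def)
  then have "exp (L * (b - a)) * (exp (- L * (b - a)) * \<phi> b) \<le> exp (L * (b - a)) * (norm (w a) + e * (b - a))"
    by (intro mult_left_mono) auto
  then have "\<phi> b \<le> exp (L * (b - a)) * (norm (w a) + e * (b - a))"
    by (simp add: mult.assoc[symmetric] exp_add[symmetric])
  then show ?thesis using le[of b] ab by (simp add: mult.commute)
qed

text \<open>Picard iteration in the supremum norm weighted by \<open>exp (- 2 * L * t)\<close>: the weight makes the
  integral operator a contraction on the whole interval at once. Non-autonomous fields are admitted because the variational equation is one.\<close>

lemma picard_global:
  fixes F :: "real \<Rightarrow> 'a::banach \<Rightarrow> 'a"
  assumes T: "0 \<le> T" and L: "0 < L"
    and contF: "continuous_on ({0..T} \<times> UNIV) (\<lambda>(t, x). F t x)"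
    and lip: "\<And>t x y. t \<in> {0..T} \<Longrightarrow> norm (F t x - F t y) \<le> L * norm (x - y)"
  obtains z where "z 0 = z0"
    "\<And>t. t \<in> {0..T} \<Longrightarrow> (z has_vector_derivative F t (z t)) (at t within {0..T})"
proof -
  define c where "c t = max 0 (min t T)" for t :: real
  have cI: "c t \<in> {0..T}" for t using T by (auto simp: c_def)
  have cid: "t \<in> {0..T} \<Longrightarrow> c t = t" for t by (auto simp: c_def)
  have contc: "continuous_on UNIV c" unfolding c_def by (intro continuous_intros)
  \<comment> \<open>\<open>u\<close> stands for the solution multiplied by the weight; values outside \<open>{0..T}\<close> are frozen by \<open>c\<close>.\<close>
  define f where "f u s = F s (exp (2 * L * s) *\<^sub>R apply_bcontfun u s)" for u :: "real \<Rightarrow>\<^sub>C 'a" and s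
  have contf: "continuous_on {0..T} (f u)" for u
  proof -
    have "continuous_on {0..T} ((\<lambda>(t, x). F t x) \<circ> (\<lambda>s. (s, exp (2 * L * s) *\<^sub>R apply_bcontfun u s)))"
      by (intro continuous_on_compose continuous_intros continuous_on_apply_bcontfun
          continuous_on_subset[OF contF]) auto
    then show ?thesis by (simp add: f_def o_def)
  qed
  have intf: "f u integrable_on {0..t}" if "t \<in> {0..T}" for u t
    using that by (intro integrable_continuous_real continuous_on_subset[OF contf]) auto
  define h where "h u t = exp (- 2 * L * t) *\<^sub>R (z0 + integral {0..t} (f u))" for u t
  have conth: "continuous_on {0..T} (h u)" for u
    unfolding h_def
    by (intro continuous_intros indefinite_integral_continuous_1 integrable_continuous_real contf)
  have hb: "(\<lambda>t. h u (c t)) \<in> bcontfun" for u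
  proof -
    have "continuous_on UNIV (h u \<circ> c)"
      by (intro continuous_on_compose contc continuous_on_subset[OF conth]) (use cI in auto)
    moreover have "bounded (range (h u \<circ> c))"
    proof (rule bounded_subset)
      show "bounded (h u ` {0..T})"
        by (intro compact_imp_bounded compact_continuous_image conth) auto
      show "range (h u \<circ> c) \<subseteq> h u ` {0..T}" using cI by auto
    qed
    ultimately show ?thesis by (simp add: bcontfun_def o_def)
  qed
  define \<Psi> where "\<Psi> u = Bcontfun (\<lambda>t. h u (c t))" for u
  have Psi: "apply_bcontfun (\<Psi> u) t = h u (c t)" for u t
    by (simp add: \<Psi>_def Bcontfun_inverse hb)
  have contr: "dist (\<Psi> u) (\<Psi> v) \<le> 1/2 * dist u v" for u v
  proof (rule dist_bound)
    fix t0 :: real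
    define t where "t = c t0"
    have t: "t \<in> {0..T}" using cI by (simp add: t_def)
    have e: "((\<lambda>s. exp (2 * L * s) * (L * dist u v)) has_integral
        (exp (2 * L * t) * (dist u v / 2) - exp (2 * L * 0) * (dist u v / 2))) {0..t}"
      using t L
      by (intro fundamental_theorem_of_calculus)
        (auto intro!: derivative_eq_intros simp: has_real_derivative_iff_has_vector_derivative[symmetric])
    have "norm (integral {0..t} (f u) - integral {0..t} (f v)) = norm (integral {0..t} (\<lambda>s. f u s - f v s))"
      using intf[OF t] by (simp add: integral_diff)
    also have "\<dots> \<le> integral {0..t} (\<lambda>s. exp (2 * L * s) * (L * dist u v))"
    proof (rule integral_norm_bound_integral)
      show "(\<lambda>s. f u s - f v s) integrable_on {0..t}" using intf[OF t] by (intro integrable_diff)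
      show "(\<lambda>s. exp (2 * L * s) * (L * dist u v)) integrable_on {0..t}" using e by blast
      fix s assume s: "s \<in> {0..t}"
      have "norm (f u s - f v s) \<le> L * norm (exp (2 * L * s) *\<^sub>R apply_bcontfun u s - exp (2 * L * s) *\<^sub>R apply_bcontfun v s)"
        unfolding f_def using s t by (intro lip) auto
      also have "\<dots> = L * (exp (2 * L * s) * dist (apply_bcontfun u s) (apply_bcontfun v s))"
        by (simp add: scaleR_diff_right[symmetric] dist_norm)
      also have "\<dots> \<le> L * (exp (2 * L * s) * dist u v)"
        using L by (intro mult_left_mono dist_bounded) auto
      finally show "norm (f u s - f v s) \<le> exp (2 * L * s) * (L * dist u v)" by (simp add: algebra_simps)
    qed
    also have "\<dots> = (exp (2 * L * t) - 1) * (dist u v / 2)"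
      using integral_unique[OF e] by (simp add: algebra_simps)
    finally have i: "norm (integral {0..t} (f u) - integral {0..t} (f v)) \<le> (exp (2 * L * t) - 1) * (dist u v / 2)" .
    have "dist (h u t) (h v t) = exp (- 2 * L * t) * norm (integral {0..t} (f u) - integral {0..t} (f v))"
      by (simp add: h_def dist_norm scaleR_diff_right[symmetric])
    also have "\<dots> \<le> exp (- 2 * L * t) * ((exp (2 * L * t) - 1) * (dist u v / 2))"
      by (intro mult_left_mono i) auto
    also have "\<dots> = (1 - exp (- 2 * L * t)) * (dist u v / 2)"
      by (simp add: algebra_simps exp_minus field_simps)
    also have "\<dots> \<le> 1 * (dist u v / 2)" by (intro mult_right_mono) auto
    finally show "dist (apply_bcontfun (\<Psi> u) t0) (apply_bcontfun (\<Psi> v) t0) \<le> 1/2 * dist u v"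
      by (simp add: Psi t_def)
  qed
  obtain u where u: "\<Psi> u = u" using banach_fix_type[of "1/2" \<Psi>] contr by auto
  define z where "z t = z0 + integral {0..t} (f u)" for t
  have uz: "exp (2 * L * t) *\<^sub>R apply_bcontfun u t = z t" if "t \<in> {0..T}" for t
  proof -
    have "apply_bcontfun u t = h u t" using Psi[of u t] u cid[OF that] by simp
    then show ?thesis by (simp add: h_def z_def exp_minus)
  qed
  show ?thesis
  proof
    show "z 0 = z0" by (simp add: z_def)
    fix t assume t: "t \<in> {0..T}"
    have "((\<lambda>x. integral {0..x} (f u)) has_vector_derivative f u t) (at t within {0..T})"
      using integral_has_vector_derivative[OF contf t] .
    then have "(z has_vector_derivative f u t) (at t within {0..T})"
      unfolding z_def by (auto intro!: derivative_eq_intros)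
    then show "(z has_vector_derivative F t (z t)) (at t within {0..T})"
      using uz[OF t] by (simp add: f_def)
  qed
qed

section \<open>Differentiability of the flow in time and initial value\<close>

lemma has_derivative_quadratic_bound:
  fixes f :: "'a::real_normed_vector \<Rightarrow> 'b::real_normed_vector"
  assumes S: "open S" "x \<in> S" and A: "bounded_linear A"
    and q: "\<And>y. y \<in> S \<Longrightarrow> norm (f y - f x - A (y - x)) \<le> C * (norm (y - x))\<^sup>2"
  shows "(f has_derivative A) (at x)"
proof -
  obtain e where e: "e > 0" "ball x e \<subseteq> S" using S open_contains_ball by blast
  show ?thesis
  proof (rule has_derivativeI_sandwich[OF e(1) A])
    fix y assume y: "y \<noteq> x" "dist y x < e"
    then have "y \<in> S" using e(2) by (auto simp: dist_commute)
    from q[OF this] y show "norm (f y - f x - A (y - x)) / norm (y - x) \<le> C * norm (y - x)"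
      by (simp add: divide_simps power2_eq_square mult.assoc)
  next
    have "((\<lambda>y. C * norm (y - x)) \<longlongrightarrow> C * norm (x - x)) (at x)" by (intro tendsto_intros)
    then show "((\<lambda>y. C * norm (y - x)) \<longlongrightarrow> 0) (at x)" by simp
  qed
qed

locale lipschitz_flow =
  fixes X :: "'a::euclidean_space \<Rightarrow> 'a" and L M T :: real and \<phi> :: "real \<Rightarrow> 'a \<Rightarrow> 'a"
  assumes L_pos: "0 < L" and T_pos: "0 < T"
    and field_lip: "norm (X x - X y) \<le> L * norm (x - y)"
    and field_bound: "norm (X x) \<le> M"
    and flow_0: "\<phi> 0 x = x"
    and flow_deriv: "t \<in> {0..T} \<Longrightarrow>
      ((\<lambda>t. \<phi> t x) has_vector_derivative X (\<phi> t x)) (at t within {0..T})"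
begin

lemma flow_cont_time: "continuous_on {0..T} (\<lambda>t. \<phi> t x)"
  using flow_deriv has_vector_derivative_continuous continuous_on_eq_continuous_within by blast

lemma flow_deriv_at: "0 < t \<Longrightarrow> t < T \<Longrightarrow> ((\<lambda>t. \<phi> t x) has_vector_derivative X (\<phi> t x)) (at t)"
  using flow_deriv[of t x] by (simp add: at_within_Icc_at)

lemma flow_lipschitz:
  assumes t: "t \<in> {0..T}"
  shows "norm (\<phi> t x - \<phi> t y) \<le> norm (x - y) * exp (L * T)"
proof -
  have "norm (\<phi> t x - \<phi> t y) \<le> (norm (\<phi> 0 x - \<phi> 0 y) + 0 * (t - 0)) * exp (L * (t - 0))"
  proof (rule gronwall_vector)
    show "continuous_on {0..t} (\<lambda>t. \<phi> t x - \<phi> t y)"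
      by (intro continuous_intros continuous_on_subset[OF flow_cont_time]) (use t in auto)
    show "((\<lambda>t. \<phi> t x - \<phi> t y) has_vector_derivative X (\<phi> s x) - X (\<phi> s y)) (at s)"
      if "0 < s" "s < t" for s
      using that t by (intro has_vector_derivative_diff flow_deriv_at) auto
    show "norm (X (\<phi> s x) - X (\<phi> s y)) \<le> L * norm (\<phi> s x - \<phi> s y) + 0" for s
      using field_lip by simp
  qed (use t L_pos in auto)
  also have "\<dots> \<le> norm (x - y) * exp (L * T)"
    using t L_pos by (auto simp: flow_0 intro!: mult_left_mono)
  finally show ?thesis .
qed

lemma flow_speed:
  assumes "s \<in> {0..T}" "t \<in> {0..T}"
  shows "norm (\<phi> t x - \<phi> s x) \<le> M * \<bar>t - s\<bar>"
proof -
  have "norm (\<phi> t x - \<phi> s x) \<le> M * norm (t - s)"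
  proof (rule differentiable_bound[of "{0..T}" "\<lambda>t. \<phi> t x" "\<lambda>t h. h *\<^sub>R X (\<phi> t x)"])
    show "((\<lambda>t. \<phi> t x) has_derivative (\<lambda>h. h *\<^sub>R X (\<phi> u x))) (at u within {0..T})" if "u \<in> {0..T}" for u
      using flow_deriv[OF that] by (simp add: has_vector_derivative_def)
    show "onorm (\<lambda>h. h *\<^sub>R X (\<phi> u x)) \<le> M" for u
      using onorm_scaleR_left[of "\<lambda>h. h" "X (\<phi> u x)"] field_bound[of "\<phi> u x"]
      by (simp add: onorm_id bounded_linear_ident)
  qed (use assms in auto)
  then show ?thesis by simp
qed

lemma flow_unique:
  assumes "b \<le> T" and cz: "continuous_on {0..b} z" and z0: "z 0 = x"
    and dz: "\<And>t. 0 < t \<Longrightarrow> t < b \<Longrightarrow> (z has_vector_derivative X (z t)) (at t)"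
    and t: "t \<in> {0..b}"
  shows "z t = \<phi> t x"
proof -
  have "norm (z t - \<phi> t x) \<le> (norm (z 0 - \<phi> 0 x) + 0 * (t - 0)) * exp (L * (t - 0))"
  proof (rule gronwall_vector[where w' = "\<lambda>t. X (z t) - X (\<phi> t x)"])
    show "continuous_on {0..t} (\<lambda>t. z t - \<phi> t x)"
      by (intro continuous_intros continuous_on_subset[OF flow_cont_time] continuous_on_subset[OF cz])
        (use t assms in auto)
    show "((\<lambda>t. z t - \<phi> t x) has_vector_derivative X (z s) - X (\<phi> s x)) (at s)"
      if "0 < s" "s < t" for s
      using that t assms by (intro has_vector_derivative_diff flow_deriv_at dz) auto
  qed (use t L_pos field_lip in auto)
  then show ?thesis using z0 flow_0 by simp
qed

text \<open>This estimate drives every later claim that orbits with nearby data stay close, also when they are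
  compared at slightly different times.\<close>

lemma flow_joint_estimate:
  assumes "s \<in> {0..T}" "t \<in> {0..T}"
  shows "norm (\<phi> t x - \<phi> s y) \<le> norm (x - y) * exp (L * T) + M * \<bar>t - s\<bar>"
  using flow_lipschitz[of t x y] flow_speed[of s t y] assms
    norm_triangle_ineq[of "\<phi> t x - \<phi> t y" "\<phi> t y - \<phi> s y"] by auto

lemma M_nonneg: "0 \<le> M"
  using field_bound[of 0] norm_ge_zero order_trans by blast

lemma flow_cont: "continuous_on ({0..T} \<times> UNIV) (\<lambda>(t, x). \<phi> t x)"
  unfolding continuous_on_def
proof safe
  fix t :: real and x :: 'a assume t: "t \<in> {0..T}"
  have "((\<lambda>p. norm (snd p - x) * exp (L * T) + M * \<bar>fst p - t\<bar>) \<longlongrightarrow> norm (snd (t, x) - x) * exp (L * T) + M * \<bar>fst (t, x) - t\<bar>) (at (t, x) within {0..T} \<times> UNIV)"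
    by (intro tendsto_intros)
  then have lim: "((\<lambda>p. norm (snd p - x) * exp (L * T) + M * \<bar>fst p - t\<bar>) \<longlongrightarrow> 0) (at (t, x) within {0..T} \<times> UNIV)"
    by simp
  show "((\<lambda>(t, x). \<phi> t x) \<longlongrightarrow> \<phi> t x) (at (t, x) within {0..T} \<times> UNIV)"
  proof (rule LIM_zero_cancel, rule tendsto_0_le[OF lim, of _ 1])
    show "\<forall>\<^sub>F p in at (t, x) within {0..T} \<times> UNIV. norm ((case p of (t, x) \<Rightarrow> \<phi> t x) - \<phi> t x)
        \<le> norm (norm (snd p - x) * exp (L * T) + M * \<bar>fst p - t\<bar>) * 1"
      unfolding eventually_at_filter
      using flow_joint_estimate[OF t] M_nonneg
      by (auto intro!: always_eventually simp: abs_of_nonneg)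
  qed
qed

end

text \<open>Only on \<open>G\<close> is the field required to be differentiable, because a field that is made globally
  Lipschitz by retraction to a ball need not be differentiable outside the open ball. Differentiability
  of the flow is then obtained for orbits that remain in \<open>G\<close>.\<close>

locale smooth_flow = lipschitz_flow X L M T \<phi>
  for X :: "'a::euclidean_space \<Rightarrow> 'a" and L M T :: real and \<phi> :: "real \<Rightarrow> 'a \<Rightarrow> 'a" +
  fixes G :: "'a set" and X' :: "'a \<Rightarrow> 'a \<Rightarrow>\<^sub>L 'a" and K :: real
  assumes G_open: "open G" and G_convex: "convex G" and K_nonneg: "0 \<le> K"
    and field_deriv: "x \<in> G \<Longrightarrow> (X has_derivative X' x) (at x)"
    and deriv_lip: "x \<in> G \<Longrightarrow> y \<in> G \<Longrightarrow> norm (X' x - X' y) \<le> K * norm (x - y)"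
    and deriv_bound: "x \<in> G \<Longrightarrow> norm (X' x) \<le> L"
begin

definition "stay = {x. \<forall>t\<in>{0..T}. \<phi> t x \<in> G}"

lemma open_stay: "open stay"
  unfolding open_contains_ball
proof
  fix x assume x: "x \<in> stay"
  have "compact ((\<lambda>t. \<phi> t x) ` {0..T})" by (intro compact_continuous_image flow_cont_time) auto
  moreover have "(\<lambda>t. \<phi> t x) ` {0..T} \<subseteq> G" using x by (auto simp: stay_def)
  ultimately obtain e where e: "e > 0" "(\<Union>y\<in>(\<lambda>t. \<phi> t x) ` {0..T}. ball y e) \<subseteq> G"
    using compact_subset_open_imp_ball_epsilon_subset[OF _ G_open] by blast
  show "\<exists>e>0. ball x e \<subseteq> stay"
  proof (intro exI conjI subsetI)
    show "0 < e * exp (- (L * T))" using e by simp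
    fix y assume y: "y \<in> ball x (e * exp (- (L * T)))"
    have "\<phi> t y \<in> ball (\<phi> t x) e" if t: "t \<in> {0..T}" for t
    proof -
      have "dist (\<phi> t x) (\<phi> t y) \<le> norm (x - y) * exp (L * T)"
        using flow_lipschitz[OF t] by (simp add: dist_norm)
      also have "\<dots> < e * exp (- (L * T)) * exp (L * T)" using y by (simp add: dist_norm)
      finally show ?thesis by (simp add: mult.assoc exp_minus)
    qed
    then show "y \<in> stay" using e(2) by (force simp: stay_def)
  qed
qed

text \<open>The derivative of the field is Lipschitz, so the linearisation error is quadratic, uniformly
  on \<open>G\<close>; the flow inherits such an error from it.\<close>

lemma second_order:
  assumes "x \<in> G" "y \<in> G"
  shows "norm (X y - X x - X' x (y - x)) \<le> K * (norm (y - x))\<^sup>2"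
proof -
  have seg: "x + t *\<^sub>R (y - x) \<in> G" if "t \<in> {0..1}" for t
  proof -
    have "(1 - t) *\<^sub>R x + t *\<^sub>R y \<in> G" using G_convex assms that by (simp add: convex_def)
    then show ?thesis by (simp add: algebra_simps)
  qed
  define S where "S = closed_segment x y"
  have SG: "S \<subseteq> G" unfolding S_def using G_convex assms by (simp add: closed_segment_subset)
  have "norm (X y - X x - X' x (y - x)) \<le> norm (y - x) * (K * norm (y - x))"
  proof (rule differentiable_bound_linearization[where S = S and f' = "\<lambda>x. X' x"])
    show "x + t *\<^sub>R (y - x) \<in> S" if "t \<in> {0..1}" for t
      using that unfolding S_def in_segment by (auto intro!: exI[of _ t] simp: algebra_simps)
    show "(X has_derivative X' z) (at z within S)" if "z \<in> S" for z
      using field_deriv SG that has_derivative_at_withinI by blast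
    show "onorm (blinfun_apply (X' z) - blinfun_apply (X' x)) \<le> K * norm (y - x)" if z: "z \<in> S" for z
    proof -
      have "onorm (blinfun_apply (X' z) - blinfun_apply (X' x)) = norm (X' z - X' x)"
        by (simp add: norm_blinfun.rep_eq minus_blinfun.rep_eq fun_diff_def)
      also have "\<dots> \<le> K * norm (z - x)" using deriv_lip z SG assms by blast
      also have "\<dots> \<le> K * norm (y - x)"
        using z K_nonneg segment_bound(1)[of z x y] by (auto simp: S_def intro!: mult_left_mono)
      finally show ?thesis .
    qed
    show "x \<in> S" by (simp add: S_def)
  qed
  then show ?thesis by (simp add: power2_eq_square algebra_simps)
qed

lemma variational_solution:
  "\<exists>Y. \<forall>x\<in>stay. Y 0 x = id_blinfun \<and>
     (\<forall>t\<in>{0..T}. ((\<lambda>t. Y t x) has_vector_derivative X' (\<phi> t x) o\<^sub>L Y t x) (at t within {0..T}))"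
proof -
  have "\<exists>y. y 0 = id_blinfun \<and>
     (\<forall>t\<in>{0..T}. (y has_vector_derivative X' (\<phi> t x) o\<^sub>L y t) (at t within {0..T}))" if x: "x \<in> stay" for x
  proof -
    have contX': "continuous_on G X'"
    proof (rule continuous_on_subset[OF lipschitz_on_continuous_on order_refl])
      show "K-lipschitz_on G X'" using deriv_lip K_nonneg by (auto simp: lipschitz_on_def dist_norm)
    qed
    have c: "continuous_on {0..T} (\<lambda>t. X' (\<phi> t x))"
      using x by (intro continuous_on_compose2[OF contX' flow_cont_time]) (auto simp: stay_def)
    show ?thesis
    proof (rule picard_global[of T L "\<lambda>t A. X' (\<phi> t x) o\<^sub>L A" id_blinfun])
      show "continuous_on ({0..T} \<times> UNIV) (\<lambda>(t, A). X' (\<phi> t x) o\<^sub>L A)"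
        unfolding split_beta
        by (intro continuous_intros continuous_on_compose2[OF c]
            bounded_bilinear.continuous_on[OF bounded_bilinear_blinfun_compose]) auto
      show "norm ((X' (\<phi> t x) o\<^sub>L A) - (X' (\<phi> t x) o\<^sub>L B)) \<le> L * norm (A - B)" if t: "t \<in> {0..T}" for t A B
      proof -
        have "norm ((X' (\<phi> t x) o\<^sub>L A) - (X' (\<phi> t x) o\<^sub>L B)) = norm (X' (\<phi> t x) o\<^sub>L (A - B))"
          by (simp add: bounded_bilinear.diff_right[OF bounded_bilinear_blinfun_compose])
        also have "\<dots> \<le> norm (X' (\<phi> t x)) * norm (A - B)" by (rule norm_blinfun_compose)
        also have "\<dots> \<le> L * norm (A - B)"
          using x t by (intro mult_right_mono deriv_bound) (auto simp: stay_def)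
        finally show ?thesis .
      qed
    qed (use T_pos L_pos in auto)
  qed
  then obtain y where "\<forall>x\<in>stay. y x 0 = id_blinfun \<and>
     (\<forall>t\<in>{0..T}. (y x has_vector_derivative X' (\<phi> t x) o\<^sub>L y x t) (at t within {0..T}))"
    by metis
  then show ?thesis by (intro exI[of _ "\<lambda>t x. y x t"]) auto
qed

definition "Y = (SOME Y. \<forall>x\<in>stay. Y 0 x = id_blinfun \<and>
     (\<forall>t\<in>{0..T}. ((\<lambda>t. Y t x) has_vector_derivative X' (\<phi> t x) o\<^sub>L Y t x) (at t within {0..T})))"

lemma Y_0: "x \<in> stay \<Longrightarrow> Y 0 x = id_blinfun"
  and Y_deriv: "x \<in> stay \<Longrightarrow> t \<in> {0..T} \<Longrightarrow>
    ((\<lambda>t. Y t x) has_vector_derivative X' (\<phi> t x) o\<^sub>L Y t x) (at t within {0..T})"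
  using someI_ex[OF variational_solution] unfolding Y_def[symmetric] by blast+

lemma Y_cont_time: "x \<in> stay \<Longrightarrow> continuous_on {0..T} (\<lambda>t. Y t x)"
  using Y_deriv has_vector_derivative_continuous continuous_on_eq_continuous_within by blast

lemma Y_deriv_at: "x \<in> stay \<Longrightarrow> 0 < t \<Longrightarrow> t < T \<Longrightarrow>
    ((\<lambda>t. Y t x) has_vector_derivative X' (\<phi> t x) o\<^sub>L Y t x) (at t)"
  using Y_deriv[of x t] by (simp add: at_within_Icc_at)

lemma stay_in_G: "x \<in> stay \<Longrightarrow> t \<in> {0..T} \<Longrightarrow> \<phi> t x \<in> G"
  by (simp add: stay_def)

lemma Y_bound:
  assumes x: "x \<in> stay" and t: "t \<in> {0..T}"
  shows "norm (Y t x) \<le> exp (L * T)"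
proof -
  have "norm (Y t x) \<le> (norm (Y 0 x) + 0 * (t - 0)) * exp (L * (t - 0))"
  proof (rule gronwall_vector)
    show "continuous_on {0..t} (\<lambda>t. Y t x)"
      by (intro continuous_on_subset[OF Y_cont_time]) (use t x in auto)
    show "((\<lambda>t. Y t x) has_vector_derivative X' (\<phi> s x) o\<^sub>L Y s x) (at s)" if "0 < s" "s < t" for s
      using that t x by (intro Y_deriv_at) auto
    show "norm (X' (\<phi> s x) o\<^sub>L Y s x) \<le> L * norm (Y s x) + 0" if "0 < s" "s < t" for s
      using norm_blinfun_compose[of "X' (\<phi> s x)" "Y s x"] deriv_bound[OF stay_in_G[OF x, of s]] that t
      by (smt (verit) atLeastAtMost_iff mult_right_mono norm_ge_zero)
  qed (use t L_pos in auto)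
  also have "\<dots> \<le> 1 * exp (L * T)"
    using t L_pos by (intro mult_mono) (auto simp: Y_0[OF x] norm_blinfun_id_le)
  finally show ?thesis by simp
qed

lemma Y_lipschitz:
  assumes x: "x \<in> stay" and y: "y \<in> stay" and t: "t \<in> {0..T}"
  shows "norm (Y t x - Y t y) \<le> K * norm (x - y) * exp (L * T) * exp (L * T) * T * exp (L * T)"
proof -
  define e where "e = K * (norm (x - y) * exp (L * T)) * exp (L * T)"
  have e0: "0 \<le> e" using K_nonneg by (simp add: e_def)
  have "norm (Y t x - Y t y) \<le> (norm (Y 0 x - Y 0 y) + e * (t - 0)) * exp (L * (t - 0))"
  proof (rule gronwall_vector)
    show "continuous_on {0..t} (\<lambda>t. Y t x - Y t y)"
      by (intro continuous_intros continuous_on_subset[OF Y_cont_time]) (use t x y in auto)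
    show "((\<lambda>t. Y t x - Y t y) has_vector_derivative (X' (\<phi> s x) o\<^sub>L Y s x) - (X' (\<phi> s y) o\<^sub>L Y s y)) (at s)"
      if "0 < s" "s < t" for s
      using that t x y by (intro has_vector_derivative_diff Y_deriv_at) auto
    show "norm ((X' (\<phi> s x) o\<^sub>L Y s x) - (X' (\<phi> s y) o\<^sub>L Y s y)) \<le> L * norm (Y s x - Y s y) + e"
      if "0 < s" "s < t" for s
    proof -
      have s: "s \<in> {0..T}" using that t by auto
      have "(X' (\<phi> s x) o\<^sub>L Y s x) - (X' (\<phi> s y) o\<^sub>L Y s y)
        = (X' (\<phi> s x) o\<^sub>L (Y s x - Y s y)) + ((X' (\<phi> s x) - X' (\<phi> s y)) o\<^sub>L Y s y)"
        by (simp add: bounded_bilinear.diff_right[OF bounded_bilinear_blinfun_compose]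
            bounded_bilinear.diff_left[OF bounded_bilinear_blinfun_compose])
      also have "norm \<dots> \<le> norm (X' (\<phi> s x)) * norm (Y s x - Y s y)
          + norm (X' (\<phi> s x) - X' (\<phi> s y)) * norm (Y s y)"
        by (intro order_trans[OF norm_triangle_ineq] add_mono norm_blinfun_compose)
      also have "\<dots> \<le> L * norm (Y s x - Y s y) + (K * norm (\<phi> s x - \<phi> s y)) * exp (L * T)"
        using stay_in_G[OF x s] stay_in_G[OF y s] K_nonneg L_pos
        by (intro add_mono mult_mono deriv_bound deriv_lip Y_bound[OF y s]) auto
      also have "\<dots> \<le> L * norm (Y s x - Y s y) + e"
        unfolding e_def using K_nonneg
        by (intro add_left_mono mult_right_mono mult_left_mono flow_lipschitz s) auto
      finally show ?thesis .
    qed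
  qed (use t L_pos e0 in auto)
  also have "\<dots> = e * t * exp (L * t)" by (simp add: Y_0 x y)
  also have "\<dots> \<le> e * T * exp (L * T)"
    using t L_pos e0 by (intro mult_mono mult_left_mono) auto
  finally show ?thesis by (simp add: e_def algebra_simps)
qed

lemma Y_speed:
  assumes x: "x \<in> stay" and s: "s \<in> {0..T}" and t: "t \<in> {0..T}"
  shows "norm (Y t x - Y s x) \<le> L * exp (L * T) * \<bar>t - s\<bar>"
proof -
  have "norm (Y t x - Y s x) \<le> L * exp (L * T) * norm (t - s)"
  proof (rule differentiable_bound[of "{0..T}" "\<lambda>t. Y t x" "\<lambda>t h. h *\<^sub>R (X' (\<phi> t x) o\<^sub>L Y t x)"])
    show "((\<lambda>t. Y t x) has_derivative (\<lambda>h. h *\<^sub>R (X' (\<phi> u x) o\<^sub>L Y u x))) (at u within {0..T})" if "u \<in> {0..T}" for u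
      using Y_deriv[OF x that] by (simp add: has_vector_derivative_def)
    show "onorm (\<lambda>h. h *\<^sub>R (X' (\<phi> u x) o\<^sub>L Y u x)) \<le> L * exp (L * T)" if u: "u \<in> {0..T}" for u
    proof -
      have "onorm (\<lambda>h. h *\<^sub>R (X' (\<phi> u x) o\<^sub>L Y u x)) = norm (X' (\<phi> u x) o\<^sub>L Y u x)"
        using onorm_scaleR_left[of "\<lambda>h. h" "X' (\<phi> u x) o\<^sub>L Y u x"]
        by (simp add: onorm_id bounded_linear_ident)
      also have "\<dots> \<le> norm (X' (\<phi> u x)) * norm (Y u x)" by (rule norm_blinfun_compose)
      also have "\<dots> \<le> L * exp (L * T)"
        using L_pos by (intro mult_mono deriv_bound stay_in_G[OF x u] Y_bound[OF x u]) auto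
      finally show ?thesis .
    qed
  qed (use s t in auto)
  then show ?thesis by simp
qed

text \<open>The difference of two orbits and the solution of the variational equation satisfy the same linear
  equation up to a quadratic error, which the Gronwall inequality preserves.\<close>

lemma flow_deriv_space:
  assumes x: "x \<in> stay" and t: "t \<in> {0..T}"
  shows "(\<phi> t has_derivative Y t x) (at x)"
proof (rule has_derivative_quadratic_bound[OF open_stay x])
  show "bounded_linear (Y t x)" by (rule blinfun.bounded_linear_right)
  fix y assume y: "y \<in> stay"
  define h where "h = y - x"
  define e where "e = K * (norm h * exp (L * T))\<^sup>2"
  have e0: "0 \<le> e" using K_nonneg by (simp add: e_def)
  have "norm (\<phi> t y - \<phi> t x - Y t x h) \<le> (norm (\<phi> 0 y - \<phi> 0 x - Y 0 x h) + e * (t - 0)) * exp (L * (t - 0))"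
  proof (rule gronwall_vector)
    show "continuous_on {0..t} (\<lambda>t. \<phi> t y - \<phi> t x - Y t x h)"
      by (intro continuous_intros continuous_on_subset[OF flow_cont_time] continuous_on_subset[OF Y_cont_time])
        (use t x y in auto)
    fix s assume st: "0 < s" "s < t"
    then have s: "s \<in> {0..T}" using t by auto
    have "((\<lambda>s. Y s x h) has_vector_derivative (X' (\<phi> s x) o\<^sub>L Y s x) h) (at s)"
      using bounded_linear.has_vector_derivative[OF blinfun.bounded_linear_left Y_deriv_at[OF x]] st t by auto
    then show "((\<lambda>t. \<phi> t y - \<phi> t x - Y t x h) has_vector_derivative
        X (\<phi> s y) - X (\<phi> s x) - X' (\<phi> s x) (Y s x h)) (at s)"
      using st t by (intro has_vector_derivative_diff flow_deriv_at) auto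
    have "X (\<phi> s y) - X (\<phi> s x) - X' (\<phi> s x) (Y s x h)
      = X' (\<phi> s x) (\<phi> s y - \<phi> s x - Y s x h) + (X (\<phi> s y) - X (\<phi> s x) - X' (\<phi> s x) (\<phi> s y - \<phi> s x))"
      by (simp add: blinfun.bilinear_simps)
    also have "norm \<dots> \<le> norm (X' (\<phi> s x)) * norm (\<phi> s y - \<phi> s x - Y s x h) + K * (norm (\<phi> s y - \<phi> s x))\<^sup>2"
      using second_order stay_in_G s x y
      by (intro order_trans[OF norm_triangle_ineq] add_mono norm_blinfun) auto
    also have "\<dots> \<le> L * norm (\<phi> s y - \<phi> s x - Y s x h) + e"
      unfolding e_def h_def using K_nonneg flow_lipschitz[OF s, of y x]
      by (intro add_mono mult_right_mono mult_left_mono deriv_bound stay_in_G[OF x s] power_mono) auto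
    finally show "norm (X (\<phi> s y) - X (\<phi> s x) - X' (\<phi> s x) (Y s x h))
        \<le> L * norm (\<phi> s y - \<phi> s x - Y s x h) + e" .
  qed (use t L_pos e0 in auto)
  also have "\<dots> = e * t * exp (L * t)" by (simp add: Y_0[OF x] flow_0 h_def)
  also have "\<dots> \<le> e * T * exp (L * T)"
    using t L_pos e0 by (intro mult_mono mult_left_mono) auto
  also have "\<dots> = (K * (exp (L * T))\<^sup>2 * T * exp (L * T)) * (norm (y - x))\<^sup>2"
    by (simp add: e_def h_def power_mult_distrib)
  finally show "norm (\<phi> t y - \<phi> t x - Y t x (y - x)) \<le> (K * (exp (L * T))\<^sup>2 * T * exp (L * T)) * (norm (y - x))\<^sup>2"
    by (simp add: h_def)
qed

lemma Y_cont: "continuous_on ({0..T} \<times> stay) (\<lambda>(t, x). Y t x)"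
  unfolding continuous_on_def
proof safe
  fix t :: real and x :: 'a assume t: "t \<in> {0..T}" and x: "x \<in> stay"
  let ?C = "K * exp (L * T) * exp (L * T) * T * exp (L * T)"
  have C: "0 \<le> ?C" using K_nonneg T_pos by simp
  have "((\<lambda>p. norm (snd p - x) * ?C + L * exp (L * T) * \<bar>fst p - t\<bar>) \<longlongrightarrow> norm (snd (t, x) - x) * ?C + L * exp (L * T) * \<bar>fst (t, x) - t\<bar>) (at (t, x) within {0..T} \<times> stay)"
    by (intro tendsto_intros)
  then have lim: "((\<lambda>p. norm (snd p - x) * ?C + L * exp (L * T) * \<bar>fst p - t\<bar>) \<longlongrightarrow> 0) (at (t, x) within {0..T} \<times> stay)"
    by simp
  have est: "norm (Y s y - Y t x) \<le> norm (y - x) * ?C + L * exp (L * T) * \<bar>s - t\<bar>"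
    if "s \<in> {0..T}" "y \<in> stay" for s y
    using Y_lipschitz[OF that(2) x that(1)] Y_speed[OF x t that(1)]
      norm_triangle_ineq[of "Y s y - Y s x" "Y s x - Y t x"] by (simp add: algebra_simps)
  show "((\<lambda>(t, x). Y t x) \<longlongrightarrow> Y t x) (at (t, x) within {0..T} \<times> stay)"
  proof (rule LIM_zero_cancel, rule tendsto_0_le[OF lim, of _ 1])
    show "\<forall>\<^sub>F p in at (t, x) within {0..T} \<times> stay. norm ((case p of (t, x) \<Rightarrow> Y t x) - Y t x)
        \<le> norm (norm (snd p - x) * ?C + L * exp (L * T) * \<bar>fst p - t\<bar>) * 1"
      unfolding eventually_at_filter
      using est by (auto intro!: always_eventually intro: order_trans[OF _ abs_ge_self])
  qed
qed

text \<open>The implicit function theorem needs the total derivative in time and initial value; it follows from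
  the two partial ones because the variational solution depends continuously on both.\<close>

lemma flow_has_derivative:
  assumes x: "x \<in> stay" and t: "0 < t" "t < T"
  shows "((\<lambda>(t, x). \<phi> t x) has_derivative (\<lambda>(s, h). s *\<^sub>R X (\<phi> t x) + Y t x h)) (at (t, x))"
proof -
  obtain e where e: "e > 0" "ball x e \<subseteq> stay" using open_stay x open_contains_ball by blast
  have op: "open ({0<..<T} \<times> ball x e)" by (intro open_Times) auto
  have mem: "(t, x) \<in> {0<..<T} \<times> ball x e" using t e by auto
  have "((\<lambda>(t, x). \<phi> t x) has_derivative (\<lambda>(s, h). s *\<^sub>R X (\<phi> t x) + Y t x h)) (at (t, x) within {0<..<T} \<times> ball x e)"
  proof (rule has_derivative_partialsI[where fy = "Y"])
    show "((\<lambda>t. \<phi> t x) has_derivative (\<lambda>s. s *\<^sub>R X (\<phi> t x))) (at t within {0<..<T})"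
      using flow_deriv_at[OF t] by (auto simp: has_vector_derivative_def intro: has_derivative_at_withinI)
    show "(\<phi> s has_derivative Y s y) (at y within ball x e)" if "s \<in> {0<..<T}" "y \<in> ball x e" for s y
      by (rule has_derivative_at_withinI, rule flow_deriv_space) (use that e in auto)
    have "continuous_on ({0<..<T} \<times> ball x e) (\<lambda>(t, x). Y t x)"
      by (rule continuous_on_subset[OF Y_cont]) (use e in auto)
    then show "continuous (at (t, x) within {0<..<T} \<times> ball x e) (\<lambda>(t, x). Y t x)"
      using mem by (simp add: continuous_on_eq_continuous_within)
  qed (use e in auto)
  then show ?thesis using at_within_open[OF mem op] by simp
qed

end

section \<open>A scalar implicit function theorem, and regularity of the field\<close>

text \<open>If \<open>\<tau>\<close> is a continuous choice of zeros then it is differentiable, with the derivative forced by the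
  chain rule: the linearisation of \<open>H\<close> at the zeros controls \<open>\<tau> y - \<tau> e\<close> by \<open>norm (y - e)\<close>.\<close>

lemma implicit_has_derivative:
  fixes H :: "real \<times> 'e::real_normed_vector \<Rightarrow> real"
  assumes der: "(H has_derivative H') (at (\<tau> e, e))"
    and cont: "(\<tau> \<longlongrightarrow> \<tau> e) (at e)"
    and zeros: "\<forall>\<^sub>F y in at e. H (\<tau> y, y) = 0" "H (\<tau> e, e) = 0"
    and nz: "H' (1, 0) \<noteq> 0"
  shows "(\<tau> has_derivative (\<lambda>h. - H' (0, h) / H' (1, 0))) (at e)"
proof -
  define c where "c = H' (1, 0)"
  have bl: "bounded_linear H'" by (rule has_derivative_bounded_linear[OF der])
  interpret bounded_linear H' by (rule bl)
  have split: "H' (s, h) = s * c + H' (0, h)" for s h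
  proof -
    have "(s, h) = s *\<^sub>R (1, 0) + (0, h)" by simp
    then show ?thesis using add[of "s *\<^sub>R (1, 0)" "(0, h)"] scaleR[of s "(1, 0)"] by (simp add: c_def)
  qed
  have bl2: "bounded_linear (\<lambda>h. H' (0, h))"
    by (intro bounded_linear_compose[OF bl] bounded_linear_Pair bounded_linear_zero bounded_linear_ident)
  obtain B where B: "B > 0" "\<And>h. \<bar>H' (0, h)\<bar> \<le> norm h * B"
    using bounded_linear.pos_bounded[OF bl2] by auto
  have c0: "\<bar>c\<bar> > 0" using nz by (simp add: c_def)
  show ?thesis
    unfolding has_derivative_at_alt
  proof (intro conjI allI impI)
    show "bounded_linear (\<lambda>h. - H' (0, h) / H' (1, 0))"
      by (rule bounded_linear_compose[OF bounded_linear_divide bounded_linear_minus[OF bl2]])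
    fix \<epsilon> :: real assume eps: "0 < \<epsilon>"
    define Q where "Q = 2 * B / \<bar>c\<bar> + 2"
    have Q: "Q > 0" using B c0 by (simp add: Q_def add_pos_pos)
    define e1 where "e1 = min (\<bar>c\<bar> / 2) (\<epsilon> * \<bar>c\<bar> / Q)"
    have e1: "e1 > 0" "e1 \<le> \<bar>c\<bar> / 2" "e1 \<le> \<epsilon> * \<bar>c\<bar> / Q" using c0 eps Q by (simp_all only: e1_def min_less_iff_conj min.cobounded1 min.cobounded2) simp
    obtain d where d: "d > 0" and dH: "\<And>y. norm (y - (\<tau> e, e)) < d \<Longrightarrow>
        norm (H y - H (\<tau> e, e) - H' (y - (\<tau> e, e))) \<le> e1 * norm (y - (\<tau> e, e))"
      using der e1(1) unfolding has_derivative_at_alt by blast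
    have "\<forall>\<^sub>F y in at e. dist (\<tau> y) (\<tau> e) < d / 2" by (rule tendstoD[OF cont]) (use d in simp)
    from eventually_conj[OF zeros(1) this]
    have "\<forall>\<^sub>F y in at e. H (\<tau> y, y) = 0 \<and> \<bar>\<tau> y - \<tau> e\<bar> < d / 2"
      by (simp only: dist_real_def)
    then obtain r where r: "r > 0" "\<And>y. y \<noteq> e \<Longrightarrow> dist y e < r \<Longrightarrow> H (\<tau> y, y) = 0 \<and> \<bar>\<tau> y - \<tau> e\<bar> < d / 2"
      unfolding eventually_at by auto
    show "\<exists>d>0. \<forall>y. norm (y - e) < d \<longrightarrow>
        norm (\<tau> y - \<tau> e - - H' (0, y - e) / H' (1, 0)) \<le> \<epsilon> * norm (y - e)"
    proof (intro exI conjI allI impI)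
      show "0 < min r (d / 2)" using r d by simp
      fix y assume y: "norm (y - e) < min r (d / 2)"
      show "norm (\<tau> y - \<tau> e - - H' (0, y - e) / H' (1, 0)) \<le> \<epsilon> * norm (y - e)"
      proof (cases "y = e")
        case True then show ?thesis using linear_simps[OF bl2] by simp
      next
        case False
        then have ry: "H (\<tau> y, y) = 0" "\<bar>\<tau> y - \<tau> e\<bar> < d / 2"
          using r(2)[of y] y by (auto simp: dist_norm)
        define \<Delta> h where "\<Delta> = \<tau> y - \<tau> e" and "h = y - e"
        have n: "norm (\<Delta>, h) \<le> \<bar>\<Delta>\<bar> + norm h" using norm_Pair_le[of \<Delta> h] by simp
        have "norm ((\<tau> y, y) - (\<tau> e, e)) < d"
          using n ry y by (simp add: \<Delta>_def h_def)
        from dH[OF this] have "\<bar>\<Delta> * c + H' (0, h)\<bar> \<le> e1 * norm (\<Delta>, h)"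
          using ry zeros(2) split[of \<Delta> h] by (simp add: \<Delta>_def h_def)
        also have "\<dots> \<le> e1 * (\<bar>\<Delta>\<bar> + norm h)" using n e1 by simp
        finally have main: "\<bar>\<Delta> * c + H' (0, h)\<bar> \<le> e1 * (\<bar>\<Delta>\<bar> + norm h)" .
        have "\<bar>\<Delta>\<bar> * \<bar>c\<bar> \<le> \<bar>\<Delta> * c + H' (0, h)\<bar> + \<bar>H' (0, h)\<bar>"
          by (simp add: abs_mult[symmetric])
        also have "\<dots> \<le> e1 * \<bar>\<Delta>\<bar> + e1 * norm h + norm h * B"
          using main B(2)[of h] by (simp add: algebra_simps)
        also have "\<dots> \<le> \<bar>c\<bar> / 2 * \<bar>\<Delta>\<bar> + \<bar>c\<bar> / 2 * norm h + norm h * B"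
          using e1(2) B(1) by (intro add_mono mult_right_mono) auto
        finally have "\<bar>\<Delta>\<bar> * \<bar>c\<bar> \<le> norm h * \<bar>c\<bar> + 2 * (norm h * B)" by (simp add: algebra_simps)
        then have "\<bar>\<Delta>\<bar> * \<bar>c\<bar> \<le> ((Q - 1) * norm h) * \<bar>c\<bar>"
        proof -
          have "(Q - 1) * \<bar>c\<bar> = 2 * B + \<bar>c\<bar>" using c0 by (simp add: Q_def distrib_right)
          then have "((Q - 1) * norm h) * \<bar>c\<bar> = norm h * (2 * B + \<bar>c\<bar>)" by (metis mult.commute mult.left_commute)
          then show ?thesis using \<open>\<bar>\<Delta>\<bar> * \<bar>c\<bar> \<le> norm h * \<bar>c\<bar> + 2 * (norm h * B)\<close>
            by (simp add: algebra_simps)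
        qed
        then have D: "\<bar>\<Delta>\<bar> \<le> (Q - 1) * norm h" using c0 mult_right_le_imp_le by blast
        have "\<bar>\<Delta> * c + H' (0, h)\<bar> \<le> e1 * (Q * norm h)"
        proof -
          have "\<bar>\<Delta>\<bar> + norm h \<le> Q * norm h" using D by (simp add: algebra_simps)
          then have "e1 * (\<bar>\<Delta>\<bar> + norm h) \<le> e1 * (Q * norm h)" using e1(1) by (intro mult_left_mono) auto
          then show ?thesis using main by linarith
        qed
        also have "\<dots> \<le> (\<epsilon> * \<bar>c\<bar> / Q) * (Q * norm h)" using e1 Q by (intro mult_right_mono) auto
        also have "\<dots> = \<epsilon> * norm h * \<bar>c\<bar>" using Q by simp
        finally have *: "\<bar>\<Delta> * c + H' (0, h)\<bar> \<le> \<epsilon> * norm h * \<bar>c\<bar>" .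
        have "\<Delta> - - H' (0, h) / c = (\<Delta> * c + H' (0, h)) / c" using c0 by (simp add: field_simps)
        then have "\<bar>\<Delta> - - H' (0, h) / c\<bar> = \<bar>\<Delta> * c + H' (0, h)\<bar> / \<bar>c\<bar>" by (simp add: abs_divide)
        also have "\<dots> \<le> \<epsilon> * norm h" using * c0 by (simp add: divide_le_eq)
        finally show ?thesis by (simp add: \<Delta>_def h_def c_def)
      qed
    qed
  qed
qed

text \<open>For a scalar equation the zero is found by monotonicity in \<open>t\<close> and the intermediate value theorem.
  Besides the zero, the sign of \<open>H\<close> on both sides of it is recorded: below it says on which side of the
  axis an orbit lies before and after landing, and which points of the axis are crossing points.\<close>

lemma implicit_function_scalar:
  fixes H :: "real \<times> 'e::real_normed_vector \<Rightarrow> real"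
  assumes W: "open W" "(t0, e0) \<in> W" and H0: "H (t0, e0) = 0"
    and der: "\<And>p. p \<in> W \<Longrightarrow> (H has_derivative H' p) (at p)"
    and cont: "continuous_on W (\<lambda>p. H' p (1, 0))"
    and nz: "\<sigma> * H' (t0, e0) (1, 0) > 0" and \<delta>0: "0 < \<delta>0"
  obtains \<delta> \<Omega> \<tau> where "0 < \<delta>" "\<delta> \<le> \<delta>0" "open \<Omega>" "e0 \<in> \<Omega>" "\<tau> e0 = t0"
    "\<And>t e. e \<in> \<Omega> \<Longrightarrow> \<bar>t - t0\<bar> \<le> \<delta> \<Longrightarrow> (t, e) \<in> W \<and> \<sigma> * H' (t, e) (1, 0) > 0"
    "\<And>e. e \<in> \<Omega> \<Longrightarrow> \<bar>\<tau> e - t0\<bar> < \<delta> \<and> H (\<tau> e, e) = 0"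
    "\<And>t e. e \<in> \<Omega> \<Longrightarrow> \<bar>t - t0\<bar> \<le> \<delta> \<Longrightarrow> \<tau> e < t \<Longrightarrow> \<sigma> * H (t, e) > 0"
    "\<And>t e. e \<in> \<Omega> \<Longrightarrow> \<bar>t - t0\<bar> \<le> \<delta> \<Longrightarrow> t < \<tau> e \<Longrightarrow> \<sigma> * H (t, e) < 0"
    "\<And>e. e \<in> \<Omega> \<Longrightarrow> (\<tau> has_derivative (\<lambda>h. - H' (\<tau> e, e) (0, h) / H' (\<tau> e, e) (1, 0))) (at e)"
proof -
  define W' where "W' = {p \<in> W. \<sigma> * H' p (1, 0) > 0}"
  have "open W'"
  proof -
    have "open ((\<lambda>p. \<sigma> * H' p (1, 0)) -` {0<..} \<inter> W)"
      by (intro continuous_on_open_vimage[OF W(1), THEN iffD1, rule_format] continuous_intros cont open_greaterThan)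
    then show ?thesis by (simp add: W'_def vimage_def Int_def conj_commute)
  qed
  moreover have "(t0, e0) \<in> W'" using W nz by (simp add: W'_def)
  ultimately obtain A B where AB: "open A" "open B" "t0 \<in> A" "e0 \<in> B" "A \<times> B \<subseteq> W'"
    using open_prod_elim[of W' "(t0, e0)"] by (metis mem_Sigma_iff)
  obtain d1 where d1: "d1 > 0" "cball t0 d1 \<subseteq> A" using AB open_contains_cball by blast
  define \<delta> where "\<delta> = min d1 \<delta>0"
  have \<delta>: "0 < \<delta>" "\<delta> \<le> \<delta>0" using d1 \<delta>0 by (auto simp: \<delta>_def)
  have inW': "(t, e) \<in> W'" if "\<bar>t - t0\<bar> \<le> \<delta>" "e \<in> B" for t e
  proof -
    have "t \<in> A" using that d1 by (auto simp: \<delta>_def dist_real_def subset_iff abs_minus_commute)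
    then show ?thesis using AB that by auto
  qed
  have contH: "continuous_on W H"
    using der has_derivative_continuous continuous_at_imp_continuous_on by blast
  have dert: "((\<lambda>t. \<sigma> * H (t, e)) has_real_derivative \<sigma> * H' (t, e) (1, 0)) (at t)"
    if "(t, e) \<in> W" for t e
  proof -
    have "((\<lambda>t. (t, e)) has_derivative (\<lambda>s. (s, 0))) (at t)"
      by (auto intro!: derivative_eq_intros)
    from has_derivative_compose[OF this der[OF that]]
    have hd: "((\<lambda>t. H (t, e)) has_derivative (\<lambda>s. H' (t, e) (s, 0))) (at t)" .
    have H's: "H' (t, e) (s, 0) = s * H' (t, e) (1, 0)" for s
    proof -
      interpret bounded_linear "H' (t, e)" using der[OF that] by (rule has_derivative_bounded_linear)
      show ?thesis using scaleR[of s "(1, 0)"] by simp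
    qed
    have eq: "(\<lambda>s. H' (t, e) (s, 0)) = (*) (H' (t, e) (1, 0))"
      by (rule ext, subst H's) (rule mult.commute)
    have "((\<lambda>t. H (t, e)) has_real_derivative H' (t, e) (1, 0)) (at t)"
      unfolding has_field_derivative_def by (rule hd[unfolded eq])
    then show ?thesis by (rule DERIV_cmult)
  qed
  have mono: "\<sigma> * H (s, e) < \<sigma> * H (t, e)"
    if "e \<in> B" "\<bar>s - t0\<bar> \<le> \<delta>" "\<bar>t - t0\<bar> \<le> \<delta>" "s < t" for s t e
  proof (rule DERIV_pos_imp_increasing[OF \<open>s < t\<close>])
    fix x assume "s \<le> x" "x \<le> t"
    then have "\<bar>x - t0\<bar> \<le> \<delta>" using that by auto
    then have "(x, e) \<in> W'" using inW' that by blast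
    then show "\<exists>y. ((\<lambda>t. \<sigma> * H (t, e)) has_real_derivative y) (at x) \<and> 0 < y"
      using dert[of x e] by (auto simp: W'_def)
  qed
  have slice: "open {e \<in> B. \<sigma> * H (t, e) > 0}" "open {e \<in> B. \<sigma> * H (t, e) < 0}" if "\<bar>t - t0\<bar> \<le> \<delta>" for t
  proof -
    have c: "continuous_on B (\<lambda>e. \<sigma> * H (t, e))"
      by (intro continuous_intros continuous_on_compose2[OF contH]) (use inW' that in \<open>auto simp: W'_def\<close>)
    have "open ((\<lambda>e. \<sigma> * H (t, e)) -` {0<..} \<inter> B)" "open ((\<lambda>e. \<sigma> * H (t, e)) -` {..<0} \<inter> B)"
      by (intro continuous_on_open_vimage[OF AB(2), THEN iffD1, rule_format] c open_greaterThan open_lessThan)+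
    then show "open {e \<in> B. \<sigma> * H (t, e) > 0}" "open {e \<in> B. \<sigma> * H (t, e) < 0}"
      by (simp_all add: vimage_def Int_def conj_commute)
  qed
  define \<Omega> where "\<Omega> = {e \<in> B. \<sigma> * H (t0 + \<delta>, e) > 0} \<inter> {e \<in> B. \<sigma> * H (t0 - \<delta>, e) < 0}"
  have opO: "open \<Omega>" unfolding \<Omega>_def using \<delta> by (intro open_Int slice) auto
  have e0O: "e0 \<in> \<Omega>"
    using mono[of e0 t0 "t0 + \<delta>"] mono[of e0 "t0 - \<delta>" t0] \<delta> AB H0 by (auto simp: \<Omega>_def)
  have OB: "\<Omega> \<subseteq> B" by (auto simp: \<Omega>_def)
  have ex: "\<exists>t. \<bar>t - t0\<bar> < \<delta> \<and> \<sigma> * H (t, e) = 0" if e: "e \<in> \<Omega>" for e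
  proof -
    have "\<exists>t. t0 - \<delta> \<le> t \<and> t \<le> t0 + \<delta> \<and> \<sigma> * H (t, e) = 0"
    proof (rule IVT')
      show "continuous_on {t0 - \<delta>..t0 + \<delta>} (\<lambda>t. \<sigma> * H (t, e))"
        by (intro continuous_intros continuous_on_compose2[OF contH])
          (use inW' e OB in \<open>auto simp: W'_def subset_iff abs_le_iff\<close>)
    qed (use e \<delta> in \<open>auto simp: \<Omega>_def\<close>)
    then obtain t where t: "t0 - \<delta> \<le> t" "t \<le> t0 + \<delta>" "\<sigma> * H (t, e) = 0" by blast
    moreover have "t \<noteq> t0 - \<delta>" "t \<noteq> t0 + \<delta>" using t e by (auto simp: \<Omega>_def)
    ultimately show ?thesis by (intro exI[of _ t]) auto
  qed
  define \<tau> where "\<tau> e = (SOME t. \<bar>t - t0\<bar> < \<delta> \<and> \<sigma> * H (t, e) = 0)" for e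
  have \<tau>: "\<bar>\<tau> e - t0\<bar> < \<delta>" "\<sigma> * H (\<tau> e, e) = 0" if "e \<in> \<Omega>" for e
    using someI_ex[OF ex[OF that]] by (auto simp: \<tau>_def)
  have \<sigma>: "\<sigma> \<noteq> 0" using nz by auto
  have gt: "\<sigma> * H (t, e) > 0" if "e \<in> \<Omega>" "\<bar>t - t0\<bar> \<le> \<delta>" "\<tau> e < t" for t e
    using mono[of e "\<tau> e" t] \<tau>[OF that(1)] that OB by auto
  have lt: "\<sigma> * H (t, e) < 0" if "e \<in> \<Omega>" "\<bar>t - t0\<bar> \<le> \<delta>" "t < \<tau> e" for t e
    using mono[of e t "\<tau> e"] \<tau>[OF that(1)] that OB by auto
  have t0: "\<tau> e0 = t0"
    using gt[OF e0O, of t0] lt[OF e0O, of t0] H0 \<delta> by (cases "\<tau> e0" t0 rule: linorder_cases) auto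
  have lim: "(\<tau> \<longlongrightarrow> \<tau> e) (at e)" if e: "e \<in> \<Omega>" for e
  proof (rule tendstoI)
    fix \<epsilon> :: real assume "0 < \<epsilon>"
    define \<eta> where "\<eta> = min (\<epsilon> / 2) (\<delta> - \<bar>\<tau> e - t0\<bar>)"
    have \<eta>: "\<eta> > 0" "\<eta> < \<epsilon>" using \<tau>[OF e] \<open>0 < \<epsilon>\<close> by (auto simp: \<eta>_def)
    have b: "\<bar>\<tau> e + \<eta> - t0\<bar> \<le> \<delta>" "\<bar>\<tau> e - \<eta> - t0\<bar> \<le> \<delta>"
      using \<eta>(1) min.cobounded2[of "\<epsilon> / 2" "\<delta> - \<bar>\<tau> e - t0\<bar>"] unfolding \<eta>_def[symmetric] by linarith+
    have "\<forall>\<^sub>F y in at e. y \<in> {y \<in> B. \<sigma> * H (\<tau> e + \<eta>, y) > 0}"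
      by (rule eventually_at_in_open'[OF slice(1)[OF b(1)]]) (use gt[OF e b(1)] \<eta> e OB in auto)
    moreover have "\<forall>\<^sub>F y in at e. y \<in> {y \<in> B. \<sigma> * H (\<tau> e - \<eta>, y) < 0}"
      by (rule eventually_at_in_open'[OF slice(2)[OF b(2)]]) (use lt[OF e b(2)] \<eta> e OB in auto)
    moreover have "\<forall>\<^sub>F y in at e. y \<in> \<Omega>"
      using opO e by (simp add: eventually_at_in_open')
    ultimately show "\<forall>\<^sub>F y in at e. dist (\<tau> y) (\<tau> e) < \<epsilon>"
    proof eventually_elim
      case (elim y)
      have "\<tau> y < \<tau> e + \<eta>"
        using lt[OF elim(3) b(1)] elim(1) \<tau>[OF elim(3)] by (cases "\<tau> y" "\<tau> e + \<eta>" rule: linorder_cases) auto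
      moreover have "\<tau> e - \<eta> < \<tau> y"
        using gt[OF elim(3) b(2)] elim(2) \<tau>[OF elim(3)] by (cases "\<tau> y" "\<tau> e - \<eta>" rule: linorder_cases) auto
      ultimately show ?case using \<eta> by (auto simp: dist_real_def)
    qed
  qed
  show ?thesis
  proof (rule that[where \<delta> = \<delta> and \<Omega> = \<Omega> and \<tau> = \<tau>, OF \<delta> opO e0O t0])
    show "(t, e) \<in> W \<and> \<sigma> * H' (t, e) (1, 0) > 0" if "e \<in> \<Omega>" "\<bar>t - t0\<bar> \<le> \<delta>" for t e
      using inW'[of t e] that OB by (auto simp: W'_def)
    show "\<bar>\<tau> e - t0\<bar> < \<delta> \<and> H (\<tau> e, e) = 0" if "e \<in> \<Omega>" for e using \<tau>[OF that] \<sigma> by auto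
    show "(\<tau> has_derivative (\<lambda>h. - H' (\<tau> e, e) (0, h) / H' (\<tau> e, e) (1, 0))) (at e)" if e: "e \<in> \<Omega>" for e
    proof (rule implicit_has_derivative[where H = H])
      have w: "(\<tau> e, e) \<in> W'" using inW'[of "\<tau> e" e] \<tau>[OF e] e OB by auto
      show "(H has_derivative H' (\<tau> e, e)) (at (\<tau> e, e))" using w der by (auto simp: W'_def)
      show "H' (\<tau> e, e) (1, 0) \<noteq> 0" using w by (auto simp: W'_def)
      have "\<forall>\<^sub>F y in at e. y \<in> \<Omega>" using opO e by (simp add: eventually_at_in_open')
      then show "\<forall>\<^sub>F y in at e. H (\<tau> y, y) = 0" by eventually_elim (use \<tau> \<sigma> in auto)
    qed (use lim e \<tau> \<sigma> in auto)
  qed (use gt lt in auto)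
qed

lemma Ck_on_antimono: "Ck_on (Suc n) S F \<Longrightarrow> Ck_on n S F"
proof (induction n arbitrary: F)
  case 0
  then show ?case
    by (auto intro: continuous_at_imp_continuous_on differentiable_imp_continuous_within)
next
  case (Suc n)
  then show ?case by simp
qed

lemma Ck_on_le: "m \<le> n \<Longrightarrow> Ck_on n S F \<Longrightarrow> Ck_on m S F"
proof (induction rule: inc_induct)
  case (step i)
  then show ?case using Ck_on_antimono by blast
qed

text \<open>Continuity of all directional derivatives bounds the operator norm on a ball through the basis
  vectors, and the mean value theorem does the rest.\<close>

lemma C1_lipschitz_on_cball:
  fixes F :: "'a::euclidean_space \<Rightarrow> 'b::real_normed_vector"
  assumes "Ck_on 1 UNIV F"
  obtains B where "0 \<le> B" "\<And>x y. x \<in> cball 0 \<rho> \<Longrightarrow> y \<in> cball 0 \<rho> \<Longrightarrow> norm (F x - F y) \<le> B * norm (x - y)"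
proof -
  define D where "D x = frechet_derivative F (at x)" for x
  have d: "(F has_derivative D x) (at x)" for x
    using assms frechet_derivative_works by (auto simp: D_def)
  have c: "continuous_on UNIV (\<lambda>x. D x v)" for v using assms by (simp add: D_def)
  define N where "N x = (\<Sum>b\<in>Basis. norm (D x b))" for x
  have "compact (N ` cball 0 \<rho>)"
    unfolding N_def
    by (intro compact_continuous_image continuous_intros compact_cball continuous_on_subset[OF c]) auto
  then obtain B where B: "\<And>x. x \<in> cball 0 \<rho> \<Longrightarrow> norm (N x) \<le> B"
    using compact_imp_bounded[of "N ` cball 0 \<rho>"] unfolding bounded_iff by (metis imageI)
  have on: "onorm (D x) \<le> N x" for x
  proof (rule onorm_bound)
    show "0 \<le> N x" by (simp add: N_def sum_nonneg)
    fix v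
    interpret bounded_linear "D x" by (rule has_derivative_bounded_linear[OF d])
    have "D x v = (\<Sum>b\<in>Basis. (v \<bullet> b) *\<^sub>R D x b)"
      by (subst euclidean_representation[symmetric, of v], simp only: sum scaleR)
    also have "norm \<dots> \<le> (\<Sum>b\<in>Basis. norm (D x b) * norm v)"
      by (rule order_trans[OF norm_sum sum_mono])
        (auto simp: mult.commute intro!: mult_right_mono Basis_le_norm)
    finally show "norm (D x v) \<le> N x * norm v" by (simp add: N_def sum_distrib_right)
  qed
  show ?thesis
  proof (rule that[of "max B 0"])
    fix x y :: 'a assume xy: "x \<in> cball 0 \<rho>" "y \<in> cball 0 \<rho>"
    show "norm (F x - F y) \<le> max B 0 * norm (x - y)"
    proof (rule differentiable_bound[of "cball 0 \<rho>" F D])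
      show "(F has_derivative D x) (at x within cball 0 \<rho>)" for x using d by (rule has_derivative_at_withinI)
      show "onorm (D x) \<le> max B 0" if "x \<in> cball 0 \<rho>" for x
        using on[of x] B[OF that] by auto
    qed (use xy in auto)
  qed auto
qed

lemma C2_real_derivative:
  fixes F :: "'a::euclidean_space \<Rightarrow> real"
  assumes "Ck_on 2 UNIV F"
  obtains F' :: "'a \<Rightarrow> 'a \<Rightarrow>\<^sub>L real" where "\<And>x. (F has_derivative F' x) (at x)"
    "\<And>\<rho>. \<exists>K\<ge>0. \<forall>x\<in>cball 0 \<rho>. \<forall>y\<in>cball 0 \<rho>. norm (F' x - F' y) \<le> K * norm (x - y)"
proof -
  define F' where "F' x = Blinfun (frechet_derivative F (at x))" for x
  have S: "Ck_on (Suc (Suc 0)) UNIV F" using assms by (simp add: numeral_2_eq_2)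
  have d: "(F has_derivative frechet_derivative F (at x)) (at x)" for x
    using S frechet_derivative_works by auto
  have ap: "blinfun_apply (F' x) = frechet_derivative F (at x)" for x
    unfolding F'_def by (rule bounded_linear_Blinfun_apply[OF has_derivative_bounded_linear[OF d]])
  have c: "Ck_on 1 UNIV (\<lambda>x. F' x v)" for v
    using S by (simp add: ap)
  show ?thesis
  proof (rule that)
    show "(F has_derivative F' x) (at x)" for x using d by (simp add: ap)
    fix \<rho> :: real
    have "\<exists>B. 0 \<le> B \<and> (\<forall>x\<in>cball 0 \<rho>. \<forall>y\<in>cball 0 \<rho>. norm (F' x b - F' y b) \<le> B * norm (x - y))" for b
      using C1_lipschitz_on_cball[OF c[of b], of \<rho>] by metis
    then obtain B where B: "\<And>b. 0 \<le> B b"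
      "\<And>b x y. x \<in> cball 0 \<rho> \<Longrightarrow> y \<in> cball 0 \<rho> \<Longrightarrow> norm (F' x b - F' y b) \<le> B b * norm (x - y)"
      by metis
    show "\<exists>K\<ge>0. \<forall>x\<in>cball 0 \<rho>. \<forall>y\<in>cball 0 \<rho>. norm (F' x - F' y) \<le> K * norm (x - y)"
    proof (intro exI conjI ballI)
      show "0 \<le> (\<Sum>b\<in>Basis. B b)" using B by (simp add: sum_nonneg)
      fix x y :: 'a assume xy: "x \<in> cball 0 \<rho>" "y \<in> cball 0 \<rho>"
      have "norm (F' x - F' y) \<le> (\<Sum>b\<in>Basis. norm ((F' x - F' y) b))" by (rule norm_blinfun_euclidean_le)
      also have "\<dots> \<le> (\<Sum>b\<in>Basis. B b * norm (x - y))"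
        using B(2) xy by (intro sum_mono) (simp add: blinfun.diff_left)
      finally show "norm (F' x - F' y) \<le> (\<Sum>b\<in>Basis. B b) * norm (x - y)" by (simp add: sum_distrib_right)
    qed
  qed
qed

section \<open>Filippov solutions: uniqueness tools and concatenation\<close>

text \<open>A Filippov solution has a velocity only off a locally finite set of times; monotonicity arguments
  must tolerate these exceptions.\<close>

lemma derivative_lower_bound_except_finite:
  fixes h h' :: "real \<Rightarrow> real"
  assumes ab: "a \<le> b" and cont: "continuous_on {a..b} h" and D: "finite D"
    and der: "\<And>t. a < t \<Longrightarrow> t < b \<Longrightarrow> t \<notin> D \<Longrightarrow> (h has_real_derivative h' t) (at t) \<and> c \<le> h' t"
  shows "c * (b - a) \<le> h b - h a"
proof -
  define k where "k t = (if t \<in> {a<..<b} - D then h' t else c)" for t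
  have k: "(k has_integral (h b - h a)) {a..b}"
  proof (rule fundamental_theorem_of_calculus_interior_strong[OF D ab _ cont])
    fix t assume t: "t \<in> {a<..<b} - D"
    then show "(h has_vector_derivative k t) (at t)"
      using der[of t] by (simp add: k_def has_real_derivative_iff_has_vector_derivative)
  qed
  have "((\<lambda>t. c) has_integral (c * (b - a))) {a..b}"
    using has_integral_const_real[of c a b] ab by (simp add: mult.commute)
  then show ?thesis
    by (rule has_integral_le[OF _ k]) (use der in \<open>auto simp: k_def\<close>)
qed

text \<open>By the fundamental theorem of calculus a continuous candidate for the derivative extends the
  derivative across a finite set. Thus inside an open half plane a Filippov solution is an ordinary one.\<close>

lemma removable_vector_derivative:
  fixes z :: "real \<Rightarrow> 'a::banach"
  assumes cont: "continuous_on {a..b} z" and D: "finite D" and conth: "continuous_on {a..b} h"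
    and der: "\<And>t. a < t \<Longrightarrow> t < b \<Longrightarrow> t \<notin> D \<Longrightarrow> (z has_vector_derivative h t) (at t)"
    and t: "t \<in> {a..b}"
  shows "(z has_vector_derivative h t) (at t within {a..b})"
proof -
  have i: "integral {a..x} h = z x - z a" if "x \<in> {a..b}" for x
  proof (rule integral_unique, rule fundamental_theorem_of_calculus_interior_strong[OF D])
    show "continuous_on {a..x} z" using that by (intro continuous_on_subset[OF cont]) auto
  qed (use that der in auto)
  have "((\<lambda>x. z a + integral {a..x} h) has_vector_derivative h t) (at t within {a..b})"
    using integral_has_vector_derivative[OF conth t] by (auto intro!: derivative_eq_intros)
  then show ?thesis
    by (rule has_vector_derivative_transform[rotated 2]) (use t i in auto)
qed

lemma ode_unique:
  fixes Z :: "'a::real_normed_vector \<Rightarrow> 'a"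
  assumes lip: "\<And>\<rho>. \<exists>L. L-lipschitz_on (cball 0 \<rho>) Z"
    and cz: "continuous_on {a..b} z" and cw: "continuous_on {a..b} w" and eq: "z a = w a"
    and dz: "\<And>t. a < t \<Longrightarrow> t < b \<Longrightarrow> (z has_vector_derivative Z (z t)) (at t)"
    and dw: "\<And>t. a < t \<Longrightarrow> t < b \<Longrightarrow> (w has_vector_derivative Z (w t)) (at t)"
    and t: "t \<in> {a..b}"
  shows "z t = w t"
proof -
  have "compact (z ` {a..b} \<union> w ` {a..b})"
    by (intro compact_Un compact_continuous_image cz cw) auto
  then obtain \<rho> where \<rho>: "z ` {a..b} \<union> w ` {a..b} \<subseteq> cball 0 \<rho>"
    using bounded_subset_ballD[OF compact_imp_bounded, of "z ` {a..b} \<union> w ` {a..b}" 0] ball_subset_cball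
    by (meson subset_trans)
  obtain L where L: "L-lipschitz_on (cball 0 \<rho>) Z" using lip by blast
  have "norm (z t - w t) \<le> (norm (z a - w a) + 0 * (t - a)) * exp (L * (t - a))"
  proof (rule gronwall_vector[where w' = "\<lambda>t. Z (z t) - Z (w t)"])
    show "continuous_on {a..t} (\<lambda>t. z t - w t)"
      by (intro continuous_intros continuous_on_subset[OF cz] continuous_on_subset[OF cw]) (use t in auto)
    show "((\<lambda>t. z t - w t) has_vector_derivative Z (z x) - Z (w x)) (at x)" if "a < x" "x < t" for x
      using that t by (intro has_vector_derivative_diff dz dw) auto
    show "norm (Z (z x) - Z (w x)) \<le> L * norm (z x - w x) + 0" if "a < x" "x < t" for x
    proof -
      have "x \<in> {a..b}" using that t by auto
      then have "z x \<in> cball 0 \<rho>" "w x \<in> cball 0 \<rho>" using \<rho> by blast+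
      then show ?thesis using lipschitz_onD[OF L] by (simp add: dist_norm)
    qed
  qed (use t L lipschitz_on_nonneg in auto)
  then show ?thesis using eq by simp
qed

lemma filippov_solution_cong:
  assumes z: "filippov_solution_on Zp Zm I z" and eq: "\<And>t. t \<in> I \<Longrightarrow> z' t = z t"
  shows "filippov_solution_on Zp Zm I z'"
proof -
  obtain D where D: "\<forall>b. finite (D \<inter> {-b..b})"
    "\<forall>t\<in>I - D. \<exists>v. filippov_velocity Zp Zm (z t) v \<and> (z has_vector_derivative v) (at t within I)"
    using z unfolding filippov_solution_on_def by blast
  have "continuous_on I z'"
    using z eq by (simp add: filippov_solution_on_def cong: continuous_on_cong)
  moreover have "\<exists>v. filippov_velocity Zp Zm (z' t) v \<and> (z' has_vector_derivative v) (at t within I)"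
    if t: "t \<in> I - D" for t
  proof -
    obtain v where v: "filippov_velocity Zp Zm (z t) v" "(z has_vector_derivative v) (at t within I)"
      using D(2) t by blast
    have "(z' has_vector_derivative v) (at t within I)"
      by (rule has_vector_derivative_transform[OF _ _ v(2)]) (use t eq in auto)
    then show ?thesis using v(1) eq[of t] t by (intro exI[of _ v]) auto
  qed
  ultimately show ?thesis unfolding filippov_solution_on_def using D(1) by (intro conjI exI[of _ D]) auto
qed

lemma filippov_solution_subset:
  assumes z: "filippov_solution_on Zp Zm I z" and J: "J \<subseteq> I"
  shows "filippov_solution_on Zp Zm J z"
proof -
  obtain D where D: "\<forall>b. finite (D \<inter> {-b..b})"
    "\<forall>t\<in>I - D. \<exists>v. filippov_velocity Zp Zm (z t) v \<and> (z has_vector_derivative v) (at t within I)"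
    using z unfolding filippov_solution_on_def by blast
  have "continuous_on J z"
    using z J continuous_on_subset by (auto simp: filippov_solution_on_def)
  then show ?thesis
    unfolding filippov_solution_on_def
  proof (intro conjI exI[of _ D] ballI)
    fix t assume "t \<in> J - D"
    then obtain v where "filippov_velocity Zp Zm (z t) v" "(z has_vector_derivative v) (at t within I)"
      using D(2) J by blast
    then show "\<exists>v. filippov_velocity Zp Zm (z t) v \<and> (z has_vector_derivative v) (at t within J)"
      using has_vector_derivative_within_subset[OF _ J] by (intro exI[of _ v]) auto
  qed (use D(1) in auto)
qed

lemma filippov_solution_shift:
  assumes z: "filippov_solution_on Zp Zm I z" and J: "\<And>t. t \<in> J \<Longrightarrow> t + c \<in> I"
  shows "filippov_solution_on Zp Zm J (\<lambda>t. z (t + c))"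
proof -
  obtain D where D: "\<And>b. finite (D \<inter> {-b..b})"
    "\<And>t. t \<in> I - D \<Longrightarrow> \<exists>v. filippov_velocity Zp Zm (z t) v \<and> (z has_vector_derivative v) (at t within I)"
    using z unfolding filippov_solution_on_def by blast
  define D' where "D' = (\<lambda>t. t - c) ` D"
  have "finite (D' \<inter> {-b..b})" for b
  proof (rule finite_subset)
    show "D' \<inter> {-b..b} \<subseteq> (\<lambda>t. t - c) ` (D \<inter> {- (\<bar>b\<bar> + \<bar>c\<bar>)..\<bar>b\<bar> + \<bar>c\<bar>})"
    proof
      fix x assume x: "x \<in> D' \<inter> {-b..b}"
      then have "x + c \<in> D" by (auto simp: D'_def)
      then show "x \<in> (\<lambda>t. t - c) ` (D \<inter> {- (\<bar>b\<bar> + \<bar>c\<bar>)..\<bar>b\<bar> + \<bar>c\<bar>})"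
        using x by (intro image_eqI[of _ _ "x + c"]) auto
    qed
    show "finite ((\<lambda>t. t - c) ` (D \<inter> {- (\<bar>b\<bar> + \<bar>c\<bar>)..\<bar>b\<bar> + \<bar>c\<bar>}))" using D(1) by blast
  qed
  moreover have "continuous_on J (\<lambda>t. z (t + c))"
    using z J by (intro continuous_on_compose2[of I z J]) (auto simp: filippov_solution_on_def intro!: continuous_intros)
  moreover have "\<exists>v. filippov_velocity Zp Zm (z (t + c)) v \<and> ((\<lambda>t. z (t + c)) has_vector_derivative v) (at t within J)"
    if t: "t \<in> J - D'" for t
  proof -
    have "t + c \<in> I - D" using t J by (force simp: D'_def)
    then obtain v where v: "filippov_velocity Zp Zm (z (t + c)) v" "(z has_vector_derivative v) (at (t + c) within I)"
      using D(2) by blast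
    have "((\<lambda>t. t + c) has_vector_derivative 1) (at t within J)" by (auto intro!: derivative_eq_intros)
    moreover have "(z has_vector_derivative v) (at (t + c) within (\<lambda>t. t + c) ` J)"
      by (rule has_vector_derivative_within_subset[OF v(2)]) (use J in auto)
    ultimately have "((z \<circ> (\<lambda>t. t + c)) has_vector_derivative 1 *\<^sub>R v) (at t within J)"
      by (rule vector_diff_chain_within)
    then show ?thesis using v(1) by (intro exI[of _ v]) (auto simp: o_def)
  qed
  ultimately show ?thesis unfolding filippov_solution_on_def by (intro conjI exI[of _ D']) auto
qed

text \<open>Locally finitely many pieces can be glued. The exceptional times of the glued curve are those of the
  pieces together with the end points, which is why crossing points do no harm.\<close>

lemma filippov_solution_glue:
  fixes p q :: "'i \<Rightarrow> real"
  assumes S: "S = (\<Union>n\<in>N. {p n..q n})" and pq: "\<And>n. n \<in> N \<Longrightarrow> p n \<le> q n"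
    and lf: "\<And>b. finite {n\<in>N. {p n..q n} \<inter> {-b..b} \<noteq> {}}"
    and sol: "\<And>n. n \<in> N \<Longrightarrow> filippov_solution_on Zp Zm {p n..q n} z"
  shows "filippov_solution_on Zp Zm S z"
proof -
  have "\<forall>n\<in>N. \<exists>D. (\<forall>b. finite (D \<inter> {-b..b})) \<and> (\<forall>t\<in>{p n..q n} - D.
      \<exists>v. filippov_velocity Zp Zm (z t) v \<and> (z has_vector_derivative v) (at t within {p n..q n}))"
    using sol unfolding filippov_solution_on_def by blast
  then obtain D where D: "\<And>n b. n \<in> N \<Longrightarrow> finite (D n \<inter> {-b..b})"
    "\<And>n t. n \<in> N \<Longrightarrow> t \<in> {p n..q n} - D n \<Longrightarrow>
      \<exists>v. filippov_velocity Zp Zm (z t) v \<and> (z has_vector_derivative v) (at t within {p n..q n})"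
    by metis
  define E where "E = (\<Union>n\<in>N. (D n \<inter> {p n..q n}) \<union> {p n, q n})"
  have "continuous_on S z"
    unfolding continuous_on_eq_continuous_within
  proof
    fix t assume t: "t \<in> S"
    define F where "F = {n\<in>N. {p n..q n} \<inter> {- (\<bar>t\<bar> + 1)..\<bar>t\<bar> + 1} \<noteq> {}}"
    define U where "U = (\<Union>n\<in>F. {p n..q n})"
    have "continuous_on U z"
      unfolding U_def
    proof (rule continuous_on_closed_Union)
      show "finite F" using lf[of "\<bar>t\<bar> + 1"] by (simp only: F_def)
    qed (use sol in \<open>auto simp: F_def filippov_solution_on_def\<close>)
    moreover have US: "S \<inter> ball t 1 - {t} = U \<inter> ball t 1 - {t}"
    proof -
      have "x \<in> U" if xS: "x \<in> S" "x \<in> ball t 1" for x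
      proof -
        obtain n where n: "n \<in> N" "x \<in> {p n..q n}" using xS S by blast
        have "x \<in> {- (\<bar>t\<bar> + 1)..\<bar>t\<bar> + 1}" using xS(2) by (auto simp: dist_real_def)
        then show ?thesis using n by (auto simp: U_def F_def)
      qed
      moreover have "U \<subseteq> S" by (auto simp: U_def F_def S)
      ultimately show ?thesis by blast
    qed
    moreover have "t \<in> U"
    proof -
      obtain n where n: "n \<in> N" "t \<in> {p n..q n}" using t S by blast
      then show ?thesis by (auto simp: U_def F_def intro!: bexI[of _ n] exI[of _ t])
    qed
    ultimately have "continuous (at t within U) z" by (simp add: continuous_on_eq_continuous_within)
    moreover have "at t within S = at t within U"
      by (rule at_within_nhd[of t "ball t 1"]) (use US in auto)
    ultimately show "continuous (at t within S) z" by simp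
  qed
  moreover have "finite (E \<inter> {-b..b})" for b
  proof (rule finite_subset)
    let ?F = "{n\<in>N. {p n..q n} \<inter> {-b..b} \<noteq> {}}"
    show "E \<inter> {-b..b} \<subseteq> (\<Union>n\<in>?F. (D n \<inter> {-b..b}) \<union> {p n, q n})"
      unfolding E_def using pq by fastforce
    show "finite (\<Union>n\<in>?F. (D n \<inter> {-b..b}) \<union> {p n, q n})"
      using lf[of b] D(1) by auto
  qed
  moreover have "\<exists>v. filippov_velocity Zp Zm (z t) v \<and> (z has_vector_derivative v) (at t within S)"
    if t: "t \<in> S - E" for t
  proof -
    obtain n where n: "n \<in> N" "t \<in> {p n..q n}" using t S by blast
    then have tn: "t \<notin> D n" "p n < t" "t < q n"
      using t unfolding E_def by (auto simp: less_le)
    obtain v where v: "filippov_velocity Zp Zm (z t) v" "(z has_vector_derivative v) (at t within {p n..q n})"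
      using D(2)[OF n(1)] n tn by blast
    then have "(z has_vector_derivative v) (at t)" using tn by (simp add: at_within_Icc_at)
    then show ?thesis using v(1) has_vector_derivative_at_within by (intro exI[of _ v]) auto
  qed
  ultimately show ?thesis unfolding filippov_solution_on_def by (intro conjI exI[of _ E]) auto
qed

lemma filippov_solution_upper:
  assumes "\<And>t. t \<in> {0..b} \<Longrightarrow> (w has_vector_derivative Zp (w t)) (at t within {0..b})"
    and "\<And>t. 0 < t \<Longrightarrow> t < b \<Longrightarrow> w t \<in> upper_half"
  shows "filippov_solution_on Zp Zm {0..b} w"
  unfolding filippov_solution_on_def
proof (intro conjI exI[of _ "{0, b}"] allI ballI)
  show "continuous_on {0..b} w"
    using assms(1) has_vector_derivative_continuous continuous_on_eq_continuous_within by blast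
  fix t assume "t \<in> {0..b} - {0, b}"
  then show "\<exists>v. filippov_velocity Zp Zm (w t) v \<and> (w has_vector_derivative v) (at t within {0..b})"
    using assms by (intro exI[of _ "Zp (w t)"]) (auto simp: filippov_velocity_def)
next
  fix c :: real
  show "finite ({0, b} \<inter> {- c..c})" by (rule finite_Int) simp
qed

lemma filippov_solution_velocity:
  assumes z: "filippov_solution_on Zp Zm I z" and sub: "{p..q} \<subseteq> I"
  obtains D where "finite D"
    "\<And>t. p < t \<Longrightarrow> t < q \<Longrightarrow> t \<notin> D \<Longrightarrow> \<exists>v. filippov_velocity Zp Zm (z t) v \<and> (z has_vector_derivative v) (at t)"
    "continuous_on {p..q} z"
proof -
  have z': "filippov_solution_on Zp Zm {p..q} z" by (rule filippov_solution_subset[OF z sub])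
  then obtain D where D: "\<And>b. finite (D \<inter> {-b..b})"
    "\<And>t. t \<in> {p..q} - D \<Longrightarrow> \<exists>v. filippov_velocity Zp Zm (z t) v \<and> (z has_vector_derivative v) (at t within {p..q})"
    unfolding filippov_solution_on_def by blast
  show ?thesis
  proof (rule that[of "D \<inter> {- (\<bar>p\<bar> + \<bar>q\<bar>)..\<bar>p\<bar> + \<bar>q\<bar>}"])
    show "\<exists>v. filippov_velocity Zp Zm (z t) v \<and> (z has_vector_derivative v) (at t)"
      if t: "p < t" "t < q" "t \<notin> D \<inter> {- (\<bar>p\<bar> + \<bar>q\<bar>)..\<bar>p\<bar> + \<bar>q\<bar>}" for t
    proof -
      have "t \<in> {p..q} - D" using t by auto
      from D(2)[OF this] show ?thesis using t by (simp add: at_within_Icc_at)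
    qed
    show "continuous_on {p..q} z" using z' by (simp add: filippov_solution_on_def)
  qed (rule D(1))
qed

text \<open>The lower bound \<open>c\<close> on the durations excludes accumulation of switching times, so infinitely many
  pieces fill the whole half line.\<close>

lemma filippov_solution_concat:
  assumes sol: "\<And>n. filippov_solution_on Zp Zm {0..d n} (zs n)"
    and c: "0 < c" "\<And>n. c \<le> d n" and join: "\<And>n. zs n (d n) = zs (Suc n) 0"
  obtains z where "filippov_solution_on Zp Zm {0..} z" "z 0 = zs 0 0"
proof -
  define T where "T n = (\<Sum>i<n. d i)" for n
  have T0: "T 0 = 0" and TS: "T (Suc n) = T n + d n" for n by (simp_all add: T_def)
  have dpos: "0 < d n" for n using c(1) c(2)[of n] by linarith
  have Tn: "real n * c \<le> T n" for n
  proof (induction n)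
    case (Suc n)
    then show ?case using c(2)[of n] by (simp add: TS algebra_simps)
  qed (simp add: T0)
  have mono: "strict_mono T" by (rule strict_monoI_Suc) (use dpos in \<open>simp add: TS\<close>)
  have ex: "\<exists>n. t < T (Suc n)" for t
  proof -
    obtain n where "t / c < real n" using reals_Archimedean2 by blast
    then have "t < real n * c" using c(1) by (simp add: field_simps)
    also have "\<dots> \<le> T n" by (rule Tn)
    also have "T n < T (Suc n)" using mono by (simp add: strict_mono_Suc_iff)
    finally show ?thesis by blast
  qed
  define idx where "idx t = (LEAST n. t < T (Suc n))" for t
  define z where "z t = zs (idx t) (t - T (idx t))" for t
  have idx: "idx t = n" if "T n \<le> t" "t < T (Suc n)" for t n
    unfolding idx_def
  proof (rule Least_equality)
    fix m assume "t < T (Suc m)"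
    then have "T n < T (Suc m)" using that by linarith
    then have "n < Suc m" using mono strict_mono_less by blast
    then show "n \<le> m" by simp
  qed (rule that)
  have zeq: "z t = zs n (t - T n)" if "t \<in> {T n..T (Suc n)}" for t n
  proof (cases "t = T (Suc n)")
    case True
    have "idx t = Suc n" using True mono by (intro idx) (auto simp: strict_mono_Suc_iff)
    then show ?thesis using True join[of n] by (simp add: z_def TS)
  next
    case False
    then have "idx t = n" using that by (intro idx) auto
    then show ?thesis by (simp add: z_def)
  qed
  show ?thesis
  proof (rule that)
    show "z 0 = zs 0 0" using zeq[of 0 0] T0 TS[of 0] dpos[of 0] by simp
    show "filippov_solution_on Zp Zm {0..} z"
    proof (rule filippov_solution_glue[where N = "UNIV :: nat set" and p = T and q = "\<lambda>n. T (Suc n)"])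
      show "{0..} = (\<Union>n\<in>UNIV. {T n..T (Suc n)})"
      proof (intro set_eqI iffI)
        fix t :: real assume "t \<in> {0..}"
        then have t: "0 \<le> t" by simp
        have "t < T (Suc (idx t))" unfolding idx_def by (rule LeastI_ex[OF ex])
        moreover have "T (idx t) \<le> t"
        proof (cases "idx t")
          case 0 then show ?thesis using T0 t by simp
        next
          case (Suc m)
          then have "\<not> t < T (Suc m)" using not_less_Least[of m "\<lambda>n. t < T (Suc n)"] by (simp add: idx_def)
          then show ?thesis using Suc by simp
        qed
        ultimately show "t \<in> (\<Union>n. {T n..T (Suc n)})" by (intro UN_I[of "idx t"]) auto
      next
        fix t assume "t \<in> (\<Union>n. {T n..T (Suc n)})"
        then obtain n where "t \<in> {T n..T (Suc n)}" by blast
        moreover have "0 \<le> T n" using Tn[of n] c by (smt (verit) mult_nonneg_nonneg of_nat_0_le_iff)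
        ultimately show "t \<in> {0..}" by auto
      qed
      show "T n \<le> T (Suc n)" for n using dpos[of n] TS by simp
      show "finite {n \<in> UNIV. {T n..T (Suc n)} \<inter> {- b..b} \<noteq> {}}" for b
      proof (rule finite_subset)
        show "{n \<in> UNIV. {T n..T (Suc n)} \<inter> {- b..b} \<noteq> {}} \<subseteq> {n. real n \<le> b / c}"
        proof
          fix n assume "n \<in> {n \<in> UNIV. {T n..T (Suc n)} \<inter> {- b..b} \<noteq> {}}"
          then obtain x where "x \<in> {T n..T (Suc n)}" "x \<in> {- b..b}" by blast
          then have "real n * c \<le> b" using Tn[of n] by auto
          then show "n \<in> {n. real n \<le> b / c}" using c by (simp add: field_simps)
        qed
        have "{n. real n \<le> b / c} \<subseteq> {..nat \<lfloor>b / c\<rfloor>}" by (auto simp: le_nat_floor)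
        then show "finite {n. real n \<le> b / c}" using finite_subset by blast
      qed
      show "filippov_solution_on Zp Zm {T n..T (Suc n)} z" for n
      proof (rule filippov_solution_cong)
        show "filippov_solution_on Zp Zm {T n..T (Suc n)} (\<lambda>t. zs n (t + - T n))"
          by (rule filippov_solution_shift[OF sol]) (auto simp: TS)
        show "z t = zs n (t + - T n)" if "t \<in> {T n..T (Suc n)}" for t using zeq[OF that] by simp
      qed
    qed
  qed
qed

lemma filippov_solution_join:
  assumes z: "filippov_solution_on Zp Zm {0..d} z" and w: "filippov_solution_on Zp Zm {0..e} w"
    and d: "0 \<le> d" "0 \<le> e" and join: "z d = w 0"
  shows "filippov_solution_on Zp Zm {0..d + e} (\<lambda>t. if t \<le> d then z t else w (t - d))"
    (is "filippov_solution_on _ _ _ ?v")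
proof (rule filippov_solution_glue[where N = "UNIV :: bool set" and p = "\<lambda>i. if i then 0 else d"
      and q = "\<lambda>i. if i then d else d + e"])
  show "{0..d + e} = (\<Union>n\<in>UNIV. {if n then 0 else d..if n then d else d + e})"
    using d by (auto simp: UNIV_bool)
  show "filippov_solution_on Zp Zm {if n then 0 else d..if n then d else d + e} ?v" for n
  proof (cases n)
    case True
    show ?thesis by (rule filippov_solution_cong[of _ _ _ z]) (use True z in auto)
  next
    case False
    have "filippov_solution_on Zp Zm {d..d + e} (\<lambda>t. w (t + - d))"
      by (rule filippov_solution_shift[OF w]) auto
    moreover have "?v t = w (t + - d)" if "t \<in> {d..d + e}" for t
      using that join by (cases "t = d") auto
    ultimately have "filippov_solution_on Zp Zm {d..d + e} ?v" by (rule filippov_solution_cong)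
    then show ?thesis using False by simp
  qed
qed (use d in auto)

section \<open>Symmetric Filippov systems with a half return map\<close>

definition mirror :: "vfield \<Rightarrow> vfield" where "mirror Z p = - Z (- p)"

lemma filippov_velocity_mirror:
  assumes "filippov_velocity Z (mirror Z) p v"
  shows "filippov_velocity Z (mirror Z) (- p) (- v)"
proof -
  consider (up) "p \<in> upper_half" "v = Z p" | (low) "p \<in> lower_half" "v = mirror Z p"
    | (sl) "p \<in> sliding_set Z (mirror Z)" "sliding_velocity Z (mirror Z) p v"
    using assms by (auto simp: filippov_velocity_def)
  then show ?thesis
  proof cases
    case up
    then show ?thesis by (simp add: filippov_velocity_def upper_half_def lower_half_def mirror_def)
  next
    case low
    then show ?thesis by (simp add: filippov_velocity_def upper_half_def lower_half_def mirror_def)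
  next
    case sl
    then obtain \<mu> where \<mu>: "\<mu> \<in> {0..1}" "v = \<mu> *\<^sub>R mirror Z p + (1 - \<mu>) *\<^sub>R Z p" "snd v = 0"
      by (auto simp: sliding_velocity_def)
    have "sliding_velocity Z (mirror Z) (- p) (- v)"
      unfolding sliding_velocity_def
      by (rule bexI[of _ "1 - \<mu>"]) (use \<mu> in \<open>auto simp: mirror_def\<close>)
    moreover have "- p \<in> sliding_set Z (mirror Z)"
      using sl(1) by (simp add: sliding_set_def disc_boundary_def mirror_def mult.commute)
    ultimately show ?thesis by (simp add: filippov_velocity_def)
  qed
qed

lemma filippov_solution_mirror:
  assumes z: "filippov_solution_on Z (mirror Z) I z"
  shows "filippov_solution_on Z (mirror Z) I (\<lambda>t. - z t)"
proof -
  obtain D where D: "\<forall>b. finite (D \<inter> {-b..b})"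
    "\<And>t. t \<in> I - D \<Longrightarrow> \<exists>v. filippov_velocity Z (mirror Z) (z t) v \<and> (z has_vector_derivative v) (at t within I)"
    using z unfolding filippov_solution_on_def by blast
  show ?thesis
    unfolding filippov_solution_on_def
  proof (intro conjI exI[of _ D] ballI)
    show "continuous_on I (\<lambda>t. - z t)"
      using z by (auto simp: filippov_solution_on_def intro: continuous_intros)
    fix t assume "t \<in> I - D"
    from D(2)[OF this] obtain v where "filippov_velocity Z (mirror Z) (z t) v" "(z has_vector_derivative v) (at t within I)"
      by blast
    then show "\<exists>v. filippov_velocity Z (mirror Z) (- z t) v \<and> ((\<lambda>t. - z t) has_vector_derivative v) (at t within I)"
      using filippov_velocity_mirror by (intro exI[of _ "- v"]) (auto intro: has_vector_derivative_minus)
  qed (use D in auto)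
qed

text \<open>The tangential component of the convex combination whose normal component vanishes.\<close>

definition slide_speed :: "vfield \<Rightarrow> real \<Rightarrow> real" where
  "slide_speed Z x =
     (fst (Z (x, 0)) * snd (mirror Z (x, 0)) - fst (mirror Z (x, 0)) * snd (Z (x, 0)))
       / (snd (mirror Z (x, 0)) - snd (Z (x, 0)))"

lemma sliding_velocity_unique:
  assumes "snd (Z (x, 0)) \<le> 0" "0 < snd (mirror Z (x, 0))"
  shows "sliding_velocity Z (mirror Z) (x, 0) v \<longleftrightarrow> v = (slide_speed Z x, 0)"
proof -
  define f g f' g' where "f = fst (Z (x, 0))" and "g = snd (Z (x, 0))"
    and "f' = fst (mirror Z (x, 0))" and "g' = snd (mirror Z (x, 0))"
  have g: "g \<le> 0" "0 < g'" using assms by (auto simp: g_def g'_def)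
  have Z: "Z (x, 0) = (f, g)" "mirror Z (x, 0) = (f', g')" by (simp_all add: f_def g_def f'_def g'_def)
  have tang: "\<mu> * g' + (1 - \<mu>) * g = 0 \<longleftrightarrow> \<mu> = - g / (g' - g)" for \<mu>
    using g by (auto simp: field_simps)
  have speed: "(- g / (g' - g)) * f' + (1 - (- g / (g' - g))) * f = slide_speed Z x"
  proof -
    have "1 - (- g / (g' - g)) = g' / (g' - g)" using g by (simp add: field_simps)
    then show ?thesis by (simp add: slide_speed_def Z diff_divide_distrib mult.commute)
  qed
  have mem: "- g / (g' - g) \<in> {0..1}"
  proof -
    have "0 \<le> - g / (g' - g)" by (rule divide_nonneg_pos) (use g in auto)
    moreover have "- g / (g' - g) \<le> 1" by (subst divide_le_eq_1_pos) (use g in auto)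
    ultimately show ?thesis by (simp only: atLeastAtMost_iff)
  qed
  show ?thesis
  proof
    assume "sliding_velocity Z (mirror Z) (x, 0) v"
    then obtain \<mu> where v: "v = (\<mu> * f' + (1 - \<mu>) * f, \<mu> * g' + (1 - \<mu>) * g)" "snd v = 0"
      unfolding sliding_velocity_def Z by auto
    then have 0: "\<mu> * g' + (1 - \<mu>) * g = 0" by simp
    then have m: "\<mu> = - g / (g' - g)" by (rule tang[THEN iffD1])
    have "\<mu> * f' + (1 - \<mu>) * f = slide_speed Z x" by (simp only: m speed)
    then show "v = (slide_speed Z x, 0)" using v(1) 0 by simp
  next
    assume "v = (slide_speed Z x, 0)"
    then show "sliding_velocity Z (mirror Z) (x, 0) v"
      unfolding sliding_velocity_def Z
      by (intro bexI[OF _ mem]) (use speed tang[of "- g / (g' - g)"] in auto)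
  qed
qed

text \<open>Separation of variables: the time needed to reach \<open>\<xi>\<close> is the integral of \<open>1 / W\<close>, and the solution is
  its inverse. Unlike Picard iteration this stays inside the segment by construction.\<close>

lemma positive_speed_solution:
  fixes W :: "real \<Rightarrow> real"
  assumes Q: "0 < Q" and cont: "continuous_on {0..Q} W" and pos: "\<And>\<xi>. \<xi> \<in> {0..Q} \<Longrightarrow> 0 < W \<xi>"
  obtains T q where "0 < T" "continuous_on {0..T} q" "q 0 = 0" "q T = Q"
    "\<And>t. t \<in> {0..T} \<Longrightarrow> q t \<in> {0..Q}"
    "\<And>t. 0 < t \<Longrightarrow> t < T \<Longrightarrow> (q has_real_derivative W (q t)) (at t) \<and> 0 < q t \<and> q t < Q"
proof -
  define H where "H \<xi> = integral {0..\<xi>} (\<lambda>s. 1 / W s)" for \<xi>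
  have contI: "continuous_on {0..Q} (\<lambda>s. 1 / W s)"
    using pos by (intro continuous_intros cont) force
  have dH: "(H has_real_derivative 1 / W \<xi>) (at \<xi> within {0..Q})" if "\<xi> \<in> {0..Q}" for \<xi>
    unfolding H_def using integral_has_real_derivative[OF contI that] .
  have contH: "continuous_on {0..Q} H"
    using dH DERIV_continuous continuous_on_eq_continuous_within by blast
  have dH': "(H has_real_derivative 1 / W \<xi>) (at \<xi>)" if "0 < \<xi>" "\<xi> < Q" for \<xi>
    using dH[of \<xi>] that by (simp add: at_within_Icc_at)
  have mono: "H \<xi> < H \<eta>" if "0 \<le> \<xi>" "\<xi> < \<eta>" "\<eta> \<le> Q" for \<xi> \<eta>
  proof (rule DERIV_pos_imp_increasing_open[OF that(2)])
    show "\<exists>y. (H has_real_derivative y) (at x) \<and> 0 < y" if "\<xi> < x" "x < \<eta>" for x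
      using dH'[of x] pos[of x] that \<open>0 \<le> \<xi>\<close> \<open>\<eta> \<le> Q\<close> by (intro exI[of _ "1 / W x"]) auto
    show "continuous_on {\<xi>..\<eta>} H" by (rule continuous_on_subset[OF contH]) (use that in auto)
  qed
  have H0: "H 0 = 0" by (simp add: H_def)
  define T where "T = H Q"
  have T: "0 < T" using mono[of 0 Q] Q H0 by (simp add: T_def)
  have inj: "inj_on H {0..Q}"
  proof (rule inj_onI)
    fix x y assume "x \<in> {0..Q}" "y \<in> {0..Q}" "H x = H y"
    then show "x = y" using mono[of x y] mono[of y x] by (cases x y rule: linorder_cases) auto
  qed
  have im: "H ` {0..Q} = {0..T}"
  proof
    show "H ` {0..Q} \<subseteq> {0..T}"
    proof (rule image_subsetI)
      fix x assume "x \<in> {0..Q}"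
      then show "H x \<in> {0..T}" using mono[of 0 x] mono[of x Q] H0 T_def by (cases "x = 0"; cases "x = Q") auto
    qed
    show "{0..T} \<subseteq> H ` {0..Q}"
    proof
      fix t assume "t \<in> {0..T}"
      then show "t \<in> H ` {0..Q}" using IVT'[of H 0 t Q] contH H0 Q by (auto simp: T_def)
    qed
  qed
  define q where "q = inv_into {0..Q} H"
  have Hq: "H (q t) = t" if "t \<in> {0..T}" for t
    unfolding q_def by (rule f_inv_into_f) (use that im in auto)
  have qQ: "q t \<in> {0..Q}" if "t \<in> {0..T}" for t
    unfolding q_def by (rule inv_into_into) (use that im in auto)
  have contq: "continuous_on {0..T} q"
    unfolding q_def im[symmetric] by (rule continuous_on_inv[OF contH]) (auto simp: inj)
  have q0: "q 0 = 0" using inv_into_f_f[OF inj, of 0] H0 Q by (simp add: q_def)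
  have qT: "q T = Q" using inv_into_f_f[OF inj, of Q] Q by (simp add: q_def T_def)
  show ?thesis
  proof (rule that[OF T contq q0 qT qQ])
    fix t assume t: "0 < t" "t < T"
    have b: "q t \<noteq> 0" "q t \<noteq> Q" using Hq[of t] t H0 T_def by auto
    then have qt: "0 < q t" "q t < Q" using qQ[of t] t by auto
    have "(q has_real_derivative inverse (1 / W (q t))) (at t)"
    proof (rule DERIV_inverse_function[of H])
      show "(H has_real_derivative 1 / W (q t)) (at (q t))" by (rule dH'[OF qt])
      show "1 / W (q t) \<noteq> 0" using pos[of "q t"] qt by auto
      show "isCont q t" using contq t by (intro continuous_on_interior[OF contq]) auto
      show "H (q y) = y" if "0 < y" "y < T" for y using Hq that by auto
    qed (use t in auto)
    then show "(q has_real_derivative W (q t)) (at t) \<and> 0 < q t \<and> q t < Q" using qt by simp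
  qed auto
qed

text \<open>Everything that the phase portrait depends on. The number \<open>s\<close> is the sign of the horizontal
  velocity at the fold \<open>(xT, 0)\<close>, and \<open>s * (x - xT)\<close> is positive at crossing points and negative at
  sliding points, so that both signs of \<open>s\<close> are treated together. For a starting point \<open>x\<close> on the
  crossing side or at the fold, \<open>u x\<close> is its upper orbit, which lands at \<open>(P x, 0)\<close> after time
  \<open>\<tau> x\<close>. The constant \<open>c\<close> bounds sliding speed and flight time from below, \<open>r\<close> is the radius of the
  sections around \<open>(-a, 0)\<close> and \<open>(a, 0)\<close>, and \<open>N\<close> is the neighbourhood in which periodic orbits are
  counted; the upper orbit of every point of \<open>N\<close> above the axis reaches one of the sections.\<close>

locale half_return =
  fixes Z :: vfield and s a r r0 c xT :: real and \<tau> P :: "real \<Rightarrow> real"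
    and u :: "real \<Rightarrow> real \<Rightarrow> plane" and N :: "plane set"
  assumes Z_lip: "\<exists>L. L-lipschitz_on (cball 0 \<rho>) Z"
    and s: "s = 1 \<or> s = -1" and r: "0 < r0" "r0 < r" "r < a" and c: "0 < c"
    and xT: "\<bar>xT + a\<bar> < r"
    and g_pos: "\<bar>x + a\<bar> < r \<Longrightarrow> 0 < s * (x - xT) \<Longrightarrow> 0 < snd (Z (x, 0))"
    and g_neg: "\<bar>x + a\<bar> < r \<Longrightarrow> s * (x - xT) < 0 \<Longrightarrow> snd (Z (x, 0)) < 0"
    and g_T: "snd (Z (xT, 0)) = 0"
    and g_right: "\<bar>x - a\<bar> < r \<Longrightarrow> snd (Z (x, 0)) < 0"
    and slide: "\<bar>x + a\<bar> < r \<Longrightarrow> s * (x - xT) \<le> 0 \<Longrightarrow> c \<le> s * slide_speed Z x"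
    and \<tau>: "\<bar>x + a\<bar> < r \<Longrightarrow> 0 \<le> s * (x - xT) \<Longrightarrow> c \<le> \<tau> x"
    and u_start: "\<bar>x + a\<bar> < r \<Longrightarrow> 0 \<le> s * (x - xT) \<Longrightarrow> u x 0 = (x, 0)"
    and u_deriv: "\<bar>x + a\<bar> < r \<Longrightarrow> 0 \<le> s * (x - xT) \<Longrightarrow> t \<in> {0..\<tau> x} \<Longrightarrow>
      (u x has_vector_derivative Z (u x t)) (at t within {0..\<tau> x})"
    and u_end: "\<bar>x + a\<bar> < r \<Longrightarrow> 0 \<le> s * (x - xT) \<Longrightarrow> u x (\<tau> x) = (P x, 0)"
    and u_upper: "\<bar>x + a\<bar> < r \<Longrightarrow> 0 \<le> s * (x - xT) \<Longrightarrow> 0 < t \<Longrightarrow> t < \<tau> x \<Longrightarrow> u x t \<in> upper_half"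
    and P_near: "\<bar>x + a\<bar> < r \<Longrightarrow> 0 \<le> s * (x - xT) \<Longrightarrow> \<bar>P x - a\<bar> \<le> r0"
    and P_lip: "\<bar>x + a\<bar> < r \<Longrightarrow> 0 \<le> s * (x - xT) \<Longrightarrow> \<bar>y + a\<bar> < r \<Longrightarrow> 0 \<le> s * (y - xT) \<Longrightarrow>
      \<bar>P x - P y\<bar> \<le> \<bar>x - y\<bar> / 2"
    and P_deriv: "\<bar>x + a\<bar> < r \<Longrightarrow> 0 < s * (x - xT) \<Longrightarrow> \<exists>D. (P has_real_derivative D) (at x) \<and> \<bar>D\<bar> \<le> 1/2"
    and u_near: "\<bar>y + a\<bar> < r \<Longrightarrow> 0 \<le> s * (y - xT) \<Longrightarrow> 0 < \<epsilon> \<Longrightarrow>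
      \<exists>\<delta>>0. \<forall>x. \<bar>x + a\<bar> < r \<longrightarrow> 0 \<le> s * (x - xT) \<longrightarrow> \<bar>x - y\<bar> < \<delta> \<longrightarrow>
        (\<forall>t\<in>{0..\<tau> x}. \<exists>t'\<in>{0..\<tau> y}. dist (u x t) (u y t') < \<epsilon>)"
    and N_sym: "p \<in> N \<Longrightarrow> - p \<in> N"
    and N_axis: "p \<in> N \<Longrightarrow> snd p = 0 \<Longrightarrow> \<bar>fst p + a\<bar> < r \<or> \<bar>fst p - a\<bar> < r"
    and N_upper: "p \<in> N \<Longrightarrow> 0 < snd p \<Longrightarrow> \<exists>w b. 0 < b \<and> w 0 = p \<and>
      (\<forall>t\<in>{0..b}. (w has_vector_derivative Z (w t)) (at t within {0..b})) \<and>
      (\<forall>t. 0 < t \<and> t < b \<longrightarrow> w t \<in> upper_half) \<and>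
      snd (w b) = 0 \<and> (\<bar>fst (w b) + a\<bar> < r \<or> \<bar>fst (w b) - a\<bar> < r)"
begin

abbreviation "sol I z \<equiv> filippov_solution_on Z (mirror Z) I z"

lemma Z_cont: "continuous_on UNIV Z"
  unfolding continuous_on_eq_continuous_within
proof
  fix p :: plane
  obtain L where "L-lipschitz_on (cball 0 (norm p + 1)) Z" using Z_lip by blast
  then have "continuous_on (ball 0 (norm p + 1)) Z"
    by (rule continuous_on_subset[OF lipschitz_on_continuous_on]) auto
  then show "continuous (at p) Z"
    by (subst (asm) continuous_on_eq_continuous_at) auto
qed

lemma mirror_cont: "continuous_on UNIV (mirror Z)"
proof -
  have "continuous_on UNIV (\<lambda>p. - Z (- p))"
    by (intro continuous_intros continuous_on_compose2[OF Z_cont]) auto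
  then show ?thesis by (simp add: mirror_def[abs_def])
qed

lemma s_sq: "s * (s * x) = x" "s * s = 1" using s by auto

lemma g_lower: "\<bar>x + a\<bar> < r \<Longrightarrow> 0 < snd (mirror Z (x, 0))"
proof -
  assume "\<bar>x + a\<bar> < r"
  then have "\<bar>- x - a\<bar> < r" by linarith
  then show ?thesis using g_right[of "- x"] by (simp add: mirror_def)
qed

lemma g_le: "\<bar>x + a\<bar> < r \<Longrightarrow> s * (x - xT) \<le> 0 \<Longrightarrow> snd (Z (x, 0)) \<le> 0"
  using g_neg[of x] g_T s by (cases "x = xT") (auto simp: less_le)

lemma in_sliding_set:
  "\<bar>x + a\<bar> < r \<Longrightarrow> (x, 0) \<in> sliding_set Z (mirror Z) \<longleftrightarrow> s * (x - xT) \<le> 0"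
  using g_lower[of x] g_le[of x] g_pos[of x]
  by (cases "s * (x - xT) \<le> 0") (auto simp: sliding_set_def disc_boundary_def mult_le_0_iff not_le)

lemma solution_near:
  assumes z: "sol {0..} z" and t0: "0 \<le> t0" and V: "open V" "z t0 \<in> V"
  obtains \<eta> where "0 < \<eta>" "\<And>t. t0 \<le> t \<Longrightarrow> t \<le> t0 + \<eta> \<Longrightarrow> z t \<in> V"
proof -
  have c: "continuous_on {0..} z" using z by (simp add: filippov_solution_on_def)
  obtain e where e: "e > 0" "ball (z t0) e \<subseteq> V" using V open_contains_ball by blast
  obtain d where d: "d > 0" "\<And>t. t \<in> {0..} \<Longrightarrow> dist t t0 < d \<Longrightarrow> dist (z t) (z t0) < e"
    using c t0 e(1) unfolding continuous_on_iff by (metis atLeast_iff)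
  show ?thesis
  proof (rule that[of "d / 2"])
    fix t assume "t0 \<le> t" "t \<le> t0 + d / 2"
    then have "dist (z t) (z t0) < e" using d t0 by (intro d(2)) (auto simp: dist_real_def)
    then show "z t \<in> V" using e by (auto simp: dist_commute)
  qed (use d in auto)
qed

lemma velocity_on:
  assumes z: "sol {0..} z" and p: "0 \<le> p"
  obtains D where "finite D"
    "\<And>t. p < t \<Longrightarrow> t < q \<Longrightarrow> t \<notin> D \<Longrightarrow> \<exists>v. filippov_velocity Z (mirror Z) (z t) v \<and> (z has_vector_derivative v) (at t)"
  using filippov_solution_velocity[OF z, of p q] p by auto

lemma cont_sol: "sol {0..} z \<Longrightarrow> continuous_on {0..} z"
  by (simp add: filippov_solution_on_def)

lemma snd_deriv: "(z has_vector_derivative v) (at t) \<Longrightarrow> ((\<lambda>t. snd (z t)) has_real_derivative snd v) (at t)"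
  for z :: "real \<Rightarrow> plane"
  unfolding has_real_derivative_iff_has_vector_derivative
  by (rule bounded_linear.has_vector_derivative[OF bounded_linear_snd])

lemma fst_deriv: "(z has_vector_derivative v) (at t) \<Longrightarrow> ((\<lambda>t. fst (z t)) has_real_derivative fst v) (at t)"
  for z :: "real \<Rightarrow> plane"
  unfolding has_real_derivative_iff_has_vector_derivative
  by (rule bounded_linear.has_vector_derivative[OF bounded_linear_fst])

text \<open>Read with \<open>e = 1\<close> or \<open>e = -1\<close> this gives lower or upper bounds for the height; in the same way
  \<open>growth_fst\<close> bounds horizontal motion.\<close>

lemma growth_snd:
  assumes z: "sol {0..} z" and pq: "0 \<le> p" "p \<le> q"
    and vel: "\<And>t v. p < t \<Longrightarrow> t < q \<Longrightarrow> filippov_velocity Z (mirror Z) (z t) v \<Longrightarrow> k \<le> e * snd v"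
  shows "k * (q - p) \<le> e * snd (z q) - e * snd (z p)"
proof -
  obtain D where D: "finite D" "\<And>t. p < t \<Longrightarrow> t < q \<Longrightarrow> t \<notin> D \<Longrightarrow>
      \<exists>v. filippov_velocity Z (mirror Z) (z t) v \<and> (z has_vector_derivative v) (at t)"
    using velocity_on[OF z pq(1)] by metis
  define v where "v t = (SOME v. filippov_velocity Z (mirror Z) (z t) v \<and> (z has_vector_derivative v) (at t))" for t
  show ?thesis
  proof (rule derivative_lower_bound_except_finite[OF pq(2) _ D(1), of _ "\<lambda>t. e * snd (v t)"])
    show "continuous_on {p..q} (\<lambda>t. e * snd (z t))"
      by (intro continuous_intros continuous_on_subset[OF cont_sol[OF z]]) (use pq in auto)
    fix t assume t: "p < t" "t < q" "t \<notin> D"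
    have "filippov_velocity Z (mirror Z) (z t) (v t) \<and> (z has_vector_derivative v t) (at t)"
      unfolding v_def by (rule someI_ex[OF D(2)[OF t]])
    then show "((\<lambda>t. e * snd (z t)) has_real_derivative e * snd (v t)) (at t) \<and> k \<le> e * snd (v t)"
      using vel[OF t(1,2)] DERIV_cmult[OF snd_deriv] by blast
  qed
qed

lemma growth_fst:
  assumes z: "sol {0..} z" and pq: "0 \<le> p" "p \<le> q"
    and vel: "\<And>t v. p < t \<Longrightarrow> t < q \<Longrightarrow> filippov_velocity Z (mirror Z) (z t) v \<Longrightarrow> k \<le> e * fst v"
  shows "k * (q - p) \<le> e * fst (z q) - e * fst (z p)"
proof -
  obtain D where D: "finite D" "\<And>t. p < t \<Longrightarrow> t < q \<Longrightarrow> t \<notin> D \<Longrightarrow>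
      \<exists>v. filippov_velocity Z (mirror Z) (z t) v \<and> (z has_vector_derivative v) (at t)"
    using velocity_on[OF z pq(1)] by metis
  define v where "v t = (SOME v. filippov_velocity Z (mirror Z) (z t) v \<and> (z has_vector_derivative v) (at t))" for t
  show ?thesis
  proof (rule derivative_lower_bound_except_finite[OF pq(2) _ D(1), of _ "\<lambda>t. e * fst (v t)"])
    show "continuous_on {p..q} (\<lambda>t. e * fst (z t))"
      by (intro continuous_intros continuous_on_subset[OF cont_sol[OF z]]) (use pq in auto)
    fix t assume t: "p < t" "t < q" "t \<notin> D"
    have "filippov_velocity Z (mirror Z) (z t) (v t) \<and> (z has_vector_derivative v t) (at t)"
      unfolding v_def by (rule someI_ex[OF D(2)[OF t]])
    then show "((\<lambda>t. e * fst (z t)) has_real_derivative e * fst (v t)) (at t) \<and> k \<le> e * fst (v t)"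
      using vel[OF t(1,2)] DERIV_cmult[OF fst_deriv] by blast
  qed
qed

lemma velocity_upper: "filippov_velocity Z (mirror Z) p v \<Longrightarrow> 0 < snd p \<Longrightarrow> v = Z p"
  by (auto simp: filippov_velocity_def upper_half_def lower_half_def sliding_set_def disc_boundary_def)

lemma velocity_lower: "filippov_velocity Z (mirror Z) p v \<Longrightarrow> snd p < 0 \<Longrightarrow> v = mirror Z p"
  by (auto simp: filippov_velocity_def upper_half_def lower_half_def sliding_set_def disc_boundary_def)

lemma velocity_axis: "filippov_velocity Z (mirror Z) p v \<Longrightarrow> snd p = 0 \<Longrightarrow>
    p \<in> sliding_set Z (mirror Z) \<and> sliding_velocity Z (mirror Z) p v"
  by (auto simp: filippov_velocity_def upper_half_def lower_half_def)

lemma last_zero: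
  fixes h :: "real \<Rightarrow> real"
  assumes "t0 < t1" and cont: "continuous_on {t0..t1} h" and h: "h t0 = 0" "h t1 < 0"
  obtains t2 where "t0 \<le> t2" "t2 < t1" "h t2 = 0" "\<And>t. t2 < t \<Longrightarrow> t \<le> t1 \<Longrightarrow> h t < 0"
proof -
  define A where "A = {t\<in>{t0..t1}. h t = 0}"
  have "A = {t0..t1} \<inter> h -` {0}" by (auto simp: A_def)
  moreover have "closed ({t0..t1} \<inter> h -` {0})"
    by (rule continuous_closed_preimage[OF cont]) auto
  ultimately have cl: "closed A" by simp
  have ne: "A \<noteq> {}" "bdd_above A" using assms by (auto simp: A_def intro!: exI[of _ t0])
  define t2 where "t2 = Sup A"
  have t2A: "t2 \<in> A" unfolding t2_def using closed_contains_Sup[OF ne cl] .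
  have neg: "h t < 0" if "t2 < t" "t \<le> t1" for t
  proof (rule ccontr)
    assume "\<not> h t < 0"
    have "\<exists>x\<ge>t. x \<le> t1 \<and> h x = 0"
      by (rule IVT2') (use that h \<open>\<not> h t < 0\<close> t2A in \<open>auto simp: A_def intro!: continuous_on_subset[OF cont]\<close>)
    then obtain x where x: "x \<ge> t" "x \<le> t1" "h x = 0" by blast
    then have "x \<in> A" using \<open>t2 < t\<close> t2A by (auto simp: A_def)
    then have "x \<le> t2" unfolding t2_def using ne(2) by (simp add: cSup_upper)
    then show False using x(1) \<open>t2 < t\<close> by simp
  qed
  have "t2 \<noteq> t1" using t2A h by (auto simp: A_def)
  then show ?thesis using that[of t2] t2A neg by (auto simp: A_def)
qed

text \<open>The lower field points up near the left section. A solution below the axis would have been rising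
  since its last visit to the axis, where the height was zero.\<close>

lemma not_below:
  assumes z: "sol {0..} z" and t0: "0 \<le> t0" and x: "z t0 = (x, 0)" "\<bar>x + a\<bar> < r"
  obtains \<eta> where "0 < \<eta>" "\<And>t. t0 \<le> t \<Longrightarrow> t \<le> t0 + \<eta> \<Longrightarrow> 0 \<le> snd (z t)"
proof -
  have "open {p. 0 < snd (mirror Z p)}"
    by (intro open_Collect_less continuous_intros mirror_cont)
  moreover have "z t0 \<in> {p. 0 < snd (mirror Z p)}" using g_lower[OF x(2)] x(1) by simp
  ultimately obtain \<eta> where \<eta>: "0 < \<eta>" "\<And>t. t0 \<le> t \<Longrightarrow> t \<le> t0 + \<eta> \<Longrightarrow> 0 < snd (mirror Z (z t))"
    using solution_near[OF z t0] by (metis mem_Collect_eq)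
  show ?thesis
  proof (rule that[OF \<eta>(1)], rule ccontr)
    fix t1 assume t1: "t0 \<le> t1" "t1 \<le> t0 + \<eta>" "\<not> 0 \<le> snd (z t1)"
    then have lt: "t0 < t1" using x(1) by (cases "t0 = t1") auto
    obtain t2 where t2: "t0 \<le> t2" "t2 < t1" "snd (z t2) = 0" "\<And>t. t2 < t \<Longrightarrow> t \<le> t1 \<Longrightarrow> snd (z t) < 0"
    proof (rule last_zero[OF lt, of "\<lambda>t. snd (z t)"])
      show "continuous_on {t0..t1} (\<lambda>t. snd (z t))"
        by (intro continuous_intros continuous_on_subset[OF cont_sol[OF z]]) (use t0 in auto)
    qed (use x t1 in auto)
    have "0 * (t1 - t2) \<le> 1 * snd (z t1) - 1 * snd (z t2)"
    proof (rule growth_snd[OF z])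
      fix t v assume t: "t2 < t" "t < t1" "filippov_velocity Z (mirror Z) (z t) v"
      then have "v = mirror Z (z t)" using velocity_lower t2(4)[of t] by auto
      then show "0 \<le> 1 * snd v" using \<eta>(2)[of t] t t1 t2 by auto
    qed (use t0 t2 in auto)
    then show False using t1 t2 by simp
  qed
qed

lemma not_above:
  assumes z: "sol {0..} z" and t0: "0 \<le> t0" and x: "z t0 = (x, 0)" "snd (Z (x, 0)) < 0"
  obtains \<eta> where "0 < \<eta>" "\<And>t. t0 \<le> t \<Longrightarrow> t \<le> t0 + \<eta> \<Longrightarrow> snd (z t) \<le> 0"
proof -
  have "open {p. snd (Z p) < 0}" by (intro open_Collect_less continuous_intros Z_cont)
  moreover have "z t0 \<in> {p. snd (Z p) < 0}" using x by simp
  ultimately obtain \<eta> where \<eta>: "0 < \<eta>" "\<And>t. t0 \<le> t \<Longrightarrow> t \<le> t0 + \<eta> \<Longrightarrow> snd (Z (z t)) < 0"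
    using solution_near[OF z t0] by (metis mem_Collect_eq)
  show ?thesis
  proof (rule that[OF \<eta>(1)], rule ccontr)
    fix t1 assume t1: "t0 \<le> t1" "t1 \<le> t0 + \<eta>" "\<not> snd (z t1) \<le> 0"
    then have lt: "t0 < t1" using x(1) by (cases "t0 = t1") auto
    obtain t2 where t2: "t0 \<le> t2" "t2 < t1" "- snd (z t2) = 0" "\<And>t. t2 < t \<Longrightarrow> t \<le> t1 \<Longrightarrow> - snd (z t) < 0"
    proof (rule last_zero[OF lt, of "\<lambda>t. - snd (z t)"])
      show "continuous_on {t0..t1} (\<lambda>t. - snd (z t))"
        by (intro continuous_intros continuous_on_subset[OF cont_sol[OF z]]) (use t0 in auto)
    qed (use x t1 in auto)
    have "0 * (t1 - t2) \<le> (-1) * snd (z t1) - (-1) * snd (z t2)"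
    proof (rule growth_snd[OF z])
      fix t v assume t: "t2 < t" "t < t1" "filippov_velocity Z (mirror Z) (z t) v"
      then have "v = Z (z t)" using velocity_upper t2(4)[of t] by auto
      then show "0 \<le> (-1) * snd v" using \<eta>(2)[of t] t t1 t2 by auto
    qed (use t0 t2 in auto)
    then show False using t1 t2 by simp
  qed
qed

end

section \<open>Forward uniqueness at crossing, fold and sliding points\<close>

context half_return begin

lemma solution_near_both:
  assumes z: "sol {0..} z" and t0: "0 \<le> t0" and V: "open V" "z t0 \<in> V"
  obtains \<eta> where "0 < \<eta>" "\<And>t. 0 \<le> t \<Longrightarrow> \<bar>t - t0\<bar> \<le> \<eta> \<Longrightarrow> z t \<in> V"
proof -
  have c: "continuous_on {0..} z" by (rule cont_sol[OF z])
  obtain e where e: "e > 0" "ball (z t0) e \<subseteq> V" using V open_contains_ball by blast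
  obtain d where d: "d > 0" "\<And>t. t \<in> {0..} \<Longrightarrow> dist t t0 < d \<Longrightarrow> dist (z t) (z t0) < e"
    using c t0 e(1) unfolding continuous_on_iff by (metis atLeast_iff)
  show ?thesis
  proof (rule that[of "d / 2"])
    fix t assume "0 \<le> t" "\<bar>t - t0\<bar> \<le> d / 2"
    then have "dist (z t) (z t0) < e" using d t0 by (intro d(2)) (auto simp: dist_real_def)
    then show "z t \<in> V" using e by (auto simp: dist_commute)
  qed (use d in auto)
qed

text \<open>If both fields point up then every admissible velocity does, since sliding velocities are convex
  combinations; at a point with this property on the axis there is no admissible velocity at all.\<close>

lemma crossing_velocity:
  assumes "filippov_velocity Z (mirror Z) p v" "k < snd (Z p)" "k < snd (mirror Z p)" "0 \<le> k"
  shows "k \<le> snd v"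
proof (cases "snd p" "0::real" rule: linorder_cases)
  case equal
  then have "snd (Z p) * snd (mirror Z p) \<le> 0"
    using velocity_axis[OF assms(1)] by (auto simp: sliding_set_def)
  moreover have "0 < snd (Z p) * snd (mirror Z p)" using assms by (intro mult_pos_pos) auto
  ultimately show ?thesis by simp
qed (use assms velocity_upper velocity_lower in auto)

lemma slide_velocity:
  assumes v: "filippov_velocity Z (mirror Z) p v" and p: "snd p = 0" "\<bar>fst p + a\<bar> < r"
  shows "c \<le> s * fst v"
proof -
  have pe: "p = (fst p, 0)" using p by (simp add: prod_eq_iff)
  have *: "p \<in> sliding_set Z (mirror Z)" "sliding_velocity Z (mirror Z) p v"
    using velocity_axis[OF v p(1)] by auto
  then have le: "s * (fst p - xT) \<le> 0" using in_sliding_set[OF p(2)] pe by simp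
  have "v = (slide_speed Z (fst p), 0)"
    using sliding_velocity_unique[OF g_le[OF p(2) le] g_lower[OF p(2)]] *(2) pe by simp
  then show ?thesis using slide[OF p(2) le] by simp
qed

text \<open>At the fold the sliding velocity is that of the upper field, because the upper field is already
  tangent to the axis.\<close>

lemma fold_speed: "c \<le> s * fst (Z (xT, 0))"
proof -
  have "slide_speed Z xT = fst (Z (xT, 0))"
    using g_lower[OF xT] by (simp add: slide_speed_def g_T)
  then show ?thesis using slide[OF xT] by simp
qed

text \<open>At a crossing point the height grows at a definite rate. Near the fold the solution does not go below
  the axis and moves with speed at least \<open>c / 2\<close> towards the crossing side. If it were on the axis at a
  later time, then at a crossing point, which is reached only from below.\<close>

lemma leaves_upward:
  assumes z: "sol {0..} z" and t0: "0 \<le> t0" and x: "z t0 = (x, 0)" "\<bar>x + a\<bar> < r" "0 \<le> s * (x - xT)"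
  obtains \<eta> where "0 < \<eta>" "\<And>t. t0 < t \<Longrightarrow> t \<le> t0 + \<eta> \<Longrightarrow> 0 < snd (z t)"
proof (cases "s * (x - xT) = 0")
  case False
  define k where "k = min (snd (Z (x, 0))) (snd (mirror Z (x, 0))) / 2"
  have sp: "0 < s * (x - xT)" using x(3) False by linarith
  have gp: "0 < snd (Z (x, 0))" "0 < snd (mirror Z (x, 0))" using g_pos[OF x(2) sp] g_lower[OF x(2)] by auto
  then have k: "0 < k" "k < snd (Z (x, 0))" "k < snd (mirror Z (x, 0))" by (auto simp: k_def)
  have "open ({p. k < snd (Z p)} \<inter> {p. k < snd (mirror Z p)})"
    by (intro open_Int open_Collect_less continuous_intros Z_cont mirror_cont)
  moreover have "z t0 \<in> {p. k < snd (Z p)} \<inter> {p. k < snd (mirror Z p)}" using k x by simp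
  ultimately obtain \<eta> where \<eta>: "0 < \<eta>"
    "\<And>t. t0 \<le> t \<Longrightarrow> t \<le> t0 + \<eta> \<Longrightarrow> z t \<in> {p. k < snd (Z p)} \<inter> {p. k < snd (mirror Z p)}"
    using solution_near[OF z t0] by metis
  show ?thesis
  proof (rule that[OF \<eta>(1)])
    fix t1 assume t1: "t0 < t1" "t1 \<le> t0 + \<eta>"
    have "k * (t1 - t0) \<le> 1 * snd (z t1) - 1 * snd (z t0)"
    proof (rule growth_snd[OF z t0])
      fix t v assume "t0 < t" "t < t1" "filippov_velocity Z (mirror Z) (z t) v"
      then show "k \<le> 1 * snd v" using crossing_velocity[of "z t" v k] \<eta>(2)[of t] t1 k by auto
    qed (use t1 in auto)
    moreover have "0 < k * (t1 - t0)" using k t1 by simp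
    ultimately show "0 < snd (z t1)" using x by simp
  qed
next
  case True
  then have xx: "x = xT" using s by auto
  have "open ({p. c / 2 < s * fst (Z p)} \<inter> {p. \<bar>fst p + a\<bar> < r})"
    by (intro open_Int open_Collect_less continuous_intros Z_cont)
  moreover have "z t0 \<in> {p. c / 2 < s * fst (Z p)} \<inter> {p. \<bar>fst p + a\<bar> < r}"
    using fold_speed c x xx by auto
  ultimately obtain \<eta>1 where \<eta>1: "0 < \<eta>1"
    "\<And>t. t0 \<le> t \<Longrightarrow> t \<le> t0 + \<eta>1 \<Longrightarrow> z t \<in> {p. c / 2 < s * fst (Z p)} \<inter> {p. \<bar>fst p + a\<bar> < r}"
    using solution_near[OF z t0] by metis
  obtain \<eta>2 where \<eta>2: "0 < \<eta>2" "\<And>t. t0 \<le> t \<Longrightarrow> t \<le> t0 + \<eta>2 \<Longrightarrow> 0 \<le> snd (z t)"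
    using not_below[OF z t0 x(1,2)] by metis
  define \<eta> where "\<eta> = min \<eta>1 \<eta>2"
  have \<eta>: "0 < \<eta>" "\<eta> \<le> \<eta>1" "\<eta> \<le> \<eta>2" using \<eta>1 \<eta>2 by (auto simp: \<eta>_def)
  show ?thesis
  proof (rule that[OF \<eta>(1)], rule ccontr)
    fix t1 assume t1: "t0 < t1" "t1 \<le> t0 + \<eta>" and neg: "\<not> 0 < snd (z t1)"
    have "c / 2 * (t1 - t0) \<le> s * fst (z t1) - s * fst (z t0)"
    proof (rule growth_fst[OF z t0])
      fix t v assume t: "t0 < t" "t < t1" and v: "filippov_velocity Z (mirror Z) (z t) v"
      have b: "z t \<in> {p. c / 2 < s * fst (Z p)} \<inter> {p. \<bar>fst p + a\<bar> < r}" "0 \<le> snd (z t)"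
        using \<eta>1(2)[of t] \<eta>2(2)[of t] t t1 \<eta> by auto
      show "c / 2 \<le> s * fst v"
      proof (cases "snd (z t) = 0")
        case True
        then show ?thesis using slide_velocity[OF v] b c by auto
      next
        case False
        then show ?thesis using velocity_upper[OF v] b by auto
      qed
    qed (use t1 in auto)
    moreover have "0 < c / 2 * (t1 - t0)" using c t1 by simp
    moreover have "s * fst (z t0) = s * xT" using x xx by simp
    ultimately have "s * xT < s * fst (z t1)" by linarith
    then have side: "0 < s * (fst (z t1) - xT)" by (simp add: right_diff_distrib)
    have near: "\<bar>fst (z t1) + a\<bar> < r" using \<eta>1(2)[of t1] t1 \<eta> by auto
    have zero: "snd (z t1) = 0" using neg \<eta>2(2)[of t1] t1 \<eta> by auto
    then have zt: "z t1 = (fst (z t1), 0)" by (simp add: prod_eq_iff)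
    define k where "k = min (snd (Z (z t1))) (snd (mirror Z (z t1))) / 2"
    have "0 < snd (Z (z t1))" "0 < snd (mirror Z (z t1))"
      using g_pos[OF near side] g_lower[OF near] zt by simp_all
    then have k: "0 < k" "k < snd (Z (z t1))" "k < snd (mirror Z (z t1))" by (auto simp: k_def)
    have "open ({p. k < snd (Z p)} \<inter> {p. k < snd (mirror Z p)})"
      by (intro open_Int open_Collect_less continuous_intros Z_cont mirror_cont)
    moreover have "z t1 \<in> {p. k < snd (Z p)} \<inter> {p. k < snd (mirror Z p)}" using k by simp
    moreover have "0 \<le> t1" using t0 t1 by simp
    ultimately obtain \<zeta> where \<zeta>: "0 < \<zeta>"
      "\<And>t. 0 \<le> t \<Longrightarrow> \<bar>t - t1\<bar> \<le> \<zeta> \<Longrightarrow> z t \<in> {p. k < snd (Z p)} \<inter> {p. k < snd (mirror Z p)}"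
      using solution_near_both[OF z] by metis
    define p where "p = max t0 (t1 - \<zeta>)"
    have p: "t0 \<le> p" "p < t1" "t1 - \<zeta> \<le> p" using \<zeta> t1 by (auto simp: p_def)
    have "k * (t1 - p) \<le> 1 * snd (z t1) - 1 * snd (z p)"
    proof (rule growth_snd[OF z])
      fix t v assume "p < t" "t < t1" "filippov_velocity Z (mirror Z) (z t) v"
      then show "k \<le> 1 * snd v" using crossing_velocity[of "z t" v k] \<zeta>(2)[of t] t0 p k by auto
    qed (use p t0 in auto)
    moreover have "0 < k * (t1 - p)" using k p by simp
    moreover have "0 \<le> snd (z p)" using \<eta>2(2)[of p] p t1 \<eta> by auto
    ultimately show False using zero by simp
  qed
qed

lemma upper_solves:
  assumes z: "sol {0..} z" and pq: "0 \<le> p" and up: "\<And>t. p < t \<Longrightarrow> t < q \<Longrightarrow> 0 < snd (z t)"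
    and t: "p < t" "t < q"
  shows "(z has_vector_derivative Z (z t)) (at t)"
proof -
  obtain D where D: "finite D" "\<And>t. p < t \<Longrightarrow> t < q \<Longrightarrow> t \<notin> D \<Longrightarrow>
      \<exists>v. filippov_velocity Z (mirror Z) (z t) v \<and> (z has_vector_derivative v) (at t)"
    using velocity_on[OF z pq] by metis
  have c: "continuous_on {p..q} z" by (rule continuous_on_subset[OF cont_sol[OF z]]) (use pq in auto)
  have "(z has_vector_derivative Z (z t)) (at t within {p..q})"
  proof (rule removable_vector_derivative[OF c D(1)])
    show "continuous_on {p..q} (\<lambda>t. Z (z t))" by (rule continuous_on_compose2[OF Z_cont c]) auto
    show "(z has_vector_derivative Z (z x)) (at x)" if x: "p < x" "x < q" "x \<notin> D" for x
      using D(2)[OF x] velocity_upper up x by metis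
  qed (use t in auto)
  then show ?thesis using t by (simp add: at_within_Icc_at)
qed

text \<open>A Filippov solution that has left the axis upwards solves the equation of the upper field as long as
  it stays above the axis, so it agrees with the classical orbit by uniqueness there; the first time at
  which the two could part is excluded by continuity.\<close>

lemma follow_orbit:
  assumes z: "sol {0..} z" and t0: "0 \<le> t0"
    and w: "\<And>t. t \<in> {0..b} \<Longrightarrow> (w has_vector_derivative Z (w t)) (at t within {0..b})"
      "\<And>t. 0 < t \<Longrightarrow> t < b \<Longrightarrow> w t \<in> upper_half" "z t0 = w 0"
    and up: "0 < \<eta>0" "\<And>t. t0 < t \<Longrightarrow> t \<le> t0 + \<eta>0 \<Longrightarrow> 0 < snd (z t)"
    and t: "t \<in> {0..b}"
  shows "z (t0 + t) = w t"
proof -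
  have b: "0 \<le> b" using t by auto
  have contw: "continuous_on {0..b} w"
    using w(1) has_vector_derivative_continuous continuous_on_eq_continuous_within by blast
  have contz: "continuous_on {0..b} (\<lambda>t. z (t0 + t))"
    by (intro continuous_on_compose2[OF cont_sol[OF z]] continuous_intros) (use t0 in auto)
  define A where "A = {q\<in>{0..b}. \<forall>t\<in>{0..q}. z (t0 + t) = w t}"
  have ne: "0 \<in> A" using b w(3) by (auto simp: A_def)
  have bdd: "bdd_above A" by (auto simp: A_def intro!: bdd_aboveI[of _ b])
  define m where "m = Sup A"
  have m: "0 \<le> m" "m \<le> b"
    using ne bdd by (auto simp: m_def A_def intro!: cSup_upper cSup_least)
  have below: "z (t0 + t) = w t" if "0 \<le> t" "t < m" for t
  proof -
    have "\<exists>q\<in>A. t < q" using less_cSup_iff[of A t] ne bdd that by (auto simp: m_def)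
    then obtain q where "q \<in> A" "t < q" by blast
    then show ?thesis using that by (auto simp: A_def)
  qed
  have atm: "z (t0 + m) = w m"
  proof (cases "m = 0")
    case True then show ?thesis using w(3) by simp
  next
    case False
    have "closed ({0..b} \<inter> (\<lambda>t. z (t0 + t) - w t) -` {0})"
      by (intro continuous_closed_preimage continuous_intros contz contw)
    moreover have "{0..b} \<inter> (\<lambda>t. z (t0 + t) - w t) -` {0} \<supseteq> {0..<m}"
      using below m by auto
    ultimately have "closure {0..<m} \<subseteq> {0..b} \<inter> (\<lambda>t. z (t0 + t) - w t) -` {0}"
      by (metis closure_minimal)
    then show ?thesis using False m by (auto simp: closure_atLeastLessThan)
  qed
  have "m = b"
  proof (rule ccontr)
    assume "m \<noteq> b"
    then have mb: "m < b" using m by simp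
    obtain \<eta> where \<eta>: "0 < \<eta>" "\<And>t. t0 + m < t \<Longrightarrow> t \<le> t0 + m + \<eta> \<Longrightarrow> 0 < snd (z t)"
    proof (cases "m = 0")
      case True then show ?thesis using that up by simp
    next
      case False
      have "open {p::plane. 0 < snd p}" by (intro open_Collect_less continuous_intros)
      moreover have "z (t0 + m) \<in> {p. 0 < snd p}" using atm w(2)[of m] False m mb by (simp add: upper_half_def)
      moreover have "0 \<le> t0 + m" using t0 m by simp
      ultimately obtain \<eta> where "0 < \<eta>" "\<And>t. t0 + m \<le> t \<Longrightarrow> t \<le> t0 + m + \<eta> \<Longrightarrow> z t \<in> {p. 0 < snd p}"
        using solution_near[OF z] by metis
      then show ?thesis using that by auto
    qed
    define q where "q = min b (m + \<eta>)"
    have q: "m < q" "q \<le> b" "q \<le> m + \<eta>" using mb \<eta> by (auto simp: q_def)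
    have ext: "z (t0 + t) = w t" if t: "t \<in> {m..q}" for t
    proof (rule ode_unique[OF Z_lip, of m q "\<lambda>t. z (t0 + t)" w])
      show "continuous_on {m..q} (\<lambda>t. z (t0 + t))" "continuous_on {m..q} w"
        using contz contw m q by (auto elim!: continuous_on_subset)
      fix x assume x: "m < x" "x < q"
      have "(w has_vector_derivative Z (w x)) (at x within {0..b})" using w(1) x m q by auto
      then show "(w has_vector_derivative Z (w x)) (at x)" using x m q by (simp add: at_within_Icc_at)
      have "(z has_vector_derivative Z (z (t0 + x))) (at (t0 + x))"
        by (rule upper_solves[OF z, of "t0 + m" "t0 + q"]) (use \<eta> x m q t0 in auto)
      moreover have "((\<lambda>t. t0 + t) has_vector_derivative 1) (at x)" by (auto intro!: derivative_eq_intros)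
      ultimately have "((z \<circ> (\<lambda>t. t0 + t)) has_vector_derivative 1 *\<^sub>R Z (z (t0 + x))) (at x)"
        using vector_diff_chain_at by blast
      then show "((\<lambda>t. z (t0 + t)) has_vector_derivative Z (z (t0 + x))) (at x)" by (simp add: o_def)
    qed (use atm t in auto)
    have "q \<in> A" unfolding A_def using below ext m q by force
    then have "q \<le> m" unfolding m_def using bdd by (rule cSup_upper)
    then show False using q by simp
  qed
  then show ?thesis using below atm t by (cases "t = b") auto
qed

lemma follow_crossing:
  assumes z: "sol {0..} z" and t0: "0 \<le> t0" and x: "z t0 = (x, 0)" "\<bar>x + a\<bar> < r" "0 \<le> s * (x - xT)"
    and t: "t \<in> {0..\<tau> x}"
  shows "z (t0 + t) = u x t"
proof -
  obtain \<eta> where "0 < \<eta>" "\<And>t. t0 < t \<Longrightarrow> t \<le> t0 + \<eta> \<Longrightarrow> 0 < snd (z t)"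
    using leaves_upward[OF z t0 x] by blast
  then show ?thesis
    by (intro follow_orbit[OF z t0 u_deriv[OF x(2,3)] u_upper[OF x(2,3)] _ _ _ t])
      (use x u_start in auto)
qed

text \<open>On the sliding segment both fields push towards the axis, so a solution cannot leave it; sliding
  with speed at least \<open>c\<close> it reaches the fold in finite time.\<close>

lemma follow_sliding:
  assumes z: "sol {0..} z" and t0: "0 \<le> t0" and x: "z t0 = (x, 0)" "\<bar>x + a\<bar> < r" "s * (x - xT) < 0"
  obtains t1 where "t0 < t1" "z t1 = (xT, 0)"
    "\<And>t. t \<in> {t0..t1} \<Longrightarrow> snd (z t) = 0 \<and> s * (x - xT) \<le> s * (fst (z t) - xT) \<and> s * (fst (z t) - xT) \<le> 0"
proof -
  define ok where "ok t \<longleftrightarrow> snd (z t) = 0 \<and> s * (x - xT) \<le> s * (fst (z t) - xT) \<and> s * (fst (z t) - xT) \<le> 0" for t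
  have near: "\<bar>fst (z t) + a\<bar> < r" if "ok t" for t
    using that s x(2) xT by (auto simp: ok_def)
  have grow: "c * (q - p) \<le> s * fst (z q) - s * fst (z p)"
    if "t0 \<le> p" "p \<le> q" "\<And>t. p < t \<Longrightarrow> t < q \<Longrightarrow> snd (z t) = 0 \<and> \<bar>fst (z t) + a\<bar> < r" for p q
    by (rule growth_fst[OF z]) (use that t0 slide_velocity in auto)
  define A where "A = {q. t0 \<le> q \<and> (\<forall>t\<in>{t0..q}. ok t)}"
  have A0: "t0 \<in> A" using x by (auto simp: A_def ok_def)
  have bound: "c * (q - t0) \<le> - (s * (x - xT))" if "q \<in> A" for q
  proof -
    have q: "t0 \<le> q" "\<And>t. t \<in> {t0..q} \<Longrightarrow> ok t" using that by (auto simp: A_def)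
    have "c * (q - t0) \<le> s * fst (z q) - s * fst (z t0)"
      using q near by (intro grow) (auto simp: ok_def)
    moreover have "s * (fst (z q) - xT) \<le> 0" using q(2)[of q] q(1) by (simp add: ok_def)
    moreover have "s * fst (z t0) = s * x" using x by simp
    ultimately show ?thesis unfolding right_diff_distrib by linarith
  qed
  have bdd: "bdd_above A"
  proof (rule bdd_aboveI[of _ "t0 + - (s * (x - xT)) / c"])
    fix q assume "q \<in> A"
    then show "q \<le> t0 + - (s * (x - xT)) / c" using bound[of q] c by (simp add: field_simps)
  qed
  define m where "m = Sup A"
  have m: "t0 \<le> m" unfolding m_def by (rule cSup_upper[OF A0 bdd])
  have below: "ok t" if "t0 \<le> t" "t < m" for t
  proof -
    have "\<exists>q\<in>A. t < q" using less_cSup_iff[of A t] A0 bdd that by (auto simp: m_def)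
    then obtain q where "q \<in> A" "t < q" by blast
    then show ?thesis using that by (auto simp: A_def)
  qed
  have contz: "continuous_on {t0..m} z" by (rule continuous_on_subset[OF cont_sol[OF z]]) (use t0 in auto)
  have okm: "ok m"
  proof (cases "m = t0")
    case True then show ?thesis using A0 by (auto simp: A_def)
  next
    case False
    then have lt: "t0 < m" using m by simp
    define K where "K = {p::plane. snd p = 0} \<inter> {p. s * (x - xT) \<le> s * (fst p - xT)} \<inter> {p. s * (fst p - xT) \<le> 0}"
    have "closed K" unfolding K_def
      by (intro closed_Int closed_Collect_eq closed_Collect_le continuous_intros)
    then have "closed ({t0..m} \<inter> z -` K)" by (intro continuous_closed_preimage contz) auto
    moreover have "{t0..<m} \<subseteq> {t0..m} \<inter> z -` K" using below by (auto simp: ok_def K_def)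
    ultimately have "closure {t0..<m} \<subseteq> {t0..m} \<inter> z -` K" by (metis closure_minimal)
    moreover have "m \<in> closure {t0..<m}" using lt by (simp add: closure_atLeastLessThan)
    ultimately have "z m \<in> K" by blast
    then show ?thesis by (auto simp: ok_def K_def)
  qed
  have mA: "m \<in> A" using below okm m unfolding A_def by (auto simp: order_le_less)
  have "fst (z m) = xT"
  proof (rule ccontr)
    assume ne: "fst (z m) \<noteq> xT"
    have neg: "s * (fst (z m) - xT) < 0" using okm ne s by (auto simp: ok_def)
    have zm: "z m = (fst (z m), 0)" using okm by (simp add: ok_def prod_eq_iff)
    have m0: "0 \<le> m" using t0 m by simp
    obtain \<eta>1 where \<eta>1: "0 < \<eta>1" "\<And>t. m \<le> t \<Longrightarrow> t \<le> m + \<eta>1 \<Longrightarrow> 0 \<le> snd (z t)"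
      using not_below[OF z m0 zm near[OF okm]] by metis
    obtain \<eta>2 where \<eta>2: "0 < \<eta>2" "\<And>t. m \<le> t \<Longrightarrow> t \<le> m + \<eta>2 \<Longrightarrow> snd (z t) \<le> 0"
      using not_above[OF z m0 zm g_neg[OF near[OF okm] neg]] by metis
    have "open ({p::plane. s * (fst p - xT) < 0} \<inter> {p. \<bar>fst p + a\<bar> < r})"
      by (intro open_Int open_Collect_less continuous_intros)
    moreover have "z m \<in> {p::plane. s * (fst p - xT) < 0} \<inter> {p. \<bar>fst p + a\<bar> < r}"
      using neg near[OF okm] by simp
    ultimately obtain \<eta>3 where \<eta>3: "0 < \<eta>3"
      "\<And>t. m \<le> t \<Longrightarrow> t \<le> m + \<eta>3 \<Longrightarrow> z t \<in> {p::plane. s * (fst p - xT) < 0} \<inter> {p. \<bar>fst p + a\<bar> < r}"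
      using solution_near[OF z m0] by metis
    define \<eta> where "\<eta> = min \<eta>1 (min \<eta>2 \<eta>3)"
    have \<eta>: "0 < \<eta>" "\<eta> \<le> \<eta>1" "\<eta> \<le> \<eta>2" "\<eta> \<le> \<eta>3" using \<eta>1 \<eta>2 \<eta>3 by (auto simp: \<eta>_def)
    have flat: "snd (z t) = 0 \<and> \<bar>fst (z t) + a\<bar> < r \<and> s * (fst (z t) - xT) < 0" if "m \<le> t" "t \<le> m + \<eta>" for t
      using \<eta>1(2)[of t] \<eta>2(2)[of t] \<eta>3(2)[of t] that \<eta> by auto
    have "ok t" if t: "m \<le> t" "t \<le> m + \<eta>" for t
    proof -
      have "c * (t - m) \<le> s * fst (z t) - s * fst (z m)"
        using t m flat by (intro grow) auto
      moreover have "0 \<le> c * (t - m)" using c t by simp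
      moreover have "s * (x - xT) \<le> s * (fst (z m) - xT)" using okm by (simp add: ok_def)
      ultimately show ?thesis using flat[OF t] by (simp add: ok_def algebra_simps)
    qed
    then have "m + \<eta> \<in> A" using mA m \<eta> unfolding A_def by (auto simp: not_le)
    then have "m + \<eta> \<le> m" unfolding m_def using bdd by (rule cSup_upper)
    then show False using \<eta> by simp
  qed
  then have zm: "z m = (xT, 0)" using okm by (simp add: ok_def prod_eq_iff)
  have "m \<noteq> t0" using zm x s by auto
  show ?thesis
  proof (rule that[of m])
    show "t0 < m" using m \<open>m \<noteq> t0\<close> by simp
    show "snd (z t) = 0 \<and> s * (x - xT) \<le> s * (fst (z t) - xT) \<and> s * (fst (z t) - xT) \<le> 0"
      if "t \<in> {t0..m}" for t
      using mA that by (auto simp: A_def ok_def)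
  qed (rule zm)
qed

end

section \<open>The half return map and the attracting orbit\<close>

context half_return begin

text \<open>The point at which the solution from \<open>(x, 0)\<close> leaves the axis: \<open>x\<close> itself on the crossing side and
  the fold on the sliding side.\<close>

definition "lift_off x = xT + s * max 0 (s * (x - xT))"
text \<open>The half return map, transported back to the left section by the symmetry.\<close>

definition "R x = - P (lift_off x)"
definition "half_arc x = (\<lambda>\<xi>. (\<xi>, 0)) ` closed_segment x (lift_off x) \<union> u (lift_off x) ` {0..\<tau> (lift_off x)}"

lemma lift_off_side: "0 \<le> s * (lift_off x - xT)" by (simp add: lift_off_def s_sq)

lemma lift_off_id: "0 \<le> s * (x - xT) \<Longrightarrow> lift_off x = x" by (simp add: lift_off_def s_sq max_def)

lemma lift_off_T: "s * (x - xT) \<le> 0 \<Longrightarrow> lift_off x = xT" by (simp add: lift_off_def max_def)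

lemma lift_off_near: "\<bar>x + a\<bar> < r \<Longrightarrow> \<bar>lift_off x + a\<bar> < r"
  using lift_off_id[of x] lift_off_T[of x] xT by (cases "0 \<le> s * (x - xT)") auto

lemma lift_off_lip: "\<bar>lift_off x - lift_off y\<bar> \<le> \<bar>x - y\<bar>"
  using s by (auto simp: lift_off_def max_def)

lemma R_near: "\<bar>x + a\<bar> < r \<Longrightarrow> \<bar>R x + a\<bar> \<le> r0"
  using P_near[OF lift_off_near lift_off_side, of x] by (simp add: R_def abs_minus_commute)

lemma R_near': "\<bar>x + a\<bar> < r \<Longrightarrow> \<bar>R x + a\<bar> < r"
  using R_near[of x] r by simp

lemma R_lip: "\<bar>x + a\<bar> < r \<Longrightarrow> \<bar>y + a\<bar> < r \<Longrightarrow> \<bar>R x - R y\<bar> \<le> \<bar>x - y\<bar> / 2"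
proof -
  assume "\<bar>x + a\<bar> < r" "\<bar>y + a\<bar> < r"
  from P_lip[OF lift_off_near[OF this(1)] lift_off_side lift_off_near[OF this(2)] lift_off_side] show ?thesis
    unfolding R_def minus_diff_minus abs_minus_cancel
    by (rule order_trans) (intro divide_right_mono lift_off_lip, simp)
qed

lemma slide_speed_cont: "continuous_on {x. \<bar>x + a\<bar> < r \<and> s * (x - xT) \<le> 0} (slide_speed Z)"
proof -
  have "snd (mirror Z (x, 0)) - snd (Z (x, 0)) \<noteq> 0" if "\<bar>x + a\<bar> < r" "s * (x - xT) \<le> 0" for x
    using g_lower[OF that(1)] g_le[OF that] by simp
  then have "continuous_on {x. \<bar>x + a\<bar> < r \<and> s * (x - xT) \<le> 0}
    (\<lambda>x. (fst (Z (x, 0)) * snd (mirror Z (x, 0)) - fst (mirror Z (x, 0)) * snd (Z (x, 0)))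
       / (snd (mirror Z (x, 0)) - snd (Z (x, 0))))"
    by (intro continuous_intros continuous_on_compose2[OF Z_cont] continuous_on_compose2[OF mirror_cont]) auto
  then show ?thesis by (simp add: slide_speed_def[abs_def])
qed

text \<open>Sliding towards the fold is a scalar equation on the segment. Measured from \<open>x\<close> in the direction
  \<open>s\<close>, the speed is positive up to and including the fold.\<close>

lemma sliding_exists:
  assumes x: "\<bar>x + a\<bar> < r" "s * (x - xT) < 0"
  obtains d z where "0 < d" "sol {0..d} z" "z 0 = (x, 0)" "z d = (xT, 0)"
    "z ` {0..d} = (\<lambda>\<xi>. (\<xi>, 0)) ` closed_segment x xT"
proof -
  define Q where "Q = - (s * (x - xT))"
  have Q: "0 < Q" using x by (simp add: Q_def)
  have xQ: "x + s * Q = xT"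
  proof -
    have "s * Q = - (s * (s * (x - xT)))" by (simp add: Q_def)
    then show ?thesis by (simp only: s_sq)
  qed
  have pt: "\<bar>x + s * \<xi> + a\<bar> < r \<and> s * (x + s * \<xi> - xT) \<le> 0" if "\<xi> \<in> {0..Q}" for \<xi>
  proof -
    have "s * (x + s * \<xi> - xT) = \<xi> - Q" using s_sq by (simp add: Q_def algebra_simps)
    moreover have "\<bar>x + s * \<xi> + a\<bar> < r" using that x(1) xT xQ s by auto
    ultimately show ?thesis using that by auto
  qed
  define W where "W \<xi> = s * slide_speed Z (x + s * \<xi>)" for \<xi>
  have Wpos: "0 < W \<xi>" if "\<xi> \<in> {0..Q}" for \<xi>
    using slide pt[OF that] c by (fastforce simp: W_def)
  have Wc: "continuous_on {0..Q} W"
    unfolding W_def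
    by (intro continuous_intros continuous_on_compose2[OF slide_speed_cont]) (use pt in auto)
  obtain d q where d: "0 < d" "continuous_on {0..d} q" "q 0 = 0" "q d = Q"
    "\<And>t. t \<in> {0..d} \<Longrightarrow> q t \<in> {0..Q}"
    "\<And>t. 0 < t \<Longrightarrow> t < d \<Longrightarrow> (q has_real_derivative W (q t)) (at t) \<and> 0 < q t \<and> q t < Q"
    using positive_speed_solution[OF Q Wc Wpos] by blast
  define z where "z t = (x + s * q t, 0::real)" for t
  have "q ` {0..d} = {0..Q}"
  proof
    show "q ` {0..d} \<subseteq> {0..Q}" using d(5) by auto
    show "{0..Q} \<subseteq> q ` {0..d}"
    proof
      fix y assume "y \<in> {0..Q}"
      then show "y \<in> q ` {0..d}" using IVT'[of q 0 y d] d by auto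
    qed
  qed
  moreover have "(\<lambda>\<xi>. x + s * \<xi>) ` {0..Q} = closed_segment x xT"
    using s
  proof
    assume "s = 1"
    then show ?thesis using Q xQ
      by (auto simp: closed_segment_eq_real_ivl intro!: image_eqI[of _ _ "_ - x"])
  next
    assume s1: "s = -1"
    have "y \<in> (\<lambda>\<xi>. x + s * \<xi>) ` {0..Q}" if "y \<in> {xT..x}" for y
      using that xQ s1 by (intro image_eqI[of _ _ "x - y"]) auto
    then show ?thesis using Q xQ s1 by (auto simp: closed_segment_eq_real_ivl)
  qed
  ultimately have im: "z ` {0..d} = (\<lambda>\<xi>. (\<xi>, 0)) ` closed_segment x xT"
    unfolding z_def by (metis (no_types, lifting) image_cong image_image)
  have "sol {0..d} z"
    unfolding filippov_solution_on_def
  proof (intro conjI exI[of _ "{0, d}"] allI ballI)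
    show "continuous_on {0..d} z" unfolding z_def by (intro continuous_intros d(2))
    show "finite ({0, d} \<inter> {- b..b})" for b :: real by (rule finite_Int) simp
    fix t assume "t \<in> {0..d} - {0, d}"
    then have t: "0 < t" "t < d" by auto
    define \<xi> where "\<xi> = x + s * q t"
    have qt: "q t \<in> {0..Q}" using d(5) t by auto
    have near: "\<bar>\<xi> + a\<bar> < r" "s * (\<xi> - xT) \<le> 0" using pt[OF qt] by (auto simp: \<xi>_def)
    have "sliding_velocity Z (mirror Z) (\<xi>, 0) (slide_speed Z \<xi>, 0)"
      using sliding_velocity_unique g_le[OF near] g_lower[OF near(1)] by blast
    moreover have "(\<xi>, 0) \<in> sliding_set Z (mirror Z)" using in_sliding_set near by blast
    ultimately have "filippov_velocity Z (mirror Z) (z t) (slide_speed Z \<xi>, 0)"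
      by (simp add: filippov_velocity_def z_def \<xi>_def)
    moreover have "(z has_vector_derivative (slide_speed Z \<xi>, 0)) (at t within {0..d})"
    proof -
      have "(q has_vector_derivative W (q t)) (at t)"
        using d(6)[OF t] by (simp add: has_real_derivative_iff_has_vector_derivative)
      then have "((\<lambda>t. x + s * q t) has_vector_derivative s * W (q t)) (at t)"
        by (auto intro!: derivative_eq_intros)
      then have "((\<lambda>t. (x + s * q t, 0::real)) has_vector_derivative (s * W (q t), 0)) (at t)"
        by (intro has_vector_derivative_Pair) auto
      moreover have "s * W (q t) = slide_speed Z \<xi>" by (simp add: W_def \<xi>_def s_sq)
      ultimately show ?thesis unfolding z_def[abs_def]
        by (simp add: has_vector_derivative_at_within)
    qed
    ultimately show "\<exists>v. filippov_velocity Z (mirror Z) (z t) v \<and> (z has_vector_derivative v) (at t within {0..d})"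
      by (intro exI[of _ "(slide_speed Z \<xi>, 0)"]) simp
  qed
  then show ?thesis using that[OF d(1) _ _ _ im] d xQ by (auto simp: z_def)
qed

lemma crossing_solution:
  assumes "\<bar>x + a\<bar> < r" "0 \<le> s * (x - xT)"
  shows "sol {0..\<tau> x} (u x)"
  by (rule filippov_solution_upper[OF u_deriv[OF assms] u_upper[OF assms]])

lemma seg_exists:
  assumes x: "\<bar>x + a\<bar> < r"
  obtains d z where "c \<le> d" "sol {0..d} z" "z 0 = (x, 0)" "z d = (- R x, 0)" "z ` {0..d} = half_arc x"
proof -
  note clx = lift_off_near[OF x] lift_off_side[of x]
  have U: "sol {0..\<tau> (lift_off x)} (u (lift_off x))" "u (lift_off x) 0 = (lift_off x, 0)" "u (lift_off x) (\<tau> (lift_off x)) = (- R x, 0)"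
    "c \<le> \<tau> (lift_off x)"
    using crossing_solution[OF clx] u_start[OF clx] u_end[OF clx] \<tau>[OF clx] by (auto simp: R_def)
  show ?thesis
  proof (cases "s * (x - xT) < 0")
    case False
    then have "lift_off x = x" by (intro lift_off_id) simp
    moreover have "(x, 0) \<in> u x ` {0..\<tau> x}" using U c \<open>lift_off x = x\<close> by (force intro: image_eqI[of _ _ 0])
    ultimately show ?thesis using that[of "\<tau> (lift_off x)" "u (lift_off x)"] U by (auto simp: half_arc_def)
  next
    case True
    then have clT: "lift_off x = xT" by (intro lift_off_T) simp
    obtain d z where z: "0 < d" "sol {0..d} z" "z 0 = (x, 0)" "z d = (xT, 0)"
      "z ` {0..d} = (\<lambda>\<xi>. (\<xi>, 0)) ` closed_segment x xT"
      using sliding_exists[OF x True] by blast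
    define e where "e = \<tau> (lift_off x)"
    define w where "w t = (if t \<le> d then z t else u xT (t - d))" for t
    have e: "0 < e" using U(4) c by (simp add: e_def)
    have sw: "sol {0..d + e} w"
      unfolding w_def using z U clT e by (intro filippov_solution_join) (auto simp: e_def)
    have "w ` {0..d + e} = w ` {0..d} \<union> w ` {d..d + e}"
      using z(1) e by (subst image_Un[symmetric]) (auto simp: ivl_disj_un_two_touch)
    also have "w ` {0..d} = z ` {0..d}" by (auto simp: w_def intro!: image_cong)
    also have "w ` {d..d + e} = u xT ` {0..e}"
    proof -
      have "w t = u xT (t - d)" if "t \<in> {d..d + e}" for t
        using that z(4) U(2) clT by (cases "t = d") (auto simp: w_def)
      then have "w ` {d..d + e} = (\<lambda>t. u xT (t - d)) ` {d..d + e}" by (intro image_cong) auto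
      also have "\<dots> = u xT ` ((\<lambda>t. t - d) ` {d..d + e})" by (simp only: image_image)
      also have "(\<lambda>t. t - d) ` {d..d + e} = {0..e}"
        by simp
      finally show ?thesis .
    qed
    finally have im: "w ` {0..d + e} = half_arc x" using z clT by (simp add: half_arc_def e_def)
    show ?thesis
    proof (rule that[OF _ sw _ _ im])
      show "c \<le> d + e" using z(1) U(4) by (simp add: e_def)
      show "w 0 = (x, 0)" using z by (simp add: w_def)
      show "w (d + e) = (- R x, 0)" using U(3) clT e by (simp add: w_def e_def)
    qed
  qed
qed

text \<open>Forward uniqueness in the form needed below: however a solution arrives at a point of the left
  section, its next half turn is the same curve.\<close>

lemma follow_seg:
  assumes z: "sol {0..} z" and t0: "0 \<le> t0" and x: "z t0 = (x, 0)" "\<bar>x + a\<bar> < r"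
  obtains t1 where "t0 + c \<le> t1" "z t1 = (- R x, 0)" "z ` {t0..t1} = half_arc x"
proof -
  note result = that
  have main: thesis if m: "t0 \<le> m" "z m = (lift_off x, 0)" "z ` {t0..m} = (\<lambda>\<xi>. (\<xi>, 0)) ` closed_segment x (lift_off x)" for m
  proof -
    note clx = lift_off_near[OF x(2)] lift_off_side[of x]
    have m0: "0 \<le> m" using t0 m by simp
    define e where "e = \<tau> (lift_off x)"
    have e: "c \<le> e" using \<tau>[OF clx] by (simp add: e_def)
    have f: "z (m + t) = u (lift_off x) t" if "t \<in> {0..e}" for t
      using follow_crossing[OF z m0 m(2) clx] that by (simp add: e_def)
    have "z ` {m..m + e} = z ` ((+) m ` {0..e})" by (simp add: add.commute)
    also have "\<dots> = u (lift_off x) ` {0..e}" unfolding image_image using f by (intro image_cong) auto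
    finally have im2: "z ` {m..m + e} = u (lift_off x) ` {0..e}" .
    have "{t0..m + e} = {t0..m} \<union> {m..m + e}" using m e c by auto
    then have "z ` {t0..m + e} = half_arc x" using im2 m(3) by (simp add: image_Un half_arc_def e_def)
    moreover have "z (m + e) = (- R x, 0)" using f[of e] u_end[OF clx] e c by (simp add: R_def e_def)
    ultimately show thesis using result[of "m + e"] m e by auto
  qed
  show thesis
  proof (cases "s * (x - xT) < 0")
    case False
    then have "lift_off x = x" by (intro lift_off_id) simp
    then show thesis using main[of t0] x by simp
  next
    case True
    then have clT: "lift_off x = xT" by (intro lift_off_T) simp
    obtain t1 where t1: "t0 < t1" "z t1 = (xT, 0)"
      "\<And>t. t \<in> {t0..t1} \<Longrightarrow> snd (z t) = 0 \<and> s * (x - xT) \<le> s * (fst (z t) - xT) \<and> s * (fst (z t) - xT) \<le> 0"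
      using follow_sliding[OF z t0 x True] by blast
    have "z ` {t0..t1} = (\<lambda>\<xi>. (\<xi>, 0)) ` closed_segment x xT"
    proof
      show "z ` {t0..t1} \<subseteq> (\<lambda>\<xi>. (\<xi>, 0)) ` closed_segment x xT"
      proof (rule image_subsetI)
        fix t assume "t \<in> {t0..t1}"
        from t1(3)[OF this] have "fst (z t) \<in> closed_segment x xT" "z t = (fst (z t), 0)"
          using s by (auto simp: closed_segment_eq_real_ivl prod_eq_iff)
        then show "z t \<in> (\<lambda>\<xi>. (\<xi>, 0)) ` closed_segment x xT" by (metis image_eqI)
      qed
      have cont: "continuous_on {t0..t1} (\<lambda>t. fst (z t))"
        by (intro continuous_intros continuous_on_subset[OF cont_sol[OF z]]) (use t0 in auto)
      show "(\<lambda>\<xi>. (\<xi>, 0)) ` closed_segment x xT \<subseteq> z ` {t0..t1}"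
      proof (rule image_subsetI)
        fix \<xi> assume \<xi>: "\<xi> \<in> closed_segment x xT"
        have "\<exists>t\<in>{t0..t1}. fst (z t) = \<xi>"
        proof (cases "x \<le> xT")
          case True
          then show ?thesis using IVT'[of "\<lambda>t. fst (z t)" t0 \<xi> t1] cont \<xi> t1 x
            by (auto simp: closed_segment_eq_real_ivl)
        next
          case False
          then show ?thesis using IVT2'[of "\<lambda>t. fst (z t)" t1 \<xi> t0] cont \<xi> t1 x
            by (auto simp: closed_segment_eq_real_ivl)
        qed
        then obtain t where t: "t \<in> {t0..t1}" "fst (z t) = \<xi>" by blast
        then have "z t = (\<xi>, 0)" using t1(3)[OF t(1)] by (simp add: prod_eq_iff)
        then show "(\<xi>, 0) \<in> z ` {t0..t1}" using t(1) by (metis image_eqI)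
      qed
    qed
    then show thesis using main[of t1] t1 clT by simp
  qed
qed

lemma sol_sign:
  assumes "sol I z" "e = 1 \<or> e = (-1::real)"
  shows "sol I (\<lambda>t. e *\<^sub>R z t)"
  using assms(2)
proof
  assume "e = 1"
  then show ?thesis using assms(1) by (simp add: filippov_solution_cong[of _ _ I z])
next
  assume "e = -1"
  then show ?thesis using filippov_solution_mirror[OF assms(1)] by simp
qed

lemma follow_seg_sign:
  assumes z: "sol {0..} z" and t0: "0 \<le> t0" and e: "e = 1 \<or> e = (-1::real)"
    and x: "z t0 = e *\<^sub>R (x, 0)" "\<bar>x + a\<bar> < r"
  obtains t1 where "t0 + c \<le> t1" "z t1 = (- e) *\<^sub>R (R x, 0)" "z ` {t0..t1} = (\<lambda>p. e *\<^sub>R p) ` half_arc x"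
proof -
  have ee: "e * e = 1" using e by auto
  obtain t1 where t1: "t0 + c \<le> t1" "e *\<^sub>R z t1 = (- R x, 0)" "(\<lambda>t. e *\<^sub>R z t) ` {t0..t1} = half_arc x"
    using follow_seg[OF sol_sign[OF z e] t0 _ x(2)] x(1) ee by (auto simp: scaleR_scaleR)
  show ?thesis
  proof (rule that[OF t1(1)])
    have "e *\<^sub>R (e *\<^sub>R z t1) = e *\<^sub>R (- R x, 0)" using t1 by simp
    then show "z t1 = (- e) *\<^sub>R (R x, 0)" using ee by simp
    have "(\<lambda>p. e *\<^sub>R p) ` half_arc x = (\<lambda>t. e *\<^sub>R e *\<^sub>R z t) ` {t0..t1}"
      unfolding t1(3)[symmetric] by (simp only: image_image)
    then show "z ` {t0..t1} = (\<lambda>p. e *\<^sub>R p) ` half_arc x" using ee by simp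
  qed
qed

lemma R_pow_near: "\<bar>x + a\<bar> < r \<Longrightarrow> \<bar>(R ^^ n) x + a\<bar> < r"
  by (induction n) (auto intro: R_near')

text \<open>By symmetry the half turns alternate between the two sections, with signs \<open>e * (-1) ^ n\<close>; the lower
  bound \<open>c\<close> on their durations makes the times exhaust the half line.\<close>

lemma orbit_chain:
  assumes z: "sol {0..} z" and t0: "0 \<le> t0" and e: "e = 1 \<or> e = (-1::real)"
    and x: "z t0 = e *\<^sub>R (x, 0)" "\<bar>x + a\<bar> < r"
  obtains t :: "nat \<Rightarrow> real" where "t 0 = t0" "\<And>n. t n + c \<le> t (Suc n)"
    "\<And>n. z ` {t n..t (Suc n)} = (\<lambda>p. (e * (-1) ^ n) *\<^sub>R p) ` half_arc ((R ^^ n) x)"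
proof -
  have "\<exists>t. \<forall>n. (t0 \<le> t n \<and> z (t n) = (e * (-1) ^ n) *\<^sub>R ((R ^^ n) x, 0) \<and> (n = 0 \<longrightarrow> t n = t0)) \<and>
      (t n + c \<le> t (Suc n) \<and> z ` {t n..t (Suc n)} = (\<lambda>p. (e * (-1) ^ n) *\<^sub>R p) ` half_arc ((R ^^ n) x))"
  proof (rule dependent_nat_choice)
    show "\<exists>t. t0 \<le> t \<and> z t = (e * (-1) ^ 0) *\<^sub>R ((R ^^ 0) x, 0) \<and> (0 = (0::nat) \<longrightarrow> t = t0)"
      using x by (intro exI[of _ t0]) simp
    fix t n
    assume *: "t0 \<le> t \<and> z t = (e * (-1) ^ n) *\<^sub>R ((R ^^ n) x, 0) \<and> (n = 0 \<longrightarrow> t = t0)"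
    have e': "e * (-1) ^ n = 1 \<or> e * (-1) ^ n = -1" using e by (cases "even n") auto
    have "0 \<le> t" using * t0 by simp
    from follow_seg_sign[OF z this e' _ R_pow_near[OF x(2)]] *
    obtain t1 where "t + c \<le> t1" "z t1 = (- (e * (-1) ^ n)) *\<^sub>R (R ((R ^^ n) x), 0)"
      "z ` {t..t1} = (\<lambda>p. (e * (-1) ^ n) *\<^sub>R p) ` half_arc ((R ^^ n) x)" by blast
    then show "\<exists>y. (t0 \<le> y \<and> z y = (e * (- 1) ^ Suc n) *\<^sub>R ((R ^^ Suc n) x, 0) \<and> (Suc n = 0 \<longrightarrow> y = t0)) \<and>
        t + c \<le> y \<and> z ` {t..y} = (\<lambda>p. (e * (- 1) ^ n) *\<^sub>R p) ` half_arc ((R ^^ n) x)"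
      using * c by (intro exI[of _ t1]) auto
  qed
  then obtain t where "\<forall>n. (t0 \<le> t n \<and> z (t n) = (e * (-1) ^ n) *\<^sub>R ((R ^^ n) x, 0) \<and> (n = 0 \<longrightarrow> t n = t0)) \<and>
      (t n + c \<le> t (Suc n) \<and> z ` {t n..t (Suc n)} = (\<lambda>p. (e * (-1) ^ n) *\<^sub>R p) ` half_arc ((R ^^ n) x))" ..
  then show thesis by (intro that[of t]) simp_all
qed

lemma fixed_point_ex: "\<exists>x. \<bar>x + a\<bar> \<le> r0 \<and> R x = x"
proof -
  have "\<exists>!x. x \<in> cball (- a) r0 \<and> R x = x"
  proof (rule Banach_fix[of _ "1/2"])
    show "complete (cball (- a) r0)" by (simp add: complete_eq_closed)
    show "cball (- a) r0 \<noteq> {}" using r by auto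
    show "R ` cball (- a) r0 \<subseteq> cball (- a) r0"
    proof (rule image_subsetI)
      fix x assume "x \<in> cball (- a) r0"
      then have "\<bar>x + a\<bar> < r" using r by (auto simp: dist_real_def)
      then show "R x \<in> cball (- a) r0" using R_near[of x] by (auto simp: dist_real_def)
    qed
    show "dist (R x) (R y) \<le> 1 / 2 * dist x y" if "x \<in> cball (- a) r0" "y \<in> cball (- a) r0" for x y
    proof -
      have "\<bar>x + a\<bar> < r" "\<bar>y + a\<bar> < r" using that r by (auto simp: dist_real_def)
      then show ?thesis using R_lip[of x y] by (simp add: dist_real_def)
    qed
  qed auto
  then obtain x where "x \<in> cball (- a) r0 \<and> R x = x" by blast
  then show ?thesis by (intro exI[of _ x]) (auto simp: dist_real_def)
qed

text \<open>The fixed point of the half return map, i.e. the position of the periodic orbit on the left section.\<close>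

definition "xs = (SOME x. \<bar>x + a\<bar> \<le> r0 \<and> R x = x)"

lemma xs_near: "\<bar>xs + a\<bar> \<le> r0" and xs_fix: "R xs = xs"
  using someI_ex[OF fixed_point_ex] unfolding xs_def[symmetric] by auto

lemma xs_near': "\<bar>xs + a\<bar> < r" using xs_near r by simp

lemma xs_neg: "xs < 0" using xs_near r by simp

definition "orbit = half_arc xs \<union> uminus ` half_arc xs"

lemma arc_xs_orbit: obtains d z where "c \<le> d" "sol {0..d} z" "z 0 = (xs, 0)" "z d = (- xs, 0)" "z ` {0..d} = half_arc xs"
  using seg_exists[OF xs_near'] xs_fix by auto

lemma compact_orbit: "compact orbit"
proof -
  obtain d z where z: "sol {0..d} z" "z ` {0..d} = half_arc xs" by (rule arc_xs_orbit)
  then have "compact (z ` {0..d})"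
    by (intro compact_continuous_image) (auto simp: filippov_solution_on_def)
  then have "compact (half_arc xs)" using z by simp
  then show ?thesis unfolding orbit_def
    by (intro compact_Un compact_continuous_image continuous_intros) auto
qed

lemma xs_in_orbit: "(xs, 0) \<in> orbit"
  by (auto simp: orbit_def half_arc_def)

lemma orbit_uminus: "uminus ` orbit = orbit"
  by (simp add: orbit_def image_Un image_image Un_commute)

lemma arc_near:
  assumes "0 < \<epsilon>"
  obtains \<delta> where "0 < \<delta>" "\<And>x p. \<bar>x + a\<bar> < r \<Longrightarrow> \<bar>x - xs\<bar> < \<delta> \<Longrightarrow> p \<in> half_arc x \<Longrightarrow> \<exists>q\<in>half_arc xs. dist p q < \<epsilon>"
proof -
  obtain \<delta> where \<delta>: "0 < \<delta>" "\<And>x t. \<bar>x + a\<bar> < r \<Longrightarrow> 0 \<le> s * (x - xT) \<Longrightarrow> \<bar>x - lift_off xs\<bar> < \<delta> \<Longrightarrow> t \<in> {0..\<tau> x} \<Longrightarrow>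
      \<exists>t'\<in>{0..\<tau> (lift_off xs)}. dist (u x t) (u (lift_off xs) t') < \<epsilon>"
    using u_near[OF lift_off_near[OF xs_near'] lift_off_side assms] by metis
  show ?thesis
  proof (rule that[of "min \<delta> \<epsilon>"])
    show "0 < min \<delta> \<epsilon>" using \<delta> assms by simp
    fix x p assume x: "\<bar>x + a\<bar> < r" "\<bar>x - xs\<bar> < min \<delta> \<epsilon>" and p: "p \<in> half_arc x"
    consider \<xi> where "\<xi> \<in> closed_segment x (lift_off x)" "p = (\<xi>, 0)" | t where "t \<in> {0..\<tau> (lift_off x)}" "p = u (lift_off x) t"
      using p by (auto simp: half_arc_def)
    then show "\<exists>q\<in>half_arc xs. dist p q < \<epsilon>"
    proof cases
      case 1
      then obtain \<theta> where \<theta>: "0 \<le> \<theta>" "\<theta> \<le> 1" "\<xi> = (1 - \<theta>) * x + \<theta> * lift_off x"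
        by (auto simp: closed_segment_def)
      define \<xi>' where "\<xi>' = (1 - \<theta>) * xs + \<theta> * lift_off xs"
      have "\<bar>\<xi> - \<xi>'\<bar> = \<bar>(1 - \<theta>) * (x - xs) + \<theta> * (lift_off x - lift_off xs)\<bar>"
        by (simp add: \<theta>(3) \<xi>'_def algebra_simps)
      also have "\<dots> \<le> (1 - \<theta>) * \<bar>x - xs\<bar> + \<theta> * \<bar>lift_off x - lift_off xs\<bar>"
        using \<theta> by (intro order_trans[OF abs_triangle_ineq]) (simp add: abs_mult)
      also have "\<dots> \<le> (1 - \<theta>) * \<bar>x - xs\<bar> + \<theta> * \<bar>x - xs\<bar>"
        using \<theta> lift_off_lip by (intro add_left_mono mult_left_mono) auto
      also have "\<dots> < \<epsilon>" using x by (simp add: algebra_simps)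
      finally have "dist p (\<xi>', 0) < \<epsilon>" using 1 by (simp add: dist_Pair_Pair dist_real_def)
      moreover have "(\<xi>', 0) \<in> half_arc xs"
        using \<theta> by (auto simp: half_arc_def \<xi>'_def closed_segment_def)
      ultimately show ?thesis by blast
    next
      case 2
      have "\<bar>lift_off x - lift_off xs\<bar> < \<delta>" using lift_off_lip[of x xs] x by simp
      then obtain t' where "t' \<in> {0..\<tau> (lift_off xs)}" "dist (u (lift_off x) t) (u (lift_off xs) t') < \<epsilon>"
        using \<delta>(2)[OF lift_off_near[OF x(1)] lift_off_side _ 2(1)] by blast
      then show ?thesis using 2 by (intro bexI[of _ "u (lift_off xs) t'"]) (auto simp: half_arc_def)
    qed
  qed
qed

lemma R_pow_tendsto:
  assumes "\<bar>x + a\<bar> < r"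
  shows "\<bar>(R ^^ n) x - xs\<bar> \<le> \<bar>x - xs\<bar> * (1/2) ^ n"
proof (induction n)
  case (Suc n)
  have "\<bar>R ((R ^^ n) x) - R xs\<bar> \<le> \<bar>(R ^^ n) x - xs\<bar> / 2"
    by (rule R_lip[OF R_pow_near[OF assms] xs_near'])
  then show ?case using Suc xs_fix by simp
qed simp

text \<open>The iterates of a contraction converge to its fixed point, and half turns depend continuously on
  their starting points.\<close>

lemma attracted_from_axis:
  assumes z: "sol {0..} z" and t0: "0 \<le> t0" and e: "e = 1 \<or> e = (-1::real)"
    and x: "z t0 = e *\<^sub>R (x, 0)" "\<bar>x + a\<bar> < r"
  shows "((\<lambda>t. infdist (z t) orbit) \<longlongrightarrow> 0) at_top"
proof -
  obtain t where t: "t 0 = t0" "\<And>n. t n + c \<le> t (Suc n)"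
    "\<And>n. z ` {t n..t (Suc n)} = (\<lambda>p. (e * (-1) ^ n) *\<^sub>R p) ` half_arc ((R ^^ n) x)"
    using orbit_chain[OF z t0 e x] by blast
  have big: "t 0 + real n * c \<le> t n" for n
  proof (induction n)
    case (Suc n) then show ?case using t(2)[of n] by (simp add: algebra_simps)
  qed simp
  have mono: "t n \<le> t (n + k)" for n k
  proof (induction k)
    case (Suc k) then show ?case using t(2)[of "n + k"] c by simp
  qed simp
  show ?thesis
  proof (rule tendstoI)
    fix \<epsilon> :: real assume "0 < \<epsilon>"
    then obtain \<delta> where \<delta>: "0 < \<delta>"
      "\<And>x p. \<bar>x + a\<bar> < r \<Longrightarrow> \<bar>x - xs\<bar> < \<delta> \<Longrightarrow> p \<in> half_arc x \<Longrightarrow> \<exists>q\<in>half_arc xs. dist p q < \<epsilon>"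
      using arc_near by blast
    have "(\<lambda>n. \<bar>x - xs\<bar> * (1/2) ^ n) \<longlonglongrightarrow> \<bar>x - xs\<bar> * 0"
      by (intro tendsto_intros LIMSEQ_power_zero) auto
    then have "\<forall>\<^sub>F n in sequentially. \<bar>x - xs\<bar> * (1/2) ^ n < \<delta>"
      using \<delta>(1) by (intro order_tendstoD(2)) auto
    then obtain n0 where n0: "\<And>n. n0 \<le> n \<Longrightarrow> \<bar>x - xs\<bar> * (1/2) ^ n < \<delta>"
      by (auto simp: eventually_sequentially)
    show "\<forall>\<^sub>F y in at_top. dist (infdist (z y) orbit) 0 < \<epsilon>"
      unfolding eventually_at_top_linorder
    proof (intro exI[of _ "t n0"] allI impI)
      fix y assume y: "t n0 \<le> y"
      define m where "m = (LEAST m. y < t (Suc m))"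
      obtain k where "y - t 0 < real k * c"
      proof -
        obtain k where "(y - t 0) / c < real k" using reals_Archimedean2 by blast
        then show thesis using that[of k] c by (simp add: field_simps)
      qed
      then have "y < t k" using big[of k] by simp
      moreover have "t k \<le> t (Suc k)" using mono[of k 1] by simp
      ultimately have ex: "y < t (Suc k)" by simp
      have m1: "y < t (Suc m)" unfolding m_def by (rule LeastI[of "\<lambda>m. y < t (Suc m)", OF ex])
      have n0m: "n0 \<le> m"
      proof (rule ccontr)
        assume "\<not> n0 \<le> m"
        then have "t (Suc m) \<le> t n0" using mono[of "Suc m" "n0 - Suc m"] by simp
        then show False using m1 y by simp
      qed
      have m2: "t m \<le> y"
      proof (cases "m = n0")
        case True then show ?thesis using y by simp
      next
        case False
        then obtain l where l: "m = Suc l" using n0m by (cases m) auto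
        have "\<not> y < t (Suc l)" using not_less_Least[of l "\<lambda>m. y < t (Suc m)"] l by (simp add: m_def)
        then show ?thesis using l by simp
      qed
      have "z y \<in> z ` {t m..t (Suc m)}" using m1 m2 by auto
      then obtain p where p: "p \<in> half_arc ((R ^^ m) x)" "z y = (e * (-1) ^ m) *\<^sub>R p" using t(3) by auto
      have "\<bar>(R ^^ m) x - xs\<bar> < \<delta>" using R_pow_tendsto[OF x(2), of m] n0[OF n0m] by simp
      then obtain q where q: "q \<in> half_arc xs" "dist p q < \<epsilon>" using \<delta>(2)[OF R_pow_near[OF x(2)] _ p(1)] by blast
      have e': "e * (-1) ^ m = 1 \<or> e * (-1) ^ m = -1" using e by (cases "even m") auto
      have "(e * (-1) ^ m) *\<^sub>R q \<in> orbit" using e' q(1) by (auto simp: orbit_def)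
      moreover have "dist (z y) ((e * (-1) ^ m) *\<^sub>R q) < \<epsilon>"
        using e' q(2) p(2) by (auto simp: dist_norm norm_minus_commute)
      ultimately have "infdist (z y) orbit < \<epsilon>" using infdist_le le_less_trans by metis
      then show "dist (infdist (z y) orbit) 0 < \<epsilon>" by (simp add: infdist_nonneg)
    qed
  qed
qed

end

section \<open>Existence and uniqueness of the periodic orbit\<close>

context half_return begin

lemma axis_point:
  assumes "snd p = 0" "\<bar>fst p + a\<bar> < r \<or> \<bar>fst p - a\<bar> < r"
  obtains e x where "e = 1 \<or> e = (-1::real)" "p = e *\<^sub>R (x, 0)" "\<bar>x + a\<bar> < r"
proof (cases "\<bar>fst p + a\<bar> < r")
  case True
  then show thesis using that[of 1 "fst p"] assms(1) by (simp add: prod_eq_iff)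
next
  case False
  then have "\<bar>- fst p + a\<bar> < r" using assms(2) by linarith
  then show thesis using that[of "-1" "- fst p"] assms(1) by (simp add: prod_eq_iff)
qed

text \<open>Below the axis the symmetry reduces the claim to the upper half plane.\<close>

lemma landing_upper:
  assumes z: "sol {0..} z" and p: "z 0 \<in> N" "0 < snd (z 0)"
  obtains t0 e x where "0 \<le> t0" "e = 1 \<or> e = (-1::real)" "z t0 = e *\<^sub>R (x, 0)" "\<bar>x + a\<bar> < r"
proof -
  obtain w b where w: "0 < b" "w 0 = z 0"
    "\<And>t. t \<in> {0..b} \<Longrightarrow> (w has_vector_derivative Z (w t)) (at t within {0..b})"
    "\<And>t. 0 < t \<Longrightarrow> t < b \<Longrightarrow> w t \<in> upper_half"
    "snd (w b) = 0" "\<bar>fst (w b) + a\<bar> < r \<or> \<bar>fst (w b) - a\<bar> < r"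
    using N_upper[OF p] by blast
  have "open {p::plane. 0 < snd p}" by (intro open_Collect_less continuous_intros)
  moreover have "z 0 \<in> {p. 0 < snd p}" using p by simp
  ultimately obtain \<eta> where \<eta>: "0 < \<eta>" "\<And>t. 0 \<le> t \<Longrightarrow> t \<le> 0 + \<eta> \<Longrightarrow> z t \<in> {p. 0 < snd p}"
    using solution_near[OF z order_refl] by metis
  have "z (0 + b) = w b"
    by (rule follow_orbit[OF z order_refl w(3,4) _ \<eta>(1)]) (use w \<eta>(2) in auto)
  moreover obtain e x where "e = 1 \<or> e = (-1::real)" "w b = e *\<^sub>R (x, 0)" "\<bar>x + a\<bar> < r"
    using axis_point[OF w(5,6)] by blast
  ultimately show thesis using that[of b e x] w(1) by simp
qed

lemma landing:
  assumes z: "sol {0..} z" and p: "z 0 \<in> N"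
  obtains t0 e x where "0 \<le> t0" "e = 1 \<or> e = (-1::real)" "z t0 = e *\<^sub>R (x, 0)" "\<bar>x + a\<bar> < r"
proof (cases "snd (z 0)" "0::real" rule: linorder_cases)
  case equal
  then obtain e x where "e = 1 \<or> e = (-1::real)" "z 0 = e *\<^sub>R (x, 0)" "\<bar>x + a\<bar> < r"
    using axis_point[OF equal N_axis[OF p equal]] by blast
  then show thesis using that[of 0 e x] by simp
next
  case greater
  then show thesis using landing_upper[OF z p] that by blast
next
  case less
  have "sol {0..} (\<lambda>t. - z t)" by (rule filippov_solution_mirror[OF z])
  then obtain t0 e x where *: "0 \<le> t0" "e = 1 \<or> e = (-1::real)" "- z t0 = e *\<^sub>R (x, 0)" "\<bar>x + a\<bar> < r"
    using landing_upper[of "\<lambda>t. - z t"] N_sym[OF p] less by auto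
  have "z t0 = - (- z t0)" by simp
  also have "\<dots> = (- e) *\<^sub>R (x, 0)" unfolding *(3) by simp
  finally show thesis using that[of t0 "- e" x] * by auto
qed

lemma attracted: "sol {0..} z \<Longrightarrow> z 0 \<in> N \<Longrightarrow> ((\<lambda>t. infdist (z t) orbit) \<longlongrightarrow> 0) at_top"
  using landing attracted_from_axis by metis

lemma forward_exists_axis:
  assumes e: "e = 1 \<or> e = (-1::real)" and x: "\<bar>x + a\<bar> < r"
  obtains d z where "\<And>n. c \<le> d n" "\<And>n. sol {0..d n} (z n)" "z 0 0 = e *\<^sub>R (x, 0)"
    "\<And>n. z n (d n) = z (Suc n) (0::real)"
proof -
  have "\<forall>x. \<exists>d z. \<bar>x + a\<bar> < r \<longrightarrow> c \<le> d \<and> sol {0..d} z \<and> z 0 = (x, 0) \<and> z d = (- R x, 0)"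
    using seg_exists by metis
  then obtain D W where DW: "\<And>x. \<bar>x + a\<bar> < r \<Longrightarrow> c \<le> D x \<and> sol {0..D x} (W x) \<and> W x 0 = (x, 0) \<and> W x (D x) = (- R x, 0)"
    by metis
  define y where "y n = (R ^^ n) x" for n
  have y: "\<bar>y n + a\<bar> < r" for n unfolding y_def by (rule R_pow_near[OF x])
  have e': "e * (-1) ^ n = 1 \<or> e * (-1) ^ n = -1" for n using e by (cases "even n") auto
  show thesis
  proof (rule that[of "\<lambda>n. D (y n)" "\<lambda>n t. (e * (-1) ^ n) *\<^sub>R W (y n) t"])
    show "sol {0..D (y n)} (\<lambda>t. (e * (-1) ^ n) *\<^sub>R W (y n) t)" for n
      using DW[OF y[of n]] e' by (intro sol_sign) auto
    show "(e * (-1) ^ n) *\<^sub>R W (y n) (D (y n)) = (e * (-1) ^ Suc n) *\<^sub>R W (y (Suc n)) 0" for n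
      using DW[OF y[of n]] DW[OF y[of "Suc n"]] by (simp add: y_def)
    show "(e * (-1) ^ 0) *\<^sub>R W (y 0) 0 = e *\<^sub>R (x, 0)" using DW[OF y[of 0]] by (simp add: y_def)
  qed (use DW y in auto)
qed

lemma forward_exists_upper:
  assumes p: "p \<in> N" "0 < snd p"
  shows "\<exists>z. sol {0..} z \<and> z 0 = p"
proof -
  obtain w b where w: "0 < b" "w 0 = p"
    "\<And>t. t \<in> {0..b} \<Longrightarrow> (w has_vector_derivative Z (w t)) (at t within {0..b})"
    "\<And>t. 0 < t \<Longrightarrow> t < b \<Longrightarrow> w t \<in> upper_half"
    "snd (w b) = 0" "\<bar>fst (w b) + a\<bar> < r \<or> \<bar>fst (w b) - a\<bar> < r"
    using N_upper[OF p] by blast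
  have sw: "sol {0..b} w" by (rule filippov_solution_upper[OF w(3,4)])
  obtain e x where ex: "e = 1 \<or> e = (-1::real)" "w b = e *\<^sub>R (x, 0)" "\<bar>x + a\<bar> < r"
    using axis_point[OF w(5,6)] by blast
  obtain d z where dz: "\<And>n. c \<le> d n" "\<And>n. sol {0..d n} (z n)" "z 0 0 = e *\<^sub>R (x, 0)"
    "\<And>n. z n (d n) = z (Suc n) (0::real)"
    using forward_exists_axis[OF ex(1,3)] by blast
  define d' z' where "d' = case_nat b d" and "z' = case_nat w z"
  obtain y where "sol {0..} y" "y 0 = z' 0 0"
  proof (rule filippov_solution_concat[of Z "mirror Z" d' z' "min b c"])
    show "sol {0..d' n} (z' n)" for n using sw dz by (cases n) (auto simp: d'_def z'_def)
    show "min b c \<le> d' n" for n using dz(1) by (cases n) (auto simp: d'_def intro: min.coboundedI2)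
    show "z' n (d' n) = z' (Suc n) 0" for n using dz ex by (cases n) (auto simp: d'_def z'_def)
  qed (use w c in auto)
  then show ?thesis using w(2) by (auto simp: z'_def)
qed

lemma forward_exists:
  assumes p: "p \<in> N"
  shows "\<exists>z. sol {0..} z \<and> z 0 = p"
proof (cases "snd p" "0::real" rule: linorder_cases)
  case equal
  obtain e x where ex: "e = 1 \<or> e = (-1::real)" "p = e *\<^sub>R (x, 0)" "\<bar>x + a\<bar> < r"
    using axis_point[OF equal N_axis[OF p equal]] by blast
  obtain d z where dz: "\<And>n. c \<le> d n" "\<And>n. sol {0..d n} (z n)" "z 0 0 = e *\<^sub>R (x, 0)"
    "\<And>n. z n (d n) = z (Suc n) (0::real)"
    using forward_exists_axis[OF ex(1,3)] by blast
  obtain y where "sol {0..} y" "y 0 = z 0 0"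
    by (rule filippov_solution_concat[of Z "mirror Z" d z c]) (use dz c in auto)
  then show ?thesis using dz ex by auto
next
  case greater
  then show ?thesis using forward_exists_upper p by blast
next
  case less
  then obtain z where "sol {0..} z" "z 0 = - p" using forward_exists_upper[OF N_sym[OF p]] by auto
  then show ?thesis using filippov_solution_mirror[of Z "{0..}" z] by (intro exI[of _ "\<lambda>t. - z t"]) auto
qed

text \<open>The solution over one half period and its mirror image are repeated for all integers; the value
  \<open>(xs, 0)\<close> is never equal to \<open>(- xs, 0)\<close>, so the solution is not constant.\<close>

lemma periodic_orbit_orbit: "periodic_orbit Z (mirror Z) orbit"
proof -
  obtain d z0 where z0: "c \<le> d" "sol {0..d} z0" "z0 0 = (xs, 0)" "z0 d = (- xs, 0)" "z0 ` {0..d} = half_arc xs"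
    by (rule arc_xs_orbit)
  have d: "0 < d" using z0 c by simp
  define e where "e n = (if even n then 1 else -1 :: real)" for n :: int
  have e1: "e n = 1 \<or> e n = -1" for n by (simp add: e_def)
  define z where "z t = e \<lfloor>t / d\<rfloor> *\<^sub>R z0 (t - of_int \<lfloor>t / d\<rfloor> * d)" for t
  have zn: "z t = e n *\<^sub>R z0 (t - of_int n * d)" if "t \<in> {of_int n * d..(of_int n + 1) * d}" for t n
  proof (cases "t = (of_int n + 1) * d")
    case True
    then have "\<lfloor>t / d\<rfloor> = n + 1" using d by (simp add: floor_eq_iff)
    then show ?thesis using True z0 by (simp add: z_def e_def algebra_simps)
  next
    case False
    have "of_int n \<le> t / d" "t / d < of_int n + 1"
      using that False d by (auto simp: field_simps)
    then have "\<lfloor>t / d\<rfloor> = n" by (simp add: floor_eq_iff)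
    then show ?thesis by (simp add: z_def)
  qed
  have cover: "t \<in> {of_int \<lfloor>t / d\<rfloor> * d..(of_int \<lfloor>t / d\<rfloor> + 1) * d}" for t
  proof -
    have "of_int \<lfloor>t / d\<rfloor> \<le> t / d" "t / d \<le> of_int \<lfloor>t / d\<rfloor> + 1" by linarith+
    then have "of_int \<lfloor>t / d\<rfloor> * d \<le> t" "t \<le> (of_int \<lfloor>t / d\<rfloor> + 1) * d"
      using pos_le_divide_eq[OF d] pos_divide_le_eq[OF d] by blast+
    then show ?thesis by simp
  qed
  have "sol UNIV z"
  proof (rule filippov_solution_glue[where N = "UNIV :: int set" and p = "\<lambda>n. of_int n * d" and q = "\<lambda>n. (of_int n + 1) * d"])
    show "UNIV = (\<Union>n\<in>UNIV. {of_int n * d..(of_int n + 1) * d})" using cover by blast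
    show "of_int n * d \<le> (of_int n + 1) * d" for n using d by (intro mult_right_mono) auto
    show "finite {n \<in> UNIV. {of_int n * d..(of_int n + 1) * d} \<inter> {- b..b} \<noteq> {}}" for b
    proof (rule finite_subset)
      show "{n \<in> UNIV. {of_int n * d..(of_int n + 1) * d} \<inter> {- b..b} \<noteq> {}} \<subseteq> {\<lfloor>- b / d\<rfloor> - 1..\<lfloor>b / d\<rfloor>}"
      proof
        fix n :: int assume "n \<in> {n \<in> UNIV. {of_int n * d..(of_int n + 1) * d} \<inter> {- b..b} \<noteq> {}}"
        then obtain y where "y \<in> {of_int n * d..(of_int n + 1) * d}" "y \<in> {- b..b}" by blast
        then have y: "of_int n * d \<le> y" "y \<le> (of_int n + 1) * d" "- b \<le> y" "y \<le> b" by simp_all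
        have "of_int n * d \<le> b" "- b \<le> (of_int n + 1) * d" using y by linarith+
        then have "of_int n \<le> b / d" "- b / d \<le> of_int n + 1"
          using pos_le_divide_eq[OF d] pos_divide_le_eq[OF d] by blast+
        then have "n \<le> \<lfloor>b / d\<rfloor>" "\<lfloor>- b / d\<rfloor> \<le> n + 1" by linarith+
        then show "n \<in> {\<lfloor>- b / d\<rfloor> - 1..\<lfloor>b / d\<rfloor>}" by simp
      qed
    qed simp
    show "sol {of_int n * d..(of_int n + 1) * d} z" for n
    proof (rule filippov_solution_cong)
      show "sol {of_int n * d..(of_int n + 1) * d} (\<lambda>t. e n *\<^sub>R z0 (t + - (of_int n * d)))"
        by (rule filippov_solution_shift[OF sol_sign[OF z0(2) e1]]) (auto simp: algebra_simps)
      show "z t = e n *\<^sub>R z0 (t + - (of_int n * d))" if "t \<in> {of_int n * d..(of_int n + 1) * d}" for t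
        using zn[OF that] by simp
    qed
  qed
  moreover have "z (t + 2 * d) = z t" for t
  proof -
    have fl: "\<lfloor>(t + 2 * d) / d\<rfloor> = \<lfloor>t / d\<rfloor> + 2" using d by (simp add: add_divide_distrib)
    have "z (t + 2 * d) = e (\<lfloor>t / d\<rfloor> + 2) *\<^sub>R z0 (t + 2 * d - of_int (\<lfloor>t / d\<rfloor> + 2) * d)"
      by (simp only: z_def fl)
    also have "t + 2 * d - of_int (\<lfloor>t / d\<rfloor> + 2) * d = t - of_int \<lfloor>t / d\<rfloor> * d" by (simp add: algebra_simps)
    also have "e (\<lfloor>t / d\<rfloor> + 2) = e \<lfloor>t / d\<rfloor>" by (simp add: e_def)
    finally show ?thesis by (simp add: z_def)
  qed
  moreover have "z d \<noteq> z 0" using zn[of 0 0] zn[of d 0] z0 d xs_neg by (simp add: e_def)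
  moreover have "orbit = range z"
  proof
    have "half_arc xs \<subseteq> range z"
    proof
      fix p assume "p \<in> half_arc xs"
      then have "p \<in> z0 ` {0..d}" by (simp only: z0(5))
      then obtain t where "t \<in> {0..d}" "p = z0 t" by blast
      then have "p = z t" using zn[of t 0] by (simp add: e_def)
      then show "p \<in> range z" by simp
    qed
    moreover have "uminus ` half_arc xs \<subseteq> range z"
    proof
      fix p assume "p \<in> uminus ` half_arc xs"
      then have "p \<in> uminus ` z0 ` {0..d}" by (simp only: z0(5))
      then obtain t where "t \<in> {0..d}" "p = - z0 t" by blast
      then have "p = z (t + d)" using zn[of "t + d" 1] by (simp add: e_def algebra_simps)
      then show "p \<in> range z" by simp
    qed
    ultimately show "orbit \<subseteq> range z" by (simp add: orbit_def)
    show "range z \<subseteq> orbit"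
    proof
      fix p assume "p \<in> range z"
      then obtain t where t: "p = z t" by auto
      define n where "n = \<lfloor>t / d\<rfloor>"
      have "t - of_int n * d \<in> {0..d}" using cover[of t] by (auto simp: n_def algebra_simps)
      then have "z0 (t - of_int n * d) \<in> half_arc xs" unfolding z0(5)[symmetric] by (rule imageI)
      moreover have "p = e n *\<^sub>R z0 (t - of_int n * d)" by (simp add: t z_def n_def)
      ultimately show "p \<in> orbit" using e1[of n] by (auto simp: orbit_def)
    qed
  qed
  ultimately show ?thesis unfolding periodic_orbit_def using d
    by (intro exI[of _ z] exI[of _ "2 * d"]) auto
qed

lemma half_arc_axis:
  assumes "p \<in> half_arc xs" "snd p = 0"
  obtains \<xi> where "\<xi> \<in> closed_segment xs (lift_off xs)" "p = (\<xi>, 0)" | "p = (- xs, 0)"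
proof -
  note cx = lift_off_near[OF xs_near'] lift_off_side[of xs]
  consider \<xi> where "\<xi> \<in> closed_segment xs (lift_off xs)" "p = (\<xi>, 0)"
    | t where "t \<in> {0..\<tau> (lift_off xs)}" "p = u (lift_off xs) t"
    using assms(1) by (auto simp: half_arc_def)
  then show thesis
  proof cases
    case 2
    have "\<not> (0 < t \<and> t < \<tau> (lift_off xs))"
      using u_upper[OF cx, of t] 2 assms(2) by (auto simp: upper_half_def)
    then consider "t = 0" | "t = \<tau> (lift_off xs)" using 2 by fastforce
    then show thesis
    proof cases
      case 1 then show thesis using that(1)[of "lift_off xs"] u_start[OF cx] 2 by simp
    next
      case 2
      have "P (lift_off xs) = - xs" using xs_fix by (simp add: R_def)
      then show thesis using that(2) u_end[OF cx] 2 \<open>p = u (lift_off xs) t\<close> by simp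
    qed
  qed (use that in blast)
qed

lemma orbit_axis:
  assumes p: "p \<in> orbit" "snd p = 0"
  obtains e \<xi> where "e = 1 \<or> e = (-1::real)" "p = e *\<^sub>R (\<xi>, 0)" "\<xi> \<in> closed_segment xs (lift_off xs)"
proof -
  have *: thesis if h: "e = 1 \<or> e = (-1::real)" "e *\<^sub>R p \<in> half_arc xs" for e
  proof -
    have ee: "e *\<^sub>R (e *\<^sub>R p) = p" using h(1) by auto
    have "snd (e *\<^sub>R p) = 0" using p(2) by simp
    then show thesis
    proof (rule half_arc_axis[OF h(2)])
      fix \<xi> assume "\<xi> \<in> closed_segment xs (lift_off xs)" "e *\<^sub>R p = (\<xi>, 0)"
      then show thesis using \<open>\<And>e \<xi>. e = 1 \<or> e = (-1::real) \<Longrightarrow> p = e *\<^sub>R (\<xi>, 0) \<Longrightarrow> \<xi> \<in> closed_segment xs (lift_off xs) \<Longrightarrow> thesis\<close>[of e \<xi>] ee h(1) by metis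
    next
      assume "e *\<^sub>R p = (- xs, 0)"
      then have "p = e *\<^sub>R (- xs, 0)" using ee by metis
      then have "p = (- e) *\<^sub>R (xs, 0)" by simp
      then show thesis using \<open>\<And>e \<xi>. e = 1 \<or> e = (-1::real) \<Longrightarrow> p = e *\<^sub>R (\<xi>, 0) \<Longrightarrow> \<xi> \<in> closed_segment xs (lift_off xs) \<Longrightarrow> thesis\<close>[of "- e" xs] h(1) by auto
    qed
  qed
  show thesis using p(1) *[of 1] *[of "-1"] by (auto simp: orbit_def)
qed

lemma seg_near: "\<xi> \<in> closed_segment xs (lift_off xs) \<Longrightarrow> \<bar>\<xi> + a\<bar> < r"
  using xs_near' lift_off_near[OF xs_near'] by (auto simp: closed_segment_eq_real_ivl split: if_splits)

lemma seg_lift_off: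
  assumes "\<xi> \<in> closed_segment xs (lift_off xs)"
  shows "lift_off \<xi> = lift_off xs"
proof (cases "0 \<le> s * (xs - xT)")
  case True
  then show ?thesis using lift_off_id[OF True] assms by simp
next
  case False
  then have c: "lift_off xs = xT" by (intro lift_off_T) simp
  then have "s * (\<xi> - xT) \<le> 0" using assms False s by (auto simp: closed_segment_eq_real_ivl split: if_splits)
  then show ?thesis using c lift_off_T by simp
qed

text \<open>A periodic solution is attracted by the orbit and returns to each of its points, hence lies in the
  orbit. Its points on the axis are therefore sliding points of the orbit or the fixed point
  itself, and from there it runs through both half turns.\<close>

lemma periodic_orbit_unique:
  assumes G: "periodic_orbit Z (mirror Z) \<Gamma>" "\<Gamma> \<subseteq> N"
  shows "\<Gamma> = orbit"
proof -
  obtain z T where z: "sol UNIV z" "0 < T" "\<And>t. z (t + T) = z t" "\<Gamma> = range z"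
    using G(1) unfolding periodic_orbit_def by blast
  have zn: "z (t + real n * T) = z t" for t n
  proof (induction n)
    case (Suc n)
    have "z (t + real (Suc n) * T) = z ((t + real n * T) + T)" by (simp add: algebra_simps)
    then show ?case using Suc z(3) by simp
  qed simp
  have z0: "sol {0..} z" by (rule filippov_solution_subset[OF z(1)]) simp
  have lim: "((\<lambda>t. infdist (z t) orbit) \<longlongrightarrow> 0) at_top"
    by (rule attracted[OF z0]) (use z G in auto)
  have sub: "\<Gamma> \<subseteq> orbit"
  proof
    \<comment> \<open>By periodicity the distance of \<open>p\<close> from the orbit recurs for arbitrarily large times.\<close>
    fix p assume "p \<in> \<Gamma>"
    then obtain t where t: "p = z t" using z by auto
    have "filterlim (\<lambda>n. t + real n * T) at_top sequentially"
      using z(2)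
      by (intro filterlim_tendsto_add_at_top[OF tendsto_const] filterlim_at_top_mult_tendsto_pos[of _ T]
          tendsto_const filterlim_real_sequentially)
    from filterlim_compose[OF lim this]
    have "(\<lambda>n. infdist (z t) orbit) \<longlonglongrightarrow> 0" by (simp add: zn)
    then have "infdist p orbit = 0" using t LIMSEQ_const_iff by blast
    then show "p \<in> orbit"
      using in_closed_iff_infdist_zero[OF compact_imp_closed[OF compact_orbit]] xs_in_orbit by blast
  qed
  have z0N: "z 0 \<in> N" using z G by auto
  obtain t0 e x where t0: "0 \<le> t0" "e = 1 \<or> e = (-1::real)" "z t0 = e *\<^sub>R (x, 0)" "\<bar>x + a\<bar> < r"
    using landing[OF z0 z0N] by blast
  have "z t0 \<in> orbit" using sub z(4) by blast
  moreover have "snd (z t0) = 0" using t0(3) by simp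
  ultimately obtain e' \<xi> where \<xi>: "e' = 1 \<or> e' = (-1::real)" "z t0 = e' *\<^sub>R (\<xi>, 0)" "\<xi> \<in> closed_segment xs (lift_off xs)"
    using orbit_axis by blast
  obtain t where t: "t 0 = t0" "\<And>n. t n + c \<le> t (Suc n)"
    "\<And>n. z ` {t n..t (Suc n)} = (\<lambda>p. (e' * (-1) ^ n) *\<^sub>R p) ` half_arc ((R ^^ n) \<xi>)"
    using orbit_chain[OF z0 t0(1) \<xi>(1,2) seg_near[OF \<xi>(3)]] by metis
  have R1: "R \<xi> = xs" using seg_lift_off[OF \<xi>(3)] xs_fix by (simp add: R_def)
  have i1: "(\<lambda>p. (- e') *\<^sub>R p) ` half_arc xs \<subseteq> \<Gamma>" using t(3)[of 1] R1 z(4) by auto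
  have i2: "(\<lambda>p. e' *\<^sub>R p) ` half_arc xs \<subseteq> \<Gamma>" using t(3)[of 2] R1 xs_fix z(4) by (auto simp: numeral_2_eq_2)
  have "orbit \<subseteq> \<Gamma>" unfolding orbit_def using i1 i2 \<xi>(1) by auto
  then show ?thesis using sub by blast
qed

end

section \<open>The type of the periodic orbit\<close>

lemma mirror_mirror: "mirror (mirror Z) = Z"
  by (rule ext) (simp add: mirror_def)

lemma tangent_of_uminus: "tangent_of Z (- p) \<longleftrightarrow> tangent_of (mirror Z) p"
  by (auto simp: tangent_of_def mirror_def disc_boundary_def)

lemma tangent_point_uminus: "tangent_point Z (mirror Z) (- p) \<longleftrightarrow> tangent_point Z (mirror Z) p"
  using tangent_of_uminus[of Z p] tangent_of_uminus[of "mirror Z" p]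
  by (auto simp: tangent_point_def mirror_mirror)

lemma normal_product_uminus: "snd (Z (- p)) * snd (mirror Z (- p)) = snd (Z p) * snd (mirror Z p)"
  by (simp add: mirror_def mult.commute)

context half_return begin

lemma normal_product:
  assumes "\<bar>x + a\<bar> < r"
  shows "0 < snd (Z (x, 0)) * snd (mirror Z (x, 0)) \<longleftrightarrow> 0 < s * (x - xT)"
    and "snd (Z (x, 0)) * snd (mirror Z (x, 0)) = 0 \<longleftrightarrow> x = xT"
proof -
  have m: "0 < snd (mirror Z (x, 0))" by (rule g_lower[OF assms])
  consider "0 < s * (x - xT)" "0 < snd (Z (x, 0))" | "s * (x - xT) < 0" "snd (Z (x, 0)) < 0"
    | "x = xT" "snd (Z (x, 0)) = 0"
    using g_pos[OF assms] g_neg[OF assms] g_T s by (cases "s * (x - xT)" "0::real" rule: linorder_cases) auto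
  then have "(0 < snd (Z (x, 0)) * snd (mirror Z (x, 0)) \<longleftrightarrow> 0 < s * (x - xT)) \<and>
    (snd (Z (x, 0)) * snd (mirror Z (x, 0)) = 0 \<longleftrightarrow> x = xT)"
  proof cases
    case 1
    then show ?thesis using mult_pos_pos[OF 1(2) m] by auto
  next
    case 2
    then show ?thesis using mult_neg_pos[OF 2(2) m] by auto
  qed simp
  then show "0 < snd (Z (x, 0)) * snd (mirror Z (x, 0)) \<longleftrightarrow> 0 < s * (x - xT)"
    "snd (Z (x, 0)) * snd (mirror Z (x, 0)) = 0 \<longleftrightarrow> x = xT" by simp_all
qed

text \<open>The product of the two vertical components decides the type of a point of the axis. It is invariant
  under the symmetry, so both sections are covered by the sign \<open>e\<close>.\<close>

lemma sign_cases:
  assumes e: "e = 1 \<or> e = (-1::real)" and x: "\<bar>x + a\<bar> < r"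
  shows crossing_iff: "e *\<^sub>R (x, 0) \<in> crossing_set Z (mirror Z) \<longleftrightarrow> 0 < s * (x - xT)"
    and product_iff: "snd (Z (e *\<^sub>R (x, 0))) * snd (mirror Z (e *\<^sub>R (x, 0))) = 0 \<longleftrightarrow> x = xT"
    and tangent_iff: "tangent_point Z (mirror Z) (e *\<^sub>R (x, 0)) \<longleftrightarrow> x = xT"
proof -
  have pr: "snd (Z (e *\<^sub>R (x, 0))) * snd (mirror Z (e *\<^sub>R (x, 0))) = snd (Z (x, 0)) * snd (mirror Z (x, 0))"
    using e normal_product_uminus[of Z "(x, 0)"] by auto
  show "e *\<^sub>R (x, 0) \<in> crossing_set Z (mirror Z) \<longleftrightarrow> 0 < s * (x - xT)"
    using normal_product(1)[OF x] pr by (simp add: crossing_set_def disc_boundary_def)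
  show "snd (Z (e *\<^sub>R (x, 0))) * snd (mirror Z (e *\<^sub>R (x, 0))) = 0 \<longleftrightarrow> x = xT"
    using normal_product(2)[OF x] pr by simp
  have "Z (xT, 0) \<noteq> 0" using fold_speed c by (auto simp: zero_prod_def)
  then have "tangent_point Z (mirror Z) (x, 0) \<longleftrightarrow> x = xT"
    using g_lower[OF x] g_T normal_product(2)[OF x]
    by (auto simp: tangent_point_def tangent_of_def disc_boundary_def)
  then show "tangent_point Z (mirror Z) (e *\<^sub>R (x, 0)) \<longleftrightarrow> x = xT"
    using e tangent_point_uminus[of Z "(x, 0)"] by auto
qed

lemma orbit_halves: "orbit \<inter> upper_half \<noteq> {}" "orbit \<inter> lower_half \<noteq> {}"
proof -
  note cx = lift_off_near[OF xs_near'] lift_off_side[of xs]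
  define p where "p = u (lift_off xs) (\<tau> (lift_off xs) / 2)"
  have t: "0 < \<tau> (lift_off xs)" using \<tau>[OF cx] c by simp
  have p: "p \<in> half_arc xs" "p \<in> upper_half"
    using t u_upper[OF cx, of "\<tau> (lift_off xs) / 2"] by (auto simp: p_def half_arc_def)
  then have "- p \<in> lower_half" by (simp add: upper_half_def lower_half_def)
  then show "orbit \<inter> upper_half \<noteq> {}" "orbit \<inter> lower_half \<noteq> {}"
    using p by (auto simp: orbit_def)
qed

lemma orbit_axis_sign:
  assumes p: "p \<in> orbit" "snd p = 0"
  obtains e \<xi> where "e = 1 \<or> e = (-1::real)" "p = e *\<^sub>R (\<xi>, 0)" "\<xi> \<in> closed_segment xs (lift_off xs)" "\<bar>\<xi> + a\<bar> < r"
  using orbit_axis[OF p] seg_near by metis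

lemma seg_in_orbit: "\<xi> \<in> closed_segment xs (lift_off xs) \<Longrightarrow> e = 1 \<or> e = (-1::real) \<Longrightarrow> e *\<^sub>R (\<xi>, 0) \<in> orbit"
proof -
  assume "\<xi> \<in> closed_segment xs (lift_off xs)" and e: "e = 1 \<or> e = -1"
  then have h: "(\<xi>, 0) \<in> half_arc xs" by (auto simp: half_arc_def)
  then have "- (\<xi>, 0) \<in> uminus ` half_arc xs" by (rule imageI)
  then have "- (\<xi>, 0) \<in> orbit" "(\<xi>, 0) \<in> orbit" using h unfolding orbit_def by blast+
  then show ?thesis using e by auto
qed

text \<open>If the fixed point is on the crossing side, then \<open>xs - R xT = R xs - R xT\<close> is at most half of
  \<open>xs - xT\<close> in absolute value, so \<open>R xT - xT\<close> and \<open>xs - xT\<close> have the same sign. On the sliding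
  side and at the fold \<open>R\<close> takes the value \<open>R xT = - P xT\<close>.\<close>

lemma beta_sign:
  "0 < s * (xs - xT) \<longleftrightarrow> s * (P xT + xT) < 0"
  "s * (xs - xT) = 0 \<longleftrightarrow> P xT + xT = 0"
  "s * (xs - xT) < 0 \<longleftrightarrow> 0 < s * (P xT + xT)"
proof -
  have s0: "s \<noteq> 0" using s by auto
  have RT: "R xT = - P xT" by (simp add: R_def lift_off_T)
  have le: "s * (P xT + xT) = - (s * (xs - xT))" if "s * (xs - xT) \<le> 0"
  proof -
    have "P xT = - xs" using xs_fix lift_off_T[OF that] by (simp add: R_def)
    then show ?thesis by (simp add: algebra_simps)
  qed
  have gt: "s * (P xT + xT) < 0" if "0 < s * (xs - xT)"
  proof -
    have "\<bar>R xs - R xT\<bar> \<le> \<bar>xs - xT\<bar> / 2" by (rule R_lip[OF xs_near' xT])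
    then have "\<bar>xs + P xT\<bar> \<le> \<bar>xs - xT\<bar> / 2" using RT xs_fix by simp
    then have "s * (xs + P xT) \<le> s * (xs - xT) / 2" using that s by (auto simp: abs_if split: if_splits)
    moreover have "s * (P xT + xT) = s * (xs + P xT) - s * (xs - xT)" by (simp add: algebra_simps)
    ultimately show ?thesis using that by simp
  qed
  have iff0: "P xT + xT = 0 \<longleftrightarrow> s * (P xT + xT) = 0" using s0 by simp
  show "0 < s * (xs - xT) \<longleftrightarrow> s * (P xT + xT) < 0" using le gt by (cases "0 < s * (xs - xT)") auto
  show "s * (xs - xT) = 0 \<longleftrightarrow> P xT + xT = 0" unfolding iff0
    using le gt by (cases "0 < s * (xs - xT)") auto
  show "s * (xs - xT) < 0 \<longleftrightarrow> 0 < s * (P xT + xT)" using le gt by (cases "0 < s * (xs - xT)") auto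
qed

lemma segment_infinite: "p < q \<Longrightarrow> infinite ({p<..<q} \<times> {0::real})" for p q :: real
proof
  assume pq: "p < q" and fin: "finite ({p<..<q} \<times> {0::real})"
  have "finite (fst ` ({p<..<q} \<times> {0::real}))" by (rule finite_imageI[OF fin])
  moreover have "fst ` ({p<..<q} \<times> {0::real}) = {p<..<q}" by force
  ultimately show False using pq infinite_Ioo by metis
qed

lemma cycle_eq_orbit: "cycle Z (mirror Z) \<Gamma> \<Longrightarrow> \<Gamma> \<subseteq> N \<Longrightarrow> \<Gamma> = orbit"
  by (rule periodic_orbit_unique) (simp add: cycle_def)

text \<open>All three families of cycles are decided by inspecting the one periodic orbit.\<close>

lemma cycle_family_eq:
  assumes A: "orbit \<subseteq> A" "A \<subseteq> N" and Q: "\<And>\<Gamma>. Q \<Gamma> \<Longrightarrow> cycle Z (mirror Z) \<Gamma>"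
  shows "{\<Gamma>. Q \<Gamma> \<and> \<Gamma> \<subseteq> A} = (if Q orbit then {orbit} else {})"
proof -
  have "\<Gamma> = orbit" if "Q \<Gamma>" "\<Gamma> \<subseteq> A" for \<Gamma>
    using cycle_eq_orbit[OF Q[OF that(1)]] that(2) A(2) by (meson subset_trans)
  then have *: "\<Gamma> \<in> {\<Gamma>. Q \<Gamma> \<and> \<Gamma> \<subseteq> A} \<longleftrightarrow> \<Gamma> = orbit \<and> Q orbit" for \<Gamma>
    using A(1) by (cases "\<Gamma> = orbit") auto
  show ?thesis by (rule set_eqI, subst *) simp
qed

lemma crossing_cycles_eq: "orbit \<subseteq> A \<Longrightarrow> A \<subseteq> N \<Longrightarrow>
    crossing_cycles Z (mirror Z) A = (if crossing_cycle Z (mirror Z) orbit then {orbit} else {})"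
  unfolding crossing_cycles_def by (rule cycle_family_eq) (simp_all add: crossing_cycle_def)

lemma critical_cycles_eq: "orbit \<subseteq> A \<Longrightarrow> A \<subseteq> N \<Longrightarrow>
    critical_cycles Z (mirror Z) A = (if critical_crossing_cycle Z (mirror Z) orbit then {orbit} else {})"
  unfolding critical_cycles_def by (rule cycle_family_eq) (simp_all add: critical_crossing_cycle_def)

lemma sliding_cycles_eq: "orbit \<subseteq> A \<Longrightarrow> A \<subseteq> N \<Longrightarrow>
    sliding_cycles Z (mirror Z) A = (if sliding_cycle Z (mirror Z) orbit then {orbit} else {})"
  unfolding sliding_cycles_def by (rule cycle_family_eq) (simp_all add: sliding_cycle_def)

lemma orbit_is_cycle:
  assumes A: "open A" "orbit \<subseteq> A" "A \<subseteq> N"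
  shows "cycle Z (mirror Z) orbit"
  unfolding cycle_def
proof (intro conjI exI[of _ A] allI impI)
  fix \<Gamma>' assume "periodic_orbit Z (mirror Z) \<Gamma>' \<and> \<Gamma>' \<subseteq> A"
  then show "\<Gamma>' = orbit" using A(3) by (intro periodic_orbit_unique) auto
qed (use A periodic_orbit_orbit in simp_all)

lemma orbit_axis_crossing:
  assumes "0 \<le> s * (xs - xT)"
  shows "orbit \<inter> disc_boundary = {(xs, 0), - (xs, 0)}"
proof
  show "orbit \<inter> disc_boundary \<subseteq> {(xs, 0), - (xs, 0)}"
  proof
    fix p assume "p \<in> orbit \<inter> disc_boundary"
    then have p: "p \<in> orbit" "snd p = 0" by (auto simp: disc_boundary_def)
    obtain e \<xi> where "e = 1 \<or> e = (-1::real)" "p = e *\<^sub>R (\<xi>, 0)" "\<xi> \<in> closed_segment xs (lift_off xs)"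
      by (rule orbit_axis[OF p])
    then show "p \<in> {(xs, 0), - (xs, 0)}" using lift_off_id[OF assms] by auto
  qed
  show "{(xs, 0), - (xs, 0)} \<subseteq> orbit \<inter> disc_boundary"
    using seg_in_orbit[of xs 1] seg_in_orbit[of xs "-1"] by (auto simp: disc_boundary_def)
qed

text \<open>An orbit that meets the axis in two points contains no segment of it.\<close>

lemma finite_axis_no_sliding:
  assumes "0 \<le> s * (xs - xT)"
  shows "\<not> sliding_cycle Z (mirror Z) orbit"
proof
  assume "sliding_cycle Z (mirror Z) orbit"
  then obtain p q where pq: "p < q" "{p<..<q} \<times> {0} \<subseteq> orbit"
    by (auto simp: sliding_cycle_def sliding_segment_def)
  then have "{p<..<q} \<times> {0} \<subseteq> orbit \<inter> disc_boundary" by (auto simp: disc_boundary_def)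
  then have "finite ({p<..<q} \<times> {0::real})"
    unfolding orbit_axis_crossing[OF assms] by (rule finite_subset) simp
  then show False using segment_infinite[OF pq(1)] by simp
qed

lemma crossing_case:
  assumes A: "open A" "orbit \<subseteq> A" "A \<subseteq> N" and pos: "0 < s * (xs - xT)"
  shows "crossing_cycles Z (mirror Z) A = {orbit}" "critical_cycles Z (mirror Z) A = {}"
    "sliding_cycles Z (mirror Z) A = {}"
proof -
  note ax = orbit_axis_crossing[OF less_imp_le[OF pos]]
  have "orbit \<inter> disc_boundary \<subseteq> crossing_set Z (mirror Z)"
    unfolding ax using crossing_iff[OF _ xs_near', of 1] crossing_iff[OF _ xs_near', of "-1"] pos by auto
  then have "crossing_cycle Z (mirror Z) orbit"
    using orbit_is_cycle[OF A] orbit_halves by (simp add: crossing_cycle_def)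
  then show "crossing_cycles Z (mirror Z) A = {orbit}"
    by (simp add: crossing_cycles_eq[OF A(2,3)])
  have "\<not> tangent_point Z (mirror Z) p" if "p \<in> orbit" for p
  proof
    assume t: "tangent_point Z (mirror Z) p"
    then have "p \<in> orbit \<inter> disc_boundary" using that by (auto simp: tangent_point_def tangent_of_def)
    then show False
      unfolding ax using t tangent_iff[OF _ xs_near', of 1] tangent_iff[OF _ xs_near', of "-1"] pos by auto
  qed
  then have "\<not> critical_crossing_cycle Z (mirror Z) orbit" by (auto simp: critical_crossing_cycle_def)
  then show "critical_cycles Z (mirror Z) A = {}"
    by (simp add: critical_cycles_eq[OF A(2,3)])
  show "sliding_cycles Z (mirror Z) A = {}"
    using finite_axis_no_sliding[OF less_imp_le[OF pos]] by (simp add: sliding_cycles_eq[OF A(2,3)])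
qed

lemma critical_case:
  assumes A: "open A" "orbit \<subseteq> A" "A \<subseteq> N" and zero: "s * (xs - xT) = 0"
  shows "critical_cycles Z (mirror Z) A = {orbit}" "crossing_cycles Z (mirror Z) A = {}"
    "sliding_cycles Z (mirror Z) A = {}" "orbit \<inter> disc_boundary = {(xT, 0), - (xT, 0)}"
proof -
  have xx: "xs = xT" using zero s by auto
  show ax: "orbit \<inter> disc_boundary = {(xT, 0), - (xT, 0)}"
    using orbit_axis_crossing zero xx by simp
  have "\<forall>p\<in>orbit \<inter> disc_boundary. p \<in> crossing_set Z (mirror Z) \<or> snd (Z p) * snd (mirror Z p) = 0"
    unfolding ax using product_iff[OF _ xT, of 1] product_iff[OF _ xT, of "-1"] by auto
  moreover have "tangent_point Z (mirror Z) (xT, 0)" using tangent_iff[OF _ xT, of 1] by simp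
  moreover have T: "(xT, 0) \<in> orbit" using xs_in_orbit xx by simp
  ultimately have "critical_crossing_cycle Z (mirror Z) orbit"
    using orbit_is_cycle[OF A] orbit_halves by (auto simp: critical_crossing_cycle_def)
  then show "critical_cycles Z (mirror Z) A = {orbit}"
    by (simp add: critical_cycles_eq[OF A(2,3)])
  have "(xT, 0) \<notin> crossing_set Z (mirror Z)" using crossing_iff[OF _ xT, of 1] by simp
  then have "\<not> crossing_cycle Z (mirror Z) orbit"
    using T by (auto simp: crossing_cycle_def disc_boundary_def)
  then show "crossing_cycles Z (mirror Z) A = {}"
    by (simp add: crossing_cycles_eq[OF A(2,3)])
  show "sliding_cycles Z (mirror Z) A = {}"
    using finite_axis_no_sliding zero by (simp add: sliding_cycles_eq[OF A(2,3)])
qed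

text \<open>Beyond the fold the orbit does not meet the axis, so a point of an open segment of the axis that is
  contained in the orbit is never a fold.\<close>

lemma orbit_segment_strict:
  assumes neg: "s * (xs - xT) < 0" and pq: "{p<..<q} \<times> {0} \<subseteq> orbit" and y: "p < y" "y < q"
  obtains e \<xi> where "e = 1 \<or> e = (-1::real)" "y = e * \<xi>" "\<bar>\<xi> + a\<bar> < r" "s * (\<xi> - xT) < 0"
proof -
  have cT: "lift_off xs = xT" using neg by (intro lift_off_T) simp
  have seg: "s * (\<xi> - xT) \<le> 0" if "\<xi> \<in> closed_segment xs xT" for \<xi>
    using that neg s by (auto simp: closed_segment_eq_real_ivl split: if_splits)
  have xTneg: "xT < 0" using xT r by linarith
  have "(y, 0) \<in> orbit" using pq y by auto
  then obtain e \<xi> where e: "e = 1 \<or> e = (-1::real)" "(y, 0) = e *\<^sub>R (\<xi>, 0::real)" "\<xi> \<in> closed_segment xs xT" "\<bar>\<xi> + a\<bar> < r"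
    using orbit_axis_sign[of "(y, 0)"] cT by auto
  have "\<xi> \<noteq> xT"
  proof
    assume xx: "\<xi> = xT"
    define h where "h = min (- xT) (min (y - p) (q - y)) / 2"
    have h: "0 < h" "h < - xT" "h < y - p" "h < q - y" using xTneg y by (auto simp: h_def)
    define y' where "y' = e * (xT + s * h)"
    have "y' = y + e * s * h" using e(2) xx by (simp add: y'_def algebra_simps)
    then have "p < y'" "y' < q" using h e(1) s by auto
    then have "(y', 0) \<in> orbit" using pq by auto
    then obtain e' \<xi>' where e': "e' = 1 \<or> e' = (-1::real)" "(y', 0) = e' *\<^sub>R (\<xi>', 0::real)"
      "\<xi>' \<in> closed_segment xs xT" "\<bar>\<xi>' + a\<bar> < r"
      using orbit_axis_sign[of "(y', 0)"] cT by auto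
    have eq: "e * (xT + s * h) = e' * \<xi>'" using e'(2) by (simp add: y'_def)
    have n: "\<xi>' < 0" "xT + s * h < 0" using e'(4) r h s by auto
    then have "e = e'" using eq e(1) e'(1) by auto
    then have "\<xi>' = xT + s * h" using eq e(1) by auto
    then have "s * (\<xi>' - xT) = h" by (simp add: s_sq)
    then show False using seg[OF e'(3)] h by simp
  qed
  then have "s * (\<xi> - xT) < 0" using seg[OF e(3)] s by auto
  then show thesis using that[OF e(1) _ e(4)] e(2) by simp
qed

lemma sliding_case:
  assumes A: "open A" "orbit \<subseteq> A" "A \<subseteq> N" and neg: "s * (xs - xT) < 0"
  shows "sliding_cycles Z (mirror Z) A = {orbit}" "crossing_cycles Z (mirror Z) A = {}"
    "critical_cycles Z (mirror Z) A = {}" "stable_sliding_cycle Z (mirror Z) orbit"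
    "slides_on Z (mirror Z) orbit (left_part A)" "slides_on Z (mirror Z) orbit (right_part A)"
proof -
  have cT: "lift_off xs = xT" using neg by (intro lift_off_T) simp
  have not_crossing: "(xs, 0) \<notin> crossing_set Z (mirror Z)" using crossing_iff[OF _ xs_near', of 1] neg by simp
  have nonzero: "snd (Z (xs, 0)) * snd (mirror Z (xs, 0)) \<noteq> 0"
    using product_iff[OF _ xs_near', of 1] neg by auto
  have xsA: "(xs, 0) \<in> orbit \<inter> disc_boundary" using xs_in_orbit by (simp add: disc_boundary_def)
  have "\<not> crossing_cycle Z (mirror Z) orbit" using not_crossing xsA by (auto simp: crossing_cycle_def)
  then show "crossing_cycles Z (mirror Z) A = {}"
    by (simp add: crossing_cycles_eq[OF A(2,3)])
  have "\<not> critical_crossing_cycle Z (mirror Z) orbit"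
    using not_crossing nonzero xsA unfolding critical_crossing_cycle_def by blast
  then show "critical_cycles Z (mirror Z) A = {}"
    by (simp add: critical_cycles_eq[OF A(2,3)])
  define l m where "l = min xs xT" and "m = max xs xT"
  have "xs \<noteq> xT" using neg by auto
  then have lm: "l < m" by (auto simp: l_def m_def min_def max_def)
  have seg: "\<xi> \<in> closed_segment xs xT" if "\<xi> \<in> {l<..<m}" for \<xi>
    using that by (auto simp: l_def m_def closed_segment_eq_real_ivl)
  have side: "s * (\<xi> - xT) < 0" "\<bar>\<xi> + a\<bar> < r" if "\<xi> \<in> {l<..<m}" for \<xi>
    using that neg s xs_near' xT by (auto simp: l_def m_def)
  have inL: "{l<..<m} \<times> {0} \<subseteq> orbit \<inter> left_part A"
  proof
    fix p :: plane assume "p \<in> {l<..<m} \<times> {0}"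
    then obtain \<xi> where \<xi>: "\<xi> \<in> {l<..<m}" "p = (\<xi>, 0)" by auto
    have "p \<in> orbit" using seg_in_orbit[of \<xi> 1] seg[OF \<xi>(1)] cT \<xi>(2) by simp
    moreover have "\<xi> < 0" using side(2)[OF \<xi>(1)] r by linarith
    ultimately show "p \<in> orbit \<inter> left_part A" using A \<xi>(2) by (auto simp: left_part_def disc_boundary_def)
  qed
  have slL: "{l<..<m} \<times> {0} \<subseteq> sliding_set Z (mirror Z)"
    using in_sliding_set side by force
  have segL: "sliding_segment Z (mirror Z) ({l<..<m} \<times> {0})"
    unfolding sliding_segment_def using lm slL by blast
  show "slides_on Z (mirror Z) orbit (left_part A)"
    unfolding slides_on_def using segL inL by blast
  have neg_seg: "uminus ` ({l<..<m} \<times> {0}) = {- m<..<- l} \<times> {0::real}"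
  proof
    show "{- m<..<- l} \<times> {0::real} \<subseteq> uminus ` ({l<..<m} \<times> {0})"
    proof
      fix p :: plane assume "p \<in> {- m<..<- l} \<times> {0}"
      then show "p \<in> uminus ` ({l<..<m} \<times> {0})" by (intro image_eqI[of _ _ "- p"]) auto
    qed
  qed auto
  have slneg: "- p \<in> sliding_set Z (mirror Z)" if "p \<in> sliding_set Z (mirror Z)" for p
    using that normal_product_uminus[of Z p] by (simp add: sliding_set_def disc_boundary_def)
  have "{- m<..<- l} \<times> {0} \<subseteq> sliding_set Z (mirror Z)"
    unfolding neg_seg[symmetric] using slL slneg by blast
  then have "sliding_segment Z (mirror Z) ({- m<..<- l} \<times> {0})"
    unfolding sliding_segment_def using lm by (intro conjI exI[of _ "- m"] exI[of _ "- l"]) auto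
  moreover have "{- m<..<- l} \<times> {0} \<subseteq> orbit \<inter> right_part A"
    unfolding neg_seg[symmetric]
  proof (rule image_subsetI)
    fix p :: plane assume "p \<in> {l<..<m} \<times> {0}"
    then have p: "p \<in> orbit" "fst p < 0" "snd p = 0" using inL by (auto simp: left_part_def)
    have "- p \<in> orbit" using p(1) orbit_uminus by blast
    then show "- p \<in> orbit \<inter> right_part A" using p A by (auto simp: right_part_def disc_boundary_def)
  qed
  ultimately show "slides_on Z (mirror Z) orbit (right_part A)" unfolding slides_on_def by blast
  have "(xT, 0) \<in> orbit" using seg_in_orbit[of xT 1] cT by simp
  moreover have "tangent_point Z (mirror Z) (xT, 0)" using tangent_iff[OF _ xT, of 1] by simp
  ultimately have sc: "sliding_cycle Z (mirror Z) orbit"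
    unfolding sliding_cycle_def using orbit_is_cycle[OF A] segL inL by blast
  then show "sliding_cycles Z (mirror Z) A = {orbit}"
    by (simp add: sliding_cycles_eq[OF A(2,3)])
  have "stable_sliding Z (mirror Z) p" if I: "I \<subseteq> orbit" "sliding_segment Z (mirror Z) I" "p \<in> I" for I p
  proof -
    obtain b d y where b: "I = {b<..<d} \<times> {0}" "p = (y, 0)" "b < y" "y < d"
      using I(2,3) by (auto simp: sliding_segment_def)
    obtain e \<xi> where e: "e = 1 \<or> e = (-1::real)" "y = e * \<xi>" "\<bar>\<xi> + a\<bar> < r" "s * (\<xi> - xT) < 0"
      using orbit_segment_strict[OF neg _ b(3,4)] I(1) b(1) by blast
    have "snd (Z (\<xi>, 0)) < 0" "0 < snd (mirror Z (\<xi>, 0))" using g_neg[OF e(3,4)] g_lower[OF e(3)] by auto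
    then show ?thesis using e(1,2) b(2) by (auto simp: stable_sliding_def disc_boundary_def mirror_def)
  qed
  then show "stable_sliding_cycle Z (mirror Z) orbit"
    unfolding stable_sliding_cycle_def using sc by blast
qed

lemma attracts:
  assumes A: "open A" "orbit \<subseteq> A" "A \<subseteq> N"
  shows "attracts_from Z (mirror Z) S orbit"
  unfolding attracts_from_def
proof (intro exI[of _ A] conjI ballI allI impI)
  fix q assume "q \<in> A \<inter> S"
  then have q: "q \<in> N" using A by blast
  show "\<exists>z. sol {0..} z \<and> z 0 = q" by (rule forward_exists[OF q])
  show "((\<lambda>t. infdist (z t) orbit) \<longlongrightarrow> 0) at_top" if "sol {0..} z \<and> z 0 = q" for z
    using attracted[of z] that q by simp
qed (use A in auto)

text \<open>The full return map is the square of \<open>R\<close>, whose multiplier is at most \<open>1/4\<close> in absolute value. The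
  radius of the section is chosen so that it stays on the crossing side and on the left of the
  origin.\<close>

lemma crossing_hyperbolic:
  assumes pos: "0 < s * (xs - xT)"
  shows "hyperbolically_stable Z (mirror Z) orbit"
proof -
  define \<delta> where "\<delta> = min (s * (xs - xT)) (min (r - \<bar>xs + a\<bar>) (- xs))"
  have \<delta>: "0 < \<delta>" "\<delta> \<le> s * (xs - xT)" "\<delta> \<le> r - \<bar>xs + a\<bar>" "\<delta> \<le> - xs"
    using pos xs_near' xs_neg by (auto simp: \<delta>_def)
  have near: "\<bar>x + a\<bar> < r" "0 < s * (x - xT)" "x < 0" if "\<bar>x - xs\<bar> < \<delta>" for x
    using that \<delta> s by auto
  have Rd: "\<bar>R x - xs\<bar> \<le> \<bar>x - xs\<bar> / 2" if "\<bar>x - xs\<bar> < \<delta>" for x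
    using R_lip[OF near(1)[OF that] xs_near'] xs_fix by simp
  have Req: "R x = - P x" if "\<bar>x - xs\<bar> < \<delta>" for x
    using lift_off_id[of x] near[OF that] by (simp add: R_def)
  have frm: "first_return_map Z (mirror Z) xs \<delta> (R \<circ> R)"
    unfolding first_return_map_def
  proof (intro allI impI conjI)
    fix x assume x: "\<bar>x - xs\<bar> < \<delta>"
    define y where "y = R x"
    have y: "\<bar>y - xs\<bar> < \<delta>" using Rd[OF x] x \<delta> by (simp add: y_def)
    show "\<bar>(R \<circ> R) x - xs\<bar> < \<delta>" using Rd[OF y] y \<delta> by (simp add: y_def)
    note nx = near(1)[OF x] less_imp_le[OF near(2)[OF x]]
    note ny = near(1)[OF y] less_imp_le[OF near(2)[OF y]]
    have tx: "0 < \<tau> x" "0 < \<tau> y" using \<tau>[OF nx] \<tau>[OF ny] c by auto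
    define z where "z t = (if t \<le> \<tau> x then u x t else - u y (t - \<tau> x))" for t
    have "sol {0..\<tau> x + \<tau> y} z"
      unfolding z_def
      using crossing_solution[OF nx] filippov_solution_mirror[OF crossing_solution[OF ny]] tx
        u_end[OF nx] u_start[OF ny] Req[OF x]
      by (intro filippov_solution_join) (auto simp: y_def)
    moreover have "z 0 = (x, 0)" using u_start[OF nx] tx by (simp add: z_def)
    moreover have "z (\<tau> x + \<tau> y) = ((R \<circ> R) x, 0)"
      using u_end[OF ny] Req[OF y] tx by (simp add: z_def y_def)
    moreover have "\<not> (snd (z t) = 0 \<and> \<bar>fst (z t) - xs\<bar> < \<delta>)" if t: "t \<in> {0<..<\<tau> x + \<tau> y}" for t
    proof (cases t "\<tau> x" rule: linorder_cases)
      case less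
      then show ?thesis using u_upper[OF nx, of t] t by (auto simp: z_def upper_half_def)
    next
      case equal
      then have "fst (z t) = - y" using u_end[OF nx] Req[OF x] by (simp add: z_def y_def)
      moreover have "- y > 0" using near(3)[OF y] by simp
      ultimately show ?thesis using \<delta>(4) by auto
    next
      case greater
      then show ?thesis using u_upper[OF ny, of "t - \<tau> x"] t by (auto simp: z_def upper_half_def)
    qed
    ultimately show "\<exists>z t. t > 0 \<and> sol {0..t} z \<and> z 0 = (x, 0) \<and> z t = ((R \<circ> R) x, 0) \<and>
        (\<forall>sa\<in>{0<..<t}. \<not> (snd (z sa) = 0 \<and> \<bar>fst (z sa) - xs\<bar> < \<delta>))"
      using tx by (intro exI[of _ z] exI[of _ "\<tau> x + \<tau> y"]) auto
  qed
  obtain D where D: "(P has_real_derivative D) (at xs)" "\<bar>D\<bar> \<le> 1/2"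
    using P_deriv[OF xs_near' pos] by blast
  have "((\<lambda>x. - P x) has_real_derivative - D) (at xs)" using D(1) by (rule DERIV_minus)
  then have dR: "(R has_real_derivative - D) (at xs)"
    by (rule has_field_derivative_transform_within_open[of _ _ _ "ball xs \<delta>"])
      (use \<delta> Req in \<open>auto simp: dist_real_def abs_minus_commute\<close>)
  then have "(R has_real_derivative - D) (at (R xs))" using xs_fix by simp
  from DERIV_chain[OF this dR] have "(R \<circ> R has_real_derivative - D * - D) (at xs)" .
  moreover have "\<bar>- D * - D\<bar> < 1"
  proof -
    have "\<bar>D\<bar> * \<bar>D\<bar> \<le> 1/2 * (1/2)" using D(2) by (intro mult_mono) auto
    then show ?thesis by (simp add: abs_mult)
  qed
  moreover have "(xs, 0) \<in> crossing_set Z (mirror Z)" using crossing_iff[OF _ xs_near', of 1] pos by simp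
  ultimately show ?thesis
    unfolding hyperbolically_stable_def using frm \<delta>(1) xs_in_orbit xs_fix
    by (intro exI[of _ xs] exI[of _ \<delta>] exI[of _ "R \<circ> R"] exI[of _ "- D * - D"]) auto
qed

text \<open>For \<open>s = 1\<close> the fold lies to the left of the fixed point. The ray of the axis from it to infinity
  misses the orbit, which meets the axis only at the two crossing points.\<close>

lemma ray_not_inside:
  assumes s1: "s = 1" and pos: "0 < s * (xs - xT)"
  shows "(xT, 0) \<notin> inside orbit" "- (xT, 0) \<notin> inside orbit"
proof -
  have ax: "orbit \<inter> disc_boundary = {(xs, 0), - (xs, 0)}"
    by (rule orbit_axis_crossing) (use pos in simp)
  have lt: "xT < xs" using s1 pos by simp
  have "e *\<^sub>R (xT, 0) \<notin> inside orbit" if e: "e = 1 \<or> e = (-1::real)" for e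
  proof
    assume ins: "e *\<^sub>R (xT, 0) \<in> inside orbit"
    \<comment> \<open>The ray starts at the fold and points away from the origin.\<close>
    define K where "K = (\<lambda>t. (e * (xT - t), 0::real)) ` {0..}"
    have "connected K" unfolding K_def
      by (intro connected_continuous_image continuous_intros) (simp add: convex_connected)
    moreover have "K \<subseteq> - orbit"
    proof
      fix p assume "p \<in> K"
      then obtain t where t: "0 \<le> t" "p = (e * (xT - t), 0)" by (auto simp: K_def)
      have "p \<noteq> (xs, 0)" "p \<noteq> - (xs, 0)" using t e lt xs_neg by auto
      moreover have "p \<in> disc_boundary" using t by (simp add: disc_boundary_def)
      ultimately show "p \<in> - orbit" using ax by blast
    qed
    moreover have "e *\<^sub>R (xT, 0) \<in> K" unfolding K_def by (rule image_eqI[of _ _ 0]) auto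
    ultimately have "K \<subseteq> connected_component_set (- orbit) (e *\<^sub>R (xT, 0))"
      by (intro connected_component_maximal)
    moreover have "bounded (connected_component_set (- orbit) (e *\<^sub>R (xT, 0)))"
      using ins by (simp add: inside_def)
    ultimately have "bounded K" using bounded_subset by blast
    then obtain B where B: "\<And>p. p \<in> K \<Longrightarrow> norm p \<le> B" by (auto simp: bounded_iff)
    define t where "t = \<bar>B\<bar> + 1"
    have "norm (e * (xT - t), 0::real) \<le> B" unfolding K_def
      by (rule B[unfolded K_def], rule image_eqI[of _ _ t]) (simp_all add: t_def)
    then have "\<bar>xT - t\<bar> \<le> B" using e by (auto simp: norm_Pair)
    moreover have "xT < 0" using lt xs_neg by simp
    ultimately show False by (simp add: t_def)
  qed
  from this[of 1] this[of "-1"] show "(xT, 0) \<notin> inside orbit" "- (xT, 0) \<notin> inside orbit" by simp_all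
qed

lemma cycles_pos_holds:
  assumes s1: "s = 1" and A: "open A" "orbit \<subseteq> A" "A \<subseteq> N"
  shows "cycles_pos Z (mirror Z) A (xT, 0) (P xT + xT)"
  unfolding cycles_pos_def
proof (intro conjI impI)
  assume "P xT + xT < 0"
  then have pos: "0 < s * (xs - xT)" using beta_sign s1 by simp
  show "\<exists>\<Gamma>. crossing_cycles Z (mirror Z) A = {\<Gamma>} \<and> hyperbolically_stable Z (mirror Z) \<Gamma> \<and>
      (xT, 0) \<notin> inside \<Gamma> \<and> - (xT, 0) \<notin> inside \<Gamma>"
    using crossing_case[OF A pos] crossing_hyperbolic[OF pos] ray_not_inside[OF s1 pos] by blast
  show "critical_cycles Z (mirror Z) A = {}" "sliding_cycles Z (mirror Z) A = {}"
    using crossing_case[OF A pos] by auto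
next
  assume "P xT + xT = 0"
  then have zero: "s * (xs - xT) = 0" using beta_sign by blast
  show "\<exists>\<Gamma>. critical_cycles Z (mirror Z) A = {\<Gamma>} \<and> \<Gamma> \<inter> disc_boundary = {(xT, 0), - (xT, 0)} \<and>
      internally_stable Z (mirror Z) \<Gamma>"
    using critical_case[OF A zero] attracts[OF A] unfolding internally_stable_def by blast
  show "crossing_cycles Z (mirror Z) A = {}" "sliding_cycles Z (mirror Z) A = {}"
    using critical_case[OF A zero] by auto
next
  assume "0 < P xT + xT"
  then have neg: "s * (xs - xT) < 0" using beta_sign s1 by simp
  show "\<exists>\<Gamma>. sliding_cycles Z (mirror Z) A = {\<Gamma>} \<and> stable_sliding_cycle Z (mirror Z) \<Gamma> \<and>
      slides_on Z (mirror Z) \<Gamma> (left_part A) \<and> slides_on Z (mirror Z) \<Gamma> (right_part A)"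
    using sliding_case[OF A neg] by blast
  show "crossing_cycles Z (mirror Z) A = {}" "critical_cycles Z (mirror Z) A = {}"
    using sliding_case[OF A neg] by auto
qed

lemma cycles_neg_if_inside:
  assumes s1: "s = -1" and A: "open A" "orbit \<subseteq> A" "A \<subseteq> N"
    and ins: "0 < s * (xs - xT) \<Longrightarrow> (xT, 0) \<in> inside orbit \<and> - (xT, 0) \<in> inside orbit"
  shows "cycles_neg Z (mirror Z) A (xT, 0) (P xT + xT)"
  unfolding cycles_neg_def
proof (intro conjI impI)
  assume "0 < P xT + xT"
  then have pos: "0 < s * (xs - xT)" using beta_sign s1 by simp
  show "\<exists>\<Gamma>. crossing_cycles Z (mirror Z) A = {\<Gamma>} \<and> hyperbolically_stable Z (mirror Z) \<Gamma> \<and>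
      (xT, 0) \<in> inside \<Gamma> \<and> - (xT, 0) \<in> inside \<Gamma>"
    using crossing_case[OF A pos] crossing_hyperbolic[OF pos] ins[OF pos] by blast
  show "critical_cycles Z (mirror Z) A = {}" "sliding_cycles Z (mirror Z) A = {}"
    using crossing_case[OF A pos] by auto
next
  assume "P xT + xT = 0"
  then have zero: "s * (xs - xT) = 0" using beta_sign by blast
  show "\<exists>\<Gamma>. critical_cycles Z (mirror Z) A = {\<Gamma>} \<and> \<Gamma> \<inter> disc_boundary = {(xT, 0), - (xT, 0)} \<and>
      externally_stable Z (mirror Z) \<Gamma>"
    using critical_case[OF A zero] attracts[OF A] unfolding externally_stable_def by blast
  show "crossing_cycles Z (mirror Z) A = {}" "sliding_cycles Z (mirror Z) A = {}"
    using critical_case[OF A zero] by auto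
next
  assume "P xT + xT < 0"
  then have neg: "s * (xs - xT) < 0" using beta_sign s1 by simp
  show "\<exists>\<Gamma>. sliding_cycles Z (mirror Z) A = {\<Gamma>} \<and> stable_sliding_cycle Z (mirror Z) \<Gamma> \<and>
      slides_on Z (mirror Z) \<Gamma> (left_part A) \<and> slides_on Z (mirror Z) \<Gamma> (right_part A)"
    using sliding_case[OF A neg] by blast
  show "crossing_cycles Z (mirror Z) A = {}" "critical_cycles Z (mirror Z) A = {}"
    using sliding_case[OF A neg] by auto
qed

end

section \<open>The interior of a crossing cycle\<close>

text \<open>A branch of the logarithm cut along the negative imaginary direction from \<open>q\<close> is a primitive along
  the whole path, end points included, so the real part of the winding number of the open path is
  the increment of the argument, from \<open>\<pi>\<close> down to \<open>0\<close>, divided by \<open>2 \<pi>\<close>.\<close>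

lemma winding_upper_path:
  fixes b d q :: real
  assumes p: "valid_path p" and ends: "pathstart p = of_real b" "pathfinish p = of_real d" "b < q" "q < d"
    and up: "\<And>t. 0 < t \<Longrightarrow> t < 1 \<Longrightarrow> 0 < Im (p t)"
  shows "Re (winding_number p (of_real q)) = - 1/2" and "of_real q \<notin> path_image p"
proof -
  define S where "S = {w. 0 \<le> Im w} - {complex_of_real q}"
  have im: "path_image p \<subseteq> S"
  proof
    fix w assume "w \<in> path_image p"
    then obtain t where t: "t \<in> {0..1}" "w = p t" by (auto simp: path_image_def)
    consider "t = 0" | "t = 1" | "0 < t" "t < 1" using t by fastforce
    then show "w \<in> S"
    proof cases
      case 1 then show ?thesis using ends t by (auto simp: S_def pathstart_def)
    next
      case 2 then show ?thesis using ends t by (auto simp: S_def pathfinish_def)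
    next
      case 3 then show ?thesis using up[OF 3] t by (auto simp: S_def complex_eq_iff)
    qed
  qed
  then show nin: "of_real q \<notin> path_image p" by (auto simp: S_def)
  \<comment> \<open>The rotation by \<open>- \<i>\<close> turns the cut of \<open>Ln\<close> away from the closed upper half plane.\<close>
  define F where "F w = Ln (- \<i> * (w - of_real q))" for w
  have "(F has_field_derivative 1 / (w - of_real q)) (at w within S)" if w: "w \<in> S" for w
  proof -
    have "- \<i> * (w - of_real q) \<notin> \<real>\<^sub>\<le>\<^sub>0"
      using w by (auto simp: S_def complex_nonpos_Reals_iff complex_eq_iff)
    moreover have "w - of_real q \<noteq> 0" using w by (auto simp: S_def)
    ultimately show ?thesis
      unfolding F_def by (auto intro!: derivative_eq_intros simp: field_simps)
  qed
  from contour_integral_primitive[OF this p im]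
  have "contour_integral p (\<lambda>w. 1 / (w - of_real q)) = F (of_real d) - F (of_real b)"
    using ends contour_integral_unique by metis
  moreover have "Im (F (of_real d)) = - pi / 2"
  proof -
    have "F (of_real d) = Ln (- (\<i> * of_real (d - q)))" by (simp add: F_def)
    also have "Im \<dots> = - pi / 2"
      using ends by (intro Im_Ln_eq[THEN trans] ) (simp_all add: Im_Ln_eq)
    finally show ?thesis .
  qed
  moreover have "Im (F (of_real b)) = pi / 2"
  proof -
    have "F (of_real b) = Ln (\<i> * of_real (q - b))" by (simp add: F_def algebra_simps)
    also have "Im \<dots> = pi / 2" using ends by (simp add: Im_Ln_eq)
    finally show ?thesis .
  qed
  ultimately have "Im (contour_integral p (\<lambda>w. 1 / (w - of_real q))) = - pi" by simp
  then show "Re (winding_number p (of_real q)) = - 1/2"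
    using Re_winding_number[OF p nin] by simp
qed

lemma winding_number_uminus_path:
  assumes p: "valid_path p" and q: "- q \<notin> path_image p"
  shows "winding_number (\<lambda>t. - p t) q = winding_number p (- q)"
proof -
  define g where "g t = p t + q" for t
  have vg: "valid_path g"
    using valid_path_offset[of p "- q"] p by (simp add: g_def[abs_def])
  have "winding_number (\<lambda>t. - p t) q = winding_number (\<lambda>t. - p t - q) 0" by (rule winding_number_offset)
  also have "(\<lambda>t. - p t - q) = uminus \<circ> g" by (auto simp: g_def)
  also have "winding_number (uminus \<circ> g) 0 = winding_number g 0"
  proof (rule winding_number_negatepath[OF vg])
    show "0 \<notin> path_image g"
    proof
      assume "0 \<in> path_image g"
      then obtain t where t: "t \<in> {0..1}" "p t + q = 0" by (auto simp: path_image_def g_def)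
      then have "p t = - q" by (simp add: eq_neg_iff_add_eq_0)
      moreover have "p t \<in> path_image p" using t(1) unfolding path_image_def by (rule imageI)
      ultimately show False using q by metis
    qed
  qed
  also have "g = (\<lambda>t. p t - (- q))" by (auto simp: g_def)
  also have "winding_number (\<lambda>t. p t - (- q)) 0 = winding_number p (- q)" by (rule winding_number_offset[symmetric])
  finally show ?thesis .
qed

context half_return begin

text \<open>The upper half of the orbit has winding number with real part \<open>- 1/2\<close> around every point of the axis
  between the crossing points, and by symmetry so has the lower half. A point outside would have
  winding number zero.\<close>

lemma inside_orbit:
  assumes pos: "0 < s * (xs - xT)" and q: "xs < q" "q < - xs"
  shows "(q, 0) \<in> inside orbit"
proof (rule ccontr)
  assume nins: "(q, 0) \<notin> inside orbit"
  have lx: "lift_off xs = xs" using pos by (intro lift_off_id) simp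
  note cx = xs_near' less_imp_le[OF pos]
  define T where "T = \<tau> xs"
  have T: "0 < T" using \<tau>[OF cx] c by (simp add: T_def)
  define j where "j w = Complex (fst w) (snd w)" for w :: plane
  have jlin: "bounded_linear j"
  proof (rule bounded_linear_intro[where K = 1])
    show "norm (j w) \<le> norm w * 1" for w by (simp add: j_def norm_prod_def cmod_def)
  qed (simp_all add: j_def complex_eq_iff)
  have jcont: "continuous_on A j" for A using linear_continuous_on[OF jlin] .
  have jnorm: "norm (j w) = norm w" for w by (simp add: j_def norm_prod_def cmod_def)
  define p where "p t = j (u xs (t * T))" for t
  have duT: "(u xs has_vector_derivative Z (u xs t)) (at t)" if "0 < t" "t < T" for t
    using u_deriv[OF cx, of t] that by (simp add: at_within_Icc_at T_def)
  have contu: "continuous_on {0..T} (u xs)"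
    using u_deriv[OF cx] has_vector_derivative_continuous continuous_on_eq_continuous_within
    unfolding T_def by blast
  have contp: "continuous_on {0..1} p"
    unfolding p_def using T
    by (intro continuous_on_compose2[OF jcont[of UNIV]] continuous_on_compose2[OF contu] continuous_intros)
      (auto simp: mult_left_le_one_le)
  have dp: "(p has_vector_derivative j (T *\<^sub>R Z (u xs (t * T)))) (at t)" if t: "0 < t" "t < 1" for t
  proof -
    have "((\<lambda>t. t * T) has_vector_derivative T) (at t)" by (auto intro!: derivative_eq_intros)
    moreover have "(u xs has_vector_derivative Z (u xs (t * T))) (at (t * T))"
      using t T by (intro duT) auto
    ultimately have "((u xs \<circ> (\<lambda>t. t * T)) has_vector_derivative T *\<^sub>R Z (u xs (t * T))) (at t)"
      by (rule vector_diff_chain_at)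
    from bounded_linear.has_vector_derivative[OF jlin this] show ?thesis by (simp add: p_def[abs_def] o_def)
  qed
  have vp: "valid_path p"
    unfolding valid_path_def piecewise_C1_differentiable_on_def C1_differentiable_on_def
  proof (intro conjI exI[of _ "{0, 1}"] exI[of _ "\<lambda>t. j (T *\<^sub>R Z (u xs (t * T)))"])
    show "\<forall>t\<in>{0..1} - {0, 1}. (p has_vector_derivative j (T *\<^sub>R Z (u xs (t * T)))) (at t)"
      using dp by auto
    have "continuous_on {0..1} (\<lambda>t. j (T *\<^sub>R Z (u xs (t * T))))"
      using T
      by (intro continuous_on_compose2[OF jcont[of UNIV]] continuous_on_scaleR continuous_on_const
          continuous_on_compose2[OF Z_cont] continuous_on_compose2[OF contu] continuous_intros)
        (auto simp: mult_left_le_one_le)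
    then show "continuous_on ({0..1} - {0, 1}) (\<lambda>t. j (T *\<^sub>R Z (u xs (t * T))))"
      by (rule continuous_on_subset) auto
  qed (use contp in auto)
  have Pxs: "P xs = - xs" using xs_fix lx by (simp add: R_def)
  have p0: "pathstart p = of_real xs" using u_start[OF cx] by (simp add: pathstart_def p_def j_def complex_eq_iff)
  have p1: "pathfinish p = of_real (- xs)"
    using u_end[OF cx] Pxs by (simp add: pathfinish_def p_def j_def complex_eq_iff T_def)
  have pup: "0 < Im (p t)" if "0 < t" "t < 1" for t
    using u_upper[OF cx, of "t * T"] that T by (simp add: p_def j_def upper_half_def T_def)
  define m where "m t = - p t" for t
  have vm: "valid_path m"
  proof -
    have "(\<lambda>t. - p t) piecewise_C1_differentiable_on {0..1}"
      using vp unfolding valid_path_def by (rule piecewise_C1_differentiable_neg)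
    then show ?thesis by (simp add: valid_path_def m_def[abs_def])
  qed
  have w1: "Re (winding_number p (of_real q)) = - 1/2" "of_real q \<notin> path_image p"
    using winding_upper_path[OF vp p0 p1 q pup] by auto
  have w2: "Re (winding_number p (of_real (- q))) = - 1/2" "of_real (- q) \<notin> path_image p"
    using winding_upper_path[OF vp p0 p1 _ _ pup, of "- q"] q by auto
  have wm: "winding_number m (of_real q) = winding_number p (of_real (- q))"
    using winding_number_uminus_path[OF vp, of "of_real q"] w2(2) by (simp add: m_def[abs_def])
  have nm: "of_real q \<notin> path_image m"
    using w2(2) by (auto simp: path_image_def m_def)
  have join: "pathfinish p = pathstart m" using p0 p1 by (simp add: pathstart_def m_def)
  have loop: "pathfinish (p +++ m) = pathstart (p +++ m)"
    using p0 p1 by (simp add: pathfinish_def[of m] m_def pathfinish_def[of p, symmetric])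
  have pth: "path (p +++ m)" using vp vm join by (simp add: valid_path_imp_path)
  have "winding_number (p +++ m) (of_real q) = winding_number p (of_real q) + winding_number m (of_real q)"
    using vp vm join w1 nm by (intro winding_number_join) (auto simp: valid_path_imp_path)
  then have "Re (winding_number (p +++ m) (of_real q)) = - 1" using w1 w2 wm by simp
  then have "winding_number (p +++ m) (of_real q) \<noteq> 0" by auto
  then have nout: "of_real q \<notin> outside (path_image (p +++ m))"
    using winding_number_zero_in_outside[OF pth loop] by blast
  have harc: "half_arc xs = u xs ` {0..T}"
    using lx u_start[OF cx] T by (force simp: half_arc_def T_def intro: image_eqI[of _ _ 0])
  have "path_image p = j ` half_arc xs"
  proof -
    have "(\<lambda>t. t * T) ` {0..1} = {0..T}" 
    proof
      show "{0..T} \<subseteq> (\<lambda>t. t * T) ` {0..1}"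
      proof
        fix y assume "y \<in> {0..T}"
        then show "y \<in> (\<lambda>t. t * T) ` {0..1}" using T by (intro image_eqI[of _ _ "y / T"]) auto
      qed
    qed (use T in \<open>auto simp: mult_left_le_one_le\<close>)
    then show ?thesis unfolding harc path_image_def p_def by (metis image_image)
  qed
  moreover have "path_image m = j ` uminus ` half_arc xs"
  proof -
    have "path_image m = uminus ` path_image p" by (auto simp: path_image_def m_def)
    also have "\<dots> = j ` uminus ` half_arc xs"
      unfolding \<open>path_image p = j ` half_arc xs\<close> image_image
      by (intro image_cong) (auto simp: j_def complex_eq_iff)
    finally show ?thesis .
  qed
  ultimately have img: "path_image (p +++ m) = j ` orbit"
    using join by (simp add: path_image_join orbit_def image_Un)
  have jq: "j (q, 0) = of_real q" by (simp add: j_def complex_eq_iff)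
  have inj: "inj j" by (auto simp: inj_def j_def prod_eq_iff)
  have qn: "(q, 0) \<notin> orbit"
    using w1(2) nm img jq join by (metis UnE image_eqI path_image_join)
  define K where "K = connected_component_set (- orbit) (q, 0)"
  have unb: "\<not> bounded K" using nins qn by (simp add: inside_def K_def)
  have "connected (j ` K)" unfolding K_def by (intro connected_continuous_image jcont) simp
  moreover have "j ` K \<subseteq> - j ` orbit"
    using connected_component_subset[of "- orbit" "(q, 0)"] inj unfolding K_def by (auto dest: injD)
  moreover have "j (q, 0) \<in> j ` K" using qn by (simp add: K_def)
  ultimately have "j ` K \<subseteq> connected_component_set (- j ` orbit) (of_real q)"
    unfolding jq[symmetric] by (intro connected_component_maximal)
  moreover have "\<not> bounded (j ` K)"
  proof
    assume "bounded (j ` K)"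
    then have "bounded K" by (simp add: bounded_iff jnorm)
    then show False using unb by simp
  qed
  ultimately have "\<not> bounded (connected_component_set (- j ` orbit) (of_real q))"
    using bounded_subset by blast
  then have "of_real q \<notin> inside (path_image (p +++ m))" unfolding img by (simp add: inside_def)
  moreover have "of_real q \<notin> path_image (p +++ m)" using w1(2) nm join by (simp add: path_image_join)
  ultimately show False using nout inside_Un_outside[of "path_image (p +++ m)"] by blast
qed

lemma cycles_neg_holds:
  assumes s1: "s = -1" and A: "open A" "orbit \<subseteq> A" "A \<subseteq> N"
  shows "cycles_neg Z (mirror Z) A (xT, 0) (P xT + xT)"
proof (rule cycles_neg_if_inside[OF s1 A])
  assume pos: "0 < s * (xs - xT)"
  then have "xs < xT" using s1 by simp
  moreover have "xT < 0" using xT r by linarith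
  ultimately show "(xT, 0) \<in> inside orbit \<and> - (xT, 0) \<in> inside orbit"
    using inside_orbit[OF pos, of xT] inside_orbit[OF pos, of "- xT"] by simp
qed

end

section \<open>Dynamics on the discontinuity boundary\<close>

lemma sliding_velocity_mirror:
  assumes "sliding_velocity Z (mirror Z) p v"
  shows "sliding_velocity Z (mirror Z) (- p) (- v)"
proof -
  obtain \<mu> where \<mu>: "\<mu> \<in> {0..1}" "v = \<mu> *\<^sub>R mirror Z p + (1 - \<mu>) *\<^sub>R Z p" "snd v = 0"
    using assms by (auto simp: sliding_velocity_def)
  show ?thesis
    unfolding sliding_velocity_def
    by (rule bexI[of _ "1 - \<mu>"]) (use \<mu> in \<open>auto simp: mirror_def\<close>)
qed

lemma lie_derivative_snd: "lie_derivative Z snd = (\<lambda>p. snd (Z p))"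
proof
  fix p :: plane
  have "(snd has_derivative snd) (at p)" for p :: plane
    by (rule bounded_linear_imp_has_derivative[OF bounded_linear_snd])
  then have "frechet_derivative snd (at p) = snd" by (rule frechet_derivative_at[symmetric])
  then show "lie_derivative Z snd p = snd (Z p)" by (simp add: lie_derivative_def)
qed

text \<open>Only the derivative of the vertical component at the point itself enters the second Lie derivative.\<close>

lemma second_lie_eq:
  assumes "((\<lambda>p. snd (Z p)) has_derivative D) (at p)"
  shows "second_lie Z p = D (Z p)"
  unfolding second_lie_def lie_derivative_snd
  by (simp add: lie_derivative_def frechet_derivative_at[OF assms, symmetric])

lemma second_lie_mirror:
  assumes "((\<lambda>p. snd (Z p)) has_derivative D) (at p)"
  shows "second_lie (mirror Z) (- p) = - second_lie Z p"
proof -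
  have minus: "D (- v) = - D v" for v by (rule linear_simps(4)[OF has_derivative_bounded_linear[OF assms]])
  have "((\<lambda>q::plane. - q) has_derivative (\<lambda>v. - v)) (at (- p))" by (auto intro!: derivative_eq_intros)
  moreover have "((\<lambda>p. snd (Z p)) has_derivative D) (at (- (- p)))" using assms by simp
  ultimately have "((\<lambda>q. snd (Z (- q))) has_derivative (\<lambda>v. D (- v))) (at (- p))"
    by (rule has_derivative_compose)
  then have "((\<lambda>q. - snd (Z (- q))) has_derivative (\<lambda>v. - D (- v))) (at (- p))"
    by (rule has_derivative_minus)
  then have "((\<lambda>q. snd (mirror Z q)) has_derivative D) (at (- p))"
    by (simp add: mirror_def minus)
  from second_lie_eq[OF this] have "second_lie (mirror Z) (- p) = D (mirror Z (- p))" .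
  then show ?thesis using second_lie_eq[OF assms] by (simp add: mirror_def minus)
qed

context half_return begin

lemma stable_sliding_at:
  assumes e: "e = 1 \<or> e = (-1::real)" and x: "\<bar>x + a\<bar> < r" "s * (x - xT) < 0"
  shows "stable_sliding Z (mirror Z) (e *\<^sub>R (x, 0))"
  using e g_neg[OF x] g_lower[OF x(1)] by (auto simp: stable_sliding_def disc_boundary_def mirror_def)

lemma sliding_velocity_at:
  assumes e: "e = 1 \<or> e = (-1::real)" and x: "\<bar>x + a\<bar> < r" "s * (x - xT) < 0"
  shows "sliding_velocity Z (mirror Z) (e *\<^sub>R (x, 0)) v \<longleftrightarrow> v = e *\<^sub>R (slide_speed Z x, 0)"
proof -
  have u: "sliding_velocity Z (mirror Z) (x, 0) w \<longleftrightarrow> w = (slide_speed Z x, 0)" for w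
    by (rule sliding_velocity_unique[OF less_imp_le[OF g_neg[OF x]] g_lower[OF x(1)]])
  show ?thesis
    using e
  proof
    assume "e = -1"
    moreover have "sliding_velocity Z (mirror Z) (- (x, 0)) v \<longleftrightarrow> sliding_velocity Z (mirror Z) (x, 0) (- v)"
      using sliding_velocity_mirror[of Z "(x, 0)" "- v"] sliding_velocity_mirror[of Z "- (x, 0)" v] by auto
    moreover have "- v = (slide_speed Z x, 0) \<longleftrightarrow> v = - (slide_speed Z x, 0)" by (metis minus_minus)
    ultimately show ?thesis using u by simp
  qed (simp add: u)
qed

lemma slides_at:
  assumes e: "e = 1 \<or> e = (-1::real)" and x: "\<bar>x + a\<bar> < r" "s * (x - xT) < 0"
  shows "0 < e * s \<Longrightarrow> slides_rightward Z (mirror Z) (e *\<^sub>R (x, 0))"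
    and "e * s < 0 \<Longrightarrow> slides_leftward Z (mirror Z) (e *\<^sub>R (x, 0))"
  unfolding slides_rightward_def slides_leftward_def sliding_velocity_at[OF assms]
  using slide[OF x(1) less_imp_le[OF x(2)]] c e s by auto

text \<open>The sign of \<open>x\<close> separates the two sections because their radius is less than \<open>a\<close>.\<close>

lemma axis_part:
  assumes A: "A \<subseteq> N"
  shows "p \<in> left_part A \<Longrightarrow> p = (fst p, 0) \<and> \<bar>fst p + a\<bar> < r"
    and "p \<in> right_part A \<Longrightarrow> p = (-1) *\<^sub>R (- fst p, 0) \<and> \<bar>- fst p + a\<bar> < r"
proof -
  show "p = (fst p, 0) \<and> \<bar>fst p + a\<bar> < r" if "p \<in> left_part A"
  proof -
    have p: "p \<in> N" "snd p = 0" "fst p < 0" using that A by (auto simp: left_part_def disc_boundary_def)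
    then show ?thesis using N_axis[OF p(1,2)] r by (auto simp: prod_eq_iff)
  qed
  show "p = (-1) *\<^sub>R (- fst p, 0) \<and> \<bar>- fst p + a\<bar> < r" if "p \<in> right_part A"
  proof -
    have p: "p \<in> N" "snd p = 0" "fst p > 0" using that A by (auto simp: right_part_def disc_boundary_def)
    then show ?thesis using N_axis[OF p(1,2)] r by (auto simp: prod_eq_iff)
  qed
qed

lemma axis_component:
  assumes "\<And>x. x \<in> closed_segment (- a) xT \<Longrightarrow> e *\<^sub>R (x, 0::real) \<in> A"
  shows "connected_component (disc_boundary \<inter> A) (e *\<^sub>R (- a, 0)) (e *\<^sub>R (xT, 0))"
  unfolding connected_component_def
proof (intro exI conjI)
  let ?K = "(\<lambda>x. e *\<^sub>R (x, 0::real)) ` closed_segment (- a) xT"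
  show "connected ?K" by (intro connected_continuous_image continuous_intros) simp
  show "?K \<subseteq> disc_boundary \<inter> A" using assms by (auto simp: disc_boundary_def)
  show "e *\<^sub>R (- a, 0) \<in> ?K" by (rule imageI) simp
  show "e *\<^sub>R (xT, 0) \<in> ?K" by (rule imageI) simp
qed

lemma boundary_dynamics_holds:
  assumes A: "A \<subseteq> N"
    and seg: "\<And>x e. x \<in> closed_segment (- a) xT \<Longrightarrow> e = 1 \<or> e = (-1::real) \<Longrightarrow> e *\<^sub>R (x, 0) \<in> A"
    and D: "((\<lambda>p. snd (Z p)) has_derivative D) (at (xT, 0))" and vis: "0 < D (Z (xT, 0))"
    and \<phi>: "0 < s * \<phi>"
  shows "boundary_dynamics Z (mirror Z) A a \<phi> (xT, 0)"
proof -
  have xTneg: "xT < 0" using xT r by linarith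
  have sl: "0 < second_lie Z (xT, 0)" using second_lie_eq[OF D] vis by simp
  have sl': "second_lie (mirror Z) (- (xT, 0)) < 0" using second_lie_mirror[OF D] sl by simp
  have nz: "Z (xT, 0) \<noteq> 0" using fold_speed c by (auto simp: zero_prod_def)
  have tan: "tangent_of Z (xT, 0)" using nz g_T by (simp add: tangent_of_def disc_boundary_def)
  then have tan': "tangent_of (mirror Z) (- (xT, 0))"
    using tangent_of_uminus[of "mirror Z" "(xT, 0)"] by (simp add: mirror_mirror)
  have f1: "fold_of Z (xT, 0)" "visible_fold_upper Z (xT, 0)"
    using tan sl by (auto simp: fold_of_def visible_fold_upper_def)
  have f2: "fold_of (mirror Z) (- (xT, 0))" "visible_fold_lower (mirror Z) (- (xT, 0))"
    using tan' sl' by (auto simp: fold_of_def visible_fold_lower_def)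
  have gm: "0 < snd (mirror Z (xT, 0))" by (rule g_lower[OF xT])
  have rf1: "regular_fold Z (mirror Z) (xT, 0)" using f1 gm by (simp add: regular_fold_def)
  have rf2: "regular_fold Z (mirror Z) (- (xT, 0))"
    using f2 gm by (simp add: regular_fold_def mirror_def)
  have TA: "(xT, 0) \<in> A" "- (xT, 0) \<in> A" using seg[of xT 1] seg[of xT "-1"] by auto
  have t1: "{p \<in> left_part A. tangent_point Z (mirror Z) p} = {(xT, 0)}"
  proof -
    have "p = (xT, 0)" if p: "p \<in> left_part A" "tangent_point Z (mirror Z) p" for p
      using axis_part(1)[OF A p(1)] tangent_iff[of 1 "fst p"] p(2) by auto
    moreover have "(xT, 0) \<in> left_part A" using TA xTneg by (simp add: left_part_def disc_boundary_def)
    moreover have "tangent_point Z (mirror Z) (xT, 0)" using tan by (simp add: tangent_point_def)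
    ultimately show ?thesis by blast
  qed
  have t2: "{p \<in> right_part A. tangent_point Z (mirror Z) p} = {- (xT, 0)}"
  proof -
    have "p = - (xT, 0)" if p: "p \<in> right_part A" "tangent_point Z (mirror Z) p" for p
    proof -
      have q: "p = (-1) *\<^sub>R (- fst p, 0)" "\<bar>- fst p + a\<bar> < r" using axis_part(2)[OF A p(1)] by auto
      have "- fst p = xT" using tangent_iff[OF _ q(2), of "-1"] p(2) q(1) by auto
      then show ?thesis using q(1) by auto
    qed
    moreover have "- (xT, 0) \<in> right_part A" using TA xTneg by (simp add: right_part_def disc_boundary_def)
    moreover have "tangent_point Z (mirror Z) (- (xT, 0))" using tan' by (simp add: tangent_point_def)
    ultimately show ?thesis by blast
  qed
  have L: "(s * (fst p - xT) < 0 \<longrightarrow> stable_sliding Z (mirror Z) p \<and> (0 < s \<longrightarrow> slides_rightward Z (mirror Z) p) \<and>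
      (s < 0 \<longrightarrow> slides_leftward Z (mirror Z) p)) \<and> (0 < s * (fst p - xT) \<longrightarrow> upward_crossing Z (mirror Z) p)"
    if "p \<in> left_part A" for p
  proof -
    have q: "p = 1 *\<^sub>R (fst p, 0)" "\<bar>fst p + a\<bar> < r" using axis_part(1)[OF A that] by auto
    have "upward_crossing Z (mirror Z) p" if "0 < s * (fst p - xT)"
    proof -
      have "upward_crossing Z (mirror Z) (fst p, 0)"
        using g_pos[OF q(2) that] g_lower[OF q(2)] by (simp add: upward_crossing_def disc_boundary_def)
      then show ?thesis using q(1) by simp
    qed
    then show ?thesis
      using stable_sliding_at[OF _ q(2), of 1] slides_at[OF _ q(2), of 1] q(1) by auto
  qed
  have Rr: "(s * (- fst p - xT) < 0 \<longrightarrow> stable_sliding Z (mirror Z) p \<and> (0 < s \<longrightarrow> slides_leftward Z (mirror Z) p) \<and>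
      (s < 0 \<longrightarrow> slides_rightward Z (mirror Z) p)) \<and> (0 < s * (- fst p - xT) \<longrightarrow> downward_crossing Z (mirror Z) p)"
    if "p \<in> right_part A" for p
  proof -
    have q: "p = (-1) *\<^sub>R (- fst p, 0)" "\<bar>- fst p + a\<bar> < r" using axis_part(2)[OF A that] by auto
    have "downward_crossing Z (mirror Z) ((-1) *\<^sub>R (- fst p, 0))" if "0 < s * (- fst p - xT)"
      using g_pos[OF q(2) that] g_lower[OF q(2)] by (simp add: downward_crossing_def disc_boundary_def mirror_def)
    then show ?thesis
      using stable_sliding_at[OF _ q(2), of "-1"] slides_at[OF _ q(2), of "-1"] q(1) by auto
  qed
  have cc: "connected_component (disc_boundary \<inter> A) (- a, 0) (xT, 0)"
    "connected_component (disc_boundary \<inter> A) (a, 0) (- (xT, 0))"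
  proof -
    have "connected_component (disc_boundary \<inter> A) (1 *\<^sub>R (- a, 0)) (1 *\<^sub>R (xT, 0))"
      by (rule axis_component, rule seg) auto
    then show "connected_component (disc_boundary \<inter> A) (- a, 0) (xT, 0)" by simp
    have "connected_component (disc_boundary \<inter> A) ((-1) *\<^sub>R (- a, 0)) ((-1) *\<^sub>R (xT, 0))"
      by (rule axis_component, rule seg) auto
    then show "connected_component (disc_boundary \<inter> A) (a, 0) (- (xT, 0))" by simp
  qed
  have ps: "\<phi> > 0 \<Longrightarrow> s = 1" "\<phi> < 0 \<Longrightarrow> s = -1" using \<phi> s by auto
  show ?thesis
    unfolding boundary_dynamics_def
    using t1 t2 cc rf1 rf2 f1(2) f2(2) L Rr ps by auto
qed

end

section \<open>Landing time, fold position and the variational equation\<close>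

text \<open>Variation of constants, obtained by integrating the derivative of \<open>E t * w t\<close> with the integrating
  factor \<open>E t = exp (integral {t..\<tau>} d)\<close>.\<close>

lemma linear_ode_formula:
  fixes w d b :: "real \<Rightarrow> real"
  assumes \<tau>: "0 \<le> \<tau>" and contd: "continuous_on {0..\<tau>} d"
    and der: "\<And>t. t \<in> {0..\<tau>} \<Longrightarrow> (w has_real_derivative d t * w t + b t) (at t within {0..\<tau>})"
  shows "w \<tau> = exp (integral {0..\<tau>} d) * w 0 + integral {0..\<tau>} (\<lambda>t. exp (integral {t..\<tau>} d) * b t)"
proof -
  define E where "E t = exp (integral {0..\<tau>} d - integral {0..t} d)" for t
  have int: "integral {t..\<tau>} d = integral {0..\<tau>} d - integral {0..t} d" if "t \<in> {0..\<tau>}" for t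
    using Henstock_Kurzweil_Integration.integral_combine[of 0 t \<tau> d] that
      integrable_continuous_real[OF contd] by auto
  have dE: "(E has_real_derivative - d t * E t) (at t within {0..\<tau>})" if "t \<in> {0..\<tau>}" for t
    unfolding E_def using integral_has_real_derivative[OF contd that]
    by (auto intro!: derivative_eq_intros)
  have "((\<lambda>t. E t * b t) has_integral (E \<tau> * w \<tau> - E 0 * w 0)) {0..\<tau>}"
  proof (rule fundamental_theorem_of_calculus[OF \<tau>])
    fix t assume t: "t \<in> {0..\<tau>}"
    have "((\<lambda>t. E t * w t) has_real_derivative E t * (d t * w t + b t) + (- d t * E t) * w t) (at t within {0..\<tau>})"
      by (rule DERIV_mult'[OF dE[OF t] der[OF t]])
    moreover have "E t * (d t * w t + b t) + (- d t * E t) * w t = E t * b t" by (simp add: algebra_simps)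
    ultimately show "((\<lambda>t. E t * w t) has_vector_derivative E t * b t) (at t within {0..\<tau>})"
      by (simp add: has_real_derivative_iff_has_vector_derivative)
  qed
  then have "integral {0..\<tau>} (\<lambda>t. E t * b t) = E \<tau> * w \<tau> - E 0 * w 0" by (rule integral_unique)
  moreover have "integral {0..\<tau>} (\<lambda>t. E t * b t) = integral {0..\<tau>} (\<lambda>t. exp (integral {t..\<tau>} d) * b t)"
    by (rule Henstock_Kurzweil_Integration.integral_cong) (simp only: E_def int)
  moreover have "E \<tau> = 1" "E 0 = exp (integral {0..\<tau>} d)" by (simp_all add: E_def)
  ultimately show ?thesis by simp
qed

text \<open>Parameters are added to the state as constant coordinates, so that dependence on parameters is
  dependence on initial values. The field \<open>X\<close> is a globally Lipschitz field that agrees with \<open>(Fld, 0)\<close>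
  on \<open>B\<close>.\<close>

locale critical_flow = smooth_flow X L M T \<phi> B X' K
  for X :: "plane \<times> (real^'m) \<Rightarrow> plane \<times> (real^'m)" and L M T :: real
    and \<phi> :: "real \<Rightarrow> plane \<times> (real^'m) \<Rightarrow> plane \<times> (real^'m)"
    and B :: "(plane \<times> (real^'m)) set"
    and X' :: "plane \<times> (real^'m) \<Rightarrow> (plane \<times> (real^'m)) \<Rightarrow>\<^sub>L (plane \<times> (real^'m))" and K :: real +
  fixes Fld :: "plane \<times> (real^'m) \<Rightarrow> plane"
    and Fld' :: "plane \<times> (real^'m) \<Rightarrow> (plane \<times> (real^'m)) \<Rightarrow>\<^sub>L plane"
    and a \<tau>0 :: real
  assumes X_eq: "e \<in> B \<Longrightarrow> X e = (Fld e, 0)" and X_snd: "snd (X e) = 0"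
    and X'_eq: "e \<in> B \<Longrightarrow> X' e v = (Fld' e v, 0)"
    and Fld_deriv: "(Fld has_derivative Fld' e) (at e)"
    and Fld'_cont: "continuous_on UNIV Fld'"
    and Fld_lip: "\<exists>L. L-lipschitz_on (cball 0 \<rho>) Fld"
    and a_pos: "0 < a" and \<tau>0: "0 < \<tau>0" "\<tau>0 < T"
    and e0_stay: "((- a, 0), 0) \<in> stay"
    and e0_end: "\<phi> \<tau>0 ((- a, 0), 0) = ((a, 0), 0)"
    and e0_up: "0 < t \<Longrightarrow> t < \<tau>0 \<Longrightarrow> 0 < snd (fst (\<phi> t ((- a, 0), 0)))"
    and fold_g: "snd (Fld ((- a, 0), 0)) = 0"
    and fold_vis: "0 < fst (Fld ((- a, 0), 0)) * snd (Fld' ((- a, 0), 0) ((1, 0), 0))"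
    and end_g: "snd (Fld ((a, 0), 0)) < 0"
begin

abbreviation "e0 \<equiv> ((- a, 0), 0) :: plane \<times> (real^'m)"

lemma X_cont: "continuous_on UNIV X"
proof (rule continuous_on_subset[OF lipschitz_on_continuous_on order_refl])
  show "L-lipschitz_on UNIV X" using field_lip L_pos by (auto simp: lipschitz_on_def dist_norm)
qed

lemma Fld_cont: "continuous_on A Fld"
  by (intro continuous_at_imp_continuous_on ballI has_derivative_continuous[OF Fld_deriv])

lemma flow_param:
  assumes "t \<in> {0..T}"
  shows "snd (\<phi> t e) = snd e"
proof -
  have "((\<lambda>t. snd (\<phi> t e)) has_vector_derivative 0) (at x within {0..T})" if "x \<in> {0..T}" for x
    using bounded_linear.has_vector_derivative[OF bounded_linear_snd flow_deriv[OF that]] by (simp add: X_snd)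
  from has_vector_derivative_zero_constant[OF _ this]
  obtain c where c: "\<And>x. x \<in> {0..T} \<Longrightarrow> snd (\<phi> x e) = c" by auto
  have "snd (\<phi> t e) = snd (\<phi> 0 e)" using c[OF assms] c[of 0] T_pos by simp
  then show ?thesis by (simp add: flow_0)
qed

definition "height p = snd (fst (\<phi> (fst p) (snd p)))"
definition "height' p q = fst q * snd (fst (X (\<phi> (fst p) (snd p)))) + snd (fst (Y (fst p) (snd p) (snd q)))"

lemma flow_pair_deriv:
  assumes "p \<in> {0<..<T} \<times> stay"
  shows "((\<lambda>p. \<phi> (fst p) (snd p)) has_derivative
     (\<lambda>q. fst q *\<^sub>R X (\<phi> (fst p) (snd p)) + Y (fst p) (snd p) (snd q))) (at p)"
  using flow_has_derivative[of "snd p" "fst p"] assms by (simp add: case_prod_unfold mem_Times_iff)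

lemma height_deriv:
  assumes "p \<in> {0<..<T} \<times> stay"
  shows "(height has_derivative height' p) (at p)"
proof -
  have bl: "bounded_linear (\<lambda>q::plane \<times> (real^'m). snd (fst q))"
    by (intro bounded_linear_compose[OF bounded_linear_snd] bounded_linear_fst)
  have "height' p = (\<lambda>q. snd (fst (fst q *\<^sub>R X (\<phi> (fst p) (snd p)) + Y (fst p) (snd p) (snd q))))"
    by (rule ext) (simp add: height'_def)
  then show ?thesis
    unfolding height_def[abs_def]
    using bounded_linear.has_derivative[OF bl flow_pair_deriv[OF assms]] by simp
qed

lemma Y_pair_cont: "continuous_on ({0..T} \<times> stay) (\<lambda>p. Y (fst p) (snd p))"
  using Y_cont by (simp add: split_beta)

lemma flow_pair_cont: "continuous_on ({0..T} \<times> UNIV) (\<lambda>p. \<phi> (fst p) (snd p))"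
  using flow_cont by (simp add: split_beta)

lemma end_speed: "snd (fst (X (\<phi> \<tau>0 e0))) < 0"
  using X_eq[OF stay_in_G[OF e0_stay, of \<tau>0]] \<tau>0 e0_end end_g by simp

text \<open>The landing time as an implicit function: at the end point the reference orbit crosses the axis
  downwards with nonzero speed.\<close>

lemma hit_exists:
  assumes "0 < \<delta>0"
  obtains \<delta> \<Omega> \<tau> where "0 < \<delta>" "\<delta> < \<tau>0" "\<tau>0 + \<delta> < T" "\<delta> \<le> \<delta>0" "open \<Omega>" "e0 \<in> \<Omega>" "\<tau> e0 = \<tau>0"
    "\<And>t e. e \<in> \<Omega> \<Longrightarrow> \<bar>t - \<tau>0\<bar> \<le> \<delta> \<Longrightarrow> e \<in> stay \<and> snd (fst (X (\<phi> t e))) < 0"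
    "\<And>e. e \<in> \<Omega> \<Longrightarrow> \<bar>\<tau> e - \<tau>0\<bar> < \<delta> \<and> snd (fst (\<phi> (\<tau> e) e)) = 0"
    "\<And>t e. e \<in> \<Omega> \<Longrightarrow> \<bar>t - \<tau>0\<bar> \<le> \<delta> \<Longrightarrow> t < \<tau> e \<Longrightarrow> 0 < snd (fst (\<phi> t e))"
    "\<And>t e. e \<in> \<Omega> \<Longrightarrow> \<bar>t - \<tau>0\<bar> \<le> \<delta> \<Longrightarrow> \<tau> e < t \<Longrightarrow> snd (fst (\<phi> t e)) < 0"
    "\<And>e. e \<in> \<Omega> \<Longrightarrow> (\<tau> has_derivative
       (\<lambda>h. - snd (fst (Y (\<tau> e) e h)) / snd (fst (X (\<phi> (\<tau> e) e))))) (at e)"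
proof -
  define d where "d = min \<delta>0 (min \<tau>0 (T - \<tau>0) / 2)"
  have d: "0 < d" "d \<le> \<delta>0" "d < \<tau>0" "\<tau>0 + d < T" using assms \<tau>0 by (auto simp: d_def min_def field_simps)
  have op: "open ({0<..<T} \<times> stay)" by (intro open_Times open_stay) auto
  have mem: "(\<tau>0, e0) \<in> {0<..<T} \<times> stay" using \<tau>0 e0_stay by simp
  have h1: "height' p (1, 0) = snd (fst (X (\<phi> (fst p) (snd p))))" for p by (simp add: height'_def blinfun.zero_right)
  have cont: "continuous_on ({0<..<T} \<times> stay) (\<lambda>p. height' p (1, 0))"
    unfolding h1
    by (intro continuous_intros continuous_on_compose2[OF X_cont] continuous_on_subset[OF flow_pair_cont]) auto
  have z: "height (\<tau>0, e0) = 0" by (simp add: height_def e0_end)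
  have nz: "(-1) * height' (\<tau>0, e0) (1, 0) > 0" using end_speed by (simp add: h1)
  obtain \<delta> \<Omega> \<tau> where *: "0 < \<delta>" "\<delta> \<le> d" "open \<Omega>" "e0 \<in> \<Omega>" "\<tau> e0 = \<tau>0"
    "\<And>t e. e \<in> \<Omega> \<Longrightarrow> \<bar>t - \<tau>0\<bar> \<le> \<delta> \<Longrightarrow> (t, e) \<in> {0<..<T} \<times> stay \<and> (-1) * height' (t, e) (1, 0) > 0"
    "\<And>e. e \<in> \<Omega> \<Longrightarrow> \<bar>\<tau> e - \<tau>0\<bar> < \<delta> \<and> height (\<tau> e, e) = 0"
    "\<And>t e. e \<in> \<Omega> \<Longrightarrow> \<bar>t - \<tau>0\<bar> \<le> \<delta> \<Longrightarrow> \<tau> e < t \<Longrightarrow> (-1) * height (t, e) > 0"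
    "\<And>t e. e \<in> \<Omega> \<Longrightarrow> \<bar>t - \<tau>0\<bar> \<le> \<delta> \<Longrightarrow> t < \<tau> e \<Longrightarrow> (-1) * height (t, e) < 0"
    "\<And>e. e \<in> \<Omega> \<Longrightarrow> (\<tau> has_derivative (\<lambda>h. - height' (\<tau> e, e) (0, h) / height' (\<tau> e, e) (1, 0))) (at e)"
    using implicit_function_scalar[OF op mem z height_deriv cont nz d(1)] by blast
  show thesis
  proof (rule that[of \<delta> \<Omega> \<tau>])
    show "e \<in> stay \<and> snd (fst (X (\<phi> t e))) < 0" if "e \<in> \<Omega>" "\<bar>t - \<tau>0\<bar> \<le> \<delta>" for t e
      using *(6)[OF that] by (simp add: h1)
    show "\<bar>\<tau> e - \<tau>0\<bar> < \<delta> \<and> snd (fst (\<phi> (\<tau> e) e)) = 0" if "e \<in> \<Omega>" for e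
      using *(7)[OF that] by (simp add: height_def)
    show "snd (fst (\<phi> t e)) < 0" if "e \<in> \<Omega>" "\<bar>t - \<tau>0\<bar> \<le> \<delta>" "\<tau> e < t" for t e
      using *(8)[OF that] by (simp add: height_def)
    show "0 < snd (fst (\<phi> t e))" if "e \<in> \<Omega>" "\<bar>t - \<tau>0\<bar> \<le> \<delta>" "t < \<tau> e" for t e
      using *(9)[OF that] by (simp add: height_def)
    show "(\<tau> has_derivative (\<lambda>h. - snd (fst (Y (\<tau> e) e h)) / snd (fst (X (\<phi> (\<tau> e) e))))) (at e)" if "e \<in> \<Omega>" for e
      using *(10)[OF that] unfolding h1 by (simp add: height'_def)
  qed (use * d in auto)
qed

text \<open>The fold position as an implicit function of the parameters; \<open>s\<close> normalises the sign of the
  derivative of the vertical component along the axis.\<close>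

lemma fold_exists:
  assumes s: "s = 1 \<or> s = (-1::real)" "0 < s * snd (Fld' e0 ((1, 0), 0))" and "0 < \<delta>0"
  obtains \<delta> \<Omega> xT where "0 < \<delta>" "\<delta> \<le> \<delta>0" "open \<Omega>" "0 \<in> \<Omega>" "xT 0 = - a"
    "\<And>\<alpha>. \<alpha> \<in> \<Omega> \<Longrightarrow> \<bar>xT \<alpha> + a\<bar> < \<delta> \<and> snd (Fld ((xT \<alpha>, 0), \<alpha>)) = 0"
    "\<And>x \<alpha>. \<alpha> \<in> \<Omega> \<Longrightarrow> \<bar>x + a\<bar> \<le> \<delta> \<Longrightarrow> xT \<alpha> < x \<Longrightarrow> 0 < s * snd (Fld ((x, 0), \<alpha>))"
    "\<And>x \<alpha>. \<alpha> \<in> \<Omega> \<Longrightarrow> \<bar>x + a\<bar> \<le> \<delta> \<Longrightarrow> x < xT \<alpha> \<Longrightarrow> s * snd (Fld ((x, 0), \<alpha>)) < 0"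
    "\<And>\<alpha>. \<alpha> \<in> \<Omega> \<Longrightarrow> (xT has_derivative
       (\<lambda>h. - snd (Fld' ((xT \<alpha>, 0), \<alpha>) (0, h)) / snd (Fld' ((xT \<alpha>, 0), \<alpha>) ((1, 0), 0)))) (at \<alpha>)"
    "\<And>\<alpha>. \<alpha> \<in> \<Omega> \<Longrightarrow> snd (Fld' ((xT \<alpha>, 0), \<alpha>) ((1, 0), 0)) \<noteq> 0"
proof -
  define J where "J p = ((fst p, 0::real), snd p)" for p :: "real \<times> (real^'m)"
  define H where "H p = snd (Fld (J p))" for p
  define H' where "H' p q = snd (Fld' (J p) (J q))" for p q
  have blJ: "bounded_linear J"
    unfolding J_def by (intro bounded_linear_Pair bounded_linear_fst bounded_linear_snd bounded_linear_zero)
  have der: "(H has_derivative H' p) (at p)" for p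
  proof -
    have "(J has_derivative J) (at p)" by (rule bounded_linear_imp_has_derivative[OF blJ])
    from has_derivative_compose[OF this Fld_deriv]
    have "((\<lambda>p. Fld (J p)) has_derivative (\<lambda>q. Fld' (J p) (J q))) (at p)" .
    from bounded_linear.has_derivative[OF bounded_linear_snd this] show ?thesis
      by (simp add: H_def[abs_def] H'_def[abs_def])
  qed
  have cont: "continuous_on UNIV (\<lambda>p. H' p (1, 0))"
    unfolding H'_def
    by (intro continuous_intros blinfun.continuous_on continuous_on_compose2[OF Fld'_cont]
        linear_continuous_on[OF blJ]) auto
  have z: "H (- a, 0) = 0" using fold_g by (simp add: H_def J_def)
  have nz: "s * H' (- a, 0) (1, 0) > 0" using s by (simp add: H'_def J_def)
  obtain \<delta> \<Omega> xT where *: "0 < \<delta>" "\<delta> \<le> \<delta>0" "open \<Omega>" "0 \<in> \<Omega>" "xT 0 = - a"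
    "\<And>t e. e \<in> \<Omega> \<Longrightarrow> \<bar>t - (- a)\<bar> \<le> \<delta> \<Longrightarrow> (t, e) \<in> UNIV \<and> s * H' (t, e) (1, 0) > 0"
    "\<And>e. e \<in> \<Omega> \<Longrightarrow> \<bar>xT e - (- a)\<bar> < \<delta> \<and> H (xT e, e) = 0"
    "\<And>t e. e \<in> \<Omega> \<Longrightarrow> \<bar>t - (- a)\<bar> \<le> \<delta> \<Longrightarrow> xT e < t \<Longrightarrow> s * H (t, e) > 0"
    "\<And>t e. e \<in> \<Omega> \<Longrightarrow> \<bar>t - (- a)\<bar> \<le> \<delta> \<Longrightarrow> t < xT e \<Longrightarrow> s * H (t, e) < 0"
    "\<And>e. e \<in> \<Omega> \<Longrightarrow> (xT has_derivative (\<lambda>h. - H' (xT e, e) (0, h) / H' (xT e, e) (1, 0))) (at e)"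
    using implicit_function_scalar[OF open_UNIV UNIV_I z der cont nz assms(3)] by blast
  show thesis
  proof (rule that[of \<delta> \<Omega> xT])
    show "(xT has_derivative (\<lambda>h. - snd (Fld' ((xT \<alpha>, 0), \<alpha>) (0, h)) / snd (Fld' ((xT \<alpha>, 0), \<alpha>) ((1, 0), 0)))) (at \<alpha>)"
      if "\<alpha> \<in> \<Omega>" for \<alpha>
      using *(10)[OF that] by (simp add: H'_def J_def zero_prod_def)
    show "snd (Fld' ((xT \<alpha>, 0), \<alpha>) ((1, 0), 0)) \<noteq> 0" if "\<alpha> \<in> \<Omega>" for \<alpha>
      using *(6)[of \<alpha> "xT \<alpha>"] *(7)[OF that] that by (auto simp: H'_def J_def)
  qed (use * in \<open>auto simp: H_def J_def\<close>)
qed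

text \<open>Along the reference orbit the wedge product of the field with a solution of the variational
  equation satisfies a scalar linear equation whose coefficient is the divergence of the field.\<close>

lemma wedge_formula:
  assumes h: "fst h = (\<xi>, 0)"
  defines "v \<equiv> fst (Y \<tau>0 e0 h)"
  shows "fst (Fld ((a, 0), 0)) * snd v - snd (Fld ((a, 0), 0)) * fst v =
    integral {0..\<tau>0} (\<lambda>t. exp (integral {t..\<tau>0} (\<lambda>t. fst (Fld' (\<phi> t e0) ((1, 0), 0)) + snd (Fld' (\<phi> t e0) ((0, 1), 0)))) *
      (fst (Fld (\<phi> t e0)) * snd (Fld' (\<phi> t e0) (0, snd h)) - snd (Fld (\<phi> t e0)) * fst (Fld' (\<phi> t e0) (0, snd h))))"
proof -
  define V where "V t = Y t e0 h" for t
  define D where "D t = Fld' (\<phi> t e0)" for t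
  define F where "F t = Fld (\<phi> t e0)" for t
  have T0: "{0..\<tau>0} \<subseteq> {0..T}" using \<tau>0 by auto
  have inB: "\<phi> t e0 \<in> B" if "t \<in> {0..T}" for t using stay_in_G[OF e0_stay that] .
  have dV: "(V has_vector_derivative (D t (V t), 0)) (at t within {0..T})" if "t \<in> {0..T}" for t
  proof -
    have "(V has_vector_derivative (X' (\<phi> t e0) o\<^sub>L Y t e0) h) (at t within {0..T})"
      unfolding V_def
      by (rule bounded_linear.has_vector_derivative[OF blinfun.bounded_linear_left Y_deriv[OF e0_stay that]])
    then show ?thesis using X'_eq[OF inB[OF that]] by (simp add: V_def D_def)
  qed
  have sndV: "snd (V t) = snd h" if "t \<in> {0..T}" for t
  proof -
    have "((\<lambda>t. snd (V t)) has_vector_derivative 0) (at x within {0..T})" if "x \<in> {0..T}" for x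
      using bounded_linear.has_vector_derivative[OF bounded_linear_snd dV[OF that]] by simp
    from has_vector_derivative_zero_constant[OF _ this]
    obtain c where c: "\<And>x. x \<in> {0..T} \<Longrightarrow> snd (V x) = c" by auto
    have "snd (V t) = snd (V 0)" using c[OF that] c[of 0] T_pos by simp
    then show ?thesis by (simp add: V_def Y_0[OF e0_stay])
  qed
  have dv: "((\<lambda>t. fst (V t)) has_vector_derivative D t (V t)) (at t within {0..T})" if "t \<in> {0..T}" for t
    using bounded_linear.has_vector_derivative[OF bounded_linear_fst dV[OF that]] by simp
  have dF: "(F has_vector_derivative D t (F t, 0)) (at t within {0..T})" if "t \<in> {0..T}" for t
  proof -
    have "((\<lambda>t. \<phi> t e0) has_vector_derivative (F t, 0)) (at t within {0..T})"
      using flow_deriv[OF that, of e0] X_eq[OF inB[OF that]] by (simp add: F_def)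
    then have "((\<lambda>t. \<phi> t e0) has_derivative (\<lambda>s. s *\<^sub>R (F t, 0))) (at t within {0..T})"
      by (simp add: has_vector_derivative_def)
    from has_derivative_compose[OF this Fld_deriv]
    have "(F has_derivative (\<lambda>s. D t (s *\<^sub>R (F t, 0)))) (at t within {0..T})"
      by (simp add: F_def[abs_def] D_def)
    then show ?thesis by (simp only: has_vector_derivative_def blinfun.scaleR_right)
  qed
  define d where "d t = fst (D t ((1, 0), 0)) + snd (D t ((0, 1), 0))" for t
  define b where "b t = fst (F t) * snd (D t (0, snd h)) - snd (F t) * fst (D t (0, snd h))" for t
  define w where "w t = fst (F t) * snd (fst (V t)) - snd (F t) * fst (fst (V t))" for t
  have lin: "D t (p, \<iota>) = fst p *\<^sub>R D t ((1, 0), 0) + snd p *\<^sub>R D t ((0, 1), 0) + D t (0, \<iota>)" for t p \<iota>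
  proof -
    have "(p, \<iota>) = fst p *\<^sub>R ((1, 0), 0) + snd p *\<^sub>R ((0, 1), 0) + (0, \<iota>)"
      by (simp add: prod_eq_iff)
    then show ?thesis by (metis blinfun.add_right blinfun.scaleR_right)
  qed
  have dw: "(w has_real_derivative d t * w t + b t) (at t within {0..\<tau>0})" if t: "t \<in> {0..\<tau>0}" for t
  proof -
    have tT: "t \<in> {0..T}" using t T0 by auto
    note fF = bounded_linear.has_vector_derivative[OF bounded_linear_fst dF[OF tT]]
    note sF = bounded_linear.has_vector_derivative[OF bounded_linear_snd dF[OF tT]]
    note fV = bounded_linear.has_vector_derivative[OF bounded_linear_fst dv[OF tT]]
    note sV = bounded_linear.has_vector_derivative[OF bounded_linear_snd dv[OF tT]]
    have "(w has_real_derivative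
        (fst (F t) * snd (D t (V t)) + fst (D t (F t, 0)) * snd (fst (V t)))
        - (snd (F t) * fst (D t (V t)) + snd (D t (F t, 0)) * fst (fst (V t)))) (at t within {0..T})"
      unfolding w_def
      using fF sF fV sV
      by (intro DERIV_diff DERIV_mult') (simp_all add: has_real_derivative_iff_has_vector_derivative)
    moreover have "(fst (F t) * snd (D t (V t)) + fst (D t (F t, 0)) * snd (fst (V t)))
        - (snd (F t) * fst (D t (V t)) + snd (D t (F t, 0)) * fst (fst (V t))) = d t * w t + b t"
    proof -
      have 1: "D t (V t) = fst (fst (V t)) *\<^sub>R D t ((1, 0), 0) + snd (fst (V t)) *\<^sub>R D t ((0, 1), 0) + D t (0, snd h)"
        using lin[of t "fst (V t)" "snd h"] sndV[OF tT] by (metis prod.collapse)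
      have 2: "D t (F t, 0) = fst (F t) *\<^sub>R D t ((1, 0), 0) + snd (F t) *\<^sub>R D t ((0, 1), 0)"
        using lin[of t "F t" 0] by (simp add: blinfun.zero_right zero_prod_def[symmetric])
      show ?thesis unfolding 1 2 by (simp add: d_def w_def b_def algebra_simps)
    qed
    ultimately show ?thesis using DERIV_subset[OF _ T0] by simp
  qed
  have contd: "continuous_on {0..\<tau>0} d"
    unfolding d_def D_def
    by (intro continuous_intros blinfun.continuous_on continuous_on_compose2[OF Fld'_cont]
        continuous_on_subset[OF flow_cont_time T0]) auto
  have "w \<tau>0 = exp (integral {0..\<tau>0} d) * w 0 + integral {0..\<tau>0} (\<lambda>t. exp (integral {t..\<tau>0} d) * b t)"
    by (rule linear_ode_formula[OF less_imp_le[OF \<tau>0(1)] contd dw])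
  moreover have "w 0 = 0"
    using h fold_g by (simp add: w_def F_def V_def Y_0[OF e0_stay] flow_0)
  moreover have "w \<tau>0 = fst (Fld ((a, 0), 0)) * snd v - snd (Fld ((a, 0), 0)) * fst v"
    by (simp add: w_def F_def e0_end V_def v_def)
  ultimately show ?thesis by (simp add: d_def[abs_def] b_def[abs_def] D_def F_def)
qed

text \<open>The curve \<open>\<Gamma>\<^sub>0\<close>, expressed by the flow.\<close>

definition "cycle0 = (\<lambda>t. fst (\<phi> t e0)) ` {0..\<tau>0} \<union> uminus ` (\<lambda>t. fst (\<phi> t e0)) ` {0..\<tau>0}"

end

section \<open>The landing map near the reference orbit\<close>

lemma norm_fst_bound: "norm (fst v) \<le> norm v"
  using norm_fst_le[of "fst v" "snd v"] by simp

lemma norm_snd_bound: "norm (snd v) \<le> norm v"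
  using norm_snd_le[of "snd v" "fst v"] by simp

text \<open>The implicit functions are fixed here: \<open>\<tau> e\<close> is the landing time of \<open>e\<close> and \<open>xT \<alpha>\<close> the fold
  position.\<close>

locale critical_hit = critical_flow X L M T \<phi> B X' K Fld Fld' a \<tau>0
  for X :: "plane \<times> (real^'m) \<Rightarrow> plane \<times> (real^'m)" and L M T :: real
    and \<phi> :: "real \<Rightarrow> plane \<times> (real^'m) \<Rightarrow> plane \<times> (real^'m)"
    and B :: "(plane \<times> (real^'m)) set"
    and X' :: "plane \<times> (real^'m) \<Rightarrow> (plane \<times> (real^'m)) \<Rightarrow>\<^sub>L (plane \<times> (real^'m))" and K :: real
    and Fld :: "plane \<times> (real^'m) \<Rightarrow> plane"
    and Fld' :: "plane \<times> (real^'m) \<Rightarrow> (plane \<times> (real^'m)) \<Rightarrow>\<^sub>L plane"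
    and a \<tau>0 :: real +
  fixes s \<delta> \<delta>T :: real and \<Omega> :: "(plane \<times> (real^'m)) set" and \<Omega>T :: "(real^'m) set"
    and \<tau> :: "plane \<times> (real^'m) \<Rightarrow> real" and xT :: "real^'m \<Rightarrow> real"
  assumes s: "s = 1 \<or> s = -1" and s_f: "0 < s * fst (Fld ((- a, 0), 0))"
    and \<delta>: "0 < \<delta>" "\<delta> < \<tau>0" "\<tau>0 + \<delta> < T"
    and \<Omega>: "open \<Omega>" "((- a, 0), 0) \<in> \<Omega>" "\<tau> ((- a, 0), 0) = \<tau>0"
    and hit_window: "e \<in> \<Omega> \<Longrightarrow> \<bar>t - \<tau>0\<bar> \<le> \<delta> \<Longrightarrow> e \<in> stay \<and> snd (fst (X (\<phi> t e))) < 0"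
    and hit_zero: "e \<in> \<Omega> \<Longrightarrow> \<bar>\<tau> e - \<tau>0\<bar> < \<delta> \<and> snd (fst (\<phi> (\<tau> e) e)) = 0"
    and hit_before: "e \<in> \<Omega> \<Longrightarrow> \<bar>t - \<tau>0\<bar> \<le> \<delta> \<Longrightarrow> t < \<tau> e \<Longrightarrow> 0 < snd (fst (\<phi> t e))"
    and hit_after: "e \<in> \<Omega> \<Longrightarrow> \<bar>t - \<tau>0\<bar> \<le> \<delta> \<Longrightarrow> \<tau> e < t \<Longrightarrow> snd (fst (\<phi> t e)) < 0"
    and hit_deriv: "e \<in> \<Omega> \<Longrightarrow> (\<tau> has_derivative
       (\<lambda>h. - snd (fst (Y (\<tau> e) e h)) / snd (fst (X (\<phi> (\<tau> e) e))))) (at e)"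
    and \<delta>T: "0 < \<delta>T" and \<Omega>T: "open \<Omega>T" "0 \<in> \<Omega>T" "xT 0 = - a"
    and xT_zero: "\<alpha> \<in> \<Omega>T \<Longrightarrow> \<bar>xT \<alpha> + a\<bar> < \<delta>T \<and> snd (Fld ((xT \<alpha>, 0), \<alpha>)) = 0"
    and xT_after: "\<alpha> \<in> \<Omega>T \<Longrightarrow> \<bar>x + a\<bar> \<le> \<delta>T \<Longrightarrow> xT \<alpha> < x \<Longrightarrow> 0 < s * snd (Fld ((x, 0), \<alpha>))"
    and xT_before: "\<alpha> \<in> \<Omega>T \<Longrightarrow> \<bar>x + a\<bar> \<le> \<delta>T \<Longrightarrow> x < xT \<alpha> \<Longrightarrow> s * snd (Fld ((x, 0), \<alpha>)) < 0"
    and xT_deriv: "\<alpha> \<in> \<Omega>T \<Longrightarrow> (xT has_derivative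
       (\<lambda>h. - snd (Fld' ((xT \<alpha>, 0), \<alpha>) (0, h)) / snd (Fld' ((xT \<alpha>, 0), \<alpha>) ((1, 0), 0)))) (at \<alpha>)"
    and xT_slope: "\<alpha> \<in> \<Omega>T \<Longrightarrow> snd (Fld' ((xT \<alpha>, 0), \<alpha>) ((1, 0), 0)) \<noteq> 0"
begin

definition "land e = fst (fst (\<phi> (\<tau> e) e))"
definition "land' e h = fst (fst (Y (\<tau> e) e h)) -
   fst (fst (X (\<phi> (\<tau> e) e))) * snd (fst (Y (\<tau> e) e h)) / snd (fst (X (\<phi> (\<tau> e) e)))"

lemma in_stay: "e \<in> \<Omega> \<Longrightarrow> e \<in> stay"
  using hit_window[of e \<tau>0] \<delta> by simp

lemma hit_range: "e \<in> \<Omega> \<Longrightarrow> 0 < \<tau> e \<and> \<tau> e < T"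
  using hit_zero[of e] \<delta> \<tau>0 by auto

lemma hit_speed: "e \<in> \<Omega> \<Longrightarrow> snd (fst (X (\<phi> (\<tau> e) e))) < 0"
  using hit_window[of e "\<tau> e"] hit_zero[of e] by auto

lemma hit_cont: "e \<in> \<Omega> \<Longrightarrow> isCont \<tau> e"
  by (rule has_derivative_continuous[OF hit_deriv])

lemma hit_cont_on: "continuous_on \<Omega> \<tau>"
  using hit_cont by (intro continuous_at_imp_continuous_on ballI)

lemma land_deriv:
  assumes e: "e \<in> \<Omega>"
  shows "(land has_derivative land' e) (at e)"
proof -
  define \<tau>' where "\<tau>' h = - snd (fst (Y (\<tau> e) e h)) / snd (fst (X (\<phi> (\<tau> e) e)))" for h
  have "((\<lambda>e. (\<tau> e, e)) has_derivative (\<lambda>h. (\<tau>' h, h))) (at e)"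
    unfolding \<tau>'_def by (intro has_derivative_Pair hit_deriv e has_derivative_ident)
  moreover have "(\<tau> e, e) \<in> {0<..<T} \<times> stay" using hit_range[OF e] in_stay[OF e] by simp
  ultimately have "((\<lambda>e. \<phi> (\<tau> e) e) has_derivative (\<lambda>h. \<tau>' h *\<^sub>R X (\<phi> (\<tau> e) e) + Y (\<tau> e) e h)) (at e)"
    using has_derivative_compose[OF _ flow_pair_deriv] by fastforce
  then have "((\<lambda>e. fst (fst (\<phi> (\<tau> e) e))) has_derivative
      (\<lambda>h. fst (fst (\<tau>' h *\<^sub>R X (\<phi> (\<tau> e) e) + Y (\<tau> e) e h)))) (at e)"
    by (intro has_derivative_fst)
  moreover have "fst (fst (\<tau>' h *\<^sub>R X (\<phi> (\<tau> e) e) + Y (\<tau> e) e h)) = land' e h" for h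
    by (simp add: land'_def \<tau>'_def)
  ultimately show ?thesis by (simp add: land_def[abs_def] land'_def[abs_def])
qed

lemma land'_cont: "continuous_on \<Omega> (\<lambda>e. land' e h)"
proof -
  have pr: "continuous_on \<Omega> (\<lambda>e. (\<tau> e, e))" by (intro continuous_intros hit_cont_on)
  have im: "(\<lambda>e. (\<tau> e, e)) ` \<Omega> \<subseteq> {0..T} \<times> stay"
    using hit_range in_stay by (auto simp: less_imp_le)
  have cY: "continuous_on \<Omega> (\<lambda>e. Y (\<tau> e) e)"
    using continuous_on_compose2[OF Y_pair_cont pr im] by simp
  have c\<phi>: "continuous_on \<Omega> (\<lambda>e. \<phi> (\<tau> e) e)"
  proof -
    have "(\<lambda>e. (\<tau> e, e)) ` \<Omega> \<subseteq> {0..T} \<times> UNIV" using hit_range by (auto simp: less_imp_le)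
    from continuous_on_compose2[OF flow_pair_cont pr this] show ?thesis by simp
  qed
  have "snd (fst (X (\<phi> (\<tau> e) e))) \<noteq> 0" if "e \<in> \<Omega>" for e using hit_speed[OF that] by simp
  then show ?thesis
    unfolding land'_def
    by (intro continuous_intros blinfun.continuous_on cY continuous_on_compose2[OF X_cont c\<phi>]) auto
qed

lemma land_e0: "land e0 = a" by (simp add: land_def \<Omega> e0_end)

text \<open>At landing the derivative of the horizontal position is, up to sign, the wedge product of field and
  variation divided by the vertical speed, which is where \<open>wedge_formula\<close> enters. The horizontal
  component \<open>\<xi>\<close> of the initial variation does not occur in the result: at the fold it is parallel to
  the field, so its wedge product with the field vanishes.\<close>

lemma land'_e0:
  assumes h: "fst h = (\<xi>, 0)"
  shows "land' e0 h = - integral {0..\<tau>0} (\<lambda>t. exp (integral {t..\<tau>0} (\<lambda>t. fst (Fld' (\<phi> t e0) ((1, 0), 0)) + snd (Fld' (\<phi> t e0) ((0, 1), 0)))) *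
      (fst (Fld (\<phi> t e0)) * snd (Fld' (\<phi> t e0) (0, snd h)) - snd (Fld (\<phi> t e0)) * fst (Fld' (\<phi> t e0) (0, snd h))))
      / snd (Fld ((a, 0), 0))"
proof -
  have inB: "((a, 0), 0) \<in> B" using stay_in_G[OF e0_stay, of \<tau>0] \<tau>0 e0_end by simp
  have X1: "X (\<phi> \<tau>0 e0) = (Fld ((a, 0), 0), 0)" using X_eq[OF inB] by (simp add: e0_end)
  show ?thesis
    unfolding wedge_formula[OF h, symmetric]
    using end_g by (simp add: land'_def \<Omega> X1 field_simps)
qed

lemma land'_e0_zero: "land' e0 ((1, 0), 0) = 0"
  using land'_e0[of "((1, 0), 0)" 1] by (simp add: blinfun.zero_right zero_prod_def[symmetric])

text \<open>At a visible fold the height has positive second derivative along the flow, so an orbit that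
  starts on the axis with nonnegative vertical speed rises.\<close>

lemma orbit_rises:
  "\<forall>\<^sub>F e in nhds e0. snd (fst e) = 0 \<longrightarrow> 0 \<le> snd (Fld e) \<longrightarrow>
     (\<forall>t. 0 < t \<and> t < \<tau> e \<longrightarrow> 0 < snd (fst (\<phi> t e)))"
proof -
  define Q where "Q e = snd (Fld' e (Fld e, 0))" for e
  have cQ: "continuous_on UNIV Q"
    unfolding Q_def by (intro continuous_intros blinfun.continuous_on Fld'_cont Fld_cont)
  have Q0: "0 < Q e0"
  proof -
    have E: "(Fld e0, 0) = fst (Fld e0) *\<^sub>R ((1, 0), 0)" using fold_g by (simp add: prod_eq_iff)
    have "Q e0 = snd (Fld' e0 (fst (Fld e0) *\<^sub>R ((1, 0), 0)))" by (simp only: Q_def E[symmetric])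
    also have "\<dots> = fst (Fld e0) * snd (Fld' e0 ((1, 0), 0))"
      by (simp only: blinfun.scaleR_right snd_scaleR real_scaleR_def)
    finally show ?thesis using fold_vis by (simp only:)
  qed
  have "open {e. 0 < Q e}" by (intro open_Collect_less continuous_intros cQ)
  then obtain \<rho> where \<rho>: "0 < \<rho>" "ball e0 \<rho> \<subseteq> {e. 0 < Q e}" using Q0 open_contains_ball by blast
  \<comment> \<open>Up to time \<open>t1\<close> the second derivative of the height stays positive; after it the reference orbit is
    bounded away from the axis until shortly before landing.\<close>
  define t1 where "t1 = min ((\<tau>0 - \<delta>) / 2) (\<rho> / (2 * (M + 1)))"
  have M: "0 \<le> M" by (rule M_nonneg)
  have half: "t1 \<le> (\<tau>0 - \<delta>) / 2" unfolding t1_def by (rule min.cobounded1)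
  have "0 < \<rho> / (2 * (M + 1))" using \<rho>(1) M by (intro divide_pos_pos) auto
  then have "0 < t1" unfolding t1_def using \<delta> by simp
  moreover have "t1 < \<tau>0 - \<delta>" using half \<delta>(2) by (simp add: field_simps)
  moreover from this have "t1 \<le> T" using \<delta> by simp
  ultimately have t1: "0 < t1" "t1 < \<tau>0 - \<delta>" "t1 \<le> T" by simp_all
  have Mt1: "M * t1 \<le> \<rho> / 2"
  proof -
    have "M * t1 \<le> (M + 1) * t1" using t1 by simp
    also have "\<dots> \<le> (M + 1) * (\<rho> / (2 * (M + 1)))"
      using M unfolding t1_def by (intro mult_left_mono min.cobounded2) auto
    also have "\<dots> = \<rho> / 2"
    proof -
      have "M + 1 \<noteq> 0" using M by simp
      then show ?thesis by (simp only: times_divide_eq_right nonzero_mult_div_cancel_left mult.commute[of 2]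
            mult_divide_mult_cancel_left_if) simp
    qed
    finally show ?thesis .
  qed
  define y where "y t e = snd (fst (\<phi> t e))" for t e
  have cy: "continuous_on {0..T} (\<lambda>t. y t e)" for e
    unfolding y_def by (intro continuous_intros flow_cont_time)
  have "\<exists>tm\<in>{t1..\<tau>0 - \<delta>}. \<forall>t\<in>{t1..\<tau>0 - \<delta>}. y tm e0 \<le> y t e0"
    by (rule continuous_attains_inf) (use t1 \<tau>0 \<delta> in \<open>auto intro!: continuous_on_subset[OF cy]\<close>)
  then obtain tm where tm: "tm \<in> {t1..\<tau>0 - \<delta>}" "\<And>t. t \<in> {t1..\<tau>0 - \<delta>} \<Longrightarrow> y tm e0 \<le> y t e0" by blast
  have ym: "0 < y tm e0" using e0_up[of tm] tm(1) t1 \<delta> by (simp add: y_def)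
  define \<eta> where "\<eta> = min (\<rho> / 2) (y tm e0) * exp (- (L * T))"
  have \<eta>: "0 < \<eta>" using \<rho> ym by (simp add: \<eta>_def)
  have "\<forall>\<^sub>F e in nhds e0. e \<in> \<Omega> \<and> dist e e0 < \<eta>"
    using \<eta> by (intro eventually_conj eventually_nhds_in_open \<Omega>) (auto simp: eventually_nhds_metric)
  then show ?thesis
  proof eventually_elim
    case (elim e)
    have e: "e \<in> \<Omega>" "e \<in> stay" using elim in_stay by auto
    have close: "norm (e - e0) * exp (L * T) < min (\<rho> / 2) (y tm e0)"
    proof -
      have "norm (e - e0) * exp (L * T) < \<eta> * exp (L * T)" using elim by (simp add: dist_norm)
      also have "\<dots> = min (\<rho> / 2) (y tm e0)" by (simp add: \<eta>_def exp_minus)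
      finally show ?thesis .
    qed
    show ?case
    proof (intro impI allI)
      fix t assume ax: "snd (fst e) = 0" "0 \<le> snd (Fld e)" and t: "0 < t \<and> t < \<tau> e"
      have tT: "t < T" using t hit_range[OF e(1)] by simp
      consider "t \<le> t1" | "t1 < t" "t \<le> \<tau>0 - \<delta>" | "\<tau>0 - \<delta> < t" by linarith
      then show "0 < snd (fst (\<phi> t e))"
      proof cases
        case 1
        define \<gamma> where "\<gamma> t = snd (Fld (\<phi> t e))" for t
        have Qpos: "0 < Q (\<phi> x e)" if "x \<in> {0..t1}" for x
        proof -
          have "norm (\<phi> x e - \<phi> 0 e0) \<le> norm (e - e0) * exp (L * T) + M * \<bar>x - 0\<bar>"
            using that t1 T_pos by (intro flow_joint_estimate) auto
          also have "\<dots> < \<rho> / 2 + \<rho> / 2"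
          proof (rule add_less_le_mono)
            show "norm (e - e0) * exp (L * T) < \<rho> / 2" using close by simp
            have "M * \<bar>x - 0\<bar> \<le> M * t1" using that M by (intro mult_left_mono) auto
            then show "M * \<bar>x - 0\<bar> \<le> \<rho> / 2" using Mt1 by simp
          qed
          finally show ?thesis using \<rho>(2) by (auto simp: flow_0 dist_norm norm_minus_commute)
        qed
        have dg: "(\<gamma> has_real_derivative Q (\<phi> x e)) (at x)" if "0 < x" "x < T" for x
        proof -
          have inB: "\<phi> x e \<in> B" using stay_in_G[OF e(2), of x] that by simp
          have "((\<lambda>t. \<phi> t e) has_derivative (\<lambda>s. s *\<^sub>R X (\<phi> x e))) (at x)"
            using flow_deriv_at[OF that, of e] by (simp add: has_vector_derivative_def)
          from has_derivative_compose[OF this Fld_deriv]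
          have "((\<lambda>t. Fld (\<phi> t e)) has_derivative (\<lambda>s. Fld' (\<phi> x e) (s *\<^sub>R X (\<phi> x e)))) (at x)" .
          then have "((\<lambda>t. Fld (\<phi> t e)) has_vector_derivative Fld' (\<phi> x e) (Fld (\<phi> x e), 0)) (at x)"
            using X_eq[OF inB] by (simp only: has_vector_derivative_def blinfun.scaleR_right)
          from bounded_linear.has_vector_derivative[OF bounded_linear_snd this] show ?thesis
            by (simp add: \<gamma>_def[abs_def] Q_def has_real_derivative_iff_has_vector_derivative)
        qed
        have cg: "continuous_on {0..T} \<gamma>"
          unfolding \<gamma>_def by (intro continuous_intros continuous_on_compose2[OF Fld_cont[of UNIV] flow_cont_time]) auto
        have gpos: "0 < \<gamma> x" if "0 < x" "x \<le> t1" for x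
        proof -
          have "\<gamma> 0 < \<gamma> x"
          proof (rule DERIV_pos_imp_increasing_open[OF that(1)])
            show "\<exists>l. (\<gamma> has_real_derivative l) (at w) \<and> 0 < l" if "0 < w" "w < x" for w
              using dg[of w] Qpos[of w] that \<open>x \<le> t1\<close> t1 by (intro exI[of _ "Q (\<phi> w e)"]) auto
            show "continuous_on {0..x} \<gamma>" by (rule continuous_on_subset[OF cg]) (use that t1 in auto)
          qed
          then show ?thesis using ax by (simp add: \<gamma>_def flow_0)
        qed
        have "y 0 e < y t e"
        proof (rule DERIV_pos_imp_increasing_open[where f = "\<lambda>t. y t e" and a = 0 and b = t])
          show "0 < t" using t by simp
          show "\<exists>l. ((\<lambda>t. y t e) has_real_derivative l) (at w) \<and> 0 < l" if "0 < w" "w < t" for w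
          proof -
            have w: "0 < w" "w < T" using that tT by auto
            have inB: "\<phi> w e \<in> B" using stay_in_G[OF e(2), of w] w by simp
            have "((\<lambda>t. y t e) has_vector_derivative snd (fst (X (\<phi> w e)))) (at w)"
              unfolding y_def
              by (intro bounded_linear.has_vector_derivative[OF bounded_linear_snd]
                  bounded_linear.has_vector_derivative[OF bounded_linear_fst] flow_deriv_at w)
            then show ?thesis using gpos[of w] that 1 X_eq[OF inB]
              by (intro exI[of _ "\<gamma> w"]) (simp add: \<gamma>_def has_real_derivative_iff_has_vector_derivative)
          qed
          show "continuous_on {0..t} (\<lambda>t. y t e)" by (rule continuous_on_subset[OF cy]) (use tT in auto)
        qed
        then show ?thesis using ax by (simp add: y_def flow_0)
      next
        case 2
        have "\<bar>y t e - y t e0\<bar> \<le> norm (\<phi> t e - \<phi> t e0)"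
        proof -
          have "\<bar>y t e - y t e0\<bar> = norm (snd (fst (\<phi> t e - \<phi> t e0)))" by (simp add: y_def)
          also have "\<dots> \<le> norm (fst (\<phi> t e - \<phi> t e0))" by (rule norm_snd_bound)
          also have "\<dots> \<le> norm (\<phi> t e - \<phi> t e0)" by (rule norm_fst_bound)
          finally show ?thesis .
        qed
        also have "\<dots> \<le> norm (e - e0) * exp (L * T)" using t tT by (intro flow_lipschitz) auto
        also have "\<dots> < y tm e0" using close by simp
        also have "\<dots> \<le> y t e0" using 2 by (intro tm) auto
        finally show ?thesis by (simp add: y_def)
      next
        case 3
        have "\<bar>t - \<tau>0\<bar> \<le> \<delta>" using 3 t hit_zero[OF e(1)] by auto
        then show ?thesis using hit_before[OF e(1)] t by blast
      qed
    qed
  qed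
qed

text \<open>Inside the time interval the reference orbit is above the axis, hence at low height only near its
  ends; compactness makes this uniform.\<close>

lemma axis_near:
  assumes "0 < \<rho>"
  obtains d where "0 < d" "\<And>t. t \<in> {0..\<tau>0 + \<delta>} \<Longrightarrow> \<bar>snd (fst (\<phi> t e0))\<bar> < d \<Longrightarrow>
    dist (fst (\<phi> t e0)) (- a, 0) < \<rho> \<or> dist (fst (\<phi> t e0)) (a, 0) < \<rho>"
proof -
  define G where "G t = fst (\<phi> t e0)" for t
  define k where "k t = min (dist (G t) (- a, 0)) (dist (G t) (a, 0))" for t
  have cG: "continuous_on {0..\<tau>0 + \<delta>} G"
    unfolding G_def by (intro continuous_intros continuous_on_subset[OF flow_cont_time]) (use \<delta> in auto)
  define C where "C = {0..\<tau>0 + \<delta>} \<inter> k -` {\<rho>..}"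
  have "closed C" unfolding C_def k_def
    by (intro continuous_closed_preimage continuous_intros cG)
  then have comp: "compact C"
    unfolding C_def by (metis Int_lower1 bounded_closed_interval bounded_subset compact_eq_bounded_closed)
  have nz: "snd (G t) \<noteq> 0" if "t \<in> C" for t
  proof
    assume z: "snd (G t) = 0"
    have t: "t \<in> {0..\<tau>0 + \<delta>}" "\<rho> \<le> k t" using that by (auto simp: C_def)
    have "\<not> (0 < t \<and> t < \<tau>0)" using e0_up[of t] z by (auto simp: G_def)
    moreover have "\<not> \<tau>0 < t" using hit_after[OF \<Omega>(2), of t] \<Omega>(3) z t by (auto simp: G_def)
    ultimately have "t = 0 \<or> t = \<tau>0" using t by fastforce
    then have "k t = 0"
      using e0_end by (auto simp: k_def G_def flow_0)
    then show False using t assms by simp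
  qed
  show thesis
  proof (cases "C = {}")
    case True
    then show ?thesis using that[of 1] by (force simp: C_def k_def G_def)
  next
    case False
    have "continuous_on C (\<lambda>t. \<bar>snd (G t)\<bar>)"
      by (intro continuous_intros continuous_on_subset[OF cG]) (auto simp: C_def)
    from continuous_attains_inf[OF comp False this]
    obtain m where m: "m \<in> C" "\<And>t. t \<in> C \<Longrightarrow> \<bar>snd (G m)\<bar> \<le> \<bar>snd (G t)\<bar>" by blast
    show ?thesis
    proof (rule that[of "\<bar>snd (G m)\<bar>"])
      show "0 < \<bar>snd (G m)\<bar>" using nz[OF m(1)] by simp
      fix t assume t: "t \<in> {0..\<tau>0 + \<delta>}" "\<bar>snd (fst (\<phi> t e0))\<bar> < \<bar>snd (G m)\<bar>"
      then have "t \<notin> C" using m(2)[of t] by (auto simp: G_def)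
      then show "dist (fst (\<phi> t e0)) (- a, 0) < \<rho> \<or> dist (fst (\<phi> t e0)) (a, 0) < \<rho>"
        using t by (auto simp: C_def k_def G_def min_def split: if_splits)
    qed
  qed
qed

lemma cycle0_near:
  assumes "infdist p cycle0 < \<epsilon>"
  obtains t \<sigma> where "t \<in> {0..\<tau>0}" "\<sigma> = 1 \<or> \<sigma> = (-1::real)" "dist p (\<sigma> *\<^sub>R fst (\<phi> t e0)) < \<epsilon>"
proof -
  have ne: "cycle0 \<noteq> {}" using \<tau>0 by (auto simp: cycle0_def)
  have "\<exists>q\<in>cycle0. dist p q < \<epsilon>"
  proof -
    have "Inf (dist p ` cycle0) < \<epsilon>" using assms ne by (simp add: infdist_def)
    then show ?thesis using ne cInf_lessD[of "dist p ` cycle0" \<epsilon>] by blast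
  qed
  then obtain q where q: "q \<in> cycle0" "dist p q < \<epsilon>" by blast
  show thesis
    using q(1) unfolding cycle0_def
  proof
    assume "q \<in> (\<lambda>t. fst (\<phi> t e0)) ` {0..\<tau>0}"
    then obtain t where "t \<in> {0..\<tau>0}" "q = fst (\<phi> t e0)" by blast
    then show thesis using that[of t 1] q(2) by simp
  next
    assume "q \<in> uminus ` (\<lambda>t. fst (\<phi> t e0)) ` {0..\<tau>0}"
    then obtain t where "t \<in> {0..\<tau>0}" "q = - fst (\<phi> t e0)" by blast
    then show thesis using that[of t "-1"] q(2) by simp
  qed
qed

lemma e0_height_nonneg: "t \<in> {0..\<tau>0} \<Longrightarrow> 0 \<le> snd (fst (\<phi> t e0))"
  using e0_up[of t] e0_end flow_0[of e0] by (cases "t = 0"; cases "t = \<tau>0") auto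

lemma cycle0_axis:
  assumes "0 < r"
  obtains \<epsilon> where "0 < \<epsilon>" "\<And>p. infdist p cycle0 < \<epsilon> \<Longrightarrow> snd p = 0 \<Longrightarrow> \<bar>fst p + a\<bar> < r \<or> \<bar>fst p - a\<bar> < r"
proof -
  obtain d where d: "0 < d" "\<And>t. t \<in> {0..\<tau>0 + \<delta>} \<Longrightarrow> \<bar>snd (fst (\<phi> t e0))\<bar> < d \<Longrightarrow>
    dist (fst (\<phi> t e0)) (- a, 0) < r / 2 \<or> dist (fst (\<phi> t e0)) (a, 0) < r / 2"
    using axis_near[of "r / 2"] assms by auto
  show thesis
  proof (rule that[of "min d (r / 2)"])
    fix p assume p: "infdist p cycle0 < min d (r / 2)" "snd p = 0"
    then obtain t \<sigma> where t: "t \<in> {0..\<tau>0}" "\<sigma> = 1 \<or> \<sigma> = (-1::real)" "dist p (\<sigma> *\<^sub>R fst (\<phi> t e0)) < min d (r / 2)"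
      using cycle0_near by blast
    define q where "q = fst (\<phi> t e0)"
    have "\<bar>snd p - snd (\<sigma> *\<^sub>R q)\<bar> \<le> dist p (\<sigma> *\<^sub>R q)"
      using dist_snd_le[of p "\<sigma> *\<^sub>R q"] by (simp add: dist_real_def)
    then have "\<bar>snd q\<bar> < d" using t p(2) by (auto simp: q_def)
    then have "dist q (- a, 0) < r / 2 \<or> dist q (a, 0) < r / 2" using d(2)[of t] t(1) \<delta> by (simp add: q_def)
    then have 1: "\<bar>fst q + a\<bar> < r / 2 \<or> \<bar>fst q - a\<bar> < r / 2"
      using dist_fst_le[of q "(- a, 0)"] dist_fst_le[of q "(a, 0)"] by (auto simp: dist_real_def)
    have 2: "\<bar>fst p - \<sigma> * fst q\<bar> < r / 2"
      using dist_fst_le[of p "\<sigma> *\<^sub>R q"] t(3) by (simp add: dist_real_def q_def)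
    show "\<bar>fst p + a\<bar> < r \<or> \<bar>fst p - a\<bar> < r"
      using t(2)
    proof
      assume "\<sigma> = 1"
      then have "\<bar>fst p - fst q\<bar> < r / 2" using 2 by simp
      then show ?thesis using 1 by (smt (verit) field_sum_of_halves)
    next
      assume "\<sigma> = -1"
      then have "\<bar>fst p + fst q\<bar> < r / 2" using 2 by simp
      then show ?thesis using 1 by (smt (verit) field_sum_of_halves)
    qed
  qed (use d assms in auto)
qed

end

section \<open>Orbits starting near the reference cycle\<close>

lemma first_zero:
  fixes h :: "real \<Rightarrow> real"
  assumes cont: "continuous_on {0..c} h" and c: "0 \<le> c" and h: "0 < h 0" "h c < 0"
  obtains b where "0 < b" "b < c" "h b = 0" "\<And>t. 0 \<le> t \<Longrightarrow> t < b \<Longrightarrow> 0 < h t"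
proof -
  define A where "A = {0..c} \<inter> h -` {0}"
  have cl: "closed A" unfolding A_def by (rule continuous_closed_preimage[OF cont]) auto
  have "\<exists>x\<ge>0. x \<le> c \<and> h x = 0" by (rule IVT2') (use h c cont in auto)
  then have ne: "A \<noteq> {}" by (auto simp: A_def)
  have bb: "bdd_below A" by (auto simp: A_def intro!: bdd_belowI[of _ 0])
  define b where "b = Inf A"
  have bA: "b \<in> A" unfolding b_def by (rule closed_contains_Inf[OF ne bb cl])
  have pos: "0 < h t" if "0 \<le> t" "t < b" for t
  proof (rule ccontr)
    assume "\<not> 0 < h t"
    then have "\<exists>x\<ge>0. x \<le> t \<and> h x = 0"
      by (intro IVT2') (use h that bA in \<open>auto simp: A_def intro!: continuous_on_subset[OF cont]\<close>)
    then obtain x where x: "0 \<le> x" "x \<le> t" "h x = 0" by blast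
    then have "x \<in> A" using \<open>t < b\<close> bA by (auto simp: A_def)
    then have "b \<le> x" unfolding b_def using bb by (simp add: cInf_lower)
    then show False using x(2) \<open>t < b\<close> by simp
  qed
  have "b \<noteq> 0" "b \<noteq> c" using bA h by (auto simp: A_def)
  then show thesis using that[of b] bA pos by (auto simp: A_def)
qed

definition J :: "real \<times> (real^'m) \<Rightarrow> plane \<times> (real^'m)" where "J q = ((fst q, 0), snd q)"

lemma J_cont: "continuous_on A (J :: real \<times> (real^'m) \<Rightarrow> _)"
  unfolding J_def by (intro continuous_intros)

lemma isCont_nhds: "isCont f x \<Longrightarrow> (f \<longlongrightarrow> f x) (nhds x)"
  by (simp add: isCont_def tendsto_at_iff_tendsto_nhds)

context critical_hit begin

lemma flow_semigroup:
  assumes "0 \<le> t" "0 \<le> s'" "s' + t \<le> T"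
  shows "\<phi> t (\<phi> s' x) = \<phi> (s' + t) x"
proof -
  have "\<phi> (s' + t) x = \<phi> t (\<phi> s' x)"
  proof (rule flow_unique[where b = "T - s'" and z = "\<lambda>t. \<phi> (s' + t) x"])
    show "continuous_on {0..T - s'} (\<lambda>t. \<phi> (s' + t) x)"
      by (intro continuous_on_compose2[OF flow_cont_time] continuous_intros) (use assms in auto)
    fix w assume w: "0 < w" "w < T - s'"
    have "((\<lambda>t. s' + t) has_vector_derivative 1) (at w)" by (auto intro!: derivative_eq_intros)
    moreover have "((\<lambda>t. \<phi> t x) has_vector_derivative X (\<phi> (s' + w) x)) (at (s' + w))"
      using w assms by (intro flow_deriv_at) auto
    ultimately have "(((\<lambda>t. \<phi> t x) \<circ> (\<lambda>t. s' + t)) has_vector_derivative 1 *\<^sub>R X (\<phi> (s' + w) x)) (at w)"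
      by (rule vector_diff_chain_at)
    then show "((\<lambda>t. \<phi> (s' + t) x) has_vector_derivative X (\<phi> (s' + w) x)) (at w)" by (simp add: o_def)
  qed (use assms in auto)
  then show ?thesis by simp
qed

text \<open>A point above the axis and near \<open>\<Gamma>\<^sub>0\<close> is near a point of the upper half of \<open>\<Gamma>\<^sub>0\<close>; if the nearest
  point lies on the lower half, then it is close to the axis and hence to an end point of the upper half.
  From there the orbit shadows the reference orbit until it goes below the axis, and it first
  reaches the axis where the reference orbit is low.\<close>

lemma cycle0_lands:
  assumes r: "0 < r"
  obtains \<epsilon> where "0 < \<epsilon>"
    "\<forall>\<^sub>F \<alpha> in nhds 0. \<forall>p. infdist p cycle0 < \<epsilon> \<longrightarrow> 0 < snd p \<longrightarrow> (\<exists>b. 0 < b \<and> b \<le> T \<and>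
       (\<forall>t\<in>{0..b}. \<phi> t (p, \<alpha>) \<in> B) \<and> (\<forall>t. 0 < t \<and> t < b \<longrightarrow> 0 < snd (fst (\<phi> t (p, \<alpha>)))) \<and>
       snd (fst (\<phi> b (p, \<alpha>))) = 0 \<and>
       (\<bar>fst (fst (\<phi> b (p, \<alpha>))) + a\<bar> < r \<or> \<bar>fst (fst (\<phi> b (p, \<alpha>))) - a\<bar> < r))"
proof -
  define G where "G t = fst (\<phi> t e0)" for t
  have Gpair: "\<phi> t e0 = (G t, 0)" if "t \<in> {0..T}" for t
    using flow_param[OF that, of e0] by (simp add: G_def prod_eq_iff)
  have "compact ((\<lambda>t. \<phi> t e0) ` {0..T})" by (intro compact_continuous_image flow_cont_time) auto
  moreover have "(\<lambda>t. \<phi> t e0) ` {0..T} \<subseteq> B" using stay_in_G[OF e0_stay] by auto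
  ultimately obtain \<mu> where \<mu>: "\<mu> > 0" "(\<Union>y\<in>(\<lambda>t. \<phi> t e0) ` {0..T}. ball y \<mu>) \<subseteq> B"
    using compact_subset_open_imp_ball_epsilon_subset[OF _ G_open] by blast
  define T' where "T' = \<tau>0 + \<delta>"
  have T': "0 < T'" "T' \<le> T" "\<tau>0 < T'" using \<delta> \<tau>0 by (auto simp: T'_def)
  define yT where "yT = - snd (G T')"
  have yT: "0 < yT" using hit_after[OF \<Omega>(2), of T'] \<Omega>(3) \<delta> by (simp add: yT_def G_def T'_def)
  obtain d1 where d1: "0 < d1" "\<And>t. t \<in> {0..\<tau>0 + \<delta>} \<Longrightarrow> \<bar>snd (fst (\<phi> t e0))\<bar> < d1 \<Longrightarrow>
      dist (fst (\<phi> t e0)) (- a, 0) < r / 2 \<or> dist (fst (\<phi> t e0)) (a, 0) < r / 2"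
    using axis_near[of "r / 2"] r by auto
  define \<kappa> where "\<kappa> = min (min \<mu> yT) (min d1 (r / 2))"
  have \<kappa>: "0 < \<kappa>" "\<kappa> \<le> \<mu>" "\<kappa> \<le> yT" "\<kappa> \<le> d1" "\<kappa> \<le> r / 2" using \<mu> yT d1 r by (auto simp: \<kappa>_def)
  define \<eta> where "\<eta> = \<kappa> * exp (- (L * T)) / 2"
  have \<eta>: "0 < \<eta>" using \<kappa> by (simp add: \<eta>_def)
  have \<eta>\<kappa>: "2 * \<eta> * exp (L * T) = \<kappa>" by (simp add: \<eta>_def exp_minus)
  obtain d2 where d2: "0 < d2" "\<And>t. t \<in> {0..\<tau>0 + \<delta>} \<Longrightarrow> \<bar>snd (fst (\<phi> t e0))\<bar> < d2 \<Longrightarrow>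
      dist (fst (\<phi> t e0)) (- a, 0) < \<eta> / 2 \<or> dist (fst (\<phi> t e0)) (a, 0) < \<eta> / 2"
    using axis_near[of "\<eta> / 2"] \<eta> by auto
  define \<epsilon> where "\<epsilon> = min (\<eta> / 2) d2"
  have \<epsilon>: "0 < \<epsilon>" "\<epsilon> \<le> \<eta> / 2" "\<epsilon> \<le> d2" using \<eta> d2 by (auto simp: \<epsilon>_def)
  have start: "\<exists>s'\<in>{0..\<tau>0}. norm (p - G s') < \<eta>" if p: "infdist p cycle0 < \<epsilon>" "0 < snd p" for p
  proof -
    obtain t \<sigma> where t: "t \<in> {0..\<tau>0}" "\<sigma> = 1 \<or> \<sigma> = (-1::real)" "dist p (\<sigma> *\<^sub>R fst (\<phi> t e0)) < \<epsilon>"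
      using cycle0_near[OF p(1)] by metis
    show ?thesis
      using t(2)
    proof
      assume "\<sigma> = 1"
      then have "norm (p - G t) < \<eta>" using t(3) \<epsilon> \<eta> by (simp add: G_def dist_norm)
      then show ?thesis using t(1) by blast
    next
      assume s1: "\<sigma> = -1"
      have gp: "0 \<le> snd (G t)" using e0_height_nonneg[OF t(1)] by (simp add: G_def)
      have "\<bar>snd p + snd (G t)\<bar> < \<epsilon>"
        using dist_snd_le[of p "- G t"] t(3) s1 by (simp add: G_def dist_real_def)
      then have "\<bar>snd (G t)\<bar> < d2" using gp p(2) \<epsilon> by linarith
      then consider "dist (G t) (- a, 0) < \<eta> / 2" | "dist (G t) (a, 0) < \<eta> / 2"
        using d2(2)[of t] t(1) \<delta> by (auto simp: G_def)
      then show ?thesis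
      proof cases
        case 1
        have "dist p (a, 0) \<le> dist p (- G t) + dist (- G t) (a, 0)" by (rule dist_triangle)
        also have "dist (- G t) (a, 0) = dist (G t) (- a, 0)"
          using dist_minus[of "G t" "(- a, 0)"] by simp
        finally have "dist p (a, 0) < \<eta>" using 1 t(3) s1 \<epsilon> by (simp add: G_def)
        moreover have "G \<tau>0 = (a, 0)" by (simp add: G_def e0_end)
        ultimately show ?thesis using \<tau>0 by (intro bexI[of _ \<tau>0]) (auto simp: dist_norm)
      next
        case 2
        have "dist p (- a, 0) \<le> dist p (- G t) + dist (- G t) (- a, 0)" by (rule dist_triangle)
        also have "dist (- G t) (- a, 0) = dist (G t) (a, 0)"
          using dist_minus[of "G t" "(a, 0)"] by simp
        finally have "dist p (- a, 0) < \<eta>" using 2 t(3) s1 \<epsilon> by (simp add: G_def)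
        moreover have "G 0 = (- a, 0)" by (simp add: G_def flow_0)
        ultimately show ?thesis using \<tau>0 by (intro bexI[of _ 0]) (auto simp: dist_norm)
      qed
    qed
  qed
  have land: "\<exists>b. 0 < b \<and> b \<le> T \<and>
       (\<forall>t\<in>{0..b}. \<phi> t (p, \<alpha>) \<in> B) \<and> (\<forall>t. 0 < t \<and> t < b \<longrightarrow> 0 < snd (fst (\<phi> t (p, \<alpha>)))) \<and>
       snd (fst (\<phi> b (p, \<alpha>))) = 0 \<and>
       (\<bar>fst (fst (\<phi> b (p, \<alpha>))) + a\<bar> < r \<or> \<bar>fst (fst (\<phi> b (p, \<alpha>))) - a\<bar> < r)"
    if \<alpha>: "norm \<alpha> < \<eta>" and p: "infdist p cycle0 < \<epsilon>" "0 < snd p" for \<alpha> p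
  proof -
    obtain s' where s': "s' \<in> {0..\<tau>0}" "norm (p - G s') < \<eta>" using start[OF p] by blast
    define b1 where "b1 = T' - s'"
    have b1: "0 < b1" "s' + b1 \<le> T" using s' T' by (auto simp: b1_def)
    have close: "norm (\<phi> t (p, \<alpha>) - \<phi> (s' + t) e0) < \<kappa>" if "t \<in> {0..b1}" for t
    proof -
      have "norm ((p, \<alpha>) - \<phi> s' e0) = norm (p - G s', \<alpha>)" using Gpair[of s'] s' T' by simp
      also have "\<dots> \<le> norm (p - G s') + norm \<alpha>" by (rule norm_Pair_le)
      also have "\<dots> < 2 * \<eta>" using s' \<alpha> by simp
      finally have n: "norm ((p, \<alpha>) - \<phi> s' e0) < 2 * \<eta>" .
      have "norm (\<phi> t (p, \<alpha>) - \<phi> t (\<phi> s' e0)) \<le> norm ((p, \<alpha>) - \<phi> s' e0) * exp (L * T)"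
        using that b1 s' by (intro flow_lipschitz) auto
      also have "\<dots> < 2 * \<eta> * exp (L * T)" using n by simp
      finally show ?thesis using flow_semigroup[of t s' e0] that b1 s' \<eta>\<kappa> by auto
    qed
    have comp: "\<bar>snd (fst (\<phi> t (p, \<alpha>))) - snd (G (s' + t))\<bar> < \<kappa>" "\<bar>fst (fst (\<phi> t (p, \<alpha>))) - fst (G (s' + t))\<bar> < \<kappa>"
      if "t \<in> {0..b1}" for t
    proof -
      define v where "v = \<phi> t (p, \<alpha>) - \<phi> (s' + t) e0"
      have "norm (fst v) < \<kappa>" using close[OF that] norm_fst_bound[of v] by (simp add: v_def)
      then have "norm (snd (fst v)) < \<kappa>" "norm (fst (fst v)) < \<kappa>"
        using norm_snd_bound[of "fst v"] norm_fst_bound[of "fst v"] by simp_all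
      then show "\<bar>snd (fst (\<phi> t (p, \<alpha>))) - snd (G (s' + t))\<bar> < \<kappa>" "\<bar>fst (fst (\<phi> t (p, \<alpha>))) - fst (G (s' + t))\<bar> < \<kappa>"
        by (simp_all add: v_def G_def)
    qed
    obtain b where b: "0 < b" "b < b1" "snd (fst (\<phi> b (p, \<alpha>))) = 0" "\<And>t. 0 \<le> t \<Longrightarrow> t < b \<Longrightarrow> 0 < snd (fst (\<phi> t (p, \<alpha>)))"
    proof (rule first_zero[of b1 "\<lambda>t. snd (fst (\<phi> t (p, \<alpha>)))"])
      show "continuous_on {0..b1} (\<lambda>t. snd (fst (\<phi> t (p, \<alpha>))))"
        by (intro continuous_intros continuous_on_subset[OF flow_cont_time]) (use b1 s' in auto)
      show "0 < snd (fst (\<phi> 0 (p, \<alpha>)))" using p(2) by (simp add: flow_0)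
      show "snd (fst (\<phi> b1 (p, \<alpha>))) < 0"
        using comp(1)[of b1] b1 \<kappa>(3) by (auto simp: b1_def yT_def)
    qed (use b1 in auto)
    have inB: "\<phi> t (p, \<alpha>) \<in> B" if "t \<in> {0..b}" for t
    proof -
      have "dist (\<phi> (s' + t) e0) (\<phi> t (p, \<alpha>)) < \<mu>"
        using close[of t] that b \<kappa>(2) by (auto simp: dist_norm norm_minus_commute)
      then have "\<phi> t (p, \<alpha>) \<in> ball (\<phi> (s' + t) e0) \<mu>" by simp
      moreover have "s' + t \<in> {0..T}" using that b b1 s' by auto
      ultimately show ?thesis using \<mu>(2) by blast
    qed
    have "\<bar>snd (G (s' + b))\<bar> < d1" using comp(1)[of b] b \<kappa>(4) by auto
    moreover have "s' + b \<in> {0..\<tau>0 + \<delta>}" using b s' by (auto simp: b1_def T'_def)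
    ultimately have "dist (G (s' + b)) (- a, 0) < r / 2 \<or> dist (G (s' + b)) (a, 0) < r / 2"
      using d1(2) by (simp add: G_def)
    then have "\<bar>fst (G (s' + b)) + a\<bar> < r / 2 \<or> \<bar>fst (G (s' + b)) - a\<bar> < r / 2"
      using dist_fst_le[of "G (s' + b)" "(- a, 0)"] dist_fst_le[of "G (s' + b)" "(a, 0)"] by (auto simp: dist_real_def)
    moreover have "\<bar>fst (fst (\<phi> b (p, \<alpha>))) - fst (G (s' + b))\<bar> < r / 2"
      using comp(2)[of b] b \<kappa>(5) by auto
    ultimately have "\<bar>fst (fst (\<phi> b (p, \<alpha>))) + a\<bar> < r \<or> \<bar>fst (fst (\<phi> b (p, \<alpha>))) - a\<bar> < r"
      by (smt (verit) field_sum_of_halves)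
    then show ?thesis using b inB b1 s' by (intro exI[of _ b]) auto
  qed
  show thesis
  proof (rule that[OF \<epsilon>(1)])
    have "\<forall>\<^sub>F \<alpha> in nhds (0::real^'m). norm \<alpha> < \<eta>"
      using \<eta> by (auto simp: eventually_nhds_metric dist_norm)
    then show "\<forall>\<^sub>F \<alpha> in nhds 0. \<forall>p. infdist p cycle0 < \<epsilon> \<longrightarrow> 0 < snd p \<longrightarrow> (\<exists>b. 0 < b \<and> b \<le> T \<and>
       (\<forall>t\<in>{0..b}. \<phi> t (p, \<alpha>) \<in> B) \<and> (\<forall>t. 0 < t \<and> t < b \<longrightarrow> 0 < snd (fst (\<phi> t (p, \<alpha>)))) \<and>
       snd (fst (\<phi> b (p, \<alpha>))) = 0 \<and>
       (\<bar>fst (fst (\<phi> b (p, \<alpha>))) + a\<bar> < r \<or> \<bar>fst (fst (\<phi> b (p, \<alpha>))) - a\<bar> < r))"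
      by eventually_elim (use land in blast)
  qed
qed

lemma eventually_J:
  assumes "\<forall>\<^sub>F e in nhds e0. Q e"
  shows "\<forall>\<^sub>F q in nhds (- a, 0). Q (J q)"
proof -
  obtain S where S: "open S" "e0 \<in> S" "\<And>e. e \<in> S \<Longrightarrow> Q e" using assms unfolding eventually_nhds by blast
  have "open (J -` S)" by (rule open_vimage[OF S(1) J_cont])
  moreover have "(- a, 0) \<in> J -` S" using S(2) by (simp add: J_def)
  ultimately show ?thesis unfolding eventually_nhds using S(3) by blast
qed

lemma slide_speed_near: "\<forall>\<^sub>F q in nhds (- a, 0). s * fst (Fld e0) / 2 < s * slide_speed (\<lambda>p. Fld (p, snd q)) (fst q)"
proof -
  define J' where "J' q = ((- fst q, 0::real), snd q)" for q :: "real \<times> (real^'m)"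
  define S where "S q = s * ((fst (Fld (J q)) * - snd (Fld (J' q)) - - fst (Fld (J' q)) * snd (Fld (J q)))
       / (- snd (Fld (J' q)) - snd (Fld (J q))))" for q
  have S: "s * slide_speed (\<lambda>p. Fld (p, snd q)) (fst q) = S q" for q
    by (simp add: slide_speed_def mirror_def S_def J_def J'_def)
  have iF: "isCont Fld e" for e using Fld_deriv has_derivative_continuous by blast
  have j0: "J (- a, 0) = e0" "J' (- a, 0) = ((a, 0), 0)" by (simp_all add: J_def J'_def)
  have cJ: "isCont (\<lambda>q. Fld (J q)) (- a, 0)" "isCont (\<lambda>q. Fld (J' q)) (- a, 0)"
    unfolding J_def J'_def by (intro isCont_o2[OF _ iF] continuous_intros)+
  have "isCont S (- a, 0)"
    unfolding S_def using end_g fold_g by (intro continuous_intros cJ) (simp add: j0)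
  then have "(S \<longlongrightarrow> S (- a, 0)) (nhds (- a, 0))"
    by (rule isCont_nhds)
  moreover have "s * fst (Fld e0) / 2 < S (- a, 0)" using end_g fold_g s_f by (simp add: S_def j0)
  ultimately have "\<forall>\<^sub>F q in nhds (- a, 0). s * fst (Fld e0) / 2 < S q" by (rule order_tendstoD)
  then show ?thesis by (simp add: S)
qed

lemma xT_cont: "\<alpha> \<in> \<Omega>T \<Longrightarrow> isCont xT \<alpha>"
  by (rule has_derivative_continuous[OF xT_deriv])

lemma xT_near:
  assumes "0 < d"
  shows "\<forall>\<^sub>F \<alpha> in nhds 0. \<bar>xT \<alpha> + a\<bar> < d"
proof -
  have "(xT \<longlongrightarrow> - a) (nhds 0)"
    using isCont_nhds[OF xT_cont[OF \<Omega>T(2)]] \<Omega>T(3) by simp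
  from tendstoD[OF this assms] show ?thesis by (simp add: dist_real_def)
qed

lemma land_near:
  assumes "0 < d"
  shows "\<forall>\<^sub>F e in nhds e0. \<bar>land e - a\<bar> < d"
proof -
  have "isCont land e0" by (rule has_derivative_continuous[OF land_deriv[OF \<Omega>(2)]])
  then have "(land \<longlongrightarrow> a) (nhds e0)"
    using isCont_nhds land_e0 by fastforce
  from tendstoD[OF this assms] show ?thesis by (simp add: dist_real_def)
qed

lemma hit_near:
  assumes "0 < d"
  shows "\<forall>\<^sub>F e in nhds e0. \<bar>\<tau> e - \<tau>0\<bar> < d"
proof -
  have "(\<tau> \<longlongrightarrow> \<tau>0) (nhds e0)"
    using isCont_nhds[OF hit_cont[OF \<Omega>(2)]] \<Omega>(3) by simp
  from tendstoD[OF this assms] show ?thesis by (simp add: dist_real_def)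
qed

lemma land_slope_near: "\<forall>\<^sub>F e in nhds e0. \<bar>land' e ((1, 0), 0)\<bar> < 1/2"
proof -
  have "isCont (\<lambda>e. land' e ((1, 0), 0)) e0"
    using land'_cont \<Omega> by (simp add: continuous_on_eq_continuous_at)
  then have "((\<lambda>e. land' e ((1, 0), 0)) \<longlongrightarrow> 0) (nhds e0)"
    using isCont_nhds[where f = "\<lambda>e. land' e ((1, 0), 0)" and x = e0] land'_e0_zero by simp
  from tendstoD[OF this, of "1/2"] show ?thesis by (simp add: dist_real_def)
qed

lemma right_end_near: "\<forall>\<^sub>F q in nhds (- a, 0). snd (Fld ((- fst q, 0), snd q)) < 0"
proof -
  have iF: "isCont Fld e" for e using Fld_deriv has_derivative_continuous by blast
  have "isCont (\<lambda>q::real \<times> (real^'m). snd (Fld ((- fst q, 0), snd q))) (- a, 0)"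
    by (intro continuous_intros isCont_o2[OF _ iF])
  then have "((\<lambda>q::real \<times> (real^'m). snd (Fld ((- fst q, 0), snd q))) \<longlongrightarrow> snd (Fld ((a, 0), 0))) (nhds (- a, 0))"
    using isCont_nhds[where f = "\<lambda>q. snd (Fld ((- fst q, 0), snd q))" and x = "(- a, 0)"] by simp
  from order_tendstoD(2)[OF this end_g] show ?thesis .
qed

end

section \<open>The half return system for small parameters\<close>

context critical_hit begin

lemma field_slice_lipschitz: "\<exists>L. L-lipschitz_on (cball 0 \<rho>) (\<lambda>p. Fld (p, \<alpha>))"
proof -
  obtain L where L: "L-lipschitz_on (cball 0 (\<rho> + norm \<alpha>)) Fld" using Fld_lip by blast
  have "L-lipschitz_on (cball 0 \<rho>) (\<lambda>p. Fld (p, \<alpha>))"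
  proof (rule lipschitz_onI)
    fix p q :: plane assume pq: "p \<in> cball 0 \<rho>" "q \<in> cball 0 \<rho>"
    have m: "(p, \<alpha>) \<in> cball 0 (\<rho> + norm \<alpha>)" "(q, \<alpha>) \<in> cball 0 (\<rho> + norm \<alpha>)"
      using pq norm_Pair_le[of p \<alpha>] norm_Pair_le[of q \<alpha>] by auto
    have "dist (Fld (p, \<alpha>)) (Fld (q, \<alpha>)) \<le> L * dist (p, \<alpha>) (q, \<alpha>)"
      by (rule lipschitz_onD[OF L m])
    then show "dist (Fld (p, \<alpha>)) (Fld (q, \<alpha>)) \<le> L * dist p q" by (simp add: dist_Pair_Pair)
  qed (rule lipschitz_on_nonneg[OF L])
  then show ?thesis by blast
qed

lemma orbit_field:
  assumes e: "\<And>t. t \<in> {0..b} \<Longrightarrow> \<phi> t (p, \<alpha>) \<in> B" and b: "b \<le> T" and t: "t \<in> {0..b}"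
  shows "((\<lambda>t. fst (\<phi> t (p, \<alpha>))) has_vector_derivative Fld (fst (\<phi> t (p, \<alpha>)), \<alpha>)) (at t within {0..b})"
proof -
  have tT: "t \<in> {0..T}" using b t by auto
  have "\<phi> t (p, \<alpha>) = (fst (\<phi> t (p, \<alpha>)), \<alpha>)" using flow_param[OF tT, of "(p, \<alpha>)"] by (simp add: prod_eq_iff)
  then have "fst (X (\<phi> t (p, \<alpha>))) = Fld (fst (\<phi> t (p, \<alpha>)), \<alpha>)" using X_eq[OF e[OF t]] by simp
  then have "((\<lambda>t. fst (\<phi> t (p, \<alpha>))) has_vector_derivative Fld (fst (\<phi> t (p, \<alpha>)), \<alpha>)) (at t within {0..T})"
    using bounded_linear.has_vector_derivative[OF bounded_linear_fst flow_deriv[OF tT, of "(p, \<alpha>)"]] by simp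
  then show ?thesis by (rule has_vector_derivative_within_subset) (use b in auto)
qed

lemma cycle0_uminus: "p \<in> cycle0 \<Longrightarrow> - p \<in> cycle0"
  by (auto simp: cycle0_def)

lemma infdist_cycle0_uminus: "infdist (- p) cycle0 = infdist p cycle0"
proof -
  have u: "uminus ` cycle0 = cycle0"
  proof
    show "cycle0 \<subseteq> uminus ` cycle0"
    proof
      fix q assume "q \<in> cycle0"
      then show "q \<in> uminus ` cycle0" using cycle0_uminus[of q] by (intro image_eqI[of _ _ "- q"]) auto
    qed
  qed (use cycle0_uminus in auto)
  have "dist (- p) ` cycle0 = dist (- p) ` uminus ` cycle0" by (simp only: u)
  also have "\<dots> = dist p ` cycle0" by (simp add: image_image dist_minus)
  finally show ?thesis by (simp add: infdist_def)
qed

abbreviation "system r r0 c \<epsilon> \<alpha> \<equiv> half_return (\<lambda>p. Fld (p, \<alpha>)) s a r r0 c (xT \<alpha>) (\<lambda>x. \<tau> ((x, 0), \<alpha>))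
     (\<lambda>x. land ((x, 0), \<alpha>)) (\<lambda>x t. fst (\<phi> t ((x, 0), \<alpha>))) {p. infdist p cycle0 < \<epsilon>}"

text \<open>The slope of the landing map is zero at the reference orbit, and the other requirements are strict
  inequalities there, so small sections and small parameters satisfy all of them. The bound \<open>r / 8\<close> for the
  landing point of \<open>-a\<close> and the Lipschitz constant \<open>1/2\<close> put the image of the section in the radius
  \<open>3 * r / 4\<close>.\<close>

lemma half_return_near:
  obtains r r0 c \<epsilon> where "0 < r" "0 < \<epsilon>"
    "\<forall>\<^sub>F \<alpha> in nhds 0. \<alpha> \<in> \<Omega>T \<and> (\<forall>x. \<bar>x + a\<bar> < r \<longrightarrow> ((x, 0), \<alpha>) \<in> \<Omega>) \<and> system r r0 c \<epsilon> \<alpha>"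
proof -
  define c where "c = min (s * fst (Fld e0) / 2) (\<tau>0 / 2)"
  have c: "0 < c" "c \<le> s * fst (Fld e0) / 2" "c \<le> \<tau>0 / 2" using s_f \<tau>0 by (auto simp: c_def)
  define good where "good q \<longleftrightarrow> J q \<in> \<Omega> \<and> \<bar>\<tau> (J q) - \<tau>0\<bar> < \<tau>0 / 2 \<and> \<bar>land' (J q) ((1, 0), 0)\<bar> < 1/2 \<and>
      (0 \<le> snd (Fld (J q)) \<longrightarrow> (\<forall>t. 0 < t \<and> t < \<tau> (J q) \<longrightarrow> 0 < snd (fst (\<phi> t (J q))))) \<and>
      s * fst (Fld e0) / 2 < s * slide_speed (\<lambda>p. Fld (p, snd q)) (fst q) \<and> snd (Fld ((- fst q, 0), snd q)) < 0" for q
  have "\<forall>\<^sub>F q in nhds (- a, 0). J q \<in> \<Omega>"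
    by (rule eventually_J) (rule eventually_nhds_in_open[OF \<Omega>(1,2)])
  moreover have "\<forall>\<^sub>F q in nhds (- a, 0). \<bar>\<tau> (J q) - \<tau>0\<bar> < \<tau>0 / 2"
    by (rule eventually_J, rule hit_near) (use \<tau>0 in simp)
  moreover have "\<forall>\<^sub>F q in nhds (- a, 0). \<bar>land' (J q) ((1, 0), 0)\<bar> < 1/2"
    by (rule eventually_J[OF land_slope_near])
  moreover note eventually_J[OF orbit_rises] slide_speed_near right_end_near
  ultimately have "\<forall>\<^sub>F q in nhds (- a, 0). good q"
    by eventually_elim (simp add: good_def J_def)
  then obtain d where d: "0 < d" "\<And>q. dist q (- a, 0) < d \<Longrightarrow> good q"
    unfolding eventually_nhds_metric by blast
  define r where "r = min (min (d / 2) \<delta>T) (a / 2)"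
  define r0 where "r0 = 3 * r / 4"
  have r: "0 < r" "r \<le> d / 2" "r \<le> \<delta>T" "r < a" using d(1) \<delta>T a_pos by (auto simp: r_def)
  have r0: "0 < r0" "r0 < r" using r by (auto simp: r0_def)
  obtain \<epsilon>1 where \<epsilon>1: "0 < \<epsilon>1" "\<And>p. infdist p cycle0 < \<epsilon>1 \<Longrightarrow> snd p = 0 \<Longrightarrow> \<bar>fst p + a\<bar> < r \<or> \<bar>fst p - a\<bar> < r"
    using cycle0_axis[OF r(1)] by metis
  obtain \<epsilon>2 where \<epsilon>2: "0 < \<epsilon>2"
    "\<forall>\<^sub>F \<alpha> in nhds 0. \<forall>p. infdist p cycle0 < \<epsilon>2 \<longrightarrow> 0 < snd p \<longrightarrow> (\<exists>b. 0 < b \<and> b \<le> T \<and>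
       (\<forall>t\<in>{0..b}. \<phi> t (p, \<alpha>) \<in> B) \<and> (\<forall>t. 0 < t \<and> t < b \<longrightarrow> 0 < snd (fst (\<phi> t (p, \<alpha>)))) \<and>
       snd (fst (\<phi> b (p, \<alpha>))) = 0 \<and>
       (\<bar>fst (fst (\<phi> b (p, \<alpha>))) + a\<bar> < r \<or> \<bar>fst (fst (\<phi> b (p, \<alpha>))) - a\<bar> < r))"
    by (rule cycle0_lands[OF r(1)])
  define \<epsilon> where "\<epsilon> = min \<epsilon>1 \<epsilon>2"
  have \<epsilon>: "0 < \<epsilon>" "\<epsilon> \<le> \<epsilon>1" "\<epsilon> \<le> \<epsilon>2" using \<epsilon>1 \<epsilon>2 by (auto simp: \<epsilon>_def)
  have "\<forall>\<^sub>F q in nhds (- a, 0). \<bar>land (J q) - a\<bar> < r / 8"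
    by (rule eventually_J, rule land_near) (use r in simp)
  then obtain d' where d': "0 < d'" "\<And>q. dist q (- a, 0) < d' \<Longrightarrow> \<bar>land (J q) - a\<bar> < r / 8"
    unfolding eventually_nhds_metric by blast
  have "\<forall>\<^sub>F \<alpha> in nhds (0::real^'m). norm \<alpha> < min (d / 2) d'"
    unfolding eventually_nhds_metric dist_norm diff_zero
    by (rule exI[of _ "min (d / 2) d'"]) (use d(1) d'(1) in simp)
  moreover have "\<forall>\<^sub>F \<alpha> in nhds 0. \<alpha> \<in> \<Omega>T" by (rule eventually_nhds_in_open[OF \<Omega>T(1,2)])
  moreover note xT_near[OF r(1)] \<epsilon>2(2)
  ultimately have "\<forall>\<^sub>F \<alpha> in nhds 0. \<alpha> \<in> \<Omega>T \<and> (\<forall>x. \<bar>x + a\<bar> < r \<longrightarrow> ((x, 0), \<alpha>) \<in> \<Omega>) \<and> system r r0 c \<epsilon> \<alpha>"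
  proof eventually_elim
    case (elim \<alpha>)
    have na: "norm \<alpha> < d / 2" "norm \<alpha> < d'" "\<alpha> \<in> \<Omega>T" "\<bar>xT \<alpha> + a\<bar> < r" using elim by auto
    have g: "good (x, \<alpha>)" if "\<bar>x + a\<bar> < r" for x
    proof (rule d(2))
      have "dist (x, \<alpha>) (- a, 0) \<le> \<bar>x + a\<bar> + norm \<alpha>"
        using norm_Pair_le[of "x + a" \<alpha>] by (simp add: dist_norm)
      then show "dist (x, \<alpha>) (- a, 0) < d" using that na r by simp
    qed
    have inO: "((x, 0), \<alpha>) \<in> \<Omega>" if "\<bar>x + a\<bar> < r" for x using g[OF that] by (simp add: good_def J_def)
    have gsign: "0 \<le> snd (Fld ((x, 0), \<alpha>))" if "\<bar>x + a\<bar> < r" "0 \<le> s * (x - xT \<alpha>)" for x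
    proof (cases "x = xT \<alpha>")
      case True then show ?thesis using xT_zero[OF na(3)] by simp
    next
      case False
      then show ?thesis using xT_after[OF na(3), of x] xT_before[OF na(3), of x] that s r by auto
    qed
    have lip: "\<bar>land ((x, 0), \<alpha>) - land ((y, 0), \<alpha>)\<bar> \<le> \<bar>x - y\<bar> / 2" if "\<bar>x + a\<bar> < r" "\<bar>y + a\<bar> < r" for x y
    proof -
      have "norm (land ((x, 0), \<alpha>) - land ((y, 0), \<alpha>)) \<le> 1/2 * norm (x - y)"
      proof (rule differentiable_bound[of "ball (- a) r" "\<lambda>x. land ((x, 0), \<alpha>)" "\<lambda>x h. land' ((x, 0), \<alpha>) ((h, 0), 0)"])
        fix w assume w: "w \<in> ball (- a) r"
        then have w': "\<bar>w + a\<bar> < r" by (auto simp: dist_real_def)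
        have "((\<lambda>x. ((x, 0::real), \<alpha>)) has_derivative (\<lambda>h. ((h, 0), 0))) (at w)"
          by (auto intro!: derivative_eq_intros simp: zero_prod_def)
        from has_derivative_compose[OF this land_deriv[OF inO[OF w']]]
        have "((\<lambda>x. land ((x, 0), \<alpha>)) has_derivative (\<lambda>h. land' ((w, 0), \<alpha>) ((h, 0), 0))) (at w)" .
        then show "((\<lambda>x. land ((x, 0), \<alpha>)) has_derivative (\<lambda>h. land' ((w, 0), \<alpha>) ((h, 0), 0))) (at w within ball (- a) r)"
          by (rule has_derivative_at_withinI)
        interpret bounded_linear "land' ((w, 0), \<alpha>)"
          by (rule has_derivative_bounded_linear[OF land_deriv[OF inO[OF w']]])
        have sc: "land' ((w, 0), \<alpha>) ((h, 0), 0) = h * land' ((w, 0), \<alpha>) ((1, 0), 0)" for h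
          using scaleR[of h "((1, 0), 0)"] by simp
        show "onorm (\<lambda>h. land' ((w, 0), \<alpha>) ((h, 0), 0)) \<le> 1/2"
        proof (rule onorm_le)
          fix h :: real
          have "\<bar>land' ((w, 0), \<alpha>) ((1, 0), 0)\<bar> \<le> 1/2" using g[OF w'] by (simp add: good_def J_def)
          then have "\<bar>h\<bar> * \<bar>land' ((w, 0), \<alpha>) ((1, 0), 0)\<bar> \<le> \<bar>h\<bar> * (1/2)" by (intro mult_left_mono) auto
          then show "norm (land' ((w, 0), \<alpha>) ((h, 0), 0)) \<le> 1/2 * norm h"
            by (subst sc) (simp add: abs_mult)
        qed
      qed (use that in \<open>auto simp: dist_real_def\<close>)
      then show ?thesis by simp
    qed
    have start: "\<bar>land ((- a, 0), \<alpha>) - a\<bar> < r / 8"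
      using d'(2)[of "(- a, \<alpha>)"] na by (simp add: J_def dist_norm norm_Pair)
    have stay: "\<phi> t ((x, 0), \<alpha>) \<in> B" if "\<bar>x + a\<bar> < r" "t \<in> {0..\<tau> ((x, 0), \<alpha>)}" for x t
      using stay_in_G[OF in_stay[OF inO[OF that(1)]], of t] hit_range[OF inO[OF that(1)]] that by auto
    have sys: "system r r0 c \<epsilon> \<alpha>"
    proof (unfold_locales)
      show "\<exists>L. L-lipschitz_on (cball 0 \<rho>) (\<lambda>p. Fld (p, \<alpha>))" for \<rho> by (rule field_slice_lipschitz)
      show "s = 1 \<or> s = -1" by (rule s)
      show "0 < r0" "r0 < r" "r < a" "0 < c" using r0 r c by auto
      show "\<bar>xT \<alpha> + a\<bar> < r" by (rule na(4))
      show "0 < snd (Fld ((x, 0), \<alpha>))" if "\<bar>x + a\<bar> < r" "0 < s * (x - xT \<alpha>)" for x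
        using xT_after[OF na(3), of x] xT_before[OF na(3), of x] that s r by auto
      show "snd (Fld ((x, 0), \<alpha>)) < 0" if "\<bar>x + a\<bar> < r" "s * (x - xT \<alpha>) < 0" for x
        using xT_after[OF na(3), of x] xT_before[OF na(3), of x] that s r by auto
      show "snd (Fld ((xT \<alpha>, 0), \<alpha>)) = 0" using xT_zero[OF na(3)] by simp
      show "snd (Fld ((x, 0), \<alpha>)) < 0" if "\<bar>x - a\<bar> < r" for x
        using g[of "- x"] that by (simp add: good_def abs_minus_commute)
      show "c \<le> s * slide_speed (\<lambda>p. Fld (p, \<alpha>)) x" if "\<bar>x + a\<bar> < r" "s * (x - xT \<alpha>) \<le> 0" for x
        using g[OF that(1)] c by (simp add: good_def)
      show "c \<le> \<tau> ((x, 0), \<alpha>)" if "\<bar>x + a\<bar> < r" "0 \<le> s * (x - xT \<alpha>)" for x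
      proof -
        have "\<bar>\<tau> ((x, 0), \<alpha>) - \<tau>0\<bar> < \<tau>0 / 2" using g[OF that(1)] unfolding good_def J_def by simp
        then show ?thesis using c(3) by linarith
      qed
      show "fst (\<phi> 0 ((x, 0), \<alpha>)) = (x, 0)" for x by (simp add: flow_0)
      show "((\<lambda>t. fst (\<phi> t ((x, 0), \<alpha>))) has_vector_derivative Fld (fst (\<phi> t ((x, 0), \<alpha>)), \<alpha>))
          (at t within {0..\<tau> ((x, 0), \<alpha>)})"
        if "\<bar>x + a\<bar> < r" "0 \<le> s * (x - xT \<alpha>)" "t \<in> {0..\<tau> ((x, 0), \<alpha>)}" for x t
        by (rule orbit_field) (use stay that hit_range[OF inO[OF that(1)]] in auto)
      show "fst (\<phi> (\<tau> ((x, 0), \<alpha>)) ((x, 0), \<alpha>)) = (land ((x, 0), \<alpha>), 0)" if "\<bar>x + a\<bar> < r" for x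
        using hit_zero[OF inO[OF that]] by (simp add: land_def prod_eq_iff)
      show "fst (\<phi> t ((x, 0), \<alpha>)) \<in> upper_half"
        if "\<bar>x + a\<bar> < r" "0 \<le> s * (x - xT \<alpha>)" "0 < t" "t < \<tau> ((x, 0), \<alpha>)" for x t
        using g[OF that(1)] gsign[OF that(1,2)] that by (simp add: good_def J_def upper_half_def)
      show "\<bar>land ((x, 0), \<alpha>) - a\<bar> \<le> r0" if "\<bar>x + a\<bar> < r" for x
      proof -
        have "\<bar>land ((x, 0), \<alpha>) - a\<bar> \<le>
            \<bar>land ((x, 0), \<alpha>) - land ((- a, 0), \<alpha>)\<bar> + \<bar>land ((- a, 0), \<alpha>) - a\<bar>" by linarith
        also have "\<dots> \<le> \<bar>x + a\<bar> / 2 + r / 8" using lip[of x "- a"] start that r by simp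
        also have "\<dots> \<le> r0" using that r(1) unfolding r0_def by simp
        finally show ?thesis .
      qed
      show "\<bar>land ((x, 0), \<alpha>) - land ((y, 0), \<alpha>)\<bar> \<le> \<bar>x - y\<bar> / 2" if "\<bar>x + a\<bar> < r" "\<bar>y + a\<bar> < r" for x y
        by (rule lip[OF that])
      show "\<exists>D. ((\<lambda>x. land ((x, 0), \<alpha>)) has_real_derivative D) (at x) \<and> \<bar>D\<bar> \<le> 1/2" if "\<bar>x + a\<bar> < r" for x
      proof -
        have "((\<lambda>x. ((x, 0::real), \<alpha>)) has_derivative (\<lambda>h. ((h, 0), 0))) (at x)"
          by (auto intro!: derivative_eq_intros simp: zero_prod_def)
        from has_derivative_compose[OF this land_deriv[OF inO[OF that]]]
        have "((\<lambda>x. land ((x, 0), \<alpha>)) has_derivative (\<lambda>h. land' ((x, 0), \<alpha>) ((h, 0), 0))) (at x)" .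
        moreover have "(\<lambda>h. land' ((x, 0), \<alpha>) ((h, 0), 0)) = (*) (land' ((x, 0), \<alpha>) ((1, 0), 0))"
        proof
          fix h :: real
          interpret bounded_linear "land' ((x, 0), \<alpha>)"
            by (rule has_derivative_bounded_linear[OF land_deriv[OF inO[OF that]]])
          show "land' ((x, 0), \<alpha>) ((h, 0), 0) = land' ((x, 0), \<alpha>) ((1, 0), 0) * h"
            using scaleR[of h "((1, 0), 0)"] by simp
        qed
        ultimately have "((\<lambda>x. land ((x, 0), \<alpha>)) has_real_derivative land' ((x, 0), \<alpha>) ((1, 0), 0)) (at x)"
          by (simp only: has_field_derivative_def)
        then show ?thesis using g[OF that] by (intro exI[of _ "land' ((x, 0), \<alpha>) ((1, 0), 0)"]) (simp add: good_def J_def)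
      qed
      show "\<exists>\<zeta>>0. \<forall>x. \<bar>x + a\<bar> < r \<longrightarrow> 0 \<le> s * (x - xT \<alpha>) \<longrightarrow> \<bar>x - y\<bar> < \<zeta> \<longrightarrow>
          (\<forall>t\<in>{0..\<tau> ((x, 0), \<alpha>)}. \<exists>t'\<in>{0..\<tau> ((y, 0), \<alpha>)}. dist (fst (\<phi> t ((x, 0), \<alpha>))) (fst (\<phi> t' ((y, 0), \<alpha>))) < \<xi>)"
        if y: "\<bar>y + a\<bar> < r" and \<xi>: "0 < \<xi>" for y \<xi>
      proof -
        define k where "k = \<xi> / (2 * (M + 1))"
        have M: "0 \<le> M" by (rule M_nonneg)
        have k: "0 < k" using \<xi> M by (simp add: k_def)
        have Mk: "M * k \<le> \<xi> / 2"
        proof -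
          have "M * k \<le> (M + 1) * k" using k by simp
          also have "\<dots> = \<xi> / 2" using M by (simp add: k_def field_simps)
          finally show ?thesis .
        qed
        have "isCont (\<lambda>x. \<tau> ((x, 0), \<alpha>)) y"
          by (rule isCont_o2[where f = "\<lambda>x. ((x, 0), \<alpha>)" and g = \<tau>])
            (intro continuous_intros, rule hit_cont[OF inO[OF y]])
        then obtain z where z: "0 < z" "\<And>x. \<bar>x - y\<bar> < z \<Longrightarrow> \<bar>\<tau> ((x, 0), \<alpha>) - \<tau> ((y, 0), \<alpha>)\<bar> < k"
          using k unfolding continuous_at_eps_delta by (metis dist_real_def)
        define \<zeta> where "\<zeta> = min z (\<xi> / 2 * exp (- (L * T)))"
        show ?thesis
        proof (intro exI[of _ \<zeta>] conjI allI impI ballI)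
          show "0 < \<zeta>" using z \<xi> by (simp add: \<zeta>_def)
          fix x t assume x: "\<bar>x + a\<bar> < r" "\<bar>x - y\<bar> < \<zeta>" and t: "t \<in> {0..\<tau> ((x, 0), \<alpha>)}"
          define t' where "t' = min t (\<tau> ((y, 0), \<alpha>))"
          have t': "t' \<in> {0..\<tau> ((y, 0), \<alpha>)}" using t hit_range[OF inO[OF y]] by (auto simp: t'_def)
          have tT: "t \<in> {0..T}" "t' \<in> {0..T}"
            using t t' hit_range[OF inO[OF y]] hit_range[OF inO[OF x(1)]] by auto
          have tt: "\<bar>t - t'\<bar> \<le> k" using z(2)[of x] x t by (auto simp: t'_def \<zeta>_def)
          have "dist (fst (\<phi> t ((x, 0), \<alpha>))) (fst (\<phi> t' ((y, 0), \<alpha>))) \<le> norm (\<phi> t ((x, 0), \<alpha>) - \<phi> t' ((y, 0), \<alpha>))"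
            using norm_fst_bound[of "\<phi> t ((x, 0), \<alpha>) - \<phi> t' ((y, 0), \<alpha>)"] by (simp add: dist_norm)
          also have "\<dots> \<le> norm (((x, 0), \<alpha>) - ((y, 0::real), \<alpha>)) * exp (L * T) + M * \<bar>t - t'\<bar>"
            by (rule flow_joint_estimate[OF tT(2,1)])
          also have "norm (((x, 0), \<alpha>) - ((y, 0::real), \<alpha>)) = \<bar>x - y\<bar>" by (simp add: norm_Pair)
          also have "\<bar>x - y\<bar> * exp (L * T) + M * \<bar>t - t'\<bar> < \<xi> / 2 + \<xi> / 2"
          proof (rule add_less_le_mono)
            have "\<bar>x - y\<bar> < \<xi> / 2 * exp (- (L * T))" using x by (simp add: \<zeta>_def)
            then have "\<bar>x - y\<bar> * exp (L * T) < \<xi> / 2 * exp (- (L * T)) * exp (L * T)"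
              by (rule mult_strict_right_mono) simp
            also have "\<xi> / 2 * exp (- (L * T)) * exp (L * T) = \<xi> / 2" by (simp add: exp_minus)
            finally show "\<bar>x - y\<bar> * exp (L * T) < \<xi> / 2" .
            show "M * \<bar>t - t'\<bar> \<le> \<xi> / 2" using mult_left_mono[OF tt M] Mk by simp
          qed
          finally show "\<exists>t'\<in>{0..\<tau> ((y, 0), \<alpha>)}. dist (fst (\<phi> t ((x, 0), \<alpha>))) (fst (\<phi> t' ((y, 0), \<alpha>))) < \<xi>"
            using t' by auto
        qed
      qed
      show "- p \<in> {p. infdist p cycle0 < \<epsilon>}" if "p \<in> {p. infdist p cycle0 < \<epsilon>}" for p
        using that by (simp add: infdist_cycle0_uminus)
      show "\<bar>fst p + a\<bar> < r \<or> \<bar>fst p - a\<bar> < r" if "p \<in> {p. infdist p cycle0 < \<epsilon>}" "snd p = 0" for p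
        using \<epsilon>1(2)[of p] that \<epsilon> by auto
      show "\<exists>w b. 0 < b \<and> w 0 = p \<and>
          (\<forall>t\<in>{0..b}. (w has_vector_derivative Fld (w t, \<alpha>)) (at t within {0..b})) \<and>
          (\<forall>t. 0 < t \<and> t < b \<longrightarrow> w t \<in> upper_half) \<and>
          snd (w b) = 0 \<and> (\<bar>fst (w b) + a\<bar> < r \<or> \<bar>fst (w b) - a\<bar> < r)"
        if p: "p \<in> {p. infdist p cycle0 < \<epsilon>}" "0 < snd p" for p
      proof -
        have "infdist p cycle0 < \<epsilon>2" using p \<epsilon> by auto
        then obtain b where b: "0 < b" "b \<le> T" "\<And>t. t \<in> {0..b} \<Longrightarrow> \<phi> t (p, \<alpha>) \<in> B"
          "\<And>t. 0 < t \<Longrightarrow> t < b \<Longrightarrow> 0 < snd (fst (\<phi> t (p, \<alpha>)))" "snd (fst (\<phi> b (p, \<alpha>))) = 0"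
          "\<bar>fst (fst (\<phi> b (p, \<alpha>))) + a\<bar> < r \<or> \<bar>fst (fst (\<phi> b (p, \<alpha>))) - a\<bar> < r"
          using elim p(2) by blast
        show ?thesis
        proof (intro exI[of _ "\<lambda>t. fst (\<phi> t (p, \<alpha>))"] exI[of _ b] conjI ballI allI impI)
          show "((\<lambda>t. fst (\<phi> t (p, \<alpha>))) has_vector_derivative Fld (fst (\<phi> t (p, \<alpha>)), \<alpha>)) (at t within {0..b})"
            if "t \<in> {0..b}" for t
            by (rule orbit_field[OF b(3) b(2) that])
        qed (use b in \<open>auto simp: flow_0 upper_half_def\<close>)
      qed
    qed
    show ?case using na(3) inO sys by blast
  qed
  then show thesis using that r(1) \<epsilon>(1) by blast
qed

end

section \<open>The phase portrait for small parameters\<close>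

context half_return begin

text \<open>The distance of the fixed point of a contraction with constant \<open>1/2\<close> from any point is at most twice
  the displacement of that point.\<close>

lemma xs_bound: "\<bar>xs - xT\<bar> \<le> 2 * \<bar>P xT + xT\<bar>"
proof -
  have "R xT = - P xT" by (simp add: R_def lift_off_id)
  moreover have "\<bar>R xs - R xT\<bar> \<le> \<bar>xs - xT\<bar> / 2" by (rule R_lip[OF xs_near' xT])
  ultimately have "\<bar>xs + P xT\<bar> \<le> \<bar>xs - xT\<bar> / 2" by (simp add: xs_fix)
  moreover have "\<bar>xs - xT\<bar> \<le> \<bar>xs + P xT\<bar> + \<bar>P xT + xT\<bar>" by linarith
  ultimately show ?thesis by argo
qed

lemma orbit_in:
  assumes sym: "\<And>p. p \<in> D \<Longrightarrow> - p \<in> D"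
    and axis: "\<And>x. \<bar>x - xT\<bar> \<le> 2 * \<bar>P xT + xT\<bar> \<Longrightarrow> (x, 0) \<in> D"
    and arcs: "\<And>x t. \<bar>x - xT\<bar> \<le> 2 * \<bar>P xT + xT\<bar> \<Longrightarrow> \<bar>x + a\<bar> < r \<Longrightarrow> t \<in> {0..\<tau> x} \<Longrightarrow> u x t \<in> D"
  shows "orbit \<subseteq> D"
proof -
  have "lift_off xT = xT" by (simp add: lift_off_id)
  then have l: "\<bar>lift_off xs - xT\<bar> \<le> \<bar>xs - xT\<bar>" using lift_off_lip[of xs xT] by simp
  have "half_arc xs \<subseteq> D"
  proof
    fix p assume "p \<in> half_arc xs"
    then consider x where "x \<in> closed_segment xs (lift_off xs)" "p = (x, 0)"
      | t where "t \<in> {0..\<tau> (lift_off xs)}" "p = u (lift_off xs) t"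
      by (auto simp: half_arc_def)
    then show "p \<in> D"
    proof cases
      case 1
      have "\<bar>x - xT\<bar> \<le> \<bar>xs - xT\<bar>"
        using 1(1) l by (auto simp: closed_segment_eq_real_ivl split: if_splits)
      then show ?thesis using axis[of x] xs_bound 1(2) by simp
    next
      case 2
      then show ?thesis using arcs[OF _ lift_off_near[OF xs_near'] 2(1)] xs_bound l by simp
    qed
  qed
  then show ?thesis using sym by (auto simp: orbit_def)
qed

end

context critical_hit begin

definition "\<beta>1 \<alpha> = land ((xT \<alpha>, 0), \<alpha>) + xT \<alpha>"

lemma fold_point_cont: "\<alpha> \<in> \<Omega>T \<Longrightarrow> isCont (\<lambda>\<alpha>. ((xT \<alpha>, 0), \<alpha>)) \<alpha>"
  by (intro continuous_intros xT_cont)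

lemma \<beta>1_0: "\<beta>1 0 = 0" by (simp add: \<beta>1_def \<Omega>T land_e0)

lemma \<beta>1_near:
  assumes "0 < d"
  shows "\<forall>\<^sub>F \<alpha> in nhds 0. \<bar>\<beta>1 \<alpha>\<bar> < d"
proof -
  have "isCont land ((xT 0, 0), 0)"
    using has_derivative_continuous[OF land_deriv[OF \<Omega>(2)]] by (simp add: \<Omega>T)
  then have "isCont (\<lambda>\<alpha>. land ((xT \<alpha>, 0), \<alpha>)) 0"
    by (rule isCont_o2[where f = "\<lambda>\<alpha>. ((xT \<alpha>, 0), \<alpha>)" and g = land, OF fold_point_cont[OF \<Omega>T(2)]])
  then have "isCont \<beta>1 0" unfolding \<beta>1_def by (intro continuous_intros xT_cont \<Omega>T)
  then have "(\<beta>1 \<longlongrightarrow> \<beta>1 0) (nhds 0)" by (rule isCont_nhds)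
  from tendstoD[OF this assms] show ?thesis by (simp add: dist_real_def \<beta>1_0)
qed

lemma fold_visible_near:
  "\<forall>\<^sub>F \<alpha> in nhds 0. 0 < snd (Fld' ((xT \<alpha>, 0), \<alpha>) (Fld ((xT \<alpha>, 0), \<alpha>), 0))"
proof -
  define W where "W e = snd (Fld' e (Fld e, 0))" for e
  have "continuous_on UNIV W"
    unfolding W_def by (intro continuous_intros Fld'_cont Fld_cont)
  then have "isCont W ((xT 0, 0), 0)" by (simp add: continuous_on_eq_continuous_at)
  then have "isCont (\<lambda>\<alpha>. W ((xT \<alpha>, 0), \<alpha>)) 0"
    by (rule isCont_o2[where f = "\<lambda>\<alpha>. ((xT \<alpha>, 0), \<alpha>)" and g = W, OF fold_point_cont[OF \<Omega>T(2)]])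
  then have lim: "((\<lambda>\<alpha>. W ((xT \<alpha>, 0), \<alpha>)) \<longlongrightarrow> W ((xT 0, 0), 0)) (nhds 0)"
    using isCont_nhds[where f = "\<lambda>\<alpha>. W ((xT \<alpha>, 0), \<alpha>)" and x = 0] by simp
  have "(Fld e0, 0) = fst (Fld e0) *\<^sub>R (((1, 0), 0) :: plane \<times> (real^'m))"
    using fold_g by (simp add: prod_eq_iff)
  then have "W e0 = fst (Fld e0) * snd (Fld' e0 ((1, 0), 0))"
    by (simp only: W_def blinfun.scaleR_right) simp
  then have "0 < W ((xT 0, 0), 0)" using fold_vis by (simp add: \<Omega>T)
  from order_tendstoD(1)[OF lim this] show ?thesis by (simp add: W_def)
qed

lemma cycle0_mem: "t \<in> {0..\<tau>0} \<Longrightarrow> fst (\<phi> t e0) \<in> cycle0" by (auto simp: cycle0_def)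

lemma cycle0_neighbourhood:
  assumes "open A" "cycle0 \<subseteq> A"
  obtains d where "0 < d" "{p. infdist p cycle0 < d} \<subseteq> A"
proof -
  have c: "compact ((\<lambda>t. fst (\<phi> t e0)) ` {0..\<tau>0})"
    by (intro compact_continuous_image continuous_on_fst continuous_on_subset[OF flow_cont_time])
      (use \<tau>0 in auto)
  have "compact cycle0" unfolding cycle0_def
    by (intro compact_Un c compact_continuous_image[OF _ c] continuous_intros)
  then obtain d where d: "d > 0" "(\<Union>y\<in>cycle0. ball y d) \<subseteq> A"
    using compact_subset_open_imp_ball_epsilon_subset[OF _ assms] by blast
  show thesis
  proof (rule that[OF d(1)], rule subsetI)
    fix p assume "p \<in> {p. infdist p cycle0 < d}"
    then have "infdist p cycle0 < d" by simp
    then obtain t \<sigma> where t: "t \<in> {0..\<tau>0}" "\<sigma> = 1 \<or> \<sigma> = (-1::real)" "dist p (\<sigma> *\<^sub>R fst (\<phi> t e0)) < d"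
      by (rule cycle0_near)
    have "\<sigma> *\<^sub>R fst (\<phi> t e0) \<in> cycle0" using cycle0_mem[OF t(1)] cycle0_uminus[OF cycle0_mem[OF t(1)]] t(2) by auto
    moreover have "p \<in> ball (\<sigma> *\<^sub>R fst (\<phi> t e0)) d" using t(3) by (simp add: dist_commute)
    ultimately show "p \<in> A" using d(2) by blast
  qed
qed

text \<open>This places the periodic orbit in the given annulus once its position on the section is close to
  \<open>-a\<close>.\<close>

lemma orbits_near_cycle0:
  assumes d: "0 < d"
  obtains \<eta> where "0 < \<eta>"
    "\<And>x \<alpha> t. \<bar>x + a\<bar> < \<eta> \<Longrightarrow> norm \<alpha> < \<eta> \<Longrightarrow> ((x, 0), \<alpha>) \<in> \<Omega> \<Longrightarrow> t \<in> {0..\<tau> ((x, 0), \<alpha>)} \<Longrightarrow>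
       infdist (fst (\<phi> t ((x, 0), \<alpha>))) cycle0 < d"
proof -
  define k where "k = d / (2 * (M + 1))"
  have M: "0 \<le> M" by (rule M_nonneg)
  have k: "0 < k" using d M by (simp add: k_def)
  have Mk: "M * k \<le> d / 2"
  proof -
    have "M * k \<le> (M + 1) * k" using k by simp
    also have "\<dots> = d / 2" using M by (simp add: k_def field_simps)
    finally show ?thesis .
  qed
  have "\<forall>\<^sub>F q in nhds (- a, 0). \<bar>\<tau> (J q) - \<tau>0\<bar> < k" by (rule eventually_J, rule hit_near[OF k])
  then obtain d1 where d1: "0 < d1" "\<And>q. dist q (- a, 0) < d1 \<Longrightarrow> \<bar>\<tau> (J q) - \<tau>0\<bar> < k"
    unfolding eventually_nhds_metric by blast
  define \<eta> where "\<eta> = min (d1 / 2) (d / 4 * exp (- (L * T)))"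
  have \<eta>: "0 < \<eta>" "2 * \<eta> \<le> d1" using d d1 by (auto simp: \<eta>_def)
  have "2 * \<eta> * exp (L * T) \<le> 2 * (d / 4 * exp (- (L * T))) * exp (L * T)"
    by (intro mult_right_mono mult_left_mono) (auto simp: \<eta>_def)
  also have "\<dots> = d / 2" by (simp add: exp_minus)
  finally have \<eta>d: "2 * \<eta> * exp (L * T) \<le> d / 2" .
  show thesis
  proof (rule that[OF \<eta>(1)])
    fix x t :: real and \<alpha> :: "real^'m"
    assume x: "\<bar>x + a\<bar> < \<eta>" and \<alpha>: "norm \<alpha> < \<eta>" and in\<Omega>: "((x, 0), \<alpha>) \<in> \<Omega>" and t: "t \<in> {0..\<tau> ((x, 0), \<alpha>)}"
    have n: "norm (x + a, \<alpha>) < 2 * \<eta>" using norm_Pair_le[of "x + a" \<alpha>] x \<alpha> by simp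
    have "dist (x, \<alpha>) (- a, 0) < d1" using n \<eta>(2) by (simp add: dist_norm)
    then have tk: "\<bar>\<tau> ((x, 0), \<alpha>) - \<tau>0\<bar> < k" using d1(2)[of "(x, \<alpha>)"] by (simp add: J_def)
    define t' where "t' = min t \<tau>0"
    have t': "t' \<in> {0..\<tau>0}" "t' \<in> {0..T}" "t \<in> {0..T}" "\<bar>t - t'\<bar> \<le> k"
      using t tk \<tau>0 hit_range[OF in\<Omega>] by (auto simp: t'_def)
    have "infdist (fst (\<phi> t ((x, 0), \<alpha>))) cycle0 \<le> dist (fst (\<phi> t ((x, 0), \<alpha>))) (fst (\<phi> t' e0))"
      by (rule infdist_le[OF cycle0_mem[OF t'(1)]])
    also have "\<dots> \<le> norm (\<phi> t ((x, 0), \<alpha>) - \<phi> t' e0)"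
      using norm_fst_bound[of "\<phi> t ((x, 0), \<alpha>) - \<phi> t' e0"] by (simp add: dist_norm)
    also have "\<dots> \<le> norm (((x, 0), \<alpha>) - e0) * exp (L * T) + M * \<bar>t - t'\<bar>"
      by (rule flow_joint_estimate[OF t'(2,3)])
    also have "norm (((x, 0), \<alpha>) - e0) = norm (x + a, \<alpha>)" by (simp add: norm_Pair)
    also have "norm (x + a, \<alpha>) * exp (L * T) + M * \<bar>t - t'\<bar> < d / 2 + d / 2"
    proof (rule add_less_le_mono)
      have "norm (x + a, \<alpha>) * exp (L * T) < 2 * \<eta> * exp (L * T)" using n by simp
      then show "norm (x + a, \<alpha>) * exp (L * T) < d / 2" using \<eta>d by linarith
      show "M * \<bar>t - t'\<bar> \<le> d / 2" using mult_left_mono[OF t'(4) M] Mk by linarith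
    qed
    finally show "infdist (fst (\<phi> t ((x, 0), \<alpha>))) cycle0 < d" by simp
  qed
qed

text \<open>By \<open>xs_bound\<close> the periodic orbit tends to \<open>\<Gamma>\<^sub>0\<close> as the parameter tends to zero, because \<open>\<beta>1\<close> does.
  So it lies in \<open>A\<close>, and the case distinction for the half return system applies.\<close>

lemma diagram_near:
  assumes ev: "\<forall>\<^sub>F \<alpha> in nhds 0. \<alpha> \<in> \<Omega>T \<and> (\<forall>x. \<bar>x + a\<bar> < r \<longrightarrow> ((x, 0), \<alpha>) \<in> \<Omega>) \<and> system r r0 c \<epsilon> \<alpha>"
    and A: "open A" "cycle0 \<subseteq> A" "A \<subseteq> {p. infdist p cycle0 < \<epsilon>}"
  shows "\<forall>\<^sub>F \<alpha> in nhds 0.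
     boundary_dynamics (\<lambda>p. Fld (p, \<alpha>)) (mirror (\<lambda>p. Fld (p, \<alpha>))) A a (fst (Fld e0)) (xT \<alpha>, 0) \<and>
     (s = 1 \<longrightarrow> cycles_pos (\<lambda>p. Fld (p, \<alpha>)) (mirror (\<lambda>p. Fld (p, \<alpha>))) A (xT \<alpha>, 0) (\<beta>1 \<alpha>)) \<and>
     (s = -1 \<longrightarrow> cycles_neg (\<lambda>p. Fld (p, \<alpha>)) (mirror (\<lambda>p. Fld (p, \<alpha>))) A (xT \<alpha>, 0) (\<beta>1 \<alpha>))"
proof -
  obtain d where d: "0 < d" "{p. infdist p cycle0 < d} \<subseteq> A" using cycle0_neighbourhood[OF A(1,2)] .
  obtain \<eta> where \<eta>: "0 < \<eta>"
    "\<And>x \<alpha> t. \<bar>x + a\<bar> < \<eta> \<Longrightarrow> norm \<alpha> < \<eta> \<Longrightarrow> ((x, 0), \<alpha>) \<in> \<Omega> \<Longrightarrow> t \<in> {0..\<tau> ((x, 0), \<alpha>)} \<Longrightarrow>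
       infdist (fst (\<phi> t ((x, 0), \<alpha>))) cycle0 < d"
    by (rule orbits_near_cycle0[OF d(1)]) blast
  define \<zeta> where "\<zeta> = min \<eta> d / 3"
  have \<zeta>: "0 < \<zeta>" "3 * \<zeta> \<le> \<eta>" "3 * \<zeta> \<le> d" using \<eta> d by (auto simp: \<zeta>_def)
  have start: "(- a, 0) \<in> cycle0" using cycle0_mem[of 0] \<tau>0 by (simp add: flow_0)
  have axis: "infdist (x, 0) cycle0 < d" if "\<bar>x + a\<bar> < d" for x
    using infdist_le[OF start, of "(x, 0)"] that by (simp add: dist_norm norm_Pair)
  have "\<forall>\<^sub>F \<alpha> in nhds (0::real^'m). norm \<alpha> < \<zeta>"
    unfolding eventually_nhds_metric dist_norm diff_zero by (rule exI[of _ \<zeta>]) (use \<zeta> in simp)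
  from ev this xT_near[OF \<zeta>(1)] \<beta>1_near[OF \<zeta>(1)] fold_visible_near show ?thesis
  proof eventually_elim
    case (elim \<alpha>)
    then have n: "norm \<alpha> < \<zeta>" "\<bar>xT \<alpha> + a\<bar> < \<zeta>" "\<bar>\<beta>1 \<alpha>\<bar> < \<zeta>"
      "0 < snd (Fld' ((xT \<alpha>, 0), \<alpha>) (Fld ((xT \<alpha>, 0), \<alpha>), 0))"
      and O': "\<And>x. \<bar>x + a\<bar> < r \<Longrightarrow> ((x, 0), \<alpha>) \<in> \<Omega>" and sys: "system r r0 c \<epsilon> \<alpha>" by auto
    interpret h: half_return "\<lambda>p. Fld (p, \<alpha>)" s a r r0 c "xT \<alpha>" "\<lambda>x. \<tau> ((x, 0), \<alpha>)"
      "\<lambda>x. land ((x, 0), \<alpha>)" "\<lambda>x t. fst (\<phi> t ((x, 0), \<alpha>))" "{p. infdist p cycle0 < \<epsilon>}"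
      by (rule sys)
    have near: "\<bar>x + a\<bar> < 3 * \<zeta>" if "\<bar>x - xT \<alpha>\<bar> \<le> 2 * \<bar>land ((xT \<alpha>, 0), \<alpha>) + xT \<alpha>\<bar>" for x
    proof -
      have "\<bar>x + a\<bar> \<le> \<bar>x - xT \<alpha>\<bar> + \<bar>xT \<alpha> + a\<bar>" by linarith
      also have "\<dots> < 2 * \<zeta> + \<zeta>"
      proof (rule add_le_less_mono[OF order_trans[OF that] n(2)])
        show "2 * \<bar>land ((xT \<alpha>, 0), \<alpha>) + xT \<alpha>\<bar> \<le> 2 * \<zeta>" using n(3) unfolding \<beta>1_def by simp
      qed
      finally show ?thesis by simp
    qed
    have "h.orbit \<subseteq> {p. infdist p cycle0 < d}"
    proof (rule h.orbit_in)
      show "- p \<in> {p. infdist p cycle0 < d}" if "p \<in> {p. infdist p cycle0 < d}" for p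
        using that by (simp add: infdist_cycle0_uminus)
      show "(x, 0) \<in> {p. infdist p cycle0 < d}"
        if "\<bar>x - xT \<alpha>\<bar> \<le> 2 * \<bar>land ((xT \<alpha>, 0), \<alpha>) + xT \<alpha>\<bar>" for x
        using axis[of x] near[OF that] \<zeta> by simp
      show "fst (\<phi> t ((x, 0), \<alpha>)) \<in> {p. infdist p cycle0 < d}"
        if "\<bar>x - xT \<alpha>\<bar> \<le> 2 * \<bar>land ((xT \<alpha>, 0), \<alpha>) + xT \<alpha>\<bar>" "\<bar>x + a\<bar> < r" "t \<in> {0..\<tau> ((x, 0), \<alpha>)}" for x t
      proof -
        have "\<bar>x + a\<bar> < \<eta>" "norm \<alpha> < \<eta>" using near[OF that(1)] n(1) \<zeta> by simp_all
        from \<eta>(2)[OF this O'[OF that(2)] that(3)] show ?thesis by simp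
      qed
    qed
    then have oA: "h.orbit \<subseteq> A" using d(2) by (rule order_trans)
    have "boundary_dynamics (\<lambda>p. Fld (p, \<alpha>)) (mirror (\<lambda>p. Fld (p, \<alpha>))) A a (fst (Fld e0)) (xT \<alpha>, 0)"
    proof (rule h.boundary_dynamics_holds[OF A(3), where D = "\<lambda>p. snd (Fld' ((xT \<alpha>, 0), \<alpha>) (p, 0))"])
      show "e *\<^sub>R (x, 0) \<in> A" if x: "x \<in> closed_segment (- a) (xT \<alpha>)" and e: "e = 1 \<or> e = (-1::real)" for x e
      proof -
        have "\<bar>x + a\<bar> < d" using x n(2) \<zeta> by (auto simp: closed_segment_eq_real_ivl split: if_splits)
        then have "infdist (x, 0) cycle0 < d" by (rule axis)
        then have "infdist (e *\<^sub>R (x, 0)) cycle0 < d" using e infdist_cycle0_uminus[of "(x, 0)"] by auto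
        then show ?thesis using d(2) by blast
      qed
      have "((\<lambda>p. (p, \<alpha>)) has_derivative (\<lambda>p. (p, 0))) (at (xT \<alpha>, 0))" by (auto intro!: derivative_eq_intros)
      from has_derivative_compose[OF this Fld_deriv]
      show "((\<lambda>p. snd (Fld (p, \<alpha>))) has_derivative (\<lambda>p. snd (Fld' ((xT \<alpha>, 0), \<alpha>) (p, 0)))) (at (xT \<alpha>, 0))"
        by (rule has_derivative_snd)
    qed (use n s_f in auto)
    moreover have "s = 1 \<longrightarrow> cycles_pos (\<lambda>p. Fld (p, \<alpha>)) (mirror (\<lambda>p. Fld (p, \<alpha>))) A (xT \<alpha>, 0) (\<beta>1 \<alpha>)"
      unfolding \<beta>1_def using h.cycles_pos_holds[OF _ A(1) oA A(3)] by simp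
    moreover have "s = -1 \<longrightarrow> cycles_neg (\<lambda>p. Fld (p, \<alpha>)) (mirror (\<lambda>p. Fld (p, \<alpha>))) A (xT \<alpha>, 0) (\<beta>1 \<alpha>)"
      unfolding \<beta>1_def using h.cycles_neg_holds[OF _ A(1) oA A(3)] by simp
    ultimately show ?case by simp
  qed
qed

end

section \<open>Completing a function to a coordinate system\<close>

text \<open>Where \<open>\<beta>\<close> depends on the coordinate \<open>j\<close> to first order, \<open>\<beta>\<close> can replace that coordinate. It is to be
  the coordinate \<open>one\<close> of the new system, so for \<open>j \<noteq> one\<close> the old coordinate \<open>one\<close> moves to position \<open>j\<close>.
  The inverse of the derivative is given by an explicit formula \<open>G\<close>, from which continuity of the derivative of
  the inverse map can be read off.\<close>

lemma diffeomorphism_with_coordinate: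
  fixes \<beta> :: "real^'m \<Rightarrow> real" and one j :: 'm
  assumes W: "open W" "0 \<in> W"
    and der: "\<And>\<alpha>. \<alpha> \<in> W \<Longrightarrow> (\<beta> has_derivative \<beta>' \<alpha>) (at \<alpha>)"
    and cont: "\<And>h. continuous_on W (\<lambda>\<alpha>. \<beta>' \<alpha> h)"
    and zero: "\<beta> 0 = 0" and nz: "\<beta>' 0 (axis j 1) \<noteq> 0"
  obtains U V \<rho> where "0 \<in> U" "U \<subseteq> W" "C1_diffeomorphism \<rho> U V" "\<rho> 0 = 0" "\<And>\<alpha>. \<rho> \<alpha> $ one = \<beta> \<alpha>"
proof -
  define W' where "W' = {\<alpha> \<in> W. \<beta>' \<alpha> (axis j 1) \<noteq> 0}"
  have W'_eq: "W' = W \<inter> (\<lambda>\<alpha>. \<beta>' \<alpha> (axis j 1)) -` (- {0})" by (auto simp: W'_def)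
  have W': "open W'" "0 \<in> W'" "W' \<subseteq> W"
    unfolding W'_eq using W nz by (auto intro!: continuous_open_preimage[OF cont])
  define P :: "real^'m \<Rightarrow> real^'m" where "P h = (\<chi> i. if i = one then 0 else if i = j then h $ one else h $ i)" for h
  define Q :: "real^'m \<Rightarrow> real^'m" where "Q k = (\<chi> i. if i = j then 0 else if i = one then k $ j else k $ i)" for k
  have lP: "bounded_linear P"
    by (intro linear_conv_bounded_linear[THEN iffD1] linearI) (auto simp: P_def vec_eq_iff)
  define \<rho> where "\<rho> \<alpha> = \<beta> \<alpha> *\<^sub>R axis one 1 + P \<alpha>" for \<alpha>
  define D where "D \<alpha> h = \<beta>' \<alpha> h *\<^sub>R axis one 1 + P h" for \<alpha> h
  define G where "G \<alpha> k = Q k + ((k $ one - \<beta>' \<alpha> (Q k)) / \<beta>' \<alpha> (axis j 1)) *\<^sub>R axis j 1" for \<alpha> k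
  have \<rho>_one: "\<rho> \<alpha> $ one = \<beta> \<alpha>" for \<alpha> by (simp add: \<rho>_def P_def axis_def)
  have \<rho>_deriv: "(\<rho> has_derivative D \<alpha>) (at \<alpha>)" if "\<alpha> \<in> W" for \<alpha>
    unfolding \<rho>_def D_def
    by (intro has_derivative_add has_derivative_scaleR_left der that bounded_linear_imp_has_derivative lP)
  have ap: "blinfun_apply (Blinfun (D \<alpha>)) = D \<alpha>" if "\<alpha> \<in> W" for \<alpha>
    by (rule bounded_linear_Blinfun_apply[OF has_derivative_bounded_linear[OF \<rho>_deriv[OF that]]])
  have D_cont: "continuous_on W (\<lambda>\<alpha>. D \<alpha> h)" for h
    unfolding D_def by (intro continuous_intros cont)
  have B_cont: "continuous_on W' (\<lambda>\<alpha>. Blinfun (D \<alpha>))"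
  proof (rule continuous_on_blinfun_componentwise)
    fix b :: "real^'m"
    have "continuous_on W' (\<lambda>\<alpha>. D \<alpha> b)" by (rule continuous_on_subset[OF D_cont W'(3)])
    moreover have "continuous_on W' (\<lambda>\<alpha>. D \<alpha> b) \<longleftrightarrow> continuous_on W' (\<lambda>\<alpha>. blinfun_apply (Blinfun (D \<alpha>)) b)"
      by (rule continuous_on_cong) (use W'(3) ap in auto)
    ultimately show "continuous_on W' (\<lambda>\<alpha>. blinfun_apply (Blinfun (D \<alpha>)) b)" by simp
  qed
  have GD: "G \<alpha> (D \<alpha> h) = h" and DG: "D \<alpha> (G \<alpha> h) = h" if "\<alpha> \<in> W'" for \<alpha> h
  proof -
    interpret bounded_linear "\<beta>' \<alpha>" using that W'(3) by (intro has_derivative_bounded_linear[OF der]) auto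
    have n: "\<beta>' \<alpha> (axis j 1) \<noteq> 0" using that by (simp add: W'_def)
    have "Q (D \<alpha> h) = h - h $ j *\<^sub>R axis j 1"
      by (auto simp: Q_def D_def P_def vec_eq_iff axis_def)
    moreover have "D \<alpha> h $ one = \<beta>' \<alpha> h" by (simp add: D_def P_def axis_def)
    ultimately show "G \<alpha> (D \<alpha> h) = h" using n by (simp add: G_def diff scaleR)
    have "\<beta>' \<alpha> (G \<alpha> h) = h $ one" using n by (simp add: G_def add scaleR)
    then show "D \<alpha> (G \<alpha> h) = h"
      by (auto simp: D_def P_def vec_eq_iff axis_def G_def Q_def)
  qed
  have invD: "inv (D \<alpha>) = G \<alpha>" if "\<alpha> \<in> W'" for \<alpha>
    by (rule inv_unique_comp) (use GD[OF that] DG[OF that] in auto)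
  have G_cont: "continuous_on W' (\<lambda>\<alpha>. G \<alpha> k)" for k
    unfolding G_def by (intro continuous_intros continuous_on_subset[OF cont W'(3)]) (auto simp: W'_def)
  have lG: "bounded_linear (G 0)"
  proof -
    have "linear (D 0)"
      using has_derivative_bounded_linear[OF \<rho>_deriv[OF W(2)]] by (simp add: linear_conv_bounded_linear)
    moreover have "inj (D 0)" by (rule inj_on_inverseI[of _ "G 0"]) (rule GD[OF W'(2)])
    ultimately obtain g where g: "linear g" "g \<circ> D 0 = id"
      using linear_injective_left_inverse by blast
    have "g = G 0"
    proof
      fix k
      have "g (D 0 (G 0 k)) = G 0 k" using g(2) by (metis comp_apply id_apply)
      then show "g k = G 0 k" by (simp add: DG[OF W'(2)])
    qed
    then show ?thesis using g(1) by (simp add: linear_conv_bounded_linear)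
  qed
  have inv0: "Blinfun (G 0) o\<^sub>L Blinfun (D 0) = id_blinfun"
    by (rule blinfun_eqI) (simp add: ap[OF W(2)] bounded_linear_Blinfun_apply[OF lG] GD[OF W'(2)])
  have derB: "(\<rho> has_derivative blinfun_apply (Blinfun (D \<alpha>))) (at \<alpha>)" if "\<alpha> \<in> W'" for \<alpha>
    using \<rho>_deriv[of \<alpha>] ap[of \<alpha>] that W'(3) by auto
  obtain U V g g' where iv: "open U" "U \<subseteq> W'" "0 \<in> U" "open V" "\<rho> 0 \<in> V" "homeomorphism U V \<rho> g"
    "\<And>y. y \<in> V \<Longrightarrow> (g has_derivative (g' y)) (at y)"
    "\<And>y. y \<in> V \<Longrightarrow> g' y = inv (blinfun_apply (Blinfun (D (g y))))"
    "\<And>y. y \<in> V \<Longrightarrow> bij (blinfun_apply (Blinfun (D (g y))))"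
    by (rule inverse_function_theorem[OF W'(1) derB B_cont W'(2) inv0]) (assumption, rule that, assumption+)
  have UW: "U \<subseteq> W" using iv(2) W'(3) by blast
  have g: "\<And>y. y \<in> V \<Longrightarrow> g y \<in> U" "\<And>y. y \<in> V \<Longrightarrow> \<rho> (g y) = y" "\<And>x. x \<in> U \<Longrightarrow> \<rho> x \<in> V"
    "\<And>x. x \<in> U \<Longrightarrow> g (\<rho> x) = x" "continuous_on V g"
    using iv(6) by (auto simp: homeomorphism_def)
  have inj: "inj_on \<rho> U" by (rule inj_on_inverseI[of _ g]) (rule g(4))
  have gi: "inv_into U \<rho> y = g y" if "y \<in> V" for y
    using inv_into_f_f[OF inj g(1)[OF that]] by (simp add: g(2)[OF that])
  have fd: "frechet_derivative \<rho> (at \<alpha>) = D \<alpha>" if "\<alpha> \<in> U" for \<alpha>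
    using frechet_derivative_at[OF \<rho>_deriv] that UW by auto
  have C\<rho>: "Ck_on 1 U \<rho>"
  proof -
    have "continuous_on U (\<lambda>x. frechet_derivative \<rho> (at x) v)" for v
      using continuous_on_subset[OF D_cont UW, of v] by (subst continuous_on_cong[OF refl]) (simp add: fd, simp)
    moreover have "\<rho> differentiable (at x)" if "x \<in> U" for x
      using \<rho>_deriv[of x] that UW by (auto simp: differentiable_def)
    ultimately show ?thesis by simp
  qed
  have dg: "(inv_into U \<rho> has_derivative G (g y)) (at y)" if y: "y \<in> V" for y
  proof -
    have "g y \<in> W'" "g y \<in> W" using g(1)[OF y] iv(2) UW by auto
    then have "g' y = G (g y)" using iv(8)[OF y] invD ap by simp
    then have "(g has_derivative G (g y)) (at y)" using iv(7)[OF y] by simp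
    then show ?thesis
      by (rule has_derivative_transform_within_open[OF _ iv(4) y]) (simp add: gi)
  qed
  have Cg: "Ck_on 1 V (inv_into U \<rho>)"
  proof -
    have "continuous_on V (\<lambda>y. G (g y) v)" for v
      by (rule continuous_on_compose2[OF G_cont g(5)]) (use g(1) iv(2) in blast)
    then have "continuous_on V (\<lambda>y. frechet_derivative (inv_into U \<rho>) (at y) v)" for v
      by (subst continuous_on_cong[OF refl]) (simp_all add: frechet_derivative_at[OF dg, symmetric])
    moreover have "inv_into U \<rho> differentiable (at y)" if "y \<in> V" for y
      using dg[OF that] by (auto simp: differentiable_def)
    ultimately show ?thesis by simp
  qed
  have "bij_betw \<rho> U V" by (rule bij_betw_byWitness[of _ g]) (use g in auto)
  then have "C1_diffeomorphism \<rho> U V" using iv(1,4) C\<rho> Cg by (simp add: C1_diffeomorphism_def)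
  moreover have "\<rho> 0 = 0" by (simp add: \<rho>_def zero linear_0[OF bounded_linear.linear[OF lP]])
  ultimately show thesis using that[OF iv(3) UW] \<rho>_one by blast
qed

section \<open>The bifurcation parameter and its gradient\<close>

context critical_hit begin

definition "\<Omega>F = {\<alpha> \<in> \<Omega>T. ((xT \<alpha>, 0), \<alpha>) \<in> \<Omega>}"
definition "xT' \<alpha> h = - snd (Fld' ((xT \<alpha>, 0), \<alpha>) (0, h)) / snd (Fld' ((xT \<alpha>, 0), \<alpha>) ((1, 0), 0))"
definition "\<beta>1' \<alpha> h = land' ((xT \<alpha>, 0), \<alpha>) ((xT' \<alpha> h, 0), h) + xT' \<alpha> h"

lemma fold_point_cont_on: "continuous_on \<Omega>T (\<lambda>\<alpha>. ((xT \<alpha>, 0), \<alpha>))"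
  by (intro continuous_at_imp_continuous_on ballI fold_point_cont)

lemma open_\<Omega>F: "open \<Omega>F" and zero_\<Omega>F: "0 \<in> \<Omega>F"
proof -
  have "\<Omega>F = \<Omega>T \<inter> (\<lambda>\<alpha>. ((xT \<alpha>, 0), \<alpha>)) -` \<Omega>" by (auto simp: \<Omega>F_def)
  then show "open \<Omega>F" using continuous_open_preimage[OF fold_point_cont_on \<Omega>T(1) \<Omega>(1)] by simp
  show "0 \<in> \<Omega>F" by (simp add: \<Omega>F_def \<Omega> \<Omega>T)
qed

lemma xT_has_derivative: "\<alpha> \<in> \<Omega>T \<Longrightarrow> (xT has_derivative xT' \<alpha>) (at \<alpha>)"
  using xT_deriv unfolding xT'_def[abs_def] .

lemma \<beta>1_deriv:
  assumes "\<alpha> \<in> \<Omega>F"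
  shows "(\<beta>1 has_derivative \<beta>1' \<alpha>) (at \<alpha>)"
proof -
  have \<alpha>: "\<alpha> \<in> \<Omega>T" "((xT \<alpha>, 0), \<alpha>) \<in> \<Omega>" using assms by (auto simp: \<Omega>F_def)
  have "((\<lambda>\<alpha>. ((xT \<alpha>, 0), \<alpha>)) has_derivative (\<lambda>h. ((xT' \<alpha> h, 0), h))) (at \<alpha>)"
    by (intro has_derivative_Pair xT_has_derivative \<alpha> has_derivative_const has_derivative_ident)
  from has_derivative_compose[OF this land_deriv[OF \<alpha>(2)]]
  have "((\<lambda>\<alpha>. land ((xT \<alpha>, 0), \<alpha>)) has_derivative (\<lambda>h. land' ((xT \<alpha>, 0), \<alpha>) ((xT' \<alpha> h, 0), h))) (at \<alpha>)" .
  then show ?thesis unfolding \<beta>1_def[abs_def] \<beta>1'_def[abs_def]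
    by (intro has_derivative_add xT_has_derivative \<alpha>)
qed

lemma \<beta>1'_cont: "continuous_on \<Omega>F (\<lambda>\<alpha>. \<beta>1' \<alpha> h)"
proof -
  have e: "continuous_on \<Omega>F (\<lambda>\<alpha>. ((xT \<alpha>, 0), \<alpha>))"
    by (rule continuous_on_subset[OF fold_point_cont_on]) (auto simp: \<Omega>F_def)
  have im: "(\<lambda>\<alpha>. ((xT \<alpha>, 0), \<alpha>)) ` \<Omega>F \<subseteq> \<Omega>" by (auto simp: \<Omega>F_def)
  have cF: "continuous_on \<Omega>F (\<lambda>\<alpha>. Fld' ((xT \<alpha>, 0), \<alpha>))"
    by (rule continuous_on_compose2[OF Fld'_cont e]) simp
  have cx: "continuous_on \<Omega>F (\<lambda>\<alpha>. xT' \<alpha> h)"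
    unfolding xT'_def by (intro continuous_intros cF) (auto simp: \<Omega>F_def xT_slope)
  have cl: "continuous_on \<Omega>F (\<lambda>\<alpha>. land' ((xT \<alpha>, 0), \<alpha>) k)" for k
    by (rule continuous_on_compose2[OF land'_cont e im])
  have sp: "\<beta>1' \<alpha> h = xT' \<alpha> h * land' ((xT \<alpha>, 0), \<alpha>) ((1, 0), 0) + land' ((xT \<alpha>, 0), \<alpha>) (0, h) + xT' \<alpha> h"
    if "\<alpha> \<in> \<Omega>F" for \<alpha>
  proof -
    have "((xT \<alpha>, 0), \<alpha>) \<in> \<Omega>" using that by (simp add: \<Omega>F_def)
    then interpret bounded_linear "land' ((xT \<alpha>, 0), \<alpha>)" by (intro has_derivative_bounded_linear[OF land_deriv])
    have "((xT' \<alpha> h, 0::real), h) = xT' \<alpha> h *\<^sub>R ((1, 0), 0) + (0, h)" by (simp add: zero_prod_def)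
    then have "land' ((xT \<alpha>, 0), \<alpha>) ((xT' \<alpha> h, 0), h) =
        xT' \<alpha> h *\<^sub>R land' ((xT \<alpha>, 0), \<alpha>) ((1, 0), 0) + land' ((xT \<alpha>, 0), \<alpha>) (0, h)"
      by (simp only: add scaleR)
    then show ?thesis by (simp add: \<beta>1'_def)
  qed
  have "continuous_on \<Omega>F (\<lambda>\<alpha>. xT' \<alpha> h * land' ((xT \<alpha>, 0), \<alpha>) ((1, 0), 0) + land' ((xT \<alpha>, 0), \<alpha>) (0, h) + xT' \<alpha> h)"
    by (intro continuous_intros cx cl)
  then show ?thesis by (simp cong: continuous_on_cong add: sp)
qed

end

context critical_flow begin

text \<open>The linear form whose coefficients are the numbers \<open>\<theta>\<^sub>i\<close>.\<close>

definition "Melnikov h = - integral {0..\<tau>0} (\<lambda>t.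
      exp (integral {t..\<tau>0} (\<lambda>t. fst (Fld' (\<phi> t e0) ((1, 0), 0)) + snd (Fld' (\<phi> t e0) ((0, 1), 0)))) *
      (fst (Fld (\<phi> t e0)) * snd (Fld' (\<phi> t e0) (0, h)) - snd (Fld (\<phi> t e0)) * fst (Fld' (\<phi> t e0) (0, h))))
      / snd (Fld ((a, 0), 0)) - snd (Fld' e0 (0, h)) / snd (Fld' e0 ((1, 0), 0))"

end

context critical_hit begin

text \<open>The displacement of the fold contributes only through the summand \<open>xT\<close> itself: the landing point does not
  depend on the horizontal starting position to first order.\<close>

lemma \<beta>1'_0: "\<beta>1' 0 h = Melnikov h"
  unfolding \<beta>1'_def Melnikov_def using land'_e0[of "((xT' 0 h, 0), h)" "xT' 0 h"]
  by (simp add: \<Omega>T xT'_def)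

end

context critical_flow begin

text \<open>The radius \<open>\<epsilon>\<close> is fixed by the half return system, before the annulus is chosen; the annulus then
  determines how small the parameters must be.\<close>

lemma bifurcation_diagram:
  fixes one j :: 'm
  assumes nz: "Melnikov (axis j 1) \<noteq> 0"
  shows "\<exists>\<epsilon>>0. \<forall>A. open A \<and> cycle0 \<subseteq> A \<and> A \<subseteq> {p. infdist p cycle0 < \<epsilon>} \<longrightarrow>
    (\<exists>U V \<rho>. 0 \<in> U \<and> C1_diffeomorphism \<rho> U V \<and> \<rho> 0 = 0 \<and>
      (\<forall>\<alpha>\<in>U. \<exists>Tp. boundary_dynamics (\<lambda>p. Fld (p, \<alpha>)) (mirror (\<lambda>p. Fld (p, \<alpha>))) A a (fst (Fld e0)) Tp \<and>
        (0 < fst (Fld e0) \<longrightarrow> cycles_pos (\<lambda>p. Fld (p, \<alpha>)) (mirror (\<lambda>p. Fld (p, \<alpha>))) A Tp (\<rho> \<alpha> $ one)) \<and>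
        (fst (Fld e0) < 0 \<longrightarrow> cycles_neg (\<lambda>p. Fld (p, \<alpha>)) (mirror (\<lambda>p. Fld (p, \<alpha>))) A Tp (\<rho> \<alpha> $ one))))"
proof -
  define s where "s = sgn (fst (Fld e0))"
  have s: "s = 1 \<or> s = -1" "0 < s * fst (Fld e0)" "0 < s * snd (Fld' e0 ((1, 0), 0))"
    "0 < fst (Fld e0) \<Longrightarrow> s = 1" "fst (Fld e0) < 0 \<Longrightarrow> s = -1"
    using fold_vis by (auto simp: s_def sgn_if zero_less_mult_iff)
  obtain \<delta> \<Omega> \<tau> where hit: "0 < \<delta>" "\<delta> < \<tau>0" "\<tau>0 + \<delta> < T" "\<delta> \<le> 1" "open \<Omega>" "e0 \<in> \<Omega>" "\<tau> e0 = \<tau>0"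
    "\<And>t e. e \<in> \<Omega> \<Longrightarrow> \<bar>t - \<tau>0\<bar> \<le> \<delta> \<Longrightarrow> e \<in> stay \<and> snd (fst (X (\<phi> t e))) < 0"
    "\<And>e. e \<in> \<Omega> \<Longrightarrow> \<bar>\<tau> e - \<tau>0\<bar> < \<delta> \<and> snd (fst (\<phi> (\<tau> e) e)) = 0"
    "\<And>t e. e \<in> \<Omega> \<Longrightarrow> \<bar>t - \<tau>0\<bar> \<le> \<delta> \<Longrightarrow> t < \<tau> e \<Longrightarrow> 0 < snd (fst (\<phi> t e))"
    "\<And>t e. e \<in> \<Omega> \<Longrightarrow> \<bar>t - \<tau>0\<bar> \<le> \<delta> \<Longrightarrow> \<tau> e < t \<Longrightarrow> snd (fst (\<phi> t e)) < 0"
    "\<And>e. e \<in> \<Omega> \<Longrightarrow> (\<tau> has_derivative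
       (\<lambda>h. - snd (fst (Y (\<tau> e) e h)) / snd (fst (X (\<phi> (\<tau> e) e))))) (at e)"
    by (rule hit_exists[OF zero_less_one]) (rule that, assumption+)
  obtain \<delta>T \<Omega>T xT where fld: "0 < \<delta>T" "\<delta>T \<le> 1" "open \<Omega>T" "0 \<in> \<Omega>T" "xT 0 = - a"
    "\<And>\<alpha>. \<alpha> \<in> \<Omega>T \<Longrightarrow> \<bar>xT \<alpha> + a\<bar> < \<delta>T \<and> snd (Fld ((xT \<alpha>, 0), \<alpha>)) = 0"
    "\<And>x \<alpha>. \<alpha> \<in> \<Omega>T \<Longrightarrow> \<bar>x + a\<bar> \<le> \<delta>T \<Longrightarrow> xT \<alpha> < x \<Longrightarrow> 0 < s * snd (Fld ((x, 0), \<alpha>))"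
    "\<And>x \<alpha>. \<alpha> \<in> \<Omega>T \<Longrightarrow> \<bar>x + a\<bar> \<le> \<delta>T \<Longrightarrow> x < xT \<alpha> \<Longrightarrow> s * snd (Fld ((x, 0), \<alpha>)) < 0"
    "\<And>\<alpha>. \<alpha> \<in> \<Omega>T \<Longrightarrow> (xT has_derivative
       (\<lambda>h. - snd (Fld' ((xT \<alpha>, 0), \<alpha>) (0, h)) / snd (Fld' ((xT \<alpha>, 0), \<alpha>) ((1, 0), 0)))) (at \<alpha>)"
    "\<And>\<alpha>. \<alpha> \<in> \<Omega>T \<Longrightarrow> snd (Fld' ((xT \<alpha>, 0), \<alpha>) ((1, 0), 0)) \<noteq> 0"
    by (rule fold_exists[OF s(1,3) zero_less_one]) (rule that, assumption+)
  interpret h: critical_hit X L M T \<phi> B X' K Fld Fld' a \<tau>0 s \<delta> \<delta>T \<Omega> \<Omega>T \<tau> xT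
    by unfold_locales (fact hit fld s)+
  obtain r r0 c \<epsilon> where near: "0 < r" "0 < \<epsilon>"
    "\<forall>\<^sub>F \<alpha> in nhds 0. \<alpha> \<in> \<Omega>T \<and> (\<forall>x. \<bar>x + a\<bar> < r \<longrightarrow> ((x, 0), \<alpha>) \<in> \<Omega>) \<and> h.system r r0 c \<epsilon> \<alpha>"
    by (rule h.half_return_near)
  show ?thesis
  proof (intro exI[of _ \<epsilon>] conjI allI impI near(2))
    fix A assume A: "open A \<and> cycle0 \<subseteq> A \<and> A \<subseteq> {p. infdist p cycle0 < \<epsilon>}"
    then have A': "open A" "cycle0 \<subseteq> A" "A \<subseteq> {p. infdist p cycle0 < \<epsilon>}" by simp_all
    let ?Q = "\<lambda>\<alpha>. boundary_dynamics (\<lambda>p. Fld (p, \<alpha>)) (mirror (\<lambda>p. Fld (p, \<alpha>))) A a (fst (Fld e0)) (xT \<alpha>, 0) \<and>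
     (s = 1 \<longrightarrow> cycles_pos (\<lambda>p. Fld (p, \<alpha>)) (mirror (\<lambda>p. Fld (p, \<alpha>))) A (xT \<alpha>, 0) (h.\<beta>1 \<alpha>)) \<and>
     (s = -1 \<longrightarrow> cycles_neg (\<lambda>p. Fld (p, \<alpha>)) (mirror (\<lambda>p. Fld (p, \<alpha>))) A (xT \<alpha>, 0) (h.\<beta>1 \<alpha>))"
    have "\<forall>\<^sub>F \<alpha> in nhds 0. ?Q \<alpha>" by (rule h.diagram_near[OF near(3) A'])
    then obtain S where S: "open S" "0 \<in> S" "\<forall>\<alpha>\<in>S. ?Q \<alpha>" unfolding eventually_nhds by blast
    define W where "W = S \<inter> h.\<Omega>F"
    have W: "open W" "0 \<in> W" using S h.open_\<Omega>F h.zero_\<Omega>F by (auto simp: W_def)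
    have der: "(h.\<beta>1 has_derivative h.\<beta>1' \<alpha>) (at \<alpha>)" if "\<alpha> \<in> W" for \<alpha>
      using that by (intro h.\<beta>1_deriv) (simp add: W_def)
    have cont: "continuous_on W (\<lambda>\<alpha>. h.\<beta>1' \<alpha> k)" for k
      by (rule continuous_on_subset[OF h.\<beta>1'_cont]) (simp add: W_def)
    have nz': "h.\<beta>1' 0 (axis j 1) \<noteq> 0" using nz by (simp add: h.\<beta>1'_0)
    obtain U V \<rho> where U: "0 \<in> U" "U \<subseteq> W" "C1_diffeomorphism \<rho> U V" "\<rho> 0 = 0" "\<And>\<alpha>. \<rho> \<alpha> $ one = h.\<beta>1 \<alpha>"
      using diffeomorphism_with_coordinate[where \<beta> = h.\<beta>1 and \<beta>' = "h.\<beta>1'" and one = one and j = j, OF W der cont h.\<beta>1_0 nz']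
      by metis
    show "\<exists>U V \<rho>. 0 \<in> U \<and> C1_diffeomorphism \<rho> U V \<and> \<rho> 0 = 0 \<and>
      (\<forall>\<alpha>\<in>U. \<exists>Tp. boundary_dynamics (\<lambda>p. Fld (p, \<alpha>)) (mirror (\<lambda>p. Fld (p, \<alpha>))) A a (fst (Fld e0)) Tp \<and>
        (0 < fst (Fld e0) \<longrightarrow> cycles_pos (\<lambda>p. Fld (p, \<alpha>)) (mirror (\<lambda>p. Fld (p, \<alpha>))) A Tp (\<rho> \<alpha> $ one)) \<and>
        (fst (Fld e0) < 0 \<longrightarrow> cycles_neg (\<lambda>p. Fld (p, \<alpha>)) (mirror (\<lambda>p. Fld (p, \<alpha>))) A Tp (\<rho> \<alpha> $ one)))"
    proof (rule exI[of _ U], rule exI[of _ V], rule exI[of _ \<rho>], intro conjI ballI U(1,3,4))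
      fix \<alpha> assume "\<alpha> \<in> U"
      then have "\<alpha> \<in> S" using U(2) by (auto simp: W_def)
      then have Q: "?Q \<alpha>" using S(3) by blast
      show "\<exists>Tp. boundary_dynamics (\<lambda>p. Fld (p, \<alpha>)) (mirror (\<lambda>p. Fld (p, \<alpha>))) A a (fst (Fld e0)) Tp \<and>
        (0 < fst (Fld e0) \<longrightarrow> cycles_pos (\<lambda>p. Fld (p, \<alpha>)) (mirror (\<lambda>p. Fld (p, \<alpha>))) A Tp (\<rho> \<alpha> $ one)) \<and>
        (fst (Fld e0) < 0 \<longrightarrow> cycles_neg (\<lambda>p. Fld (p, \<alpha>)) (mirror (\<lambda>p. Fld (p, \<alpha>))) A Tp (\<rho> \<alpha> $ one))"
        using Q s(4,5) by (intro exI[of _ "(xT \<alpha>, 0)"]) (simp add: U(5))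
    qed
  qed
qed

end

section \<open>The reference orbit inside a globally defined flow\<close>

text \<open>The field is cut off by composing it with the nearest-point retraction onto a ball that contains the
  reference orbit with margin \<open>2\<close>; the result is bounded and globally Lipschitz. The time interval is longer than
  \<open>\<tau>0\<close> by so little that the orbit does not leave the ball.\<close>

lemma critical_flow_exists:
  fixes Fld :: "plane \<times> (real^'m) \<Rightarrow> plane" and Fld' :: "plane \<times> (real^'m) \<Rightarrow> (plane \<times> (real^'m)) \<Rightarrow>\<^sub>L plane"
  assumes deriv: "\<And>e. (Fld has_derivative Fld' e) (at e)"
    and lip: "\<And>\<rho>. \<exists>K\<ge>0. \<forall>x\<in>cball 0 \<rho>. \<forall>y\<in>cball 0 \<rho>. norm (Fld' x - Fld' y) \<le> K * norm (x - y)"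
    and a: "0 < a" and \<tau>0: "0 < \<tau>0"
    and sol: "\<And>t. t \<in> {0..\<tau>0} \<Longrightarrow> (\<gamma> has_vector_derivative Fld (\<gamma> t, 0)) (at t within {0..\<tau>0})"
    and ends: "\<gamma> 0 = (- a, 0)" "\<gamma> \<tau>0 = (a, 0)" and up: "\<And>t. 0 < t \<Longrightarrow> t < \<tau>0 \<Longrightarrow> 0 < snd (\<gamma> t)"
    and fold_g: "snd (Fld ((- a, 0), 0)) = 0"
    and fold_vis: "0 < fst (Fld ((- a, 0), 0)) * snd (Fld' ((- a, 0), 0) ((1, 0), 0))"
    and end_g: "snd (Fld ((a, 0), 0)) < 0"
  obtains X L M T \<phi> B X' K where "critical_flow X L M T \<phi> B X' K Fld Fld' a \<tau>0"
    "\<And>t. t \<in> {0..\<tau>0} \<Longrightarrow> \<phi> t ((- a, 0), 0) = (\<gamma> t, 0)"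
proof -
  have lip_all: "\<exists>N\<ge>0. (\<forall>x\<in>cball 0 \<rho>. norm (Fld' x) \<le> N) \<and> N-lipschitz_on (cball 0 \<rho>) Fld" for \<rho>
  proof -
    obtain K where K: "0 \<le> K" "\<And>x y. x \<in> cball 0 \<bar>\<rho>\<bar> \<Longrightarrow> y \<in> cball 0 \<bar>\<rho>\<bar> \<Longrightarrow> norm (Fld' x - Fld' y) \<le> K * norm (x - y)"
      using lip[of "\<bar>\<rho>\<bar>"] by blast
    define N where "N = norm (Fld' 0) + K * \<bar>\<rho>\<bar>"
    have N: "0 \<le> N" using K by (simp add: N_def)
    have b: "norm (Fld' x) \<le> N" if "x \<in> cball 0 \<rho>" for x
    proof -
      have x: "norm x \<le> \<bar>\<rho>\<bar>" using that by simp
      have "norm (Fld' x - Fld' 0) \<le> K * norm x" using K(2)[of x 0] x by simp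
      also have "\<dots> \<le> K * \<bar>\<rho>\<bar>" using x K(1) by (rule mult_left_mono)
      finally show ?thesis using norm_triangle_sub[of "Fld' x" "Fld' 0"] by (simp add: N_def)
    qed
    have "N-lipschitz_on (cball 0 \<rho>) Fld"
    proof (rule lipschitz_onI[OF _ N])
      fix x y :: "plane \<times> (real^'m)" assume "x \<in> cball 0 \<rho>" "y \<in> cball 0 \<rho>"
      then have "norm (Fld x - Fld y) \<le> N * norm (x - y)"
        by (intro differentiable_bound[of "cball 0 \<rho>" Fld "\<lambda>x. Fld' x"])
          (auto intro: has_derivative_at_withinI deriv simp: norm_blinfun.rep_eq[symmetric] b)
      then show "dist (Fld x) (Fld y) \<le> N * dist x y" by (simp add: dist_norm)
    qed
    then show ?thesis using N b by blast
  qed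
  have "continuous_on {0..\<tau>0} \<gamma>"
    using sol has_vector_derivative_continuous continuous_on_eq_continuous_within by blast
  then have "bounded (\<gamma> ` {0..\<tau>0})" by (intro compact_imp_bounded compact_continuous_image) auto
  then obtain R where R: "0 < R" "\<And>t. t \<in> {0..\<tau>0} \<Longrightarrow> norm (\<gamma> t) \<le> R"
    unfolding bounded_pos by blast
  define \<rho> where "\<rho> = R + 2"
  have \<rho>: "0 < \<rho>" using R by (simp add: \<rho>_def)
  obtain K where K: "0 \<le> K" "\<And>x y. x \<in> cball 0 \<rho> \<Longrightarrow> y \<in> cball 0 \<rho> \<Longrightarrow> norm (Fld' x - Fld' y) \<le> K * norm (x - y)"
    using lip[of \<rho>] by blast
  obtain N where N: "0 \<le> N" "\<And>x. x \<in> cball 0 \<rho> \<Longrightarrow> norm (Fld' x) \<le> N" "N-lipschitz_on (cball 0 \<rho>) Fld"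
    using lip_all[of \<rho>] by blast
  define L where "L = N + 1"
  define M where "M = norm (Fld 0) + N * \<rho>"
  have M: "0 \<le> M" using N \<rho> by (simp add: M_def)
  have FM: "norm (Fld x) \<le> M" if "x \<in> cball 0 \<rho>" for x
  proof -
    have "norm (Fld x - Fld 0) \<le> N * norm x"
      using lipschitz_onD[OF N(3) that, of 0] \<rho> by (simp add: dist_norm)
    also have "\<dots> \<le> N * \<rho>" using that N(1) by (intro mult_left_mono) auto
    finally show ?thesis using norm_triangle_sub[of "Fld x" "Fld 0"] by (simp add: M_def)
  qed
  define cp :: "plane \<times> (real^'m) \<Rightarrow> plane \<times> (real^'m)" where "cp = closest_point (cball 0 \<rho>)"
  have ne: "cball (0::plane \<times> (real^'m)) \<rho> \<noteq> {}" using \<rho> by auto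
  have cp: "cp e \<in> cball 0 \<rho>" for e unfolding cp_def by (rule closest_point_in_set[OF closed_cball ne])
  have cp_lip: "norm (cp x - cp y) \<le> norm (x - y)" for x y
    using closest_point_lipschitz[OF convex_cball closed_cball ne, of x y] by (simp add: cp_def dist_norm)
  have cp_id: "cp e = e" if "e \<in> ball 0 \<rho>" for e
    unfolding cp_def using that by (intro closest_point_self) auto
  define X :: "plane \<times> (real^'m) \<Rightarrow> plane \<times> (real^'m)" where "X e = (Fld (cp e), 0)" for e
  have X_lip: "norm (X x - X y) \<le> L * norm (x - y)" for x y
  proof -
    have "norm (X x - X y) = norm (Fld (cp x) - Fld (cp y))" by (simp add: X_def norm_Pair)
    also have "\<dots> \<le> N * norm (cp x - cp y)" using lipschitz_onD[OF N(3) cp cp] by (simp add: dist_norm)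
    also have "\<dots> \<le> N * norm (x - y)" by (rule mult_left_mono[OF cp_lip N(1)])
    also have "\<dots> \<le> L * norm (x - y)" by (simp add: L_def mult_right_mono)
    finally show ?thesis .
  qed
  \<comment> \<open>A field bounded by \<open>M\<close> moves a point by less than \<open>1\<close> in time \<open>\<eta>\<close>.\<close>
  define \<eta> where "\<eta> = 1 / (2 * (M + 1))"
  have \<eta>: "0 < \<eta>" "M * \<eta> < 1" using M by (auto simp: \<eta>_def field_simps)
  define T where "T = \<tau>0 + \<eta>"
  have T: "0 < T" "\<tau>0 < T" using \<tau>0 \<eta> by (auto simp: T_def)
  have X_cont: "continuous_on UNIV X"
    by (rule lipschitz_on_continuous_on[where L = L]) (use X_lip N in \<open>auto simp: lipschitz_on_def dist_norm L_def\<close>)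
  have "\<exists>z. z 0 = x \<and> (\<forall>t\<in>{0..T}. (z has_vector_derivative X (z t)) (at t within {0..T}))" for x
  proof -
    have c: "continuous_on ({0..T} \<times> UNIV) (\<lambda>(t, x). X x)"
      unfolding split_beta by (intro continuous_on_compose2[OF X_cont] continuous_intros) auto
    obtain z where "z 0 = x" "\<And>t. t \<in> {0..T} \<Longrightarrow> (z has_vector_derivative X (z t)) (at t within {0..T})"
      by (rule picard_global[of T L "\<lambda>t. X" x]) (use T N c X_lip in \<open>auto simp: L_def\<close>)
    then show ?thesis by blast
  qed
  then obtain \<phi>x where \<phi>x: "\<And>x. \<phi>x x 0 = x"
    "\<And>x t. t \<in> {0..T} \<Longrightarrow> (\<phi>x x has_vector_derivative X (\<phi>x x t)) (at t within {0..T})" by metis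
  define \<phi> where "\<phi> t x = \<phi>x x t" for t x
  define I :: "plane \<Rightarrow>\<^sub>L (plane \<times> (real^'m))" where "I = Blinfun (\<lambda>p. (p, 0))"
  have I: "blinfun_apply I p = (p, 0)" for p
    unfolding I_def by (subst bounded_linear_Blinfun_apply) (auto intro!: bounded_linear_Pair bounded_linear_ident bounded_linear_zero)
  have nI: "norm (I o\<^sub>L A) \<le> norm A" for A :: "(plane \<times> (real^'m)) \<Rightarrow>\<^sub>L plane"
    by (rule norm_blinfun_bound) (simp_all add: I norm_Pair norm_blinfun)
  define X' where "X' e = I o\<^sub>L Fld' e" for e
  interpret lf: smooth_flow X L M T \<phi> "ball 0 \<rho>" X' K
  proof
    show "0 < L" "0 < T" "0 \<le> K" "open (ball (0::plane \<times> (real^'m)) \<rho>)" "convex (ball (0::plane \<times> (real^'m)) \<rho>)"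
      using N T K by (auto simp: L_def)
    show "norm (X x - X y) \<le> L * norm (x - y)" for x y by (rule X_lip)
    show "norm (X x) \<le> M" for x using FM[OF cp] by (simp add: X_def norm_Pair)
    show "\<phi> 0 x = x" for x by (simp add: \<phi>_def \<phi>x)
    show "((\<lambda>t. \<phi> t x) has_vector_derivative X (\<phi> t x)) (at t within {0..T})" if "t \<in> {0..T}" for t x
      using \<phi>x(2)[OF that, of x] by (simp add: \<phi>_def)
    show "(X has_derivative blinfun_apply (X' x)) (at x)" if x: "x \<in> ball 0 \<rho>" for x
    proof -
      have "((\<lambda>e. (Fld e, 0)) has_derivative (\<lambda>v. (Fld' x v, 0))) (at x)"
        by (intro has_derivative_Pair deriv has_derivative_const)
      moreover have "blinfun_apply (X' x) = (\<lambda>v. (Fld' x v, 0))" by (rule ext) (simp add: X'_def I)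
      ultimately have "((\<lambda>e. (Fld e, 0)) has_derivative blinfun_apply (X' x)) (at x)" by simp
      then show ?thesis
        by (rule has_derivative_transform_within_open[OF _ open_ball x]) (simp add: X_def cp_id)
    qed
    show "norm (X' x - X' y) \<le> K * norm (x - y)" if "x \<in> ball 0 \<rho>" "y \<in> ball 0 \<rho>" for x y
    proof -
      have "X' x - X' y = I o\<^sub>L (Fld' x - Fld' y)"
        by (rule blinfun_eqI) (simp add: X'_def I blinfun.diff_left)
      then have "norm (X' x - X' y) \<le> norm (Fld' x - Fld' y)" using nI by simp
      also have "\<dots> \<le> K * norm (x - y)" using that by (intro K(2)) auto
      finally show ?thesis .
    qed
    show "norm (X' x) \<le> L" if "x \<in> ball 0 \<rho>" for x
      using nI[of "Fld' x"] N(2)[of x] that by (simp add: X'_def L_def)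
  qed
  have \<gamma>B: "(\<gamma> t, 0::real^'m) \<in> ball 0 \<rho>" if "t \<in> {0..\<tau>0}" for t
    using R(2)[OF that] unfolding mem_ball_0 norm_Pair by (simp add: \<rho>_def)
  have flow0: "\<phi> t ((- a, 0), 0) = (\<gamma> t, 0)" if "t \<in> {0..\<tau>0}" for t
  proof -
    have "(\<gamma> t, 0) = \<phi> t ((- a, 0), 0)"
    proof (rule lf.flow_unique[where b = \<tau>0 and z = "\<lambda>t. (\<gamma> t, 0)"])
      show "continuous_on {0..\<tau>0} (\<lambda>t. (\<gamma> t, 0))" by (intro continuous_intros \<open>continuous_on {0..\<tau>0} \<gamma>\<close>)
      show "((\<lambda>t. (\<gamma> t, 0)) has_vector_derivative X (\<gamma> u, 0)) (at u)" if u: "0 < u" "u < \<tau>0" for u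
      proof -
        have uI: "u \<in> {0..\<tau>0}" using u by simp
        have "(\<gamma> has_vector_derivative Fld (\<gamma> u, 0)) (at u)"
          using sol[OF uI] u by (simp add: at_within_Icc_at)
        then have "((\<lambda>t. (\<gamma> t, 0)) has_vector_derivative (Fld (\<gamma> u, 0), 0)) (at u)"
          by (intro has_vector_derivative_Pair has_vector_derivative_const)
        then show ?thesis by (simp add: X_def cp_id[OF \<gamma>B[OF uI]])
      qed
    qed (use T ends that in auto)
    then show ?thesis by simp
  qed
  have stay: "((- a, 0), 0) \<in> lf.stay"
    unfolding lf.stay_def
  proof (rule CollectI, rule ballI)
    fix t assume t: "t \<in> {0..T}"
    define u where "u = min t \<tau>0"
    have u: "u \<in> {0..\<tau>0}" "u \<in> {0..T}" "\<bar>t - u\<bar> \<le> \<eta>" using t T \<tau>0 by (auto simp: u_def T_def)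
    have "norm (\<phi> t ((- a, 0), 0) - \<phi> u ((- a, 0), 0)) \<le> 0 * exp (L * T) + M * \<bar>t - u\<bar>"
      using lf.flow_joint_estimate[OF u(2) t, of "((- a, 0), 0)" "((- a, 0), 0)"] by simp
    also have "\<dots> \<le> M * \<eta>" using mult_left_mono[OF u(3) M] by simp
    finally have "norm (\<phi> t ((- a, 0), 0) - \<phi> u ((- a, 0), 0)) < 1" using \<eta> by simp
    moreover have "norm (\<phi> u ((- a, 0), 0)) \<le> R" using flow0[OF u(1)] R(2)[OF u(1)] by (simp add: norm_Pair)
    ultimately have "norm (\<phi> t ((- a, 0), 0)) < \<rho>"
      using norm_triangle_sub[of "\<phi> t ((- a, 0), 0)" "\<phi> u ((- a, 0), 0)"] by (simp add: \<rho>_def)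
    then show "\<phi> t ((- a, 0), 0) \<in> ball 0 \<rho>" unfolding mem_ball_0 .
  qed
  have Fld'_cont: "continuous_on UNIV Fld'"
  proof (rule continuous_at_imp_continuous_on, rule ballI)
    fix x :: "plane \<times> (real^'m)"
    obtain K where K: "0 \<le> K" "\<forall>y\<in>cball 0 (norm x + 1). \<forall>z\<in>cball 0 (norm x + 1). norm (Fld' y - Fld' z) \<le> K * norm (y - z)"
      using lip by blast
    have "K-lipschitz_on (cball 0 (norm x + 1)) Fld'"
      using K by (auto simp: lipschitz_on_def dist_norm)
    then have "continuous_on (cball 0 (norm x + 1)) Fld'" by (rule lipschitz_on_continuous_on)
    then show "isCont Fld' x" by (rule continuous_on_interior) simp
  qed
  have "critical_flow X L M T \<phi> (ball 0 \<rho>) X' K Fld Fld' a \<tau>0"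
  proof
    show "X e = (Fld e, 0)" if "e \<in> ball 0 \<rho>" for e using cp_id[OF that] by (simp add: X_def)
    show "snd (X e) = 0" for e by (simp add: X_def)
    show "blinfun_apply (X' e) v = (Fld' e v, 0)" for e v by (simp add: X'_def I)
    show "\<exists>L. L-lipschitz_on (cball 0 \<rho>) Fld" for \<rho> using lip_all[of \<rho>] by blast
    show "\<phi> \<tau>0 ((- a, 0), 0) = ((a, 0), 0)" using flow0[of \<tau>0] \<tau>0 ends by simp
    show "0 < snd (fst (\<phi> t ((- a, 0), 0)))" if "0 < t" "t < \<tau>0" for t
      using flow0[of t] up[OF that] that by simp
  qed (fact deriv Fld'_cont a \<tau>0 T stay fold_g fold_vis end_g)+
  then show thesis by (rule that) (rule flow0)
qed

section \<open>The bifurcation theorem\<close>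

text \<open>All three kinds of partial derivatives are derivatives along lines in the extended space.\<close>

lemma deriv_along_line:
  fixes F :: "'a::real_normed_vector \<Rightarrow> real"
  assumes "(F has_derivative D) (at c)"
  shows "deriv (\<lambda>t. F (c + (t - t0) *\<^sub>R v)) t0 = D v"
proof -
  interpret D: bounded_linear D by (rule has_derivative_bounded_linear[OF assms])
  have "((\<lambda>t. c + (t - t0) *\<^sub>R v) has_derivative (\<lambda>h. h *\<^sub>R v)) (at t0)"
    by (auto intro!: derivative_eq_intros)
  moreover have "(F has_derivative D) (at (c + (t0 - t0) *\<^sub>R v))" using assms by simp
  ultimately have "((\<lambda>t. F (c + (t - t0) *\<^sub>R v)) has_derivative (\<lambda>h. D (h *\<^sub>R v))) (at t0)"
    by (rule has_derivative_compose)
  moreover have "(\<lambda>h. D (h *\<^sub>R v)) = (*) (D v)" by (rule ext) (simp add: D.scaleR)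
  ultimately have "((\<lambda>t. F (c + (t - t0) *\<^sub>R v)) has_field_derivative D v) (at t0)"
    by (simp add: has_field_derivative_def)
  then show ?thesis by (rule DERIV_imp_deriv)
qed

lemma partial_derivatives:
  fixes F :: "plane \<Rightarrow> real^'m \<Rightarrow> real" and D :: "plane \<times> (real^'m) \<Rightarrow> (plane \<times> (real^'m)) \<Rightarrow>\<^sub>L real"
  assumes D: "\<And>e. ((\<lambda>(p, \<alpha>). F p \<alpha>) has_derivative D e) (at e)"
  shows "partial_x F p \<alpha> = D (p, \<alpha>) ((1, 0), 0)" "partial_y F p \<alpha> = D (p, \<alpha>) ((0, 1), 0)"
    "partial_par i F p \<alpha> = D (p, \<alpha>) (0, axis i 1)"
proof -
  have "(\<lambda>x. F (x, snd p) \<alpha>) = (\<lambda>x. (\<lambda>(p, \<alpha>). F p \<alpha>) ((p, \<alpha>) + (x - fst p) *\<^sub>R ((1, 0), 0)))"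
    by (rule ext) (cases p, simp)
  then show "partial_x F p \<alpha> = D (p, \<alpha>) ((1, 0), 0)"
    by (simp only: partial_x_def deriv_along_line[OF D])
  have "(\<lambda>y. F (fst p, y) \<alpha>) = (\<lambda>y. (\<lambda>(p, \<alpha>). F p \<alpha>) ((p, \<alpha>) + (y - snd p) *\<^sub>R ((0, 1), 0)))"
    by (rule ext) (cases p, simp)
  then show "partial_y F p \<alpha> = D (p, \<alpha>) ((0, 1), 0)"
    by (simp only: partial_y_def deriv_along_line[OF D])
  have "(\<lambda>s. F p (\<alpha> + s *\<^sub>R axis i 1)) = (\<lambda>s. (\<lambda>(p, \<alpha>). F p \<alpha>) ((p, \<alpha>) + (s - 0) *\<^sub>R (0, axis i 1)))"
    by (rule ext) simp
  then show "partial_par i F p \<alpha> = D (p, \<alpha>) (0, axis i 1)"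
    by (simp only: partial_par_def deriv_along_line[OF D])
qed

theorem theorem3p1:
  fixes f g :: "real \<times> real \<Rightarrow> real^'m \<Rightarrow> real"
    and k :: nat and a \<tau>\<^sub>0 :: real and \<gamma>\<^sub>0 :: "real \<Rightarrow> real \<times> real"
    and one :: 'm  \<comment> \<open>the index written 1 in the coordinates (1, ..., m)\<close>
  assumes k: "k \<ge> 3"
    and f_Ck: "Ck_on k UNIV (\<lambda>(p, \<alpha>). f p \<alpha>)"
    and g_Ck: "Ck_on k UNIV (\<lambda>(p, \<alpha>). g p \<alpha>)"
    and H0: "a > 0" "\<tau>\<^sub>0 > 0"
      "\<And>t. t \<in> {0..\<tau>\<^sub>0} \<Longrightarrow>
         (\<gamma>\<^sub>0 has_vector_derivative upper_field f g 0 (\<gamma>\<^sub>0 t)) (at t within {0..\<tau>\<^sub>0})"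
      "\<gamma>\<^sub>0 0 = (- a, 0)" "\<gamma>\<^sub>0 \<tau>\<^sub>0 = (a, 0)"
      "\<And>t. 0 < t \<Longrightarrow> t < \<tau>\<^sub>0 \<Longrightarrow> \<gamma>\<^sub>0 t \<in> upper_half"
    and H1: "g (- a, 0) 0 = 0" "f (- a, 0) 0 * partial_x g (- a, 0) 0 > 0"
    and H2: "g (a, 0) 0 < 0"
    and theta_nonzero: "(\<chi> i. theta f g a \<gamma>\<^sub>0 \<tau>\<^sub>0 i) \<noteq> 0"
  shows "\<exists>\<epsilon>>0. \<forall>A. annulus_of (Gamma0 \<gamma>\<^sub>0 \<tau>\<^sub>0) A \<and> (\<forall>p\<in>A. infdist p (Gamma0 \<gamma>\<^sub>0 \<tau>\<^sub>0) < \<epsilon>) \<longrightarrow>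
    (\<exists>U V \<rho>. 0 \<in> U \<and> C1_diffeomorphism \<rho> U V \<and> \<rho> 0 = 0 \<and>
      (\<forall>\<beta>'. \<beta>' $ one = 0 \<and> \<beta>' \<in> V \<longrightarrow>
        (\<forall>\<alpha>\<in>U. (\<forall>i. i \<noteq> one \<longrightarrow> \<rho> \<alpha> $ i = \<beta>' $ i) \<longrightarrow>
          (\<exists>T. boundary_dynamics (upper_field f g \<alpha>) (lower_field f g \<alpha>) A a (f (- a, 0) 0) T \<and>
            (f (- a, 0) 0 > 0 \<longrightarrow>
               cycles_pos (upper_field f g \<alpha>) (lower_field f g \<alpha>) A T (\<rho> \<alpha> $ one)) \<and>
            (f (- a, 0) 0 < 0 \<longrightarrow>
               cycles_neg (upper_field f g \<alpha>) (lower_field f g \<alpha>) A T (\<rho> \<alpha> $ one))))))"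
proof -
  have "Ck_on 2 UNIV (\<lambda>(p, \<alpha>). f p \<alpha>)" "Ck_on 2 UNIV (\<lambda>(p, \<alpha>). g p \<alpha>)"
    using Ck_on_le[OF _ f_Ck, of 2] Ck_on_le[OF _ g_Ck, of 2] k by simp_all
  note C2 = this
  obtain F' :: "plane \<times> (real^'m) \<Rightarrow> (plane \<times> (real^'m)) \<Rightarrow>\<^sub>L real" where F':
    "\<And>e. ((\<lambda>(p, \<alpha>). f p \<alpha>) has_derivative F' e) (at e)"
    "\<And>\<rho>. \<exists>K\<ge>0. \<forall>x\<in>cball 0 \<rho>. \<forall>y\<in>cball 0 \<rho>. norm (F' x - F' y) \<le> K * norm (x - y)"
    using C2_real_derivative[OF C2(1)] by metis
  obtain G' :: "plane \<times> (real^'m) \<Rightarrow> (plane \<times> (real^'m)) \<Rightarrow>\<^sub>L real" where G':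
    "\<And>e. ((\<lambda>(p, \<alpha>). g p \<alpha>) has_derivative G' e) (at e)"
    "\<And>\<rho>. \<exists>K\<ge>0. \<forall>x\<in>cball 0 \<rho>. \<forall>y\<in>cball 0 \<rho>. norm (G' x - G' y) \<le> K * norm (x - y)"
    using C2_real_derivative[OF C2(2)] by metis
  define Fld where "Fld e = (f (fst e) (snd e), g (fst e) (snd e))" for e
  define Fld' :: "plane \<times> (real^'m) \<Rightarrow> (plane \<times> (real^'m)) \<Rightarrow>\<^sub>L plane" where "Fld' e = Blinfun (\<lambda>v. (F' e v, G' e v))" for e
  have ap: "blinfun_apply (Fld' e) v = (F' e v, G' e v)" for e v
    unfolding Fld'_def
    by (subst bounded_linear_Blinfun_apply) (intro bounded_linear_Pair blinfun.bounded_linear_right refl)+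
  have deriv: "(Fld has_derivative Fld' e) (at e)" for e
  proof -
    have "(Fld has_derivative (\<lambda>v. (F' e v, G' e v))) (at e)"
      unfolding Fld_def[abs_def] using F'(1)[of e] G'(1)[of e]
      by (intro has_derivative_Pair) (simp_all add: split_beta')
    then show ?thesis by (simp add: ap[abs_def])
  qed
  have lip: "\<exists>K\<ge>0. \<forall>x\<in>cball 0 \<rho>. \<forall>y\<in>cball 0 \<rho>. norm (Fld' x - Fld' y) \<le> K * norm (x - y)" for \<rho>
  proof -
    obtain K1 where K1: "0 \<le> K1" "\<And>x y. x \<in> cball 0 \<rho> \<Longrightarrow> y \<in> cball 0 \<rho> \<Longrightarrow> norm (F' x - F' y) \<le> K1 * norm (x - y)"
      using F'(2)[of \<rho>] by blast
    obtain K2 where K2: "0 \<le> K2" "\<And>x y. x \<in> cball 0 \<rho> \<Longrightarrow> y \<in> cball 0 \<rho> \<Longrightarrow> norm (G' x - G' y) \<le> K2 * norm (x - y)"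
      using G'(2)[of \<rho>] by blast
    have "norm (Fld' x - Fld' y) \<le> (K1 + K2) * norm (x - y)" if "x \<in> cball 0 \<rho>" "y \<in> cball 0 \<rho>" for x y
    proof -
      have "norm (Fld' x - Fld' y) \<le> norm (F' x - F' y) + norm (G' x - G' y)"
      proof (rule norm_blinfun_bound)
        fix v
        have "norm ((Fld' x - Fld' y) v) = norm ((F' x - F' y) v, (G' x - G' y) v)"
          by (simp add: blinfun.diff_left ap)
        also have "\<dots> \<le> norm ((F' x - F' y) v) + norm ((G' x - G' y) v)" by (rule norm_Pair_le)
        also have "\<dots> \<le> norm (F' x - F' y) * norm v + norm (G' x - G' y) * norm v"
          by (intro add_mono norm_blinfun)
        finally show "norm ((Fld' x - Fld' y) v) \<le> (norm (F' x - F' y) + norm (G' x - G' y)) * norm v"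
          by (simp add: distrib_right)
      qed simp
      also have "\<dots> \<le> (K1 + K2) * norm (x - y)"
        using K1(2)[OF that] K2(2)[OF that] by (simp add: distrib_right)
      finally show ?thesis .
    qed
    then show ?thesis using K1(1) K2(1) by (intro exI[of _ "K1 + K2"]) auto
  qed
  note pf = partial_derivatives[OF F'(1)] and pg = partial_derivatives[OF G'(1)]
  have upper: "upper_field f g \<alpha> = (\<lambda>p. Fld (p, \<alpha>))" for \<alpha> by (rule ext) (simp add: upper_field_def Fld_def)
  have lower: "lower_field f g \<alpha> = mirror (\<lambda>p. Fld (p, \<alpha>))" for \<alpha>
    by (rule ext) (simp add: lower_field_def mirror_def Fld_def)
  obtain X L M T \<phi> B X' K where cf: "critical_flow X L M T \<phi> B X' K Fld Fld' a \<tau>\<^sub>0"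
    and \<phi>: "\<And>t. t \<in> {0..\<tau>\<^sub>0} \<Longrightarrow> \<phi> t ((- a, 0), 0) = (\<gamma>\<^sub>0 t, 0)"
  proof (rule critical_flow_exists[OF deriv lip H0(1,2) _ H0(4,5)])
    show "(\<gamma>\<^sub>0 has_vector_derivative Fld (\<gamma>\<^sub>0 t, 0)) (at t within {0..\<tau>\<^sub>0})" if "t \<in> {0..\<tau>\<^sub>0}" for t
      using H0(3)[OF that] by (simp add: upper)
    show "0 < snd (\<gamma>\<^sub>0 t)" if "0 < t" "t < \<tau>\<^sub>0" for t using H0(6)[OF that] by (simp add: upper_half_def)
    show "snd (Fld ((- a, 0), 0)) = 0" "snd (Fld ((a, 0), 0)) < 0" using H1 H2 by (simp_all add: Fld_def)
    show "0 < fst (Fld ((- a, 0), 0)) * snd (Fld' ((- a, 0), 0) ((1, 0), 0))"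
      using H1(2) by (simp add: Fld_def ap pg)
  qed (rule that, assumption+)
  interpret c: critical_flow X L M T \<phi> B X' K Fld Fld' a \<tau>\<^sub>0 by (rule cf)
  have arc: "(\<lambda>t. fst (\<phi> t ((- a, 0), 0))) ` {0..\<tau>\<^sub>0} = \<gamma>\<^sub>0 ` {0..\<tau>\<^sub>0}"
    by (rule image_cong) (simp_all add: \<phi>)
  have cyc: "c.cycle0 = Gamma0 \<gamma>\<^sub>0 \<tau>\<^sub>0" by (simp only: c.cycle0_def Gamma0_def arc)
  have Mel: "c.Melnikov (axis j 1) = theta f g a \<gamma>\<^sub>0 \<tau>\<^sub>0 j" for j
  proof -
    have div: "integral {t..\<tau>\<^sub>0} (\<lambda>t. fst (Fld' (\<phi> t ((- a, 0), 0)) ((1, 0), 0)) + snd (Fld' (\<phi> t ((- a, 0), 0)) ((0, 1), 0))) =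
        integral {t..\<tau>\<^sub>0} (\<lambda>s. partial_x f (\<gamma>\<^sub>0 s) 0 + partial_y g (\<gamma>\<^sub>0 s) 0)" if "t \<in> {0..\<tau>\<^sub>0}" for t
      by (rule Henstock_Kurzweil_Integration.integral_cong) (use that in \<open>simp add: \<phi> ap pf pg\<close>)
    have "integral {0..\<tau>\<^sub>0} (\<lambda>t. exp (integral {t..\<tau>\<^sub>0} (\<lambda>t. fst (Fld' (\<phi> t ((- a, 0), 0)) ((1, 0), 0)) + snd (Fld' (\<phi> t ((- a, 0), 0)) ((0, 1), 0)))) *
        (fst (Fld (\<phi> t ((- a, 0), 0))) * snd (Fld' (\<phi> t ((- a, 0), 0)) (0, axis j 1)) -
         snd (Fld (\<phi> t ((- a, 0), 0))) * fst (Fld' (\<phi> t ((- a, 0), 0)) (0, axis j 1)))) = kappa f g \<gamma>\<^sub>0 \<tau>\<^sub>0 j"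
      unfolding kappa_def lam_def
      by (rule Henstock_Kurzweil_Integration.integral_cong) (simp only: div, simp add: \<phi> ap pf pg Fld_def)
    then show ?thesis
      unfolding c.Melnikov_def theta_def by (simp only: ap pg Fld_def fst_conv snd_conv)
  qed
  obtain j where "theta f g a \<gamma>\<^sub>0 \<tau>\<^sub>0 j \<noteq> 0" using theta_nonzero by (auto simp: vec_eq_iff)
  then have "c.Melnikov (axis j 1) \<noteq> 0" by (simp add: Mel)
  from c.bifurcation_diagram[OF this, of one] obtain \<epsilon> where \<epsilon>: "0 < \<epsilon>"
    "\<And>A. open A \<Longrightarrow> Gamma0 \<gamma>\<^sub>0 \<tau>\<^sub>0 \<subseteq> A \<Longrightarrow> A \<subseteq> {p. infdist p (Gamma0 \<gamma>\<^sub>0 \<tau>\<^sub>0) < \<epsilon>} \<Longrightarrow>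
      (\<exists>U V \<rho>. 0 \<in> U \<and> C1_diffeomorphism \<rho> U V \<and> \<rho> 0 = 0 \<and>
        (\<forall>\<alpha>\<in>U. \<exists>T. boundary_dynamics (upper_field f g \<alpha>) (lower_field f g \<alpha>) A a (f (- a, 0) 0) T \<and>
            (f (- a, 0) 0 > 0 \<longrightarrow>
               cycles_pos (upper_field f g \<alpha>) (lower_field f g \<alpha>) A T (\<rho> \<alpha> $ one)) \<and>
            (f (- a, 0) 0 < 0 \<longrightarrow>
               cycles_neg (upper_field f g \<alpha>) (lower_field f g \<alpha>) A T (\<rho> \<alpha> $ one))))"
    unfolding upper lower cyc by (auto simp: Fld_def)
  show ?thesis
  proof (rule exI[of _ \<epsilon>], intro conjI allI impI \<epsilon>(1))
    fix A assume A: "annulus_of (Gamma0 \<gamma>\<^sub>0 \<tau>\<^sub>0) A \<and> (\<forall>p\<in>A. infdist p (Gamma0 \<gamma>\<^sub>0 \<tau>\<^sub>0) < \<epsilon>)"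
    then obtain h h' where oA: "open A" and h: "homeomorphism {w::plane. 1 < norm w \<and> norm w < 3} A h h'"
      "h ` sphere 0 2 = Gamma0 \<gamma>\<^sub>0 \<tau>\<^sub>0" unfolding annulus_of_def by blast
    have "h ` sphere 0 2 \<subseteq> h ` {w::plane. 1 < norm w \<and> norm w < 3}" by (rule image_mono) auto
    then have "Gamma0 \<gamma>\<^sub>0 \<tau>\<^sub>0 \<subseteq> A" using h by (simp add: homeomorphism_def)
    moreover have "A \<subseteq> {p. infdist p (Gamma0 \<gamma>\<^sub>0 \<tau>\<^sub>0) < \<epsilon>}" using A by blast
    ultimately obtain U V \<rho> where U: "0 \<in> U" "C1_diffeomorphism \<rho> U V" "\<rho> 0 = 0"
      "\<forall>\<alpha>\<in>U. \<exists>T. boundary_dynamics (upper_field f g \<alpha>) (lower_field f g \<alpha>) A a (f (- a, 0) 0) T \<and>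
            (f (- a, 0) 0 > 0 \<longrightarrow>
               cycles_pos (upper_field f g \<alpha>) (lower_field f g \<alpha>) A T (\<rho> \<alpha> $ one)) \<and>
            (f (- a, 0) 0 < 0 \<longrightarrow>
               cycles_neg (upper_field f g \<alpha>) (lower_field f g \<alpha>) A T (\<rho> \<alpha> $ one))"
      using \<epsilon>(2)[OF oA] by blast
    then show "\<exists>U V \<rho>. 0 \<in> U \<and> C1_diffeomorphism \<rho> U V \<and> \<rho> 0 = 0 \<and>
      (\<forall>\<beta>'. \<beta>' $ one = 0 \<and> \<beta>' \<in> V \<longrightarrow>
        (\<forall>\<alpha>\<in>U. (\<forall>i. i \<noteq> one \<longrightarrow> \<rho> \<alpha> $ i = \<beta>' $ i) \<longrightarrow>
          (\<exists>T. boundary_dynamics (upper_field f g \<alpha>) (lower_field f g \<alpha>) A a (f (- a, 0) 0) T \<and>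
            (f (- a, 0) 0 > 0 \<longrightarrow>
               cycles_pos (upper_field f g \<alpha>) (lower_field f g \<alpha>) A T (\<rho> \<alpha> $ one)) \<and>
            (f (- a, 0) 0 < 0 \<longrightarrow>
               cycles_neg (upper_field f g \<alpha>) (lower_field f g \<alpha>) A T (\<rho> \<alpha> $ one)))))"
      by - (rule exI[of _ U], rule exI[of _ V], rule exI[of _ \<rho>], blast)
  qed
qed

end
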